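(* Let $d\ge1$, $n\in\mathbb{N}^d$, and let $\Lambda\subset\mathbb{R}^{2d}$ be a lattice with adjoint lattice $\Lambda^0$. Then $\Gamma_\Lambda$ is a sampling sequence for $\mathbf{F}^n(\mathbb{C}^d)$ if and only if $\Gamma_{\Lambda^0}$ is a multiple interpolating sequence of multiplicity $K_n$ for the Fock space $\mathcal{F}(\mathbb{C}^d)$.
   Context: Notation: $|m|=\sum m_j$, $m!=\prod m_j!$, $z^m=\prod z_j^{m_j}$, $\bar z^m=\prod \bar z_j^{m_j}$, $|z|^2=\sum|z_j|^2$, $\bar z\cdot\zeta=\sum\bar z_j\zeta_j$. $K_n=\{k\in\mathbb{N}_0^d:0\le k_j\le n_j-1\ \forall j\}$. The Fock space $\mathcal{F}(\mathbb{C}^d)$ consists of entire functions $F$ on $\mathbb{C}^d$ with $\|F\|^2=\int_{\mathbb{C}^d}|F(z)|^2e^{-\pi|z|^2}dz<\infty$, inner product $\langle F,G\rangle=\int F\bar Ge^{-\pi|z|^2}dz$; $e_k(z)=(\pi^{|k|}/k!)^{1/2}z^k$. For $z\in\mathbb{C}^d$, $\beta_zF(\zeta)=e^{\pi\bar z\cdot\zeta-\frac{\pi}{2}|z|^2}F(\zeta-z)$. The polyanalytic Fock space $\mathbf{F}^n(\mathbb{C}^d)$ is the space of $F(z)=\sum_{k\in K_n}\bar z^k\varphi_k(z)$, $\varphi_k$ entire, with $\int|F|^2e^{-\pi|z|^2}dz<\infty$. A lattice is $\Lambda=A\mathbb{Z}^{2d}$ with $A$ an invertible real $2d\times2d$ matrix;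 for $\lambda=(x,\omega)\in\mathbb{R}^{2d}$ let $\pi_\lambda=M_\omega T_x$, where $T_xf(t)=f(t-x)$, $M_\omega f(t)=e^{2\pi i\omega\cdot t}f(t)$; the adjoint lattice is $\Lambda^0=\{\mu\in\mathbb{R}^{2d}:\pi_\lambda\pi_\mu=\pi_\mu\pi_\lambda\ \forall\lambda\in\Lambda\}$. For a set $\Lambda\subset\mathbb{R}^{2d}$, $\Gamma_\Lambda=\{x+i\omega\in\mathbb{C}^d:(x,\omega)\in\Lambda\}$. $\Gamma$ is a sampling sequence for $\mathbf{F}^n(\mathbb{C}^d)$ if there are $A,B>0$ with $A\|F\|^2\le\sum_{z\in\Gamma}|F(z)|^2e^{-\pi|z|^2}\le B\|F\|^2$ for all $F\in\mathbf{F}^n(\mathbb{C}^d)$. $\Gamma$ is a multiple interpolating sequence of multiplicity $K_n$ for $\mathcal{F}(\mathbb{C}^d)$ if for every family $(\alpha_z^{(k)})_{z\in\Gamma,k\in K_n}\in\ell^2$ there is $F\in\mathcal{F}(\mathbb{C}^d)$ with $\langle F,\beta_ze_k\rangle=\alpha_z^{(k)}$ for all $z\in\Gamma$, $k\in K_n$. *)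

theory Defs
  imports "HOL-Analysis.Analysis"
begin

definition K_set :: "nat^'d \<Rightarrow> (nat^'d) set" where
  "K_set n = {k. \<forall>j. k$j < n$j}"

definition mabs :: "nat^'d::finite \<Rightarrow> nat" where
  "mabs m = (\<Sum>j\<in>UNIV. m$j)"

definition mfact :: "nat^'d::finite \<Rightarrow> nat" where
  "mfact m = (\<Prod>j\<in>UNIV. fact (m$j))"

definition mpow :: "complex^'d::finite \<Rightarrow> nat^'d \<Rightarrow> complex" where
  "mpow z m = (\<Prod>j\<in>UNIV. (z$j) ^ (m$j))"

definition cmpow :: "complex^'d::finite \<Rightarrow> nat^'d \<Rightarrow> complex" where
  "cmpow z m = (\<Prod>j\<in>UNIV. (cnj (z$j)) ^ (m$j))"

definition cdot :: "complex^'d::finite \<Rightarrow> complex^'d \<Rightarrow> complex" where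
  "cdot z w = (\<Sum>j\<in>UNIV. cnj (z$j) * w$j)"

text \<open>Entire functions on C^d: complex (Frechet) differentiable everywhere,
  i.e. the derivative is complex-linear.\<close>
definition entire_fun :: "(complex^'d::finite \<Rightarrow> complex) \<Rightarrow> bool" where
  "entire_fun F \<longleftrightarrow> (\<forall>z. \<exists>c::complex^'d.
       (F has_derivative (\<lambda>h. \<Sum>j\<in>UNIV. c$j * h$j)) (at z))"

definition fock_norm2 :: "(complex^'d::finite \<Rightarrow> complex) \<Rightarrow> ennreal" where
  "fock_norm2 F = (\<integral>\<^sup>+ z. ennreal ((cmod (F z))\<^sup>2 * exp (- pi * (norm z)\<^sup>2)) \<partial>lborel)"

definition fock_inner :: "(complex^'d::finite \<Rightarrow> complex) \<Rightarrow> (complex^'d \<Rightarrow> complex) \<Rightarrow> complex" where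
  "fock_inner F G = (\<integral> z. F z * cnj (G z) * exp (- pi * (norm z)\<^sup>2) \<partial>lborel)"

definition fock_space :: "(complex^'d::finite \<Rightarrow> complex) set" where
  "fock_space = {F. entire_fun F \<and> fock_norm2 F < \<infinity>}"

definition polyfock_space :: "nat^'d::finite \<Rightarrow> (complex^'d \<Rightarrow> complex) set" where
  "polyfock_space n = {F. (\<exists>\<phi>. (\<forall>k\<in>K_set n. entire_fun (\<phi> k)) \<and>
        (\<forall>z. F z = (\<Sum>k\<in>K_set n. cmpow z k * \<phi> k z))) \<and> fock_norm2 F < \<infinity>}"

definition ek :: "nat^'d::finite \<Rightarrow> complex^'d \<Rightarrow> complex" where
  "ek k z = complex_of_real (sqrt (pi ^ mabs k / real (mfact k))) * mpow z k"

definition beta_op :: "complex^'d::finite \<Rightarrow> (complex^'d \<Rightarrow> complex) \<Rightarrow> complex^'d \<Rightarrow> complex" where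
  "beta_op z F \<zeta> = exp (complex_of_real pi * cdot z \<zeta> - complex_of_real (pi / 2 * (norm z)\<^sup>2)) * F (\<zeta> - z)"

definition split_vec :: "real^('d::finite + 'd) \<Rightarrow> (real^'d) \<times> (real^'d)" where
  "split_vec v = ((\<chi> i. v $ Inl i), (\<chi> i. v $ Inr i))"

definition is_lattice :: "((real^'d::finite) \<times> (real^'d)) set \<Rightarrow> bool" where
  "is_lattice \<Lambda> \<longleftrightarrow> (\<exists>A :: real^('d+'d)^('d+'d). invertible A \<and>
      \<Lambda> = {split_vec (A *v k) | k. \<forall>i. k$i \<in> \<int>})"

definition tf_shift :: "(real^'d::finite) \<times> (real^'d) \<Rightarrow> (real^'d \<Rightarrow> complex) \<Rightarrow> real^'d \<Rightarrow> complex" where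
  "tf_shift l f t = exp (complex_of_real (2 * pi) * \<i> * complex_of_real (snd l \<bullet> t)) * f (t - fst l)"

definition adjoint_lattice :: "((real^'d::finite) \<times> (real^'d)) set \<Rightarrow> ((real^'d) \<times> (real^'d)) set" where
  "adjoint_lattice \<Lambda> = {\<mu>. \<forall>l\<in>\<Lambda>. tf_shift l \<circ> tf_shift \<mu> = tf_shift \<mu> \<circ> tf_shift l}"

definition Gamma_set :: "((real^'d::finite) \<times> (real^'d)) set \<Rightarrow> (complex^'d) set" where
  "Gamma_set \<Lambda> = {(\<chi> j. Complex (x$j) (\<omega>$j)) | x \<omega>. (x, \<omega>) \<in> \<Lambda>}"

definition sampling_seq :: "nat^'d::finite \<Rightarrow> (complex^'d) set \<Rightarrow> bool" where
  "sampling_seq n \<Gamma> \<longleftrightarrow> (\<exists>A B :: real. A > 0 \<and> B > 0 \<and>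
     (\<forall>F\<in>polyfock_space n.
        ennreal A * fock_norm2 F \<le> (\<Sum>\<^sub>\<infinity>z\<in>\<Gamma>. ennreal ((cmod (F z))\<^sup>2 * exp (- pi * (norm z)\<^sup>2))) \<and>
        (\<Sum>\<^sub>\<infinity>z\<in>\<Gamma>. ennreal ((cmod (F z))\<^sup>2 * exp (- pi * (norm z)\<^sup>2))) \<le> ennreal B * fock_norm2 F))"

definition mult_interp :: "nat^'d::finite \<Rightarrow> (complex^'d) set \<Rightarrow> bool" where
  "mult_interp n \<Gamma> \<longleftrightarrow> (\<forall>\<alpha> :: complex^'d \<Rightarrow> nat^'d \<Rightarrow> complex.
     (\<Sum>\<^sub>\<infinity>(z,k)\<in>\<Gamma> \<times> K_set n. ennreal ((cmod (\<alpha> z k))\<^sup>2)) < \<infinity> \<longrightarrow>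
     (\<exists>F\<in>fock_space. \<forall>z\<in>\<Gamma>. \<forall>k\<in>K_set n. fock_inner F (beta_op z (ek k)) = \<alpha> z k))"

end

theory Submission
  imports Defs "HOL-Complex_Analysis.Complex_Analysis" "HOL-Probability.Distributions"
begin

no_notation fps_nth (infixl "$" 75)

text \<open>
  Write $v_{\mu,k} = \beta_\mu e_k$. Both properties are equivalent to the lower Riesz inequality
  $c \sum |a_{\mu,k}|^2 \le \|\sum a_{\mu,k} v_{\mu,k}\|^2$ for finite sums over $\mu$ in the adjoint lattice
  and $k \in K_n$.

  Sampling implies Riesz: apply the sampling inequality to
  $F^w(z) = e^{\pi |z|^2/2 - \pi |w|^2/2}\, \overline{\sum a_{\mu,k} (\beta_\mu \beta_z e_k)(w)}$. Since $\beta_z$ and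
  $\beta_\mu$ commute, the sampling sum equals $\sum_z |h(w-z)|^2 e^{-\pi |w-z|^2}$ with $h = \sum a_{\mu,k} v_{\mu,k}$.
  Integrating over $w$ in a fundamental domain gives $\|h\|^2$ on this side, and on the other side the
  different $\mu$ decouple by orthogonality of characters.

  Riesz implies sampling: $F(z) e^{-\pi |z|^2/2} = \sum_k \langle f_k, \beta_z e_k \rangle$ with $f_k$ holomorphic and
  $\|F\|^2 = \sum_k \|e_k\|^2 \|f_k\|^2$. For $a_{\mu,k} = \overline{(\beta_\mu f_k)(w)}$, Poisson summation turns
  $\sum a_{\mu,k} v_{\mu,k}$ into a superposition of the $\beta_{-z} K_w$ ($K_w$ the reproducing kernel) whose
  coefficients are the conjugate samples of $F$; integrate the Riesz inequality over $w$. The convergence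
  questions are easy when the $f_k$ have exponential type, and a general $F$ is the orthogonal sum of
  components, homogeneous under rotations, for which this holds.

  Riesz implies interpolation by Gram--Schmidt orthogonalisation and a limit. If conversely the Riesz inequality
  fails, then translating along the lattice yields unit coefficient families with disjoint supports and rapidly
  decreasing norms of the corresponding sums; a weighted sum of these families is square-summable data that
  cannot be interpolated.
\<close>

section \<open>Lebesgue measure and Gaussian integrals\<close>

text \<open>The equivalence is a duality of Gabor type: a vector-valued frame over a lattice
  corresponds to a Riesz sequence over the adjoint lattice. Behind it stands the symplectic form
  Im(conj(z) . \<mu>). Its integrality makes \<open>beta_op z\<close> and
  \<open>beta_op \<mu>\<close> commute, and at the same time turns the points of the adjoint lattice
  into the frequencies of functions periodic under the lattice. Hence sums over one lattice become
  diagonal over the other as soon as a free point w is averaged over a fundamental domain.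

  The obstacle is convergence. A general function of either space may grow almost like exp(pi |z|^2
  / 2), which leaves no room for exchanging sums and integrals. The computations are therefore made
  for entire functions of exponential type. Against the Gaussian they keep a positive rate of decay,
  and bounds of the form exp(C |x| - e |x|^2) serve for Fubini, for lattice sums and for Poisson
  summation alike. General functions appear only through limits: a locally uniform limit with Fatou
  on the interpolation side, orthogonal partial sums on the sampling side.\<close>

lemma nn_integral_lborel_translate:
  fixes f :: "'a::euclidean_space \<Rightarrow> ennreal"
  assumes [measurable]: "f \<in> borel_measurable borel"
  shows "(\<integral>\<^sup>+x. f (x + c) \<partial>lborel) = (\<integral>\<^sup>+x. f x \<partial>lborel)"
proof -
  have "(\<integral>\<^sup>+x. f x \<partial>lborel) = (\<integral>\<^sup>+x. f x \<partial>distr lborel borel ((+) c))"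
    by (simp add: lborel_distr_plus)
  also have "\<dots> = (\<integral>\<^sup>+x. f (c + x) \<partial>lborel)"
    by (rule nn_integral_distr) auto
  finally show ?thesis by (simp add: add.commute)
qed

text \<open>The affine change of variables with every scaling factor equal to -1 has Jacobian
  1.\<close>

lemma lborel_distr_uminus_euclidean: "distr lborel borel uminus = (lborel :: 'a::euclidean_space measure)"
proof -
  have "(lborel :: 'a measure) = density (distr lborel borel (\<lambda>x. 0 + (\<Sum>j\<in>Basis. ((-1) * (x \<bullet> j)) *\<^sub>R j)))
          (\<lambda>_. (\<Prod>j\<in>(Basis::'a set). \<bar>-1::real\<bar>))"
    by (rule lborel_affine_euclidean) auto
  moreover have "(\<lambda>x::'a. 0 + (\<Sum>j\<in>Basis. ((-1) * (x \<bullet> j)) *\<^sub>R j)) = uminus"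
    by (rule ext) (simp add: sum_negf euclidean_representation)
  ultimately show ?thesis by (simp add: density_1)
qed

lemma nn_integral_lborel_uminus:
  fixes f :: "'a::euclidean_space \<Rightarrow> ennreal"
  assumes [measurable]: "f \<in> borel_measurable borel"
  shows "(\<integral>\<^sup>+x. f (- x) \<partial>lborel) = (\<integral>\<^sup>+x. f x \<partial>lborel)"
proof -
  have "(\<integral>\<^sup>+x. f x \<partial>lborel) = (\<integral>\<^sup>+x. f x \<partial>distr lborel borel uminus)"
    by (simp add: lborel_distr_uminus_euclidean)
  also have "\<dots> = (\<integral>\<^sup>+x. f (- x) \<partial>lborel)"
    by (rule nn_integral_distr) auto
  finally show ?thesis by simp
qed

lemma nn_integral_lborel_reflect:
  fixes f :: "'a::euclidean_space \<Rightarrow> ennreal"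
  assumes [measurable]: "f \<in> borel_measurable borel"
  shows "(\<integral>\<^sup>+x. f (c - x) \<partial>lborel) = (\<integral>\<^sup>+x. f x \<partial>lborel)"
proof -
  have "(\<integral>\<^sup>+x. f (c - x) \<partial>lborel) = (\<integral>\<^sup>+x. f (- (x + (-c))) \<partial>lborel)" by simp
  also have "\<dots> = (\<integral>\<^sup>+x. f (- x) \<partial>lborel)"
    by (rule nn_integral_lborel_translate) measurable
  finally show ?thesis by (simp add: nn_integral_lborel_uminus)
qed

lemma integral_lborel_translate:
  fixes f :: "'a::euclidean_space \<Rightarrow> complex"
  assumes [measurable]: "f \<in> borel_measurable borel"
  shows "(\<integral>x. f (x + c) \<partial>lborel) = (\<integral>x. f x \<partial>lborel)"
proof -
  have "(\<integral>x. f x \<partial>lborel) = (\<integral>x. f x \<partial>distr lborel borel ((+) c))"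
    by (simp add: lborel_distr_plus)
  also have "\<dots> = (\<integral>x. f (c + x) \<partial>lborel)"
    by (rule integral_distr) auto
  finally show ?thesis by (simp add: add.commute)
qed

lemma integral_lborel_reflect:
  fixes f :: "'a::euclidean_space \<Rightarrow> complex"
  assumes [measurable]: "f \<in> borel_measurable borel"
  shows "(\<integral>x. f (c - x) \<partial>lborel) = (\<integral>x. f x \<partial>lborel)"
proof -
  have "(\<integral>x. f (c - x) \<partial>lborel) = (\<integral>x. f (- (x + (-c))) \<partial>lborel)" by simp
  also have "\<dots> = (\<integral>x. f (- x) \<partial>lborel)"
    by (rule integral_lborel_translate) measurable
  also have "\<dots> = (\<integral>x. f x \<partial>distr lborel borel uminus)"
    by (rule integral_distr[symmetric]) auto
  finally show ?thesis by (simp add: lborel_distr_uminus_euclidean)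
qed

lemma nn_integral_gauss_real:
  assumes "e > 0"
  shows "(\<integral>\<^sup>+x. ennreal (exp (- e * (x::real)\<^sup>2)) \<partial>lborel) = ennreal (sqrt (pi / e))"
proof -
  \<comment> \<open>The standard deviation for which the normal density is proportional to exp(-e
    x^2).\<close>
  define s where "s = 1 / sqrt (2 * e)"
  have s: "s > 0" "2 * s\<^sup>2 = 1 / e" using assms by (auto simp: s_def power_divide)
  have eq: "exp (- e * x\<^sup>2) = sqrt (pi / e) * normal_density 0 s x" for x
  proof -
    have "2 * pi * s\<^sup>2 = pi / e" using s(2) by (simp add: field_simps)
    moreover have "(x - 0)\<^sup>2 / (2 * s\<^sup>2) = e * x\<^sup>2" by (simp only: s(2)) simp
    ultimately show ?thesis
      using assms by (simp add: normal_density_def)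
  qed
  have "(\<integral>\<^sup>+x. ennreal (normal_density 0 s x) \<partial>lborel) = 1"
    using s by (simp add: nn_integral_eq_integral normal_density_nonneg)
  then show ?thesis
    using assms unfolding eq by (simp add: ennreal_mult normal_density_nonneg nn_integral_cmult)
qed

lemma nn_integral_gauss:
  fixes e :: real
  assumes "e > 0"
  shows "(\<integral>\<^sup>+x. ennreal (exp (- e * (norm (x::'a::euclidean_space))\<^sup>2)) \<partial>lborel) = ennreal (sqrt (pi / e) ^ DIM('a))"
proof -
  have "(\<integral>\<^sup>+x. ennreal (exp (- e * (norm (x::'a))\<^sup>2)) \<partial>lborel)
      = (\<integral>\<^sup>+x. (\<Prod>b\<in>Basis. ennreal (exp (- e * ((x::'a) \<bullet> b)\<^sup>2))) \<partial>lborel)"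
  proof (rule nn_integral_cong)
    fix x :: 'a
    have "(norm x)\<^sup>2 = (\<Sum>b\<in>Basis. (x \<bullet> b)\<^sup>2)"
      by (subst power2_norm_eq_inner, subst euclidean_inner) (simp add: power2_eq_square)
    then have "exp (- e * (norm x)\<^sup>2) = (\<Prod>b\<in>Basis. exp (- e * (x \<bullet> b)\<^sup>2))"
      by (simp add: sum_distrib_left exp_sum)
    then show "ennreal (exp (- e * (norm x)\<^sup>2)) = (\<Prod>b\<in>Basis. ennreal (exp (- e * (x \<bullet> b)\<^sup>2)))"
      by (simp add: prod_ennreal)
  qed
  also have "\<dots> = (\<Prod>b\<in>(Basis::'a set). (\<integral>\<^sup>+x. ennreal (exp (- e * x\<^sup>2)) \<partial>lborel))"
    by (rule nn_integral_lborel_prod) auto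
  finally show ?thesis
    using assms by (simp only: nn_integral_gauss_real prod_constant) (simp add: ennreal_power)
qed

text \<open>Uniqueness of Haar measure, tested against a radial Gaussian.\<close>

lemma nn_integral_lborel_orthogonal:
  fixes f :: "'a::euclidean_space \<Rightarrow> ennreal"
  assumes [measurable]: "f \<in> borel_measurable borel" and U: "orthogonal_transformation (U :: 'a \<Rightarrow> 'a)"
  shows "(\<integral>\<^sup>+x. f (U x) \<partial>lborel) = (\<integral>\<^sup>+x. f x \<partial>lborel)"
proof -
  define g :: "'a \<Rightarrow> ennreal" where "g x = ennreal (exp (- 1 * (norm x)\<^sup>2))" for x
  have lin: "linear U" and nU: "\<And>x. norm (U x) = norm x"
    using U by (auto simp: orthogonal_transformation)
  have [measurable]: "U \<in> borel_measurable borel"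
    using lin by (simp add: borel_measurable_continuous_onI linear_continuous_on linear_conv_bounded_linear)
  have [measurable]: "g \<in> borel_measurable borel" unfolding g_def by measurable
  have inj: "inj U"
    using linear_injective_0[OF lin] nU by (metis norm_eq_zero)
  have "surj U" by (rule linear_injective_imp_surjective[OF lin inj refl])
  then obtain V where V: "\<And>y. U (V y) = y" by (metis surj_f_inv_f)
  let ?c = "\<integral>\<^sup>+x. g x \<partial>(lborel::'a measure)"
  have c: "?c < \<infinity>"
    using nn_integral_gauss[of 1, where 'a='a] unfolding g_def by simp
  have c0: "?c \<noteq> 0"
  proof
    assume "?c = 0"
    then have "AE x in (lborel::'a measure). g x = 0" by (simp add: nn_integral_0_iff_AE)
    then have "AE x in (lborel::'a measure). False" by (rule eventually_mono) (simp add: g_def)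
    then show False
      by (simp add: eventually_False ae_filter_eq_bot_iff)
  qed
  have gs: "(\<integral>\<^sup>+x. g (y - U x) \<partial>lborel) = ?c" for y
  proof -
    have "g (y - U x) = g (V y - x)" for x
      using nU[of "V y - x"] by (simp add: g_def linear_diff[OF lin] V)
    then show ?thesis by (simp add: nn_integral_lborel_reflect)
  qed
  \<comment> \<open>The product with the mass of g is a double integral. Translating x brings y into
    the argument of f; after the exchange, translating y moves U from f into g, where the radial
    Gaussian does not see it.\<close>
  have "(\<integral>\<^sup>+x. f (U x) \<partial>lborel) * ?c = (\<integral>\<^sup>+y. (\<integral>\<^sup>+x. f (U x) \<partial>lborel) * g y \<partial>lborel)"
    by (simp add: nn_integral_cmult)
  also have "\<dots> = (\<integral>\<^sup>+y. (\<integral>\<^sup>+x. f (U x) * g y \<partial>lborel) \<partial>lborel)"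
    by (simp add: nn_integral_multc)
  also have "\<dots> = (\<integral>\<^sup>+y. (\<integral>\<^sup>+x. f (U x + y) * g y \<partial>lborel) \<partial>lborel)"
  proof (rule nn_integral_cong)
    fix y
    have "(\<integral>\<^sup>+x. f (U (x + V y)) * g y \<partial>lborel) = (\<integral>\<^sup>+x. f (U x) * g y \<partial>lborel)"
      by (rule nn_integral_lborel_translate[where f="\<lambda>x. f (U x) * g y"]) measurable
    then show "(\<integral>\<^sup>+x. f (U x) * g y \<partial>lborel) = (\<integral>\<^sup>+x. f (U x + y) * g y \<partial>lborel)"
      by (simp add: linear_add[OF lin] V)
  qed
  also have "\<dots> = (\<integral>\<^sup>+x. (\<integral>\<^sup>+y. f (U x + y) * g y \<partial>lborel) \<partial>lborel)"
    by (rule lborel_pair.Fubini') measurable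
  also have "\<dots> = (\<integral>\<^sup>+x. (\<integral>\<^sup>+y. f y * g (y - U x) \<partial>lborel) \<partial>lborel)"
  proof (rule nn_integral_cong)
    fix x
    have "(\<integral>\<^sup>+y. f (y + U x) * g ((y + U x) - U x) \<partial>lborel) = (\<integral>\<^sup>+y. f y * g (y - U x) \<partial>lborel)"
      by (rule nn_integral_lborel_translate[where f="\<lambda>y. f y * g (y - U x)"]) measurable
    then show "(\<integral>\<^sup>+y. f (U x + y) * g y \<partial>lborel) = (\<integral>\<^sup>+y. f y * g (y - U x) \<partial>lborel)"
      by (simp add: add.commute)
  qed
  also have "\<dots> = (\<integral>\<^sup>+y. (\<integral>\<^sup>+x. f y * g (y - U x) \<partial>lborel) \<partial>lborel)"
    by (rule lborel_pair.Fubini') measurable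
  also have "\<dots> = (\<integral>\<^sup>+y. f y \<partial>lborel) * ?c"
    by (simp add: nn_integral_cmult nn_integral_multc gs)
  finally show ?thesis
    using c c0 by (simp add: ennreal_mult_cancel_left mult.commute[of _ "?c"] less_top[symmetric])
qed

text \<open>Goes through the image measure: the nonnegative version, applied to indicators,
  identifies it with Lebesgue measure.\<close>

lemma integral_lborel_orthogonal:
  fixes f :: "'a::euclidean_space \<Rightarrow> complex"
  assumes [measurable]: "f \<in> borel_measurable borel" and U: "orthogonal_transformation (U :: 'a \<Rightarrow> 'a)"
  shows "(\<integral>x. f (U x) \<partial>lborel) = (\<integral>x. f x \<partial>lborel)"
proof -
  have lin: "linear U" using U by (auto simp: orthogonal_transformation)
  have [measurable]: "U \<in> borel_measurable borel"
    using lin by (simp add: borel_measurable_continuous_onI linear_continuous_on linear_conv_bounded_linear)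
  have "distr lborel borel U = lborel"
  proof (rule measure_eqI)
    fix A assume "A \<in> sets (distr lborel borel U)"
    then have [measurable]: "A \<in> sets borel" by simp
    have "(\<integral>\<^sup>+x. indicator A (U x) \<partial>lborel) = (\<integral>\<^sup>+x. indicator A x \<partial>distr lborel borel U)"
      by (rule nn_integral_distr[symmetric]) auto
    then have "emeasure (distr lborel borel U) A = (\<integral>\<^sup>+x. indicator A (U x) \<partial>lborel)"
      by simp
    then show "emeasure (distr lborel borel U) A = emeasure lborel A"
      by (simp add: nn_integral_lborel_orthogonal[OF _ U])
  qed simp
  then have "(\<integral>x. f x \<partial>lborel) = (\<integral>x. f x \<partial>distr lborel borel U)" by simp
  also have "\<dots> = (\<integral>x. f (U x) \<partial>lborel)" by (rule integral_distr) auto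
  finally show ?thesis by simp
qed

section \<open>Functions dominated by Gaussians\<close>

definition gauss :: "'a::real_normed_vector \<Rightarrow> complex" where
  "gauss z = complex_of_real (exp (- pi * (norm z)\<^sup>2))"

text \<open>The linear term makes the class stable under products and translations; for $e = 0$ it
  consists of the functions of at most exponential growth, and negative $e$ is allowed.\<close>

definition gauss_dom :: "real \<Rightarrow> ('a::euclidean_space \<Rightarrow> complex) \<Rightarrow> bool" where
  "gauss_dom e f \<longleftrightarrow> f \<in> borel_measurable borel \<and>
     (\<exists>C. \<forall>x. cmod (f x) \<le> C * exp (C * norm x - e * (norm x)\<^sup>2))"

lemma gauss_dom_measurable [measurable_dest]: "gauss_dom e f \<Longrightarrow> f \<in> borel_measurable borel"
  by (simp add: gauss_dom_def)

text \<open>The definition uses one constant both as prefactor and as linear rate. Estimates produce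
  two of them, which are enlarged here to a common nonnegative one.\<close>

lemma gauss_domI:
  fixes f :: "'a::euclidean_space \<Rightarrow> complex"
  assumes "f \<in> borel_measurable borel" "\<And>x. cmod (f x) \<le> A * exp (B * norm x - e * (norm x)\<^sup>2)"
  shows "gauss_dom e f"
  unfolding gauss_dom_def
proof (intro conjI exI allI)
  fix x :: 'a
  let ?C = "max (max A B) 0"
  have "A * exp (B * norm x - e * (norm x)\<^sup>2) \<le> ?C * exp (?C * norm x - e * (norm x)\<^sup>2)"
    by (intro mult_mono) (auto intro!: mult_right_mono)
  then show "cmod (f x) \<le> ?C * exp (?C * norm x - e * (norm x)\<^sup>2)"
    using assms(2)[of x] by linarith
qed (rule assms)

lemma gauss_domE:
  fixes f :: "'a::euclidean_space \<Rightarrow> complex"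
  assumes "gauss_dom e f"
  obtains C where "C > 0" "\<And>x. cmod (f x) \<le> C * exp (C * norm x - e * (norm x)\<^sup>2)"
proof -
  obtain C where C: "\<And>x. cmod (f x) \<le> C * exp (C * norm x - e * (norm x)\<^sup>2)"
    using assms by (auto simp: gauss_dom_def)
  show ?thesis
  proof (rule that[of "max C 1"])
    fix x :: 'a
    have "C * exp (C * norm x - e * (norm x)\<^sup>2) \<le> max C 1 * exp (max C 1 * norm x - e * (norm x)\<^sup>2)"
      by (intro mult_mono) (auto intro!: mult_right_mono)
    then show "cmod (f x) \<le> max C 1 * exp (max C 1 * norm x - e * (norm x)\<^sup>2)"
      using C[of x] by linarith
  qed simp
qed

lemma gauss_dom_mono:
  fixes f :: "'a::euclidean_space \<Rightarrow> complex"
  assumes f: "gauss_dom e f" and e: "e' \<le> e"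
  shows "gauss_dom e' f"
proof -
  obtain C where C: "C > 0" "\<And>x. cmod (f x) \<le> C * exp (C * norm x - e * (norm x)\<^sup>2)"
    using gauss_domE[OF f] by metis
  show "gauss_dom e' f"
  proof (rule gauss_domI)
    fix x :: 'a
    have "C * exp (C * norm x - e * (norm x)\<^sup>2) \<le> C * exp (C * norm x - e' * (norm x)\<^sup>2)"
      using e C(1) by (intro mult_left_mono) (auto intro!: mult_right_mono)
    then show "cmod (f x) \<le> C * exp (C * norm x - e' * (norm x)\<^sup>2)"
      using C(2)[of x] by linarith
  qed (use f in measurable)
qed

lemma gauss_dom_mult:
  fixes f :: "'a::euclidean_space \<Rightarrow> complex" and g :: "'a::euclidean_space \<Rightarrow> complex"
  assumes f: "gauss_dom e f" "gauss_dom e' g"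
  shows "gauss_dom (e + e') (\<lambda>x. f x * g x)"
proof -
  obtain C where C: "C > 0" "\<And>x. cmod (f x) \<le> C * exp (C * norm x - e * (norm x)\<^sup>2)"
    using gauss_domE[OF f(1)] by metis
  obtain D where D: "D > 0" "\<And>x. cmod (g x) \<le> D * exp (D * norm x - e' * (norm x)\<^sup>2)"
    using gauss_domE[OF f(2)] by metis
  show "gauss_dom (e + e') (\<lambda>x. f x * g x)"
  proof (rule gauss_domI)
    show "(\<lambda>x. f x * g x) \<in> borel_measurable borel" using f by measurable
    fix x :: 'a
    have "cmod (f x * g x) \<le> (C * exp (C * norm x - e * (norm x)\<^sup>2)) * (D * exp (D * norm x - e' * (norm x)\<^sup>2))"
      unfolding norm_mult by (intro mult_mono C D) (use C(1) in auto)
    also have "\<dots> = (C * D) * exp ((C + D) * norm x - (e + e') * (norm x)\<^sup>2)"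
      by (simp add: exp_add[symmetric] algebra_simps)
    finally show "cmod (f x * g x) \<le> (C * D) * exp ((C + D) * norm x - (e + e') * (norm x)\<^sup>2)" .
  qed
qed

lemma gauss_dom_mult0: "gauss_dom 0 f \<Longrightarrow> gauss_dom 0 g \<Longrightarrow> gauss_dom 0 (\<lambda>x. f x * g x)"
  using gauss_dom_mult[of 0 f 0 g] by simp

lemma gauss_dom_add:
  fixes f :: "'a::euclidean_space \<Rightarrow> complex" and g :: "'a::euclidean_space \<Rightarrow> complex"
  assumes f: "gauss_dom e f" "gauss_dom e g"
  shows "gauss_dom e (\<lambda>x. f x + g x)"
proof -
  obtain C where C: "C > 0" "\<And>x. cmod (f x) \<le> C * exp (C * norm x - e * (norm x)\<^sup>2)"
    using gauss_domE[OF f(1)] by metis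
  obtain D where D: "D > 0" "\<And>x. cmod (g x) \<le> D * exp (D * norm x - e * (norm x)\<^sup>2)"
    using gauss_domE[OF f(2)] by metis
  show "gauss_dom e (\<lambda>x. f x + g x)"
  proof (rule gauss_domI)
    show "(\<lambda>x. f x + g x) \<in> borel_measurable borel" using f by measurable
    fix x :: 'a
    let ?M = "max C D"
    have "C * exp (C * norm x - e * (norm x)\<^sup>2) \<le> C * exp (?M * norm x - e * (norm x)\<^sup>2)"
      "D * exp (D * norm x - e * (norm x)\<^sup>2) \<le> D * exp (?M * norm x - e * (norm x)\<^sup>2)"
      using C(1) D(1) by (auto intro!: mult_right_mono)
    then show "cmod (f x + g x) \<le> (C + D) * exp (?M * norm x - e * (norm x)\<^sup>2)"
      using norm_triangle_ineq[of "f x" "g x"] C(2)[of x] D(2)[of x] unfolding distrib_right by linarith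
  qed
qed

lemma gauss_dom_const: "gauss_dom 0 (\<lambda>x. c)"
  by (rule gauss_domI[where A="cmod c" and B=0]) auto

lemma gauss_dom_zero: "gauss_dom e (\<lambda>x. 0)"
  by (rule gauss_domI[where A="0" and B=0]) auto

lemma gauss_dom_sum: "(\<And>i. i \<in> I \<Longrightarrow> gauss_dom e (f i)) \<Longrightarrow> gauss_dom e (\<lambda>x. \<Sum>i\<in>I. f i x)"
  by (induction I rule: infinite_finite_induct) (auto intro: gauss_dom_zero gauss_dom_add)

lemma gauss_dom_prod: "(\<And>i. i \<in> I \<Longrightarrow> gauss_dom 0 (f i)) \<Longrightarrow> gauss_dom 0 (\<lambda>x. \<Prod>i\<in>I. f i x)"
  by (induction I rule: infinite_finite_induct) (auto intro: gauss_dom_const gauss_dom_mult0)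

lemma gauss_dom_power: "gauss_dom 0 f \<Longrightarrow> gauss_dom 0 (\<lambda>x. f x ^ n)"
  by (induction n) (auto intro: gauss_dom_const gauss_dom_mult0)

lemma gauss_dom_cnj: "gauss_dom e f \<Longrightarrow> gauss_dom e (\<lambda>x. cnj (f x))"
  unfolding gauss_dom_def by (auto intro!: measurable_compose[OF _ borel_measurable_continuous_onI[OF continuous_on_cnj[OF continuous_on_id]]])

lemma gauss_dom_cmult: "gauss_dom e f \<Longrightarrow> gauss_dom e (\<lambda>x. c * f x)"
  using gauss_dom_mult[OF gauss_dom_const, of e f c] by simp

lemma gauss_dom_gauss: "gauss_dom pi gauss"
  by (rule gauss_domI[where A=1 and B=0]) (auto simp: gauss_def[abs_def])

text \<open>Restricted to rate 0: a map of linear growth alters exponential growth only in its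
  constants, but it would rescale a quadratic rate.\<close>

lemma gauss_dom_compose:
  fixes f :: "'b::euclidean_space \<Rightarrow> complex" and A :: "'a::euclidean_space \<Rightarrow> 'b"
  assumes f: "gauss_dom 0 f" and A: "A \<in> borel_measurable borel" "\<And>x. norm (A x) \<le> K * norm x + L"
  shows "gauss_dom 0 (\<lambda>x. f (A x))"
proof -
  note [measurable] = gauss_dom_measurable[OF f]
  obtain C where C: "C > 0" "\<And>x. cmod (f x) \<le> C * exp (C * norm x - 0 * (norm x)\<^sup>2)"
    using gauss_domE[OF f] by metis
  show ?thesis
  proof (rule gauss_domI)
    show "(\<lambda>x. f (A x)) \<in> borel_measurable borel" using A(1) by measurable
    fix x :: 'a
    have "cmod (f (A x)) \<le> C * exp (C * norm (A x))" using C(2)[of "A x"] by simp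
    also have "\<dots> \<le> C * exp (C * (K * norm x + L))" using C(1) A(2)[of x] by auto
    finally show "cmod (f (A x)) \<le> (C * exp (C * L)) * exp ((C * K) * norm x - 0 * (norm x)\<^sup>2)"
      by (simp add: exp_add[symmetric] algebra_simps)
  qed
qed

lemma gauss_dom_translate: "gauss_dom 0 f \<Longrightarrow> gauss_dom 0 (\<lambda>x. f (x + c))"
  by (rule gauss_dom_compose[where K=1 and L="norm c"]) (auto intro: norm_triangle_ineq)

lemma gauss_dom_translate': "gauss_dom 0 f \<Longrightarrow> gauss_dom 0 (\<lambda>x. f (x - c))"
  using gauss_dom_translate[of f "-c"] by simp

lemma gauss_dom_diff_pair:
  fixes f :: "'a::euclidean_space \<Rightarrow> complex"
  assumes "gauss_dom 0 f"
  shows "gauss_dom 0 (\<lambda>p. f (fst p - snd p))"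
proof (rule gauss_dom_compose[OF assms, where K=2 and L=0])
  show "norm (fst x - snd x) \<le> 2 * norm x + 0" for x :: "'a \<times> 'a"
    using norm_triangle_ineq4[of "fst x" "snd x"] norm_fst_le[of "fst x" "snd x"] norm_snd_le[of "snd x" "fst x"] by simp
  show "(\<lambda>x::'a \<times> 'a. fst x - snd x) \<in> borel_measurable borel"
    by (intro borel_measurable_continuous_onI continuous_intros)
qed

text \<open>Squared norms add on a product, so a common rate survives, while both linear terms are
  bounded by the norm of the pair.\<close>

lemma gauss_dom_pair:
  fixes f :: "'a::euclidean_space \<Rightarrow> complex" and g :: "'b::euclidean_space \<Rightarrow> complex"
  assumes "gauss_dom e f" "gauss_dom e g"
  shows "gauss_dom e (\<lambda>p. f (fst p) * g (snd p))"
proof -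
  note [measurable] = assms[THEN gauss_dom_measurable]
  obtain C where C: "C > 0" "\<And>x. cmod (f x) \<le> C * exp (C * norm x - e * (norm x)\<^sup>2)"
    using gauss_domE[OF assms(1)] by metis
  obtain D where D: "D > 0" "\<And>x. cmod (g x) \<le> D * exp (D * norm x - e * (norm x)\<^sup>2)"
    using gauss_domE[OF assms(2)] by metis
  show ?thesis
  proof (rule gauss_domI)
    show "(\<lambda>p. f (fst p) * g (snd p)) \<in> borel_measurable borel"
      unfolding borel_prod[symmetric] by measurable
    fix p :: "'a \<times> 'b"
    have n: "(norm p)\<^sup>2 = (norm (fst p))\<^sup>2 + (norm (snd p))\<^sup>2" by (simp add: norm_prod_def)
    have "cmod (f (fst p) * g (snd p)) \<le> (C * exp (C * norm (fst p) - e * (norm (fst p))\<^sup>2)) * (D * exp (D * norm (snd p) - e * (norm (snd p))\<^sup>2))"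
      unfolding norm_mult by (intro mult_mono C D) (use C(1) in auto)
    also have "\<dots> = (C * D) * exp (C * norm (fst p) + D * norm (snd p) - e * (norm p)\<^sup>2)"
      unfolding n by (simp add: exp_add[symmetric] algebra_simps)
    also have "\<dots> \<le> (C * D) * exp ((C + D) * norm p - e * (norm p)\<^sup>2)"
      using C(1) D(1) norm_fst_le[of "fst p" "snd p"] norm_snd_le[of "snd p" "fst p"]
      by (auto simp: distrib_right intro!: add_mono)
    finally show "cmod (f (fst p) * g (snd p)) \<le> (C * D) * exp ((C + D) * norm p - e * (norm p)\<^sup>2)" .
  qed
qed

lemma gauss_dom_fst: "gauss_dom 0 f \<Longrightarrow> gauss_dom 0 (\<lambda>p. f (fst p))"
  using gauss_dom_pair[of 0 f "\<lambda>_. 1"] gauss_dom_const[of 1] by auto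

lemma gauss_dom_snd: "gauss_dom 0 f \<Longrightarrow> gauss_dom 0 (\<lambda>p. f (snd p))"
  using gauss_dom_pair[of 0 "\<lambda>_. 1" f] gauss_dom_const[of 1] by auto

text \<open>By completing the square, half of the quadratic rate absorbs the linear term at the
  price of the constant exp(C^2 / (2 e)); the other half is integrable.\<close>

lemma gauss_dom_integrable:
  fixes f :: "'a::euclidean_space \<Rightarrow> complex"
  assumes f: "gauss_dom e f" and e: "e > 0"
  shows "integrable lborel f"
proof -
  obtain C where C: "C > 0" "\<And>x. cmod (f x) \<le> C * exp (C * norm x - e * (norm x)\<^sup>2)"
    using gauss_domE[OF f] by metis
  have le: "cmod (f x) \<le> (C * exp (C\<^sup>2 / (2 * e))) * exp (- (e/2) * (norm x)\<^sup>2)" for x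
  proof -
    have "0 \<le> (e * norm x - C)\<^sup>2 / (2 * e)" using e by simp
    also have "\<dots> = e/2 * (norm x)\<^sup>2 - C * norm x + C\<^sup>2 / (2 * e)"
      using e by (simp add: field_simps power2_eq_square)
    finally have "C * norm x - e * (norm x)\<^sup>2 \<le> C\<^sup>2 / (2 * e) + (- (e/2) * (norm x)\<^sup>2)"
      by (simp add: field_simps)
    then have "C * exp (C * norm x - e * (norm x)\<^sup>2) \<le> C * exp (C\<^sup>2 / (2 * e) + (- (e/2) * (norm x)\<^sup>2))"
      using C(1) by simp
    then show ?thesis using C(2)[of x] by (simp only: exp_add mult.assoc)
  qed
  have int: "integrable lborel (\<lambda>x::'a. exp (- (e/2) * (norm x)\<^sup>2))"
    by (rule integrableI_nonneg) (use nn_integral_gauss[of "e/2", where 'a='a] e in \<open>auto simp: less_top[symmetric]\<close>)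
  show ?thesis
    by (rule Bochner_Integration.integrable_bound[OF integrable_mult_right[OF int, of "C * exp (C\<^sup>2 / (2 * e))"]])
       (use f le C(1) in \<open>auto intro!: AE_I2 simp: abs_mult intro: gauss_dom_measurable\<close>)
qed

text \<open>The purpose of the class: a single joint bound on the product space licenses an exchange
  of integrals.\<close>

lemma gauss_dom_Fubini:
  fixes f :: "'a::euclidean_space \<times> 'b::euclidean_space \<Rightarrow> complex"
  assumes f: "gauss_dom e f" and e: "e > 0"
  shows "(\<integral>y. (\<integral>x. f (x, y) \<partial>lborel) \<partial>lborel) = (\<integral>x. (\<integral>y. f (x, y) \<partial>lborel) \<partial>lborel)"
proof -
  have "integrable (lborel \<Otimes>\<^sub>M lborel) (\<lambda>(x, y). f (x, y))"
    using gauss_dom_integrable[OF f e] by (simp add: lborel_prod)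
  then show ?thesis by (rule lborel_pair.Fubini_integral)
qed

lemma integral_gauss: "(\<integral>z. gauss (z::complex^'d::finite) \<partial>lborel) = 1"
proof -
  have "(\<integral>z. exp (- pi * (norm (z::complex^'d))\<^sup>2) \<partial>lborel) = enn2real (\<integral>\<^sup>+z. ennreal (exp (- pi * (norm (z::complex^'d))\<^sup>2)) \<partial>lborel)"
    by (rule integral_eq_nn_integral) auto
  also have "\<dots> = 1" by (subst nn_integral_gauss) simp_all
  finally show ?thesis by (simp add: gauss_def)
qed

section \<open>The Hermitian form and its exponentials\<close>

lemma cmod_cdot_le: "cmod (cdot u v) \<le> norm u * norm v"
proof -
  have "cmod (cdot u v) \<le> (\<Sum>j\<in>UNIV. \<bar>cmod (u$j)\<bar> * \<bar>cmod (v$j)\<bar>)"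
    unfolding cdot_def by (rule order_trans[OF norm_sum]) (simp add: norm_mult)
  also have "\<dots> \<le> norm u * norm v"
    unfolding norm_vec_def by (rule L2_set_mult_ineq)
  finally show ?thesis .
qed

lemma cdot_cnj: "cnj (cdot u v) = cdot v u"
  by (simp add: cdot_def mult.commute)

lemma cdot_self: "cdot z z = complex_of_real ((norm z)\<^sup>2)"
  by (simp add: cdot_def norm_vec_def L2_set_def sum_nonneg complex_norm_square mult.commute flip: of_real_power)

lemma cdot_add_left: "cdot (u + v) w = cdot u w + cdot v w"
  and cdot_add_right: "cdot w (u + v) = cdot w u + cdot w v"
  and cdot_diff_left: "cdot (u - v) w = cdot u w - cdot v w"
  and cdot_diff_right: "cdot w (u - v) = cdot w u - cdot w v"
  and cdot_minus_left: "cdot (- u) w = - cdot u w"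
  and cdot_minus_right: "cdot w (- u) = - cdot w u"
  by (simp_all add: cdot_def algebra_simps sum.distrib sum_subtractf sum_negf)

lemma cdot_zero [simp]: "cdot 0 w = 0" "cdot w 0 = 0"
  by (simp_all add: cdot_def)

lemma continuous_on_cdot [continuous_intros]:
  "continuous_on S f \<Longrightarrow> continuous_on S g \<Longrightarrow> continuous_on S (\<lambda>x. cdot (f x) (g x))"
  unfolding cdot_def by (intro continuous_intros)

lemma borel_measurable_cdot [measurable]:
  fixes f g :: "_ \<Rightarrow> complex^'d::finite"
  assumes [measurable]: "f \<in> borel_measurable M" "g \<in> borel_measurable M"
  shows "(\<lambda>x. cdot (f x) (g x)) \<in> borel_measurable M"
proof -
  have "(\<lambda>p::(complex^'d) \<times> (complex^'d). cdot (fst p) (snd p)) \<in> borel_measurable borel"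
    by (intro borel_measurable_continuous_onI continuous_intros)
  then have "(\<lambda>p::(complex^'d) \<times> (complex^'d). cdot (fst p) (snd p)) \<in> borel_measurable (borel \<Otimes>\<^sub>M borel)"
    by (simp add: borel_prod)
  from measurable_compose[OF _ this, of "\<lambda>x. (f x, g x)" M] show ?thesis by simp
qed

lemma norm_scale: "norm (c *s (v::complex^'d::finite)) = cmod c * norm v"
  by (simp add: norm_vec_def norm_mult L2_set_right_distrib)

lemma gauss_dom_exp_cdot: "gauss_dom 0 (\<lambda>u. exp (of_real pi * cdot z u))" "gauss_dom 0 (\<lambda>u. exp (of_real pi * cdot u z))"
proof -
  show "gauss_dom 0 (\<lambda>u. exp (of_real pi * cdot z u))"
  proof (rule gauss_domI[where A=1 and B="pi * norm z"])
    show "cmod (exp (of_real pi * cdot z u)) \<le> 1 * exp (pi * norm z * norm u - 0 * (norm u)\<^sup>2)" for u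
    proof -
      have "norm (of_real pi * cdot z u) \<le> pi * norm z * norm u"
        using cmod_cdot_le[of z u] by (simp add: norm_mult mult.assoc)
      then show ?thesis by (intro order_trans[OF norm_exp]) simp
    qed
  qed measurable
  show "gauss_dom 0 (\<lambda>u. exp (of_real pi * cdot u z))"
  proof (rule gauss_domI[where A=1 and B="pi * norm z"])
    show "cmod (exp (of_real pi * cdot u z)) \<le> 1 * exp (pi * norm z * norm u - 0 * (norm u)\<^sup>2)" for u
    proof -
      have "norm (of_real pi * cdot u z) \<le> pi * norm z * norm u"
        using cmod_cdot_le[of u z] by (simp add: norm_mult mult_ac)
      then show ?thesis by (intro order_trans[OF norm_exp]) simp
    qed
  qed measurable
qed

text \<open>By the arithmetic-geometric inequality the reproducing kernel costs at most pi/2 of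
  quadratic rate. A Gaussian in each variable supplies pi, so that pi/2 is left over in double
  integrals involving the kernel.\<close>

lemma gauss_dom_exp_cdot_pair: "gauss_dom (- pi / 2) (\<lambda>p. exp (of_real pi * cdot (fst p) (snd p)))"
proof (rule gauss_domI[where A=1 and B=0])
  show "cmod (exp (of_real pi * cdot (fst p) (snd p))) \<le> 1 * exp (0 * norm p - (- pi / 2) * (norm p)\<^sup>2)" for p :: "(complex^'d) \<times> (complex^'d)"
  proof -
    have "norm (fst p) * norm (snd p) \<le> (norm p)\<^sup>2 / 2"
      using sum_squares_bound[of "norm (fst p)" "norm (snd p)"] by (simp add: norm_prod_def)
    then have "cmod (cdot (fst p) (snd p)) \<le> (norm p)\<^sup>2 / 2"
      using cmod_cdot_le[of "fst p" "snd p"] by linarith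
    then have "norm (of_real pi * cdot (fst p) (snd p)) \<le> pi * ((norm p)\<^sup>2 / 2)" by (simp add: norm_mult)
    then show ?thesis by (intro order_trans[OF norm_exp]) simp
  qed
  show "(\<lambda>p::(complex^'d) \<times> (complex^'d). exp (of_real pi * cdot (fst p) (snd p))) \<in> borel_measurable borel"
    unfolding borel_prod[symmetric] by measurable
qed

lemma gauss_dom_vec_nth: "gauss_dom 0 (\<lambda>z::complex^'d::finite. z $ j)"
proof (rule gauss_domI[where A=1 and B=1])
  show "cmod (z $ j) \<le> 1 * exp (1 * norm z - 0 * (norm z)\<^sup>2)" for z :: "complex^'d"
    using order_trans[OF Finite_Cartesian_Product.norm_nth_le[of z j] order_trans[OF _ exp_ge_add_one_self, of "norm z" "norm z"]] by simp
qed (intro borel_measurable_continuous_onI continuous_intros)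

section \<open>Entire functions of exponential type\<close>

lemma entireD: "entire_fun F \<Longrightarrow> \<exists>c. (F has_derivative (\<lambda>h. \<Sum>j\<in>UNIV. c $ j * h $ j)) (at z)"
  by (simp add: entire_fun_def)

lemma entire_continuous:
  assumes F: "entire_fun F"
  shows "continuous_on UNIV F"
proof (rule continuous_at_imp_continuous_on, rule ballI)
  fix z
  obtain c where "(F has_derivative (\<lambda>h. \<Sum>j\<in>UNIV. c $ j * h $ j)) (at z)"
    using entireD[OF F, of z] by (rule exE)
  then show "isCont F z" by (rule has_derivative_continuous)
qed

lemma entire_measurable: "entire_fun F \<Longrightarrow> F \<in> borel_measurable borel"
  by (simp add: entire_continuous borel_measurable_continuous_onI)

lemma entire_const: "entire_fun (\<lambda>z. a)"
  unfolding entire_fun_def by (intro allI exI[of _ 0]) (simp add: has_derivative_const)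

lemma entire_add:
  assumes "entire_fun F" "entire_fun G"
  shows "entire_fun (\<lambda>z. F z + G z)"
  unfolding entire_fun_def
proof
  fix z
  obtain c where c: "(F has_derivative (\<lambda>h. \<Sum>j\<in>UNIV. c $ j * h $ j)) (at z)"
    using entireD[OF assms(1)] by blast
  obtain d where d: "(G has_derivative (\<lambda>h. \<Sum>j\<in>UNIV. d $ j * h $ j)) (at z)"
    using entireD[OF assms(2)] by blast
  from has_derivative_add[OF c d]
  have "((\<lambda>z. F z + G z) has_derivative (\<lambda>h. \<Sum>j\<in>UNIV. (c + d) $ j * h $ j)) (at z)"
    by (simp add: distrib_right sum.distrib)
  then show "\<exists>c. ((\<lambda>z. F z + G z) has_derivative (\<lambda>h. \<Sum>j\<in>UNIV. c $ j * h $ j)) (at z)" by blast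
qed

lemma entire_mult:
  assumes "entire_fun F" "entire_fun G"
  shows "entire_fun (\<lambda>z. F z * G z)"
  unfolding entire_fun_def
proof
  fix z
  obtain c where c: "(F has_derivative (\<lambda>h. \<Sum>j\<in>UNIV. c $ j * h $ j)) (at z)"
    using entireD[OF assms(1)] by blast
  obtain d where d: "(G has_derivative (\<lambda>h. \<Sum>j\<in>UNIV. d $ j * h $ j)) (at z)"
    using entireD[OF assms(2)] by blast
  from has_derivative_mult[OF c d]
  have "((\<lambda>z. F z * G z) has_derivative (\<lambda>h. \<Sum>j\<in>UNIV. (F z *s d + G z *s c) $ j * h $ j)) (at z)"
    by (simp add: algebra_simps sum.distrib sum_distrib_left)
  then show "\<exists>c. ((\<lambda>z. F z * G z) has_derivative (\<lambda>h. \<Sum>j\<in>UNIV. c $ j * h $ j)) (at z)" by blast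
qed

lemma entire_cmult: "entire_fun F \<Longrightarrow> entire_fun (\<lambda>z. a * F z)"
  by (rule entire_mult[OF entire_const])

lemma entire_sum: "(\<And>i. i \<in> I \<Longrightarrow> entire_fun (F i)) \<Longrightarrow> entire_fun (\<lambda>z. \<Sum>i\<in>I. F i z)"
  by (induction I rule: infinite_finite_induct) (auto intro: entire_const entire_add)

lemma entire_prod: "(\<And>i. i \<in> I \<Longrightarrow> entire_fun (F i)) \<Longrightarrow> entire_fun (\<lambda>z. \<Prod>i\<in>I. F i z)"
  by (induction I rule: infinite_finite_induct) (auto intro: entire_const entire_mult)

lemma entire_power: "entire_fun F \<Longrightarrow> entire_fun (\<lambda>z. F z ^ k)"
  by (induction k) (auto intro: entire_const entire_mult)

lemma entire_diff: "entire_fun F \<Longrightarrow> entire_fun G \<Longrightarrow> entire_fun (\<lambda>z. F z - G z)"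
  using entire_add[of F "\<lambda>z. (-1) * G z"] entire_cmult[of G "-1"] by simp

lemma entire_vec_nth: "entire_fun (\<lambda>z. z $ j)"
  unfolding entire_fun_def
proof
  fix z :: "complex^'a"
  have "((\<lambda>z. z $ j) has_derivative (\<lambda>h. h $ j)) (at z)"
    by (rule bounded_linear_imp_has_derivative) (rule bounded_linear_vec_nth)
  moreover have "(\<lambda>h::complex^'a. h $ j) = (\<lambda>h. \<Sum>i\<in>UNIV. axis j 1 $ i * h $ i)"
  proof
    fix h :: "complex^'a"
    have "(\<Sum>i\<in>UNIV. axis j 1 $ i * h $ i) = (\<Sum>i\<in>UNIV. if i = j then h $ i else 0)"
      by (intro sum.cong) (auto simp: axis_def)
    then show "h $ j = (\<Sum>i\<in>UNIV. axis j 1 $ i * h $ i)" by simp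
  qed
  ultimately show "\<exists>c. ((\<lambda>z. z $ j) has_derivative (\<lambda>h. \<Sum>j\<in>UNIV. c $ j * h $ j)) (at z)" by metis
qed

lemma entire_cdot: "entire_fun (\<lambda>z. cdot w z)"
  unfolding cdot_def by (intro entire_sum entire_cmult entire_vec_nth)

lemma entire_holomorphic_compose:
  assumes F: "entire_fun F" and g: "\<And>z. g field_differentiable (at z)"
  shows "entire_fun (\<lambda>z. g (F z))"
  unfolding entire_fun_def
proof
  fix z
  obtain c where c: "(F has_derivative (\<lambda>h. \<Sum>j\<in>UNIV. c $ j * h $ j)) (at z)"
    using entireD[OF F] by blast
  obtain D where D: "(g has_field_derivative D) (at (F z))"
    using g by (auto simp: field_differentiable_def)
  have "((\<lambda>z. g (F z)) has_derivative (\<lambda>h. D * (\<Sum>j\<in>UNIV. c $ j * h $ j))) (at z)"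
    using has_derivative_compose[OF c D[unfolded has_field_derivative_def]] by simp
  then have "((\<lambda>z. g (F z)) has_derivative (\<lambda>h. \<Sum>j\<in>UNIV. (D *s c) $ j * h $ j)) (at z)"
    by (simp add: sum_distrib_left mult.assoc)
  then show "\<exists>c. ((\<lambda>z. g (F z)) has_derivative (\<lambda>h. \<Sum>j\<in>UNIV. c $ j * h $ j)) (at z)" by blast
qed

lemma entire_exp: "entire_fun F \<Longrightarrow> entire_fun (\<lambda>z. exp (F z))"
  by (rule entire_holomorphic_compose) (auto intro: field_differentiable_within_exp)

lemma bounded_linear_scale: "bounded_linear (\<lambda>v::complex^'d::finite. a *s v)"
  by (rule bounded_linear_intro[where K="cmod a"]) (simp_all add: vec_eq_iff norm_scale algebra_simps)
lemma has_derivative_scale: "((\<lambda>z::complex^'d::finite. a *s z) has_derivative (\<lambda>h. a *s h)) (at z)"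
  by (rule bounded_linear_imp_has_derivative[OF bounded_linear_scale])
lemma has_derivative_affine_scale: "((\<lambda>z::complex^'d::finite. a *s z + b) has_derivative (\<lambda>h. a *s h)) (at z)"
  using has_derivative_add_const[OF has_derivative_scale, of a b z] .
lemma bounded_linear_scale_left: "bounded_linear (\<lambda>t. t *s (v::complex^'d::finite))"
  by (rule bounded_linear_intro[where K="norm v"]) (simp_all add: vec_eq_iff norm_scale algebra_simps)
lemma has_derivative_scale_left: "((\<lambda>t. t *s (b::complex^'d::finite)) has_derivative (\<lambda>h. h *s b)) (at t)"
  by (rule bounded_linear_imp_has_derivative[OF bounded_linear_scale_left])
lemma has_derivative_line: "((\<lambda>t. a + t *s (b::complex^'d::finite)) has_derivative (\<lambda>h. h *s b)) (at t)"
  using has_derivative_add[OF has_derivative_const has_derivative_scale_left, of a b t] by simp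

lemma entire_affine:
  assumes F: "entire_fun F"
  shows "entire_fun (\<lambda>z. F (a *s z + b))"
  unfolding entire_fun_def
proof
  fix z :: "complex^'a"
  obtain c where c: "(F has_derivative (\<lambda>h. \<Sum>j\<in>UNIV. c $ j * h $ j)) (at (a *s z + b))"
    using entireD[OF F, of "a *s z + b"] by (rule exE)
  from has_derivative_compose[OF has_derivative_affine_scale c]
  have "((\<lambda>z. F (a *s z + b)) has_derivative (\<lambda>h. \<Sum>j\<in>UNIV. (a *s c) $ j * h $ j)) (at z)"
    by (simp add: mult_ac)
  then show "\<exists>c. ((\<lambda>z. F (a *s z + b)) has_derivative (\<lambda>h. \<Sum>j\<in>UNIV. c $ j * h $ j)) (at z)" by blast
qed

lemma entire_translate: "entire_fun F \<Longrightarrow> entire_fun (\<lambda>z. F (z + b))"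
  using entire_affine[of F 1 b] by simp

text \<open>Reduces several variables to one: mean values, Cauchy estimates and Taylor expansions
  are all taken along complex lines.\<close>

lemma entire_on_line:
  assumes F: "entire_fun F"
  shows "(\<lambda>t. F (a + t *s b)) holomorphic_on S"
proof -
  have "(\<lambda>t. F (a + t *s b)) field_differentiable (at t)" for t
  proof -
    obtain c where c: "(F has_derivative (\<lambda>h. \<Sum>j\<in>UNIV. c $ j * h $ j)) (at (a + t *s b))"
      using entireD[OF F, of "a + t *s b"] by (rule exE)
    from has_derivative_compose[OF has_derivative_line c]
    have "((\<lambda>t. F (a + t *s b)) has_derivative (\<lambda>h. (\<Sum>j\<in>UNIV. c $ j * b $ j) * h)) (at t)"
      by (simp add: sum_distrib_right sum_distrib_left mult_ac)
    then show ?thesis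
      unfolding field_differentiable_def has_field_derivative_def by (rule exI)
  qed
  then show ?thesis
    by (simp add: holomorphic_on_def field_differentiable_at_within)
qed

text \<open>Rate 0 in \<open>gauss_dom\<close> leaves the bound C exp(C |z|). The class contains the
  monomials and the exponentials exp(pi conj(w) . z), and it is closed under products and
  translations, hence under \<open>beta_op\<close>. Products of its members and their conjugates are
  absolutely integrable against the Gaussian.\<close>

definition exptype :: "(complex^'d::finite \<Rightarrow> complex) \<Rightarrow> bool" where
  "exptype f \<longleftrightarrow> entire_fun f \<and> gauss_dom 0 f"

lemma exptype_gauss_dom: "exptype f \<Longrightarrow> gauss_dom 0 f" and exptype_entire: "exptype f \<Longrightarrow> entire_fun f"
  by (auto simp: exptype_def)

lemma exptype_measurable: "exptype f \<Longrightarrow> f \<in> borel_measurable borel"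
  using gauss_dom_measurable exptype_def by blast

lemma exptype_const: "exptype (\<lambda>z. a)"
  by (simp add: exptype_def entire_const gauss_dom_const)

lemma exptype_mult: "exptype f \<Longrightarrow> exptype g \<Longrightarrow> exptype (\<lambda>z. f z * g z)"
  by (simp add: exptype_def entire_mult gauss_dom_mult0)

lemma exptype_cmult: "exptype f \<Longrightarrow> exptype (\<lambda>z. a * f z)"
  by (rule exptype_mult[OF exptype_const])

lemma exptype_add: "exptype f \<Longrightarrow> exptype g \<Longrightarrow> exptype (\<lambda>z. f z + g z)"
  by (simp add: exptype_def entire_add gauss_dom_add)

lemma exptype_sum: "(\<And>i. i \<in> I \<Longrightarrow> exptype (f i)) \<Longrightarrow> exptype (\<lambda>z. \<Sum>i\<in>I. f i z)"
  by (simp add: exptype_def entire_sum gauss_dom_sum)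

lemma exptype_vec_nth: "exptype (\<lambda>z. z $ j)"
  by (simp add: exptype_def entire_vec_nth gauss_dom_vec_nth)

lemma exptype_translate: "exptype f \<Longrightarrow> exptype (\<lambda>z. f (z + c))"
  by (simp add: exptype_def entire_translate gauss_dom_translate)

lemma exptype_translate': "exptype f \<Longrightarrow> exptype (\<lambda>z. f (z - c))"
  using exptype_translate[of f "-c"] by simp

lemma exptype_exp_cdot: "exptype (\<lambda>z. exp (of_real pi * cdot w z))"
  unfolding exptype_def by (intro conjI gauss_dom_exp_cdot entire_exp entire_cmult entire_cdot)

lemma exptype_mpow: "exptype (\<lambda>z. mpow z k)"
  unfolding mpow_def exptype_def
  by (intro conjI entire_prod entire_power entire_vec_nth gauss_dom_prod gauss_dom_power gauss_dom_vec_nth)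

lemma exptype_ek: "exptype (ek k)"
  unfolding ek_def[abs_def] by (rule exptype_cmult[OF exptype_mpow])

lemma beta_op_eq: "beta_op z F = (\<lambda>\<zeta>. of_real (exp (- (pi / 2 * (norm z)\<^sup>2))) * (exp (of_real pi * cdot z \<zeta>) * F (\<zeta> - z)))"
proof
  fix \<zeta>
  have "complex_of_real (exp (- (pi / 2 * (norm z)\<^sup>2))) * exp (of_real pi * cdot z \<zeta>) = exp (of_real pi * cdot z \<zeta> - of_real (pi / 2 * (norm z)\<^sup>2))"
    unfolding exp_of_real[symmetric] mult_exp_exp of_real_minus by (rule arg_cong[where f=exp]) simp
  then show "beta_op z F \<zeta> = of_real (exp (- (pi / 2 * (norm z)\<^sup>2))) * (exp (of_real pi * cdot z \<zeta>) * F (\<zeta> - z))"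
    unfolding beta_op_def by (simp only: mult.assoc[symmetric])
qed

lemma exptype_beta:
  assumes f: "exptype f"
  shows "exptype (beta_op z f)"
proof -
  have 1: "exptype (\<lambda>\<zeta>. f (\<zeta> - z))" by (rule exptype_translate'[OF f])
  show ?thesis unfolding beta_op_eq by (rule exptype_cmult[OF exptype_mult[OF exptype_exp_cdot 1]])
qed

section \<open>The reproducing kernel and the shifts\<close>

text \<open>Cauchy's formula for the centre of the unit circle, as a Lebesgue integral over the
  angle so that it can enter a Fubini argument.\<close>

lemma circle_mean:
  assumes g: "g holomorphic_on UNIV"
  shows "(\<integral>t. indicator {0..2*pi} t * g (cis t) \<partial>lborel) = of_real (2 * pi) * g 0"
proof -
  have cont: "continuous_on S g" for S
    by (rule continuous_on_subset[OF holomorphic_on_imp_continuous_on[OF g] subset_UNIV])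
  have "((\<lambda>u. g u / (u - 0)) has_contour_integral (2 * of_real pi * \<i> * g 0)) (circlepath 0 1)"
    by (rule Cauchy_integral_circlepath) (use cont g holomorphic_on_subset in auto)
  then have "((\<lambda>t. g (0 + of_real 1 * cis t) / ((0 + of_real 1 * cis t) - 0) * of_real 1 * \<i> * cis t) has_integral (2 * of_real pi * \<i> * g 0)) {0..2*pi}"
    unfolding circlepath_def by (subst (asm) has_contour_integral_part_circlepath_iff) auto
  then have "((\<lambda>t. \<i> * g (cis t)) has_integral (2 * of_real pi * \<i> * g 0)) {0..2*pi}"
    by (rule has_integral_eq[rotated]) (simp add: field_simps)
  from has_integral_mult_right[OF this, of "-\<i>"]
  have 1: "((\<lambda>t. g (cis t)) has_integral (2 * of_real pi * g 0)) {0..2*pi}"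
    by (simp add: mult_ac)
  have "continuous_on {0..2*pi} (\<lambda>t. g (cis t))"
    by (rule continuous_on_compose2[OF cont[of UNIV]]) (auto intro!: continuous_intros)
  then have "set_integrable lborel {0..2*pi} (\<lambda>t. g (cis t))"
    unfolding set_integrable_def by (intro borel_integrable_compact) auto
  from set_borel_integral_eq_integral(2)[OF this] 1
  show ?thesis
    by (simp add: set_lebesgue_integral_def integral_unique indicator_scaleR_eq_if mult.commute
        scaleR_conv_of_real of_real_indicator)
qed

lemma orthogonal_scale: "cmod a = 1 \<Longrightarrow> orthogonal_transformation (\<lambda>v::complex^'d::finite. a *s v)"
  by (simp add: orthogonal_transformation norm_scale bounded_linear_scale[THEN bounded_linear.linear])

lemma gauss_mult_exp: "gauss (z + w) = gauss z * gauss w * exp (- of_real pi * (cdot z w + cdot w z))"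
proof -
  have "complex_of_real ((norm (z + w))\<^sup>2) = of_real ((norm z)\<^sup>2) + of_real ((norm w)\<^sup>2) + (cdot z w + cdot w z)"
    unfolding cdot_self[symmetric] by (simp add: cdot_add_left cdot_add_right)
  then show ?thesis
    unfolding gauss_def exp_of_real[symmetric] of_real_mult of_real_minus
    by (simp add: exp_add[symmetric] algebra_simps)
qed

text \<open>Rotating the variable by \<open>cis t\<close> preserves the Gaussian measure. Averaging
  over t first replaces f by its mean over a circle in a complex line through the origin, which is
  f(0).\<close>

lemma integral_exptype_gauss:
  assumes f: "exptype f"
  shows "(\<integral>u. f u * gauss u \<partial>lborel) = f 0"
proof -
  note [measurable] = exptype_measurable[OF f]
  let ?I = "indicator {0..2*pi} :: real \<Rightarrow> complex"
  have [measurable]: "(gauss :: complex^'a \<Rightarrow> complex) \<in> borel_measurable borel"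
    by (rule gauss_dom_measurable[OF gauss_dom_gauss])
  have scale [measurable]: "(\<lambda>p. cis (fst p) *s snd p) \<in> borel_measurable (borel :: (real \<times> (complex^'a)) measure)"
  proof (rule borel_measurable_continuous_onI)
    have "continuous_on UNIV (\<lambda>p::real \<times> (complex^'a). \<chi> j. cis (fst p) * snd p $ j)"
      by (intro continuous_on_vec_lambda continuous_intros)
    then show "continuous_on UNIV (\<lambda>p::real \<times> (complex^'a). cis (fst p) *s snd p)"
      by (simp add: vector_scalar_mult_def)
  qed
  \<comment> \<open>A bounded function with compact support has every rate. The rate pi is chosen to
    match \<open>gauss\<close>, so that the pair satisfies one joint bound.\<close>
  have gI: "gauss_dom pi ?I"
  proof (rule gauss_domI[where A="exp (pi * (2 * pi)\<^sup>2)" and B=0])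
    fix t :: real
    have "\<bar>t\<bar> \<le> 2 * pi \<Longrightarrow> t\<^sup>2 \<le> (2 * pi)\<^sup>2" by (rule abs_le_square_iff[THEN iffD1]) auto
    then have "t \<in> {0..2*pi} \<Longrightarrow> 0 \<le> pi * (2 * pi)\<^sup>2 + (0 * norm t - pi * (norm t)\<^sup>2)" by auto
    then show "cmod (?I t) \<le> exp (pi * (2 * pi)\<^sup>2) * exp (0 * norm t - pi * (norm t)\<^sup>2)"
      unfolding exp_add[symmetric] by (auto simp: indicator_def)
  qed measurable
  have g: "gauss_dom (0 + pi) (\<lambda>p. f (cis (fst p) *s snd p) * (?I (fst p) * gauss (snd p)))"
    by (intro gauss_dom_mult gauss_dom_pair gI gauss_dom_gauss gauss_dom_compose[OF exptype_gauss_dom[OF f], where K=1 and L=0] scale)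
       (auto simp: norm_scale norm_snd_le[of "snd x" "fst x" for x, simplified])
  have "(\<integral>t. (\<integral>u. f (cis t *s u) * (?I t * gauss u) \<partial>lborel) \<partial>lborel) = (\<integral>t. ?I t * (\<integral>u. f u * gauss u \<partial>lborel) \<partial>lborel)"
  proof (rule Bochner_Integration.integral_cong[OF refl])
    fix t
    have "(\<integral>u. f u * gauss u \<partial>lborel) = (\<integral>u. f (cis t *s u) * gauss (cis t *s u) \<partial>lborel)"
      by (rule integral_lborel_orthogonal[where f="\<lambda>u. f u * gauss u", symmetric]) (measurable, rule orthogonal_scale, simp)
    also have "\<dots> = (\<integral>u. f (cis t *s u) * gauss u \<partial>lborel)" by (simp add: gauss_def norm_scale)
    finally have e: "(\<integral>u. f u * gauss u \<partial>lborel) = (\<integral>u. f (cis t *s u) * gauss u \<partial>lborel)" .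
    have "(\<integral>u. f (cis t *s u) * (?I t * gauss u) \<partial>lborel) = (\<integral>u. ?I t * (f (cis t *s u) * gauss u) \<partial>lborel)"
      by (intro Bochner_Integration.integral_cong refl) (simp only: mult_ac)
    then show "(\<integral>u. f (cis t *s u) * (?I t * gauss u) \<partial>lborel) = ?I t * (\<integral>u. f u * gauss u \<partial>lborel)"
      by (simp only: e integral_mult_right_zero)
  qed
  also have "\<dots> = of_real (2 * pi) * (\<integral>u. f u * gauss u \<partial>lborel)"
    using circle_mean[of "\<lambda>_. 1"] by (simp only: integral_mult_left_zero mult_1_right) simp
  finally have 1: "of_real (2 * pi) * (\<integral>u. f u * gauss u \<partial>lborel) = (\<integral>t. (\<integral>u. f (cis t *s u) * (?I t * gauss u) \<partial>lborel) \<partial>lborel)"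
    by simp
  also have "\<dots> = (\<integral>u. (\<integral>t. f (cis t *s u) * (?I t * gauss u) \<partial>lborel) \<partial>lborel)"
    using gauss_dom_Fubini[OF g, symmetric] by simp
  also have "\<dots> = (\<integral>u. of_real (2 * pi) * f 0 * gauss (u::complex^'a) \<partial>lborel)"
  proof (rule Bochner_Integration.integral_cong[OF refl])
    fix u
    have 2: "(\<integral>t. ?I t * f (cis t *s u) \<partial>lborel) = of_real (2 * pi) * f 0"
      using circle_mean[OF entire_on_line[OF exptype_entire[OF f], of 0 u UNIV]] by simp
    have "(\<integral>t. f (cis t *s u) * (?I t * gauss u) \<partial>lborel) = (\<integral>t. (?I t * f (cis t *s u)) * gauss u \<partial>lborel)"
      by (intro Bochner_Integration.integral_cong refl) (simp only: mult_ac)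
    then show "(\<integral>t. f (cis t *s u) * (?I t * gauss u) \<partial>lborel) = of_real (2 * pi) * f 0 * gauss u"
      by (simp only: integral_mult_left_zero 2)
  qed
  also have "\<dots> = of_real (2 * pi) * f 0" by (simp add: integral_gauss integral_mult_right_zero)
  finally show ?thesis by simp
qed

text \<open>The mean value at 0, applied to the translate of f by z times a holomorphic exponential.
  Expanding |u + z|^2 shows that this exponential is exactly what the translated Gaussian and the
  kernel leave over.\<close>

lemma reproducing:
  assumes f: "exptype f"
  shows "(\<integral>u. f u * exp (of_real pi * cdot u z) * gauss u \<partial>lborel) = f z"
proof -
  note [measurable] = exptype_measurable[OF f] gauss_dom_measurable[OF gauss_dom_gauss]
  have "f z = (\<lambda>u. exp (- of_real pi * cdot z u) * f (u + z)) 0" by simp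
  also have "\<dots> = (\<integral>u. exp (- of_real pi * cdot z u) * f (u + z) * gauss u \<partial>lborel)"
    using exptype_exp_cdot[of "-z"]
    by (intro integral_exptype_gauss[symmetric] exptype_mult exptype_translate f) (simp add: cdot_minus_left)
  also have "\<dots> = (\<integral>u. f (u + z) * exp (of_real pi * cdot (u + z) z) * gauss (u + z) \<partial>lborel)"
  proof (intro Bochner_Integration.integral_cong refl)
    fix u
    have "gauss z * exp (of_real pi * cdot z z) = 1"
      by (simp add: gauss_def cdot_self exp_of_real[symmetric] exp_add[symmetric])
    moreover have "f (u + z) * exp (of_real pi * cdot (u + z) z) * gauss (u + z)
       = exp (- of_real pi * cdot z u) * f (u + z) * gauss u * (gauss z * exp (of_real pi * cdot z z))"
      by (simp add: gauss_mult_exp cdot_add_left exp_add[symmetric] algebra_simps mult_exp_exp)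
    ultimately show "exp (- of_real pi * cdot z u) * f (u + z) * gauss u =
         f (u + z) * exp (of_real pi * cdot (u + z) z) * gauss (u + z)" by (metis mult.right_neutral)
  qed
  also have "\<dots> = (\<integral>u. f u * exp (of_real pi * cdot u z) * gauss u \<partial>lborel)"
    by (rule integral_lborel_translate[where f="\<lambda>u. f u * exp (of_real pi * cdot u z) * gauss u"]) measurable
  finally show ?thesis by simp
qed

section \<open>Shifts: isometry, composition law and the kernel form of Moyal's identity\<close>

lemma gauss_cdot: "gauss z = exp (- of_real pi * cdot z z)"
  unfolding gauss_def cdot_self exp_of_real[symmetric] by simp

lemma cnj_gauss [simp]: "cnj (gauss z) = gauss z"
  by (simp add: gauss_def)

lemma beta_op_cdot: "beta_op z F \<zeta> = exp (of_real pi * cdot z \<zeta> - of_real (pi / 2) * cdot z z) * F (\<zeta> - z)"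
  by (simp add: beta_op_def cdot_self)

lemma borel_measurable_gauss [measurable]: "(gauss :: 'a::euclidean_space \<Rightarrow> complex) \<in> borel_measurable borel"
  by (rule gauss_dom_measurable[OF gauss_dom_gauss])

lemma borel_measurable_cnj [measurable (raw)]:
  assumes "f \<in> borel_measurable M"
  shows "(\<lambda>x. cnj (f x)) \<in> borel_measurable M"
  by (rule measurable_compose[OF assms borel_measurable_continuous_onI[OF continuous_on_cnj[OF continuous_on_id]]])

lemma fock_inner_gauss: "fock_inner F G = (\<integral>z. F z * cnj (G z) * gauss z \<partial>lborel)"
  by (simp add: fock_inner_def gauss_def)

lemma fock_inner_cnj: "cnj (fock_inner F G) = fock_inner G F"
proof -
  have "cnj (fock_inner F G) = (\<integral>z. cnj (F z * cnj (G z) * gauss z) \<partial>lborel)"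
    unfolding fock_inner_gauss by (rule Bochner_Integration.integral_cnj[symmetric])
  also have "\<dots> = fock_inner G F"
    unfolding fock_inner_gauss
    by (intro Bochner_Integration.integral_cong refl) (simp only: complex_cnj_mult complex_cnj_cnj cnj_gauss mult_ac)
  finally show ?thesis .
qed

lemma gauss_dom_inner: "gauss_dom 0 f \<Longrightarrow> gauss_dom 0 g \<Longrightarrow> gauss_dom pi (\<lambda>z. f z * cnj (g z) * gauss z)"
  using gauss_dom_mult[OF gauss_dom_mult0[OF _ gauss_dom_cnj] gauss_dom_gauss, of f g] by simp

text \<open>Integration against the reproducing kernel is self-adjoint and fixes P, so it can be
  moved from m to P. Here m is merely measurable of exponential growth: this is the orthogonal
  projection onto holomorphic functions in weak form.\<close>

lemma bergman_projection:
  assumes m: "gauss_dom 0 m" and P: "exptype P"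
  shows "(\<integral>z. (\<integral>\<zeta>. m \<zeta> * exp (of_real pi * cdot \<zeta> z) * gauss \<zeta> \<partial>lborel) * cnj (P z) * gauss z \<partial>lborel)
      = (\<integral>\<zeta>. m \<zeta> * cnj (P \<zeta>) * gauss \<zeta> \<partial>lborel)"
proof -
  have g: "gauss_dom (0 + pi) (\<lambda>\<zeta>. m \<zeta> * gauss \<zeta>)" "gauss_dom (0 + pi) (\<lambda>z. cnj (P z) * gauss z)"
    by (intro gauss_dom_mult m gauss_dom_gauss gauss_dom_cnj exptype_gauss_dom[OF P])+
  \<comment> \<open>Rate pi from the two Gaussians, minus pi/2 for the kernel.\<close>
  have g2: "gauss_dom (pi + - pi / 2) (\<lambda>p. (m (fst p) * gauss (fst p)) * (cnj (P (snd p)) * gauss (snd p)) * exp (of_real pi * cdot (fst p) (snd p)))"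
    using gauss_dom_mult[OF gauss_dom_pair[OF g] gauss_dom_exp_cdot_pair] by simp
  have "(\<integral>z. (\<integral>\<zeta>. m \<zeta> * exp (of_real pi * cdot \<zeta> z) * gauss \<zeta> \<partial>lborel) * cnj (P z) * gauss z \<partial>lborel)
      = (\<integral>z. (\<integral>\<zeta>. (m \<zeta> * gauss \<zeta>) * (cnj (P z) * gauss z) * exp (of_real pi * cdot \<zeta> z) \<partial>lborel) \<partial>lborel)"
  proof (intro Bochner_Integration.integral_cong refl)
    fix z :: "complex^'a"
    have "(\<integral>\<zeta>. m \<zeta> * exp (of_real pi * cdot \<zeta> z) * gauss \<zeta> \<partial>lborel) * cnj (P z) * gauss z = (\<integral>\<zeta>. m \<zeta> * exp (of_real pi * cdot \<zeta> z) * gauss \<zeta> \<partial>lborel) * (cnj (P z) * gauss z)"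
      by (rule mult.assoc)
    also have "\<dots> = (\<integral>\<zeta>. (m \<zeta> * exp (of_real pi * cdot \<zeta> z) * gauss \<zeta>) * (cnj (P z) * gauss z) \<partial>lborel)"
      by (rule integral_mult_left_zero[symmetric])
    also have "\<dots> = (\<integral>\<zeta>. (m \<zeta> * gauss \<zeta>) * (cnj (P z) * gauss z) * exp (of_real pi * cdot \<zeta> z) \<partial>lborel)"
      by (intro Bochner_Integration.integral_cong refl) (simp only: mult_ac)
    finally show "(\<integral>\<zeta>. m \<zeta> * exp (of_real pi * cdot \<zeta> z) * gauss \<zeta> \<partial>lborel) * cnj (P z) * gauss z
       = (\<integral>\<zeta>. (m \<zeta> * gauss \<zeta>) * (cnj (P z) * gauss z) * exp (of_real pi * cdot \<zeta> z) \<partial>lborel)" .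
  qed
  also have "\<dots> = (\<integral>\<zeta>. (\<integral>z. (m \<zeta> * gauss \<zeta>) * (cnj (P z) * gauss z) * exp (of_real pi * cdot \<zeta> z) \<partial>lborel) \<partial>lborel)"
    using gauss_dom_Fubini[OF g2] pi_gt_zero by simp
  also have "\<dots> = (\<integral>\<zeta>. m \<zeta> * cnj (P \<zeta>) * gauss \<zeta> \<partial>lborel)"
  proof (intro Bochner_Integration.integral_cong refl)
    fix \<zeta> :: "complex^'a"
    have "cnj (P \<zeta>) = cnj (\<integral>z. P z * exp (of_real pi * cdot z \<zeta>) * gauss z \<partial>lborel)"
      by (simp add: reproducing[OF P])
    also have "\<dots> = (\<integral>z. cnj (P z * exp (of_real pi * cdot z \<zeta>) * gauss z) \<partial>lborel)"
      by (rule Bochner_Integration.integral_cnj[symmetric])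
    also have "\<dots> = (\<integral>z. cnj (P z) * exp (of_real pi * cdot \<zeta> z) * gauss z \<partial>lborel)"
      by (simp only: complex_cnj_mult exp_cnj cdot_cnj cnj_gauss complex_cnj_complex_of_real)
    finally have 1: "cnj (P \<zeta>) = (\<integral>z. cnj (P z) * exp (of_real pi * cdot \<zeta> z) * gauss z \<partial>lborel)" .
    have "(\<integral>z. (m \<zeta> * gauss \<zeta>) * (cnj (P z) * gauss z) * exp (of_real pi * cdot \<zeta> z) \<partial>lborel)
       = (\<integral>z. (m \<zeta> * gauss \<zeta>) * (cnj (P z) * exp (of_real pi * cdot \<zeta> z) * gauss z) \<partial>lborel)"
      by (intro Bochner_Integration.integral_cong refl) (simp only: mult_ac)
    also have "\<dots> = (m \<zeta> * gauss \<zeta>) * cnj (P \<zeta>)"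
      by (simp only: integral_mult_right_zero 1[symmetric])
    also have "\<dots> = m \<zeta> * cnj (P \<zeta>) * gauss \<zeta>" by (simp only: mult_ac)
    finally show "(\<integral>z. (m \<zeta> * gauss \<zeta>) * (cnj (P z) * gauss z) * exp (of_real pi * cdot \<zeta> z) \<partial>lborel) = m \<zeta> * cnj (P \<zeta>) * gauss \<zeta>" .
  qed
  finally show ?thesis .
qed

text \<open>The antiholomorphic factor exp(pi conj(v) . y) merges with the reproducing kernel at z
  into the kernel at z + y. So the projection of f times this factor is the translate of f, and
  pairing with the holomorphic h cannot tell the two apart.\<close>

lemma inner_translate:
  assumes f: "exptype f" and h: "exptype h"
  shows "(\<integral>v. f (v + y) * cnj (h v) * gauss v \<partial>lborel) = (\<integral>v. f v * exp (of_real pi * cdot v y) * cnj (h v) * gauss v \<partial>lborel)"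
proof -
  have "gauss_dom 0 (\<lambda>v. f v * exp (of_real pi * cdot v y))"
    by (intro gauss_dom_mult0 exptype_gauss_dom[OF f] gauss_dom_exp_cdot)
  from bergman_projection[OF this h]
  have "(\<integral>v. f v * exp (of_real pi * cdot v y) * cnj (h v) * gauss v \<partial>lborel)
      = (\<integral>z. (\<integral>\<zeta>. f \<zeta> * exp (of_real pi * cdot \<zeta> y) * exp (of_real pi * cdot \<zeta> z) * gauss \<zeta> \<partial>lborel) * cnj (h z) * gauss z \<partial>lborel)"
    by simp
  also have "\<dots> = (\<integral>v. f (v + y) * cnj (h v) * gauss v \<partial>lborel)"
  proof (intro Bochner_Integration.integral_cong refl)
    fix z
    have "(\<integral>\<zeta>. f \<zeta> * exp (of_real pi * cdot \<zeta> y) * exp (of_real pi * cdot \<zeta> z) * gauss \<zeta> \<partial>lborel) = f (z + y)"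
      unfolding reproducing[OF f, of "z + y", symmetric]
      by (intro Bochner_Integration.integral_cong refl) (simp add: cdot_add_right exp_add distrib_left mult_ac)
    then show "(\<integral>\<zeta>. f \<zeta> * exp (of_real pi * cdot \<zeta> y) * exp (of_real pi * cdot \<zeta> z) * gauss \<zeta> \<partial>lborel) * cnj (h z) * gauss z
       = f (z + y) * cnj (h z) * gauss z" by simp
  qed
  finally show ?thesis by simp
qed

text \<open>Moyal's identity before it is integrated against two functions. It is kept pointwise in
  w and \<zeta> because Poisson summation is later applied to this integrand with both points fixed.
  The substitution v = w - x collects the exponentials into one Gaussian in x and a translation by
  \<zeta> - w.\<close>

lemma moyal_kernel:
  assumes e: "exptype e" and f: "exptype f"
  shows "(\<integral>v. cnj (beta_op v f w) * beta_op v e \<zeta> \<partial>lborel) = exp (of_real pi * cdot w \<zeta>) * fock_inner e f"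
proof -
  note [measurable] = exptype_measurable[OF e] exptype_measurable[OF f]
  define y where "y = \<zeta> - w"
  \<comment> \<open>After conjugation the extra factor is inverse to the one that
    \<open>inner_translate\<close> produces for y, so the two cancel at the end.\<close>
  define h where "h x = f x * exp (of_real pi * cdot (- y) x)" for x
  have h: "exptype h" unfolding h_def by (rule exptype_mult[OF f exptype_exp_cdot])
  have [measurable]: "(\<lambda>v. cnj (beta_op v f w) * beta_op v e \<zeta>) \<in> borel_measurable borel"
    unfolding beta_op_cdot by (measurable)
  have "(\<integral>v. cnj (beta_op v f w) * beta_op v e \<zeta> \<partial>lborel) = (\<integral>x. cnj (beta_op (w - x) f w) * beta_op (w - x) e \<zeta> \<partial>lborel)"
    by (rule integral_lborel_reflect[symmetric]) measurable
  also have "\<dots> = (\<integral>x. exp (of_real pi * cdot w \<zeta>) * (e (x + y) * cnj (h x) * gauss x) \<partial>lborel)"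
  proof (intro Bochner_Integration.integral_cong refl)
    fix x
    have arg: "\<zeta> - (w - x) = x + y" "w - (w - x) = x" by (auto simp: y_def)
    have "cnj (of_real pi * cdot (w - x) w - of_real (pi / 2) * cdot (w - x) (w - x)) + (of_real pi * cdot (w - x) \<zeta> - of_real (pi / 2) * cdot (w - x) (w - x))
        = of_real pi * cdot w \<zeta> + (of_real pi * cdot x (- y) + - of_real pi * cdot x x)"
      by (simp add: cdot_cnj y_def cdot_diff_left cdot_diff_right field_simps)
    then have "exp (cnj (of_real pi * cdot (w - x) w - of_real (pi / 2) * cdot (w - x) (w - x))) * exp (of_real pi * cdot (w - x) \<zeta> - of_real (pi / 2) * cdot (w - x) (w - x))
        = exp (of_real pi * cdot w \<zeta>) * (cnj (exp (of_real pi * cdot (- y) x)) * gauss x)"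
      unfolding mult_exp_exp by (simp add: gauss_cdot mult_exp_exp exp_cnj cdot_cnj)
    then show "cnj (beta_op (w - x) f w) * beta_op (w - x) e \<zeta> = exp (of_real pi * cdot w \<zeta>) * (e (x + y) * cnj (h x) * gauss x)"
      unfolding beta_op_cdot h_def arg by (simp add: exp_cnj mult_ac)
  qed
  also have "\<dots> = exp (of_real pi * cdot w \<zeta>) * (\<integral>x. e (x + y) * cnj (h x) * gauss x \<partial>lborel)"
    by (rule integral_mult_right_zero)
  also have "(\<integral>x. e (x + y) * cnj (h x) * gauss x \<partial>lborel) = fock_inner e f"
    unfolding inner_translate[OF e h] fock_inner_gauss
    by (intro Bochner_Integration.integral_cong refl)
       (simp add: h_def exp_cnj cdot_cnj cdot_minus_left cdot_minus_right exp_minus field_simps)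
  finally show ?thesis .
qed

text \<open>The exponentials complete the square: once the weight is included, a shift is a plain
  translation. Isometry and the identity for moduli are both read off from this.\<close>

lemma beta_beta_gauss: "beta_op z f \<zeta> * cnj (beta_op z g \<zeta>) * gauss \<zeta> = f (\<zeta> - z) * cnj (g (\<zeta> - z)) * gauss (\<zeta> - z)"
proof -
  have "of_real pi * cdot z \<zeta> - of_real (pi / 2) * cdot z z + cnj (of_real pi * cdot z \<zeta> - of_real (pi / 2) * cdot z z) + (- of_real pi * cdot \<zeta> \<zeta>)
     = - of_real pi * cdot (\<zeta> - z) (\<zeta> - z)"
    by (simp add: cdot_cnj cdot_diff_left cdot_diff_right field_simps)
  then have "exp (of_real pi * cdot z \<zeta> - of_real (pi / 2) * cdot z z) * cnj (exp (of_real pi * cdot z \<zeta> - of_real (pi / 2) * cdot z z)) * gauss \<zeta> = gauss (\<zeta> - z)"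
    unfolding gauss_cdot exp_cnj mult_exp_exp by simp
  then show ?thesis unfolding beta_op_cdot by (simp add: mult_ac)
qed

lemma cmod_gauss: "cmod (gauss z) = exp (- pi * (norm z)\<^sup>2)"
  by (simp add: gauss_def)

lemma cmod_beta: "(cmod (beta_op z f \<zeta>))\<^sup>2 * exp (- pi * (norm \<zeta>)\<^sup>2) = (cmod (f (\<zeta> - z)))\<^sup>2 * exp (- pi * (norm (\<zeta> - z))\<^sup>2)"
  using arg_cong[OF beta_beta_gauss[of z f \<zeta> f], of cmod] by (simp add: norm_mult cmod_gauss power2_eq_square)

lemma fock_inner_beta:
  assumes [measurable]: "f \<in> borel_measurable borel" "g \<in> borel_measurable borel"
  shows "fock_inner (beta_op z f) (beta_op z g) = fock_inner f g"
proof -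
  have "fock_inner (beta_op z f) (beta_op z g) = (\<integral>\<zeta>. f (\<zeta> + - z) * cnj (g (\<zeta> + - z)) * gauss (\<zeta> + - z) \<partial>lborel)"
    by (simp add: fock_inner_gauss beta_beta_gauss)
  also have "\<dots> = fock_inner f g"
    unfolding fock_inner_gauss by (rule integral_lborel_translate) measurable
  finally show ?thesis .
qed

text \<open>The Weyl relation: the shifts form a projective representation whose cocycle is the
  exponential of the symplectic form.\<close>

lemma beta_beta: "beta_op z (beta_op v f) \<zeta> = exp (of_real (pi / 2) * (cdot z v - cdot v z)) * beta_op (z + v) f \<zeta>"
proof -
  have "of_real pi * cdot z \<zeta> - of_real (pi / 2) * cdot z z + (of_real pi * cdot v (\<zeta> - z) - of_real (pi / 2) * cdot v v)
      = of_real (pi / 2) * (cdot z v - cdot v z) + (of_real pi * cdot (z + v) \<zeta> - of_real (pi / 2) * cdot (z + v) (z + v))"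
    by (simp add: cdot_add_left cdot_add_right cdot_diff_right field_simps)
  then show ?thesis
    unfolding beta_op_cdot by (simp add: mult.assoc[symmetric] mult_exp_exp diff_diff_eq)
qed

lemma beta_cmult: "beta_op z (\<lambda>\<zeta>. c * f \<zeta>) \<zeta> = c * beta_op z f \<zeta>"
  by (simp add: beta_op_def)

lemma beta_sum: "beta_op z (\<lambda>\<zeta>. \<Sum>i\<in>I. f i \<zeta>) \<zeta> = (\<Sum>i\<in>I. beta_op z (f i) \<zeta>)"
  by (simp add: beta_op_def sum_distrib_left)

section \<open>Positivity and orthogonality of the monomial windows\<close>

lemma finite_K_set [simp]: "finite (K_set n)"
proof (rule finite_subset)
  show "K_set n \<subseteq> vec_lambda ` (PiE UNIV (\<lambda>j. {..<n $ j}))"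
  proof
    fix k assume "k \<in> K_set n"
    then have "vec_nth k \<in> PiE UNIV (\<lambda>j. {..<n $ j})" by (auto simp: K_set_def PiE_UNIV_domain)
    then have "vec_lambda (vec_nth k) \<in> vec_lambda ` (PiE UNIV (\<lambda>j. {..<n $ j}))" by blast
    then show "k \<in> vec_lambda ` (PiE UNIV (\<lambda>j. {..<n $ j}))" by (simp add: vec_nth_inverse)
  qed
  show "finite (vec_lambda ` (PiE UNIV (\<lambda>j. {..<n $ j})))" by (simp add: finite_PiE)
qed

text \<open>The reproducing formula turns vanishing almost everywhere into vanishing at every
  point.\<close>

lemma exptype_inner_self_eq_0:
  assumes f: "exptype f" and 0: "fock_inner f f = 0"
  shows "f z = 0"
proof -
  note [measurable] = exptype_measurable[OF f]
  have int: "integrable lborel (\<lambda>z. f z * cnj (f z) * gauss z)"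
    using gauss_dom_integrable[OF gauss_dom_inner[OF exptype_gauss_dom[OF f] exptype_gauss_dom[OF f]]] by simp
  have eq: "f z * cnj (f z) * gauss z = of_real ((cmod (f z))\<^sup>2 * exp (- pi * (norm z)\<^sup>2))" for z
    by (simp only: complex_norm_square[symmetric] gauss_def of_real_mult[symmetric])
  have "integrable lborel (\<lambda>z. (cmod (f z))\<^sup>2 * exp (- pi * (norm z)\<^sup>2))"
    using int unfolding eq complex_of_real_integrable_eq .
  moreover have "fock_inner f f = of_real (\<integral>z. (cmod (f z))\<^sup>2 * exp (- pi * (norm z)\<^sup>2) \<partial>lborel)"
    unfolding fock_inner_gauss eq by (rule integral_complex_of_real)
  then have "complex_of_real (\<integral>z. (cmod (f z))\<^sup>2 * exp (- pi * (norm z)\<^sup>2) \<partial>lborel) = 0"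
    by (rule trans[OF sym 0])
  then have "(\<integral>z. (cmod (f z))\<^sup>2 * exp (- pi * (norm z)\<^sup>2) \<partial>lborel) = 0"
    by (rule of_real_eq_0_iff[THEN iffD1])
  ultimately have "AE z in lborel. (cmod (f z))\<^sup>2 * exp (- pi * (norm z)\<^sup>2) = 0"
    by (subst (asm) integral_nonneg_eq_0_iff_AE) auto
  then have ae: "AE z in lborel. f z = 0" by simp
  have "f z = (\<integral>u. f u * exp (of_real pi * cdot u z) * gauss u \<partial>lborel)"
    by (rule reproducing[OF f, symmetric])
  also have "\<dots> = (\<integral>u. 0 \<partial>(lborel :: (complex^'a) measure))"
    by (rule Bochner_Integration.integral_cong_AE) (use ae in auto)
  finally show ?thesis by simp
qed

lemma ek_norm_pos: "Re (fock_inner (ek k) (ek k)) > 0"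
proof -
  have re: "fock_inner (ek k) (ek k) = of_real (\<integral>z. (cmod (ek k z))\<^sup>2 * exp (- pi * (norm z)\<^sup>2) \<partial>lborel)"
    unfolding fock_inner_gauss integral_complex_of_real[symmetric]
    by (simp only: complex_norm_square[symmetric] gauss_def of_real_mult[symmetric])
  \<comment> \<open>The point with all coordinates 1, where every monomial equals 1.\<close>
  have "ek k (1::complex^'a) \<noteq> 0" by (simp add: ek_def mpow_def mfact_def)
  then have "fock_inner (ek k) (ek k) \<noteq> 0"
    using exptype_inner_self_eq_0[OF exptype_ek] by blast
  moreover have "Re (fock_inner (ek k) (ek k)) \<ge> 0"
    unfolding re by (simp add: integral_nonneg_AE)
  ultimately show ?thesis unfolding re by (simp add: order_less_le)
qed

lemma ek_inner_real: "fock_inner (ek k) (ek k) = of_real (Re (fock_inner (ek k) (ek k)))"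
  using fock_inner_cnj[of "ek k" "ek k"] by (metis Reals_cnj_iff of_real_Re)

text \<open>Rotating a single coordinate in which k and l differ preserves the measure and
  multiplies the integrand by a phase. The angle t is chosen to make this phase -1.\<close>

lemma ek_orthogonal:
  assumes "k \<noteq> l"
  shows "fock_inner (ek k) (ek l) = 0"
proof -
  note [measurable] = exptype_measurable[OF exptype_ek]
  obtain j where j: "k $ j \<noteq> l $ j" using assms by (auto simp: vec_eq_iff)
  define t where "t = pi / (real (k $ j) - real (l $ j))"
  define U :: "complex^'a \<Rightarrow> complex^'a" where "U z = (\<chi> i. if i = j then cis t * z $ i else z $ i)" for z
  have nU: "norm (U z) = norm z" for z
    unfolding norm_vec_def by (rule arg_cong2[where f=L2_set]) (auto simp: U_def norm_mult)
  have lU: "linear U"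
    by (rule linearI) (auto simp: U_def vec_eq_iff algebra_simps)
  have oU: "orthogonal_transformation U" using nU lU by (simp add: orthogonal_transformation)
  have mU: "ek m (U z) = cis t ^ (m $ j) * ek m z" for m z
  proof -
    have "mpow (U z) m = (\<Prod>i\<in>UNIV. (if i = j then cis t ^ (m $ j) else 1) * (z $ i) ^ (m $ i))"
      unfolding mpow_def by (intro prod.cong) (auto simp: U_def power_mult_distrib)
    also have "\<dots> = cis t ^ (m $ j) * mpow z m"
      by (simp add: prod.distrib mpow_def)
    finally show ?thesis by (simp add: ek_def)
  qed
  have "cis t ^ (k $ j) * cnj (cis t ^ (l $ j)) = cis (real (k $ j) * t + - (real (l $ j) * t))"
    by (simp add: Complex.DeMoivre cis_mult cis_cnj)
  also have "real (k $ j) * t + - (real (l $ j) * t) = (real (k $ j) - real (l $ j)) * t"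
    by (simp add: algebra_simps)
  also have "\<dots> = pi" using j by (simp add: t_def)
  finally have c: "cis t ^ (k $ j) * cnj (cis t ^ (l $ j)) = -1" by simp
  have "fock_inner (ek k) (ek l) = (\<integral>z. ek k (U z) * cnj (ek l (U z)) * gauss (U z) \<partial>lborel)"
    unfolding fock_inner_gauss
    by (rule integral_lborel_orthogonal[where f="\<lambda>z. ek k z * cnj (ek l z) * gauss z", symmetric, OF _ oU]) measurable
  also have "\<dots> = (\<integral>z. (cis t ^ (k $ j) * cnj (cis t ^ (l $ j))) * (ek k z * cnj (ek l z) * gauss z) \<partial>lborel)"
    unfolding mU by (intro Bochner_Integration.integral_cong refl) (simp add: gauss_def nU mult_ac)
  also have "\<dots> = - fock_inner (ek k) (ek l)"
    unfolding c integral_mult_right_zero fock_inner_gauss by simp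
  finally show ?thesis by simp
qed

section \<open>Polyanalytic functions as transforms of holomorphic ones\<close>

lemma gauss_dom_of_real_norm_pow: "gauss_dom 0 (\<lambda>x. complex_of_real ((norm x)\<^sup>2))"
proof (rule gauss_domI[where A=2 and B=1])
  fix x :: 'a
  have "(norm x)\<^sup>2 / 2 \<le> exp (norm x)"
    using exp_lower_Taylor_quadratic[of "norm x"] norm_ge_zero[of x] by linarith
  then show "cmod (complex_of_real ((norm x)\<^sup>2)) \<le> 2 * exp (1 * norm x - 0 * (norm x)\<^sup>2)" unfolding norm_of_real by simp
qed measurable

lemma gauss_dom_of_real_exp_norm: "gauss_dom 0 (\<lambda>x. complex_of_real (exp (c * norm x)))"
  by (rule gauss_domI[where A=1 and B=c]) auto

lemma gauss_dom_cmod: "gauss_dom e f \<Longrightarrow> gauss_dom e (\<lambda>x. complex_of_real (cmod (f x)))"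
  unfolding gauss_dom_def by auto

lemma norm_exp_minus_linear: "cmod (exp a - 1 - a) \<le> exp (cmod a) * (cmod a)\<^sup>2"
  using Taylor_exp_field[of a 1] by (simp add: power2_eq_square algebra_simps)

lemma cmod_integral_le:
  assumes "integrable M f" "integrable M g" "\<And>x. cmod (f x) \<le> g x"
  shows "cmod (\<integral>x. f x \<partial>M) \<le> (\<integral>x. g x \<partial>M)"
  by (rule order_trans[OF Bochner_Integration.integral_norm_bound])
     (use assms in \<open>auto intro!: Bochner_Integration.integral_mono\<close>)

text \<open>A quadratic rate in the pair splits into a sum over the two components, so integrating
  out y keeps the full rate in x.\<close>

lemma gauss_dom_integral:
  fixes g :: "'a::euclidean_space \<times> 'b::euclidean_space \<Rightarrow> complex"
  assumes g: "gauss_dom e g" and e: "e > 0"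
  shows "gauss_dom e (\<lambda>x. \<integral>y. g (x, y) \<partial>lborel)"
proof -
  obtain C where C: "C > 0" "\<And>p. cmod (g p) \<le> C * exp (C * norm p - e * (norm p)\<^sup>2)"
    using gauss_domE[OF g] by metis
  define h where "h y = exp (C * norm (y::'b) - e * (norm y)\<^sup>2)" for y
  have "gauss_dom e (\<lambda>y. complex_of_real (h y))"
    by (rule gauss_domI[where A=1 and B=C]) (auto simp: h_def[abs_def])
  from gauss_dom_integrable[OF this e] have hi: "integrable lborel h"
    unfolding complex_of_real_integrable_eq .
  have [measurable]: "g \<in> borel_measurable (borel \<Otimes>\<^sub>M borel)"
    using gauss_dom_measurable[OF g] by (simp add: borel_prod)
  show ?thesis
  proof (rule gauss_domI)
    show "(\<lambda>x. \<integral>y. g (x, y) \<partial>lborel) \<in> borel_measurable borel" by measurable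
    fix x :: 'a
    have le: "cmod (g (x, y)) \<le> C * exp (C * norm x - e * (norm x)\<^sup>2) * h y" for y
    proof -
      have "cmod (g (x, y)) \<le> C * exp (C * norm (x, y) - e * (norm (x, y))\<^sup>2)" by (rule C)
      also have "\<dots> \<le> C * exp (C * (norm x + norm y) - e * ((norm x)\<^sup>2 + (norm y)\<^sup>2))"
        using C(1) norm_Pair_le[of x y] by (simp add: norm_Pair)
      also have "\<dots> = C * exp (C * norm x - e * (norm x)\<^sup>2) * h y"
        unfolding h_def mult.assoc exp_add[symmetric] by (simp add: algebra_simps)
      finally show ?thesis .
    qed
    have "cmod (\<integral>y. g (x, y) \<partial>lborel) \<le> (\<integral>y. C * exp (C * norm x - e * (norm x)\<^sup>2) * h y \<partial>lborel)"
    proof (rule cmod_integral_le[OF _ _ le])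
      show ih: "integrable lborel (\<lambda>y. C * exp (C * norm x - e * (norm x)\<^sup>2) * h y)"
        by (intro integrable_mult_right hi)
      show "integrable lborel (\<lambda>y. g (x, y))"
        by (rule Bochner_Integration.integrable_bound[OF ih]) (use le in \<open>auto intro: order_trans[OF _ abs_ge_self]\<close>)
    qed
    then show "cmod (\<integral>y. g (x, y) \<partial>lborel) \<le> (C * (\<integral>y. h y \<partial>lborel)) * exp (C * norm x - e * (norm x)\<^sup>2)"
      by (simp add: mult_ac)
  qed
qed

lemma gauss_dom_swap:
  fixes g :: "'a::euclidean_space \<times> 'b::euclidean_space \<Rightarrow> complex"
  assumes "gauss_dom e g"
  shows "gauss_dom e (\<lambda>p. g (snd p, fst p))"
proof -
  obtain C where C: "C > 0" "\<And>p. cmod (g p) \<le> C * exp (C * norm p - e * (norm p)\<^sup>2)"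
    using gauss_domE[OF assms] by metis
  have [measurable]: "g \<in> borel_measurable (borel \<Otimes>\<^sub>M borel)"
    using gauss_dom_measurable[OF assms] by (simp add: borel_prod)
  have n: "norm (snd p, fst p) = norm p" for p :: "'b \<times> 'a"
    by (simp add: norm_prod_def add.commute)
  show ?thesis
  proof (rule gauss_domI)
    show "(\<lambda>p::'b \<times> 'a. g (snd p, fst p)) \<in> borel_measurable borel"
      unfolding borel_prod[symmetric] by measurable
    show "cmod (g (snd p, fst p)) \<le> C * exp (C * norm p - e * (norm p)\<^sup>2)" for p
      using C(2)[of "(snd p, fst p)"] unfolding n .
  qed
qed

text \<open>Differentiation under the integral through an explicit quadratic remainder: exp(a) - 1 -
  a is bounded by exp(|a|) |a|^2 with a linear in h, and the Gaussian rate of m makes the majorant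
  integrable.\<close>

lemma entire_laplace:
  fixes m :: "complex^'d::finite \<Rightarrow> complex"
  assumes m: "gauss_dom e m" and e: "e > 0"
  shows "entire_fun (\<lambda>z. \<integral>\<zeta>. m \<zeta> * exp (of_real pi * cdot \<zeta> z) \<partial>lborel)"
  unfolding entire_fun_def
proof
  fix z :: "complex^'d"
  define E where "E z \<zeta> = exp (of_real pi * cdot \<zeta> z)" for z \<zeta> :: "complex^'d"
  define c where "c = (\<chi> j. \<integral>\<zeta>. m \<zeta> * (of_real pi * cnj (\<zeta> $ j)) * E z \<zeta> \<partial>lborel)"
  let ?F = "\<lambda>z. \<integral>\<zeta>. m \<zeta> * E z \<zeta> \<partial>lborel"
  have gE: "gauss_dom 0 (E z)" for z
    unfolding E_def[abs_def] by (rule gauss_dom_exp_cdot)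
  have g1: "gauss_dom e (\<lambda>\<zeta>. m \<zeta> * E z \<zeta>)" for z using gauss_dom_mult[OF m gE] by simp
  have g2: "gauss_dom e (\<lambda>\<zeta>. m \<zeta> * (of_real pi * cnj (\<zeta> $ j)) * E z \<zeta>)" for z j
    using gauss_dom_mult[OF gauss_dom_mult[OF m gauss_dom_cmult[OF gauss_dom_cnj[OF gauss_dom_vec_nth]]] gE] by simp
  \<comment> \<open>A majorant uniform in |h| <= 1, which accounts for the 1 added to the norm of z;
    the square of the norm of \<zeta> comes from the remainder.\<close>
  define M where "M \<zeta> = complex_of_real (cmod (m \<zeta>)) * (complex_of_real (exp ((pi * (norm z + 1)) * norm \<zeta>)) * complex_of_real ((norm \<zeta>)\<^sup>2))" for \<zeta>
  have gM: "gauss_dom e M" unfolding M_def[abs_def]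
    using gauss_dom_mult[OF gauss_dom_cmod[OF m] gauss_dom_mult0[OF gauss_dom_of_real_exp_norm gauss_dom_of_real_norm_pow]] by simp
  have Mint: "integrable lborel (\<lambda>\<zeta>. cmod (M \<zeta>))"
    using gauss_dom_integrable[OF gM e] by (rule integrable_norm)
  define B where "B = pi\<^sup>2 * (\<integral>\<zeta>. cmod (M \<zeta>) \<partial>lborel)"
  have lin: "bounded_linear (\<lambda>h. \<Sum>j\<in>UNIV. c $ j * h $ j)"
    by (intro bounded_linear_sum bounded_linear_mult_right[THEN bounded_linear_compose] bounded_linear_vec_nth)
  have est: "cmod (?F (z + h) - ?F z - (\<Sum>j\<in>UNIV. c $ j * h $ j)) \<le> B * (norm h)\<^sup>2" if h: "norm h \<le> 1" for h
  proof -
    have "(\<Sum>j\<in>UNIV. c $ j * h $ j) = (\<Sum>j\<in>UNIV. \<integral>\<zeta>. (m \<zeta> * (of_real pi * cnj (\<zeta> $ j)) * E z \<zeta>) * h $ j \<partial>lborel)"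
      by (simp only: c_def vec_lambda_beta integral_mult_left_zero)
    also have "\<dots> = (\<integral>\<zeta>. (\<Sum>j\<in>UNIV. (m \<zeta> * (of_real pi * cnj (\<zeta> $ j)) * E z \<zeta>) * h $ j) \<partial>lborel)"
      by (rule Bochner_Integration.integral_sum[symmetric])
         (intro integrable_mult_left gauss_dom_integrable[OF g2 e])
    also have "\<dots> = (\<integral>\<zeta>. m \<zeta> * E z \<zeta> * (of_real pi * cdot \<zeta> h) \<partial>lborel)"
      by (intro Bochner_Integration.integral_cong refl) (simp add: cdot_def sum_distrib_left sum_distrib_right mult_ac)
    finally have s: "(\<Sum>j\<in>UNIV. c $ j * h $ j) = (\<integral>\<zeta>. m \<zeta> * E z \<zeta> * (of_real pi * cdot \<zeta> h) \<partial>lborel)" .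
    have g3: "gauss_dom e (\<lambda>\<zeta>. m \<zeta> * E z \<zeta> * (of_real pi * cdot \<zeta> h))"
    proof -
      have "gauss_dom e (\<lambda>\<zeta>. \<Sum>j\<in>UNIV. h $ j * (m \<zeta> * (of_real pi * cnj (\<zeta> $ j)) * E z \<zeta>))"
        by (intro gauss_dom_sum gauss_dom_cmult g2)
      moreover have "(\<lambda>\<zeta>. \<Sum>j\<in>UNIV. h $ j * (m \<zeta> * (of_real pi * cnj (\<zeta> $ j)) * E z \<zeta>)) = (\<lambda>\<zeta>. m \<zeta> * E z \<zeta> * (of_real pi * cdot \<zeta> h))"
        by (simp add: fun_eq_iff cdot_def sum_distrib_left sum_distrib_right mult_ac)
      ultimately show ?thesis by simp
    qed
    have i1: "integrable lborel (\<lambda>\<zeta>. m \<zeta> * E y \<zeta>)" for y by (rule gauss_dom_integrable[OF g1 e])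
    have i2: "integrable lborel (\<lambda>\<zeta>. m \<zeta> * E (z + h) \<zeta> - m \<zeta> * E z \<zeta>)"
      by (rule Bochner_Integration.integrable_diff[OF i1 i1])
    have i3: "integrable lborel (\<lambda>\<zeta>. m \<zeta> * E z \<zeta> * (of_real pi * cdot \<zeta> h))"
      by (rule gauss_dom_integrable[OF g3 e])
    have i: "integrable lborel (\<lambda>\<zeta>. m \<zeta> * E (z + h) \<zeta> - m \<zeta> * E z \<zeta> - m \<zeta> * E z \<zeta> * (of_real pi * cdot \<zeta> h))"
      by (rule Bochner_Integration.integrable_diff[OF i2 i3])
    have "?F (z + h) - ?F z - (\<Sum>j\<in>UNIV. c $ j * h $ j)
        = (\<integral>\<zeta>. m \<zeta> * E (z + h) \<zeta> - m \<zeta> * E z \<zeta> \<partial>lborel) - (\<integral>\<zeta>. m \<zeta> * E z \<zeta> * (of_real pi * cdot \<zeta> h) \<partial>lborel)"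
      unfolding s Bochner_Integration.integral_diff[OF i1 i1] ..
    also have "\<dots> = (\<integral>\<zeta>. m \<zeta> * E (z + h) \<zeta> - m \<zeta> * E z \<zeta> - m \<zeta> * E z \<zeta> * (of_real pi * cdot \<zeta> h) \<partial>lborel)"
      by (rule Bochner_Integration.integral_diff[OF i2 i3, symmetric])
    finally have "cmod (?F (z + h) - ?F z - (\<Sum>j\<in>UNIV. c $ j * h $ j)) = cmod (\<integral>\<zeta>. m \<zeta> * E (z + h) \<zeta> - m \<zeta> * E z \<zeta> - m \<zeta> * E z \<zeta> * (of_real pi * cdot \<zeta> h) \<partial>lborel)"
      by (rule arg_cong)
    also have "\<dots> \<le> (\<integral>\<zeta>. (pi\<^sup>2 * (norm h)\<^sup>2) * cmod (M \<zeta>) \<partial>lborel)"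
    proof (rule cmod_integral_le[OF i])
      show "integrable lborel (\<lambda>\<zeta>. (pi\<^sup>2 * (norm h)\<^sup>2) * cmod (M \<zeta>))" by (intro integrable_mult_right Mint)
      fix \<zeta> :: "complex^'d"
      let ?a = "of_real pi * cdot \<zeta> h"
      have a: "cmod ?a \<le> pi * norm \<zeta> * norm h"
        using cmod_cdot_le[of \<zeta> h] by (simp add: norm_mult)
      have "m \<zeta> * E (z + h) \<zeta> - m \<zeta> * E z \<zeta> - m \<zeta> * E z \<zeta> * ?a = m \<zeta> * E z \<zeta> * (exp ?a - 1 - ?a)"
        by (simp add: E_def cdot_add_right distrib_left exp_add algebra_simps)
      then have "cmod (m \<zeta> * E (z + h) \<zeta> - m \<zeta> * E z \<zeta> - m \<zeta> * E z \<zeta> * ?a) = cmod (m \<zeta>) * (cmod (E z \<zeta>) * cmod (exp ?a - 1 - ?a))"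
        by (simp add: norm_mult)
      also have "\<dots> \<le> cmod (m \<zeta>) * (exp (pi * norm \<zeta> * norm z) * (exp (pi * norm \<zeta>) * (pi * norm \<zeta> * norm h)\<^sup>2))"
      proof (intro mult_left_mono mult_mono)
        have "cmod (of_real pi * cdot \<zeta> z) \<le> pi * norm \<zeta> * norm z"
          using cmod_cdot_le[of \<zeta> z] by (simp add: norm_mult)
        then show "cmod (E z \<zeta>) \<le> exp (pi * norm \<zeta> * norm z)"
          unfolding E_def by (intro order_trans[OF norm_exp]) (simp del: norm_mult)
        have "cmod (exp ?a - 1 - ?a) \<le> exp (cmod ?a) * (cmod ?a)\<^sup>2" by (rule norm_exp_minus_linear)
        also have "\<dots> \<le> exp (pi * norm \<zeta>) * (pi * norm \<zeta> * norm h)\<^sup>2"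
        proof (intro mult_mono power_mono a)
          have "pi * norm \<zeta> * norm h \<le> pi * norm \<zeta> * 1" using h by (intro mult_left_mono) auto
          then have "cmod ?a \<le> pi * norm \<zeta>" using a by linarith
          then show "exp (cmod ?a) \<le> exp (pi * norm \<zeta>)" by (simp only: exp_le_cancel_iff)
        qed auto
        finally show "cmod (exp ?a - 1 - ?a) \<le> exp (pi * norm \<zeta>) * (pi * norm \<zeta> * norm h)\<^sup>2" .
      qed auto
      also have "\<dots> = (pi\<^sup>2 * (norm h)\<^sup>2) * cmod (M \<zeta>)"
      proof -
        have "exp (pi * norm \<zeta> * norm z) * exp (pi * norm \<zeta>) = exp ((pi * (norm z + 1)) * norm \<zeta>)"
          unfolding exp_add[symmetric] by (simp add: algebra_simps)
        then show ?thesis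
          unfolding M_def norm_mult norm_of_real abs_norm_cancel abs_exp_cancel power_mult_distrib
          by (simp add: mult_ac)
      qed
      finally show "cmod (m \<zeta> * E (z + h) \<zeta> - m \<zeta> * E z \<zeta> - m \<zeta> * E z \<zeta> * ?a) \<le> (pi\<^sup>2 * (norm h)\<^sup>2) * cmod (M \<zeta>)" .
    qed
    also have "\<dots> = B * (norm h)\<^sup>2" by (simp add: B_def)
    finally show ?thesis .
  qed
  have "((\<lambda>z. ?F z) has_derivative (\<lambda>h. \<Sum>j\<in>UNIV. c $ j * h $ j)) (at z)"
    unfolding has_derivative_at
  proof (intro conjI lin)
    show "(\<lambda>h. norm (?F (z + h) - ?F z - (\<Sum>j\<in>UNIV. c $ j * h $ j)) / norm h) \<midarrow>0\<rightarrow> 0"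
    proof (rule Lim_null_comparison)
      show "\<forall>\<^sub>F h in at 0. norm (norm (?F (z + h) - ?F z - (\<Sum>j\<in>UNIV. c $ j * h $ j)) / norm h) \<le> B * norm h"
        unfolding eventually_at
      proof (intro exI[of _ 1] conjI ballI impI)
        fix h :: "complex^'d" assume "h \<noteq> 0 \<and> dist h 0 < 1"
        then show "norm (norm (?F (z + h) - ?F z - (\<Sum>j\<in>UNIV. c $ j * h $ j)) / norm h) \<le> B * norm h"
          using est[of h] by (simp add: divide_le_eq power2_eq_square mult.assoc)
      qed simp
      show "((\<lambda>h. B * norm h) \<longlongrightarrow> 0) (at 0)"
        by (auto intro!: tendsto_eq_intros)
    qed
  qed
  then show "\<exists>c. ((\<lambda>z. \<integral>\<zeta>. m \<zeta> * exp (of_real pi * cdot \<zeta> z) \<partial>lborel) has_derivative (\<lambda>h. \<Sum>j\<in>UNIV. c $ j * h $ j)) (at z)"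
    unfolding E_def by (rule exI)
qed

text \<open>This is \<open>fock_inner f (beta_op z (ek k))\<close> stripped of
  \<open>ek_coeff k\<close> and of exp(-(pi/2) |z|^2). Without these factors the recursion in k has
  no constants.\<close>

definition shifted_moment :: "nat^'d \<Rightarrow> (complex^'d::finite \<Rightarrow> complex) \<Rightarrow> complex^'d \<Rightarrow> complex" where
  "shifted_moment k f z = (\<integral>\<zeta>. f \<zeta> * cnj (mpow (\<zeta> - z) k) * exp (of_real pi * cdot \<zeta> z) * gauss \<zeta> \<partial>lborel)"

text \<open>Multiplication by $\bar\zeta_j$ followed by the projection onto holomorphic functions. With $M_k$ the
  shifted moments and $T_j$ this operator, $\bar z_j M_k f = M_k (T_j f) - M_{k+e_j} f$ absorbs the
  factors $\bar z_j$ of a polyanalytic function.\<close>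

definition toeplitz_cnj :: "'d \<Rightarrow> (complex^'d::finite \<Rightarrow> complex) \<Rightarrow> complex^'d \<Rightarrow> complex" where
  "toeplitz_cnj j f z = (\<integral>\<zeta>. (f \<zeta> * cnj (\<zeta> $ j)) * exp (of_real pi * cdot \<zeta> z) * gauss \<zeta> \<partial>lborel)"

text \<open>The Laplace representation gives holomorphy but a poor growth bound in z.
  \<open>inner_translate\<close> puts z into the argument of f instead, and the exponential growth
  of f then factors out of the integral.\<close>

lemma exptype_toeplitz_cnj:
  assumes f: "exptype f"
  shows "exptype (toeplitz_cnj j f)"
  unfolding exptype_def
proof
  have g: "gauss_dom pi (\<lambda>\<zeta>. (f \<zeta> * cnj (\<zeta> $ j)) * gauss \<zeta>)"
    using gauss_dom_mult[OF gauss_dom_mult0[OF exptype_gauss_dom[OF f] gauss_dom_cnj[OF gauss_dom_vec_nth]] gauss_dom_gauss] by simp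
  have "entire_fun (\<lambda>z. \<integral>\<zeta>. (f \<zeta> * cnj (\<zeta> $ j)) * gauss \<zeta> * exp (of_real pi * cdot \<zeta> z) \<partial>lborel)"
    by (rule entire_laplace[OF g pi_gt_zero])
  moreover have "toeplitz_cnj j f = (\<lambda>z. \<integral>\<zeta>. (f \<zeta> * cnj (\<zeta> $ j)) * gauss \<zeta> * exp (of_real pi * cdot \<zeta> z) \<partial>lborel)"
    unfolding toeplitz_cnj_def[abs_def] by (intro ext Bochner_Integration.integral_cong refl) (simp only: mult_ac)
  ultimately show e: "entire_fun (toeplitz_cnj j f)" by simp
  obtain C where C: "C > 0" "\<And>x. cmod (f x) \<le> C * exp (C * norm x - 0 * (norm x)\<^sup>2)"
    using gauss_domE[OF exptype_gauss_dom[OF f]] by metis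
  have gh: "gauss_dom pi (\<lambda>v. complex_of_real (exp (C * norm v)) * cnj (v $ j) * gauss v)"
    using gauss_dom_mult[OF gauss_dom_mult0[OF gauss_dom_of_real_exp_norm gauss_dom_cnj[OF gauss_dom_vec_nth]] gauss_dom_gauss] by simp
  define K where "K = (\<integral>v. cmod (complex_of_real (exp (C * norm (v::complex^'a))) * cnj (v $ j) * gauss v) \<partial>lborel)"
  show "gauss_dom 0 (toeplitz_cnj j f)"
  proof (rule gauss_domI)
    show "toeplitz_cnj j f \<in> borel_measurable borel" by (rule entire_measurable[OF e])
    fix z :: "complex^'a"
    have "toeplitz_cnj j f z = (\<integral>v. f (v + z) * cnj (v $ j) * gauss v \<partial>lborel)"
      unfolding toeplitz_cnj_def inner_translate[OF f exptype_vec_nth]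
      by (intro Bochner_Integration.integral_cong refl) (simp only: mult_ac)
    also have "cmod \<dots> \<le> (\<integral>v. C * exp (C * norm z) * cmod (complex_of_real (exp (C * norm v)) * cnj (v $ j) * gauss v) \<partial>lborel)"
    proof (rule cmod_integral_le)
      show "integrable lborel (\<lambda>v. f (v + z) * cnj (v $ j) * gauss v)"
        using gauss_dom_integrable[OF gauss_dom_inner[OF gauss_dom_translate[OF exptype_gauss_dom[OF f]] gauss_dom_vec_nth] pi_gt_zero] .
      show "integrable lborel (\<lambda>v. C * exp (C * norm z) * cmod (complex_of_real (exp (C * norm v)) * cnj (v $ j) * gauss v))"
        by (intro integrable_mult_right integrable_norm gauss_dom_integrable[OF gh pi_gt_zero])
      fix v
      have "cmod (f (v + z)) \<le> C * exp (C * norm (v + z))" using C(2)[of "v + z"] by simp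
      also have "\<dots> \<le> C * exp (C * (norm v + norm z))" using C(1) norm_triangle_ineq[of v z] by simp
      also have "\<dots> = C * exp (C * norm z) * exp (C * norm v)" by (simp add: exp_add distrib_left)
      finally have "cmod (f (v + z)) * (cmod (v $ j) * cmod (gauss v)) \<le> C * exp (C * norm z) * exp (C * norm v) * (cmod (v $ j) * cmod (gauss v))"
        by (intro mult_right_mono) auto
      then show "cmod (f (v + z) * cnj (v $ j) * gauss v) \<le> C * exp (C * norm z) * cmod (complex_of_real (exp (C * norm v)) * cnj (v $ j) * gauss v)"
        unfolding norm_mult by (simp add: mult_ac)
    qed
    also have "\<dots> = (C * K) * exp (C * norm z - 0 * (norm z)\<^sup>2)"
      by (simp add: K_def mult_ac)
    finally show "cmod (toeplitz_cnj j f z) \<le> (C * K) * exp (C * norm z - 0 * (norm z)\<^sup>2)" .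
  qed
qed

lemma mpow_add: "mpow z (k + l) = mpow z k * mpow z l"
  by (simp add: mpow_def power_add prod.distrib)

lemma mpow_axis: "mpow z (axis j 1) = z $ j"
proof -
  have "mpow z (axis j 1) = (\<Prod>i\<in>UNIV. if i = j then z $ i else 1)"
    unfolding mpow_def by (intro prod.cong) (auto simp: axis_def)
  then show ?thesis by simp
qed

lemma cmpow_cnj: "cmpow z k = cnj (mpow z k)"
  by (simp add: cmpow_def mpow_def)

lemma gauss_dom_shifted_moment: "gauss_dom 0 f \<Longrightarrow> gauss_dom pi (\<lambda>\<zeta>. f \<zeta> * cnj (mpow (\<zeta> - z) k) * exp (of_real pi * cdot \<zeta> z) * gauss \<zeta>)"
  using gauss_dom_mult[OF gauss_dom_mult0[OF gauss_dom_mult0[OF _ gauss_dom_cnj[OF gauss_dom_translate'[OF exptype_gauss_dom[OF exptype_mpow]]]] gauss_dom_exp_cdot(2)] gauss_dom_gauss, of f z k z] by simp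

text \<open>The new factor splits into the conjugates of \<zeta>_j and of z_j. In the first part the
  product of f with the conjugate of \<zeta>_j may be replaced by its projection, since apart from
  the Gaussian the remaining factors form the conjugate of a holomorphic function of
  \<zeta>.\<close>

lemma shifted_moment_axis:
  assumes f: "exptype f"
  shows "shifted_moment (k + axis j 1) f z = shifted_moment k (toeplitz_cnj j f) z - cnj (z $ j) * shifted_moment k f z"
proof -
  define P where "P \<zeta> = mpow (\<zeta> - z) k * exp (of_real pi * cdot z \<zeta>)" for \<zeta>
  have P: "exptype P" unfolding P_def[abs_def]
    by (rule exptype_mult[OF exptype_translate'[OF exptype_mpow] exptype_exp_cdot])
  have m: "gauss_dom 0 (\<lambda>\<zeta>. f \<zeta> * cnj (\<zeta> $ j))" by (intro gauss_dom_mult0 gauss_dom_cnj exptype_gauss_dom[OF f] gauss_dom_vec_nth)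
  have cP: "cnj (P \<zeta>) = cnj (mpow (\<zeta> - z) k) * exp (of_real pi * cdot \<zeta> z)" for \<zeta>
    by (simp add: P_def exp_cnj cdot_cnj)
  have "shifted_moment k (toeplitz_cnj j f) z = (\<integral>\<zeta>. toeplitz_cnj j f \<zeta> * cnj (P \<zeta>) * gauss \<zeta> \<partial>lborel)"
    unfolding shifted_moment_def cP by (simp only: mult.assoc)
  also have "\<dots> = (\<integral>\<zeta>. f \<zeta> * cnj (\<zeta> $ j) * cnj (P \<zeta>) * gauss \<zeta> \<partial>lborel)"
    unfolding toeplitz_cnj_def by (rule bergman_projection[OF m P])
  finally have 1: "shifted_moment k (toeplitz_cnj j f) z = (\<integral>\<zeta>. f \<zeta> * cnj (\<zeta> $ j) * cnj (P \<zeta>) * gauss \<zeta> \<partial>lborel)" .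
  have 2: "cnj (z $ j) * shifted_moment k f z = (\<integral>\<zeta>. cnj (z $ j) * (f \<zeta> * cnj (P \<zeta>) * gauss \<zeta>) \<partial>lborel)"
    unfolding shifted_moment_def cP integral_mult_right_zero by (simp only: mult.assoc)
  have i1: "integrable lborel (\<lambda>\<zeta>. f \<zeta> * cnj (\<zeta> $ j) * cnj (P \<zeta>) * gauss \<zeta>)"
    by (rule gauss_dom_integrable[OF gauss_dom_inner[OF m exptype_gauss_dom[OF P]] pi_gt_zero])
  have i2: "integrable lborel (\<lambda>\<zeta>. cnj (z $ j) * (f \<zeta> * cnj (P \<zeta>) * gauss \<zeta>))"
    by (rule integrable_mult_right[OF gauss_dom_integrable[OF gauss_dom_inner[OF exptype_gauss_dom[OF f] exptype_gauss_dom[OF P]] pi_gt_zero]])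
  have "shifted_moment (k + axis j 1) f z = (\<integral>\<zeta>. f \<zeta> * cnj (\<zeta> $ j) * cnj (P \<zeta>) * gauss \<zeta> - cnj (z $ j) * (f \<zeta> * cnj (P \<zeta>) * gauss \<zeta>) \<partial>lborel)"
    unfolding shifted_moment_def by (intro Bochner_Integration.integral_cong refl) (simp add: mpow_add mpow_axis mpow_axis[unfolded One_nat_def] cP algebra_simps)
  also have "\<dots> = shifted_moment k (toeplitz_cnj j f) z - cnj (z $ j) * shifted_moment k f z"
    unfolding 1 2 by (rule Bochner_Integration.integral_diff[OF i1 i2])
  finally show ?thesis .
qed

lemma shifted_moment_0: "exptype f \<Longrightarrow> shifted_moment 0 f z = f z"
  unfolding shifted_moment_def by (simp add: mpow_def reproducing)

lemma shifted_moment_add: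
  assumes "exptype f" "exptype g"
  shows "shifted_moment k (\<lambda>\<zeta>. f \<zeta> + g \<zeta>) z = shifted_moment k f z + shifted_moment k g z"
proof -
  let ?A = "\<lambda>f \<zeta>. f \<zeta> * cnj (mpow (\<zeta> - z) k) * exp (of_real pi * cdot \<zeta> z) * gauss \<zeta>"
  have i: "integrable lborel (?A f)" "integrable lborel (?A g)"
    by (intro gauss_dom_integrable[OF gauss_dom_shifted_moment pi_gt_zero] exptype_gauss_dom assms)+
  have "shifted_moment k (\<lambda>\<zeta>. f \<zeta> + g \<zeta>) z = (\<integral>\<zeta>. ?A f \<zeta> + ?A g \<zeta> \<partial>lborel)"
    unfolding shifted_moment_def by (intro Bochner_Integration.integral_cong refl) (simp only: distrib_right)
  also have "\<dots> = shifted_moment k f z + shifted_moment k g z"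
    unfolding shifted_moment_def by (rule Bochner_Integration.integral_add[OF i])
  finally show ?thesis .
qed

lemma shifted_moment_cmult: "shifted_moment k (\<lambda>\<zeta>. c * f \<zeta>) z = c * shifted_moment k f z"
  unfolding shifted_moment_def by (simp only: mult.assoc integral_mult_right_zero)


text \<open>Induction on |m|: each step removes a factor conj(z_j) at the cost either of a Toeplitz
  operator or of one more unit in l. The sum l + m never grows, so all moments that appear stay
  below n.\<close>

lemma shifted_moment_sum_rep:
  fixes l m n :: "nat^'d::finite"
  assumes "exptype \<phi>" "\<forall>j. l $ j + m $ j < n $ j"
  shows "\<exists>f. (\<forall>k. exptype (f k)) \<and> (\<forall>z. cmpow z m * shifted_moment l \<phi> z = (\<Sum>k\<in>K_set n. shifted_moment k (f k) z))"
  using assms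
proof (induction "mabs m" arbitrary: m l \<phi>)
  case 0
  have m: "m = 0" using 0(1) by (auto simp: mabs_def vec_eq_iff)
  have l: "l \<in> K_set n" using 0(3) by (auto simp: K_set_def m)
  define f where "f k = (if k = l then \<phi> else (\<lambda>_. 0))" for k
  have D0: "shifted_moment k (\<lambda>_. 0) z = 0" for k and z :: "complex^'d" by (simp add: shifted_moment_def)
  have "shifted_moment k (f k) z = (if k = l then shifted_moment k \<phi> z else 0)" for k z
    by (simp add: f_def D0)
  moreover have "(\<Sum>k\<in>K_set n. (if k = l then shifted_moment k \<phi> z else 0)) = shifted_moment l \<phi> z" for z
    using l by simp
  moreover have "\<forall>k. exptype (f k)" using 0(2) by (simp add: f_def exptype_const)
  ultimately show ?case by (intro exI[of _ f]) (simp add: m cmpow_def)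
next
  case (Suc N)
  obtain j where j: "m $ j > 0"
    using Suc(2) by (metis mabs_def gr0I sum.neutral nat.distinct(1))
  define m' where "m' = m - axis j 1"
  have m: "m = m' + axis j 1" using j by (auto simp: m'_def vec_eq_iff axis_def)
  have "mabs m = mabs m' + mabs (axis j 1)" by (simp add: m mabs_def sum.distrib)
  moreover have "mabs (axis j 1) = 1"
  proof -
    have "mabs (axis j 1) = (\<Sum>i\<in>UNIV. if i = j then 1 else 0)"
      unfolding mabs_def by (intro sum.cong) (auto simp: axis_def)
    then show ?thesis by simp
  qed
  ultimately have N: "N = mabs m'" using Suc(2) by simp
  have c1: "\<forall>i. l $ i + m' $ i < n $ i"
    using Suc(4) by (auto simp: m intro: le_less_trans[rotated])
  have c2: "\<forall>i. (l + axis j 1) $ i + m' $ i < n $ i"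
    using Suc(4) by (simp add: m add.assoc add.left_commute add.commute)
  obtain f1 where f1: "\<And>k. exptype (f1 k)" "\<And>z. cmpow z m' * shifted_moment l (toeplitz_cnj j \<phi>) z = (\<Sum>k\<in>K_set n. shifted_moment k (f1 k) z)"
    using Suc(1)[OF N exptype_toeplitz_cnj[OF Suc(3)] c1] by metis
  obtain f2 where f2: "\<And>k. exptype (f2 k)" "\<And>z. cmpow z m' * shifted_moment (l + axis j 1) \<phi> z = (\<Sum>k\<in>K_set n. shifted_moment k (f2 k) z)"
    using Suc(1)[OF N Suc(3) c2] by metis
  define f where "f k = (\<lambda>\<zeta>. f1 k \<zeta> + (-1) * f2 k \<zeta>)" for k
  have nf: "\<forall>k. exptype (f k)" unfolding f_def using f1(1) f2(1) by (intro allI exptype_add exptype_cmult) 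
  have "cmpow z m * shifted_moment l \<phi> z = (\<Sum>k\<in>K_set n. shifted_moment k (f k) z)" for z
  proof -
    have "cmpow z m * shifted_moment l \<phi> z = cmpow z m' * (cnj (z $ j) * shifted_moment l \<phi> z)"
      by (simp add: cmpow_cnj m mpow_add mpow_axis mpow_axis[unfolded One_nat_def])
    also have "\<dots> = cmpow z m' * shifted_moment l (toeplitz_cnj j \<phi>) z - cmpow z m' * shifted_moment (l + axis j 1) \<phi> z"
    proof -
      have e: "cnj (z $ j) * shifted_moment l \<phi> z = shifted_moment l (toeplitz_cnj j \<phi>) z - shifted_moment (l + axis j 1) \<phi> z"
        using shifted_moment_axis[OF Suc(3), of l j z] by simp
      show ?thesis unfolding e by (rule right_diff_distrib)
    qed
    also have "\<dots> = (\<Sum>k\<in>K_set n. shifted_moment k (f1 k) z - shifted_moment k (f2 k) z)"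
      by (simp only: f1(2) f2(2) sum_subtractf)
    also have "\<dots> = (\<Sum>k\<in>K_set n. shifted_moment k (f k) z)"
      unfolding f_def shifted_moment_add[OF f1(1) exptype_cmult[OF f2(1)]] shifted_moment_cmult by simp
    finally show ?thesis .
  qed
  with nf show ?case by blast
qed

definition ek_coeff :: "nat^'d::finite \<Rightarrow> real" where
  "ek_coeff k = sqrt (pi ^ mabs k / real (mfact k))"

lemma ek_coeff_pos: "ek_coeff k > 0"
  by (auto simp: ek_coeff_def mfact_def intro!: divide_pos_pos prod_pos)

lemma fock_inner_beta_ek:
  "fock_inner f (beta_op z (ek k)) = of_real (ek_coeff k) * exp (- of_real (pi / 2) * cdot z z) * shifted_moment k f z"
proof -
  have "fock_inner f (beta_op z (ek k)) = (\<integral>\<zeta>. (of_real (ek_coeff k) * exp (- of_real (pi / 2) * cdot z z)) * (f \<zeta> * cnj (mpow (\<zeta> - z) k) * exp (of_real pi * cdot \<zeta> z) * gauss \<zeta>) \<partial>lborel)"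
    unfolding fock_inner_gauss
  proof (intro Bochner_Integration.integral_cong refl)
    fix \<zeta>
    have "cnj (beta_op z (ek k) \<zeta>) = exp (of_real pi * cdot \<zeta> z - of_real (pi / 2) * cdot z z) * (of_real (ek_coeff k) * cnj (mpow (\<zeta> - z) k))"
      by (simp add: beta_op_cdot exp_cnj cdot_cnj ek_def ek_coeff_def)
    also have "exp (of_real pi * cdot \<zeta> z - of_real (pi / 2) * cdot z z) = exp (of_real pi * cdot \<zeta> z) * exp (- of_real (pi / 2) * cdot z z)"
      by (simp add: mult_exp_exp)
    finally show "f \<zeta> * cnj (beta_op z (ek k) \<zeta>) * gauss \<zeta> = (of_real (ek_coeff k) * exp (- of_real (pi / 2) * cdot z z)) * (f \<zeta> * cnj (mpow (\<zeta> - z) k) * exp (of_real pi * cdot \<zeta> z) * gauss \<zeta>)"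
      by (simp only: mult_ac)
  qed
  then show ?thesis unfolding shifted_moment_def by (simp only: integral_mult_right_zero)
qed

text \<open>Each \<phi>_m is its own moment of order 0, so the recursion starts at l = 0 and its
  invariant says just that m lies in \<open>K_set n\<close>. Dividing by \<open>ek_coeff\<close>
  then reaches the normalised windows.\<close>

lemma exptype_polyanalytic_rep:
  assumes "\<And>k. k \<in> K_set n \<Longrightarrow> exptype (\<phi> k)"
  shows "\<exists>f. (\<forall>k. exptype (f k)) \<and> (\<forall>z. exp (- of_real (pi / 2) * cdot z z) * (\<Sum>k\<in>K_set n. cmpow z k * \<phi> k z) = (\<Sum>k\<in>K_set n. fock_inner (f k) (beta_op z (ek k))))"
proof -
  have "\<exists>f. (\<forall>k. exptype (f k)) \<and> (\<forall>z. cmpow z m * \<phi> m z = (\<Sum>k\<in>K_set n. shifted_moment k (f k) z))" if m: "m \<in> K_set n" for m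
    using shifted_moment_sum_rep[OF assms[OF m], of 0 m n] m by (simp add: K_set_def shifted_moment_0[OF assms[OF m]])
  then obtain f where f: "\<And>m k. m \<in> K_set n \<Longrightarrow> exptype (f m k)"
      "\<And>m z. m \<in> K_set n \<Longrightarrow> cmpow z m * \<phi> m z = (\<Sum>k\<in>K_set n. shifted_moment k (f m k) z)"
    by metis
  define g where "g k = (\<lambda>\<zeta>. of_real (1 / ek_coeff k) * (\<Sum>m\<in>K_set n. f m k \<zeta>))" for k
  have ng: "exptype (g k)" for k unfolding g_def by (intro exptype_cmult exptype_sum f(1))
  have D0: "shifted_moment k (\<lambda>_. 0) z = 0" for k and z :: "complex^'a" by (simp add: shifted_moment_def)
  have Ds: "shifted_moment k (\<lambda>\<zeta>. \<Sum>m\<in>M. f m k \<zeta>) z = (\<Sum>m\<in>M. shifted_moment k (f m k) z)" if "M \<subseteq> K_set n" for M k z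
  proof -
    have "finite M" by (rule finite_subset[OF that finite_K_set])
    then show ?thesis using that
    proof (induction M)
      case (insert x F)
      have "shifted_moment k (\<lambda>\<zeta>. f x k \<zeta> + (\<Sum>m\<in>F. f m k \<zeta>)) z = shifted_moment k (f x k) z + shifted_moment k (\<lambda>\<zeta>. \<Sum>m\<in>F. f m k \<zeta>) z"
        using insert(4) by (intro shifted_moment_add f(1) exptype_sum) auto
      then show ?case using insert by simp
    qed (simp add: D0)
  qed
  have "exp (- of_real (pi / 2) * cdot z z) * (\<Sum>k\<in>K_set n. cmpow z k * \<phi> k z) = (\<Sum>k\<in>K_set n. fock_inner (g k) (beta_op z (ek k)))" for z
  proof -
    have "(\<Sum>k\<in>K_set n. cmpow z k * \<phi> k z) = (\<Sum>m\<in>K_set n. \<Sum>k\<in>K_set n. shifted_moment k (f m k) z)"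
      by (intro sum.cong refl f(2))
    also have "\<dots> = (\<Sum>k\<in>K_set n. shifted_moment k (\<lambda>\<zeta>. \<Sum>m\<in>K_set n. f m k \<zeta>) z)"
      by (subst sum.swap) (simp add: Ds)
    finally have "exp (- of_real (pi / 2) * cdot z z) * (\<Sum>k\<in>K_set n. cmpow z k * \<phi> k z)
       = (\<Sum>k\<in>K_set n. exp (- of_real (pi / 2) * cdot z z) * shifted_moment k (\<lambda>\<zeta>. \<Sum>m\<in>K_set n. f m k \<zeta>) z)"
      by (simp only: sum_distrib_left)
    also have "\<dots> = (\<Sum>k\<in>K_set n. fock_inner (g k) (beta_op z (ek k)))"
    proof (intro sum.cong refl)
      fix k :: "nat^'a"
      have "complex_of_real (ek_coeff k) \<noteq> 0" using ek_coeff_pos[of k] by simp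
      then show "exp (- of_real (pi / 2) * cdot z z) * shifted_moment k (\<lambda>\<zeta>. \<Sum>m\<in>K_set n. f m k \<zeta>) z = fock_inner (g k) (beta_op z (ek k))"
        unfolding fock_inner_beta_ek g_def shifted_moment_cmult by (simp add: field_simps)
    qed
    finally show ?thesis .
  qed
  with ng show ?thesis by blast
qed

section \<open>Moyal's identity and the norm of a polyanalytic function\<close>

lemma norm_diff_cdot: "(norm (\<zeta> - z))\<^sup>2 = (norm \<zeta>)\<^sup>2 + (norm z)\<^sup>2 - 2 * Re (cdot z \<zeta>)"
proof -
  have "complex_of_real ((norm (\<zeta> - z))\<^sup>2) = of_real ((norm \<zeta>)\<^sup>2) + of_real ((norm z)\<^sup>2) - (cdot z \<zeta> + cnj (cdot z \<zeta>))"
    unfolding cdot_self[symmetric] by (simp add: cdot_diff_left cdot_diff_right cdot_cnj)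
  then have "Re (complex_of_real ((norm (\<zeta> - z))\<^sup>2)) = Re (of_real ((norm \<zeta>)\<^sup>2) + of_real ((norm z)\<^sup>2) - (cdot z \<zeta> + cnj (cdot z \<zeta>)))"
    by (rule arg_cong)
  then show ?thesis by (simp only: Re_complex_of_real plus_complex.sel minus_complex.sel cnj.sel)
qed

lemma cmod_beta_half: "cmod (beta_op z f \<zeta>) = cmod (f (\<zeta> - z)) * exp (pi / 2 * (norm \<zeta>)\<^sup>2 - pi / 2 * (norm (\<zeta> - z))\<^sup>2)"
proof -
  have "Re (of_real pi * cdot z \<zeta> - of_real (pi / 2 * (norm z)\<^sup>2)) = pi / 2 * (norm \<zeta>)\<^sup>2 - pi / 2 * (norm (\<zeta> - z))\<^sup>2"
    unfolding norm_diff_cdot by (simp add: field_simps)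
  then show ?thesis unfolding beta_op_def norm_mult norm_exp_eq_Re by (simp only: mult.commute)
qed

text \<open>Besides e(\<zeta> - z), the modulus is exp(-(pi/2) (|\<zeta> - z|^2 + |\<zeta>|^2)).
  Since |z|^2 + |\<zeta>|^2 is at most three times the inner bracket, a rate of pi/6 in the pair
  remains.\<close>

lemma gauss_dom_beta_pair:
  assumes e: "exptype e"
  shows "gauss_dom (pi / 6) (\<lambda>p. beta_op (fst p) e (snd p) * gauss (snd p))"
proof -
  define X :: "(complex^'a) \<times> (complex^'a) \<Rightarrow> complex" where
    "X p = exp (of_real pi * cdot (fst p) (snd p) - of_real (pi / 2) * cdot (fst p) (fst p)) * gauss (snd p)" for p
  have [measurable]: "X \<in> borel_measurable borel"
    unfolding X_def[abs_def] borel_prod[symmetric] by measurable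
  have cX: "cmod (X p) = exp (- (pi / 2) * ((norm (snd p - fst p))\<^sup>2 + (norm (snd p))\<^sup>2))" for p
    using cmod_beta_half[of "fst p" "\<lambda>_. 1" "snd p"]
    by (simp add: X_def beta_op_cdot norm_mult cmod_gauss exp_add[symmetric] algebra_simps)
  have gX: "gauss_dom (pi / 6) X"
  proof (rule gauss_domI[where A=1 and B=0])
    fix p :: "(complex^'a) \<times> (complex^'a)"
    have "(norm (fst p))\<^sup>2 \<le> (norm (fst p - snd p) + norm (snd p))\<^sup>2"
      using norm_triangle_ineq[of "fst p - snd p" "snd p"] by (intro power_mono) auto
    also have "\<dots> \<le> 2 * (norm (snd p - fst p))\<^sup>2 + 2 * (norm (snd p))\<^sup>2"
      using sum_squares_bound[of "norm (fst p - snd p)" "norm (snd p)"] by (simp add: power2_sum norm_minus_commute)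
    finally have "(norm p)\<^sup>2 \<le> 3 * ((norm (snd p - fst p))\<^sup>2 + (norm (snd p))\<^sup>2)"
      by (simp add: norm_prod_def) (use zero_le_power2[of "norm (snd p - fst p)"] in linarith)
    then have "pi / 6 * (norm p)\<^sup>2 \<le> pi / 6 * (3 * ((norm (snd p - fst p))\<^sup>2 + (norm (snd p))\<^sup>2))"
      by (intro mult_left_mono) auto
    then show "cmod (X p) \<le> 1 * exp (0 * norm p - pi / 6 * (norm p)\<^sup>2)"
      unfolding cX by simp
  qed measurable
  have "gauss_dom (0 + pi / 6) (\<lambda>p. e (snd p - fst p) * X p)"
    using gauss_dom_mult[OF gauss_dom_swap[OF gauss_dom_diff_pair[OF exptype_gauss_dom[OF e]]] gX] by simp
  then show ?thesis by (simp add: X_def beta_op_cdot mult_ac)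
qed

text \<open>Records growth in z only, for use where another factor supplies the decay; the Gaussian
  decay itself is in \<open>gauss_dom_beta_decay\<close>.\<close>

lemma gauss_dom_beta_snd:
  assumes e: "exptype e"
  shows "gauss_dom 0 (\<lambda>z. beta_op z e \<zeta>)"
proof -
  have g: "gauss_dom 0 (\<lambda>z. complex_of_real (exp (- (pi / 2 * (norm (z::complex^'a))\<^sup>2))))"
    by (rule gauss_domI[where A=1 and B=0]) auto
  have g2: "gauss_dom 0 (\<lambda>z. e (\<zeta> - z))"
    by (rule gauss_dom_compose[OF exptype_gauss_dom[OF e], where K=1 and L="norm \<zeta>"])
       (auto intro: order_trans[OF norm_triangle_ineq4])
  show ?thesis
    unfolding beta_op_eq by (rule gauss_dom_mult0[OF g gauss_dom_mult0[OF gauss_dom_exp_cdot(2) g2]])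
qed

text \<open>Integrating out the second variable of \<open>gauss_dom_beta_pair\<close> keeps the rate
  in z; this is what makes the integrals in Moyal's identity converge absolutely.\<close>

lemma gauss_dom_fock_inner_beta:
  assumes f: "exptype f" and e: "exptype e"
  shows "gauss_dom (pi / 6) (\<lambda>z. fock_inner f (beta_op z e))"
proof -
  have "gauss_dom (0 + pi / 6) (\<lambda>p. f (snd p) * cnj (beta_op (fst p) e (snd p) * gauss (snd p)))"
    by (rule gauss_dom_mult[OF gauss_dom_snd[OF exptype_gauss_dom[OF f]] gauss_dom_cnj[OF gauss_dom_beta_pair[OF e]]])
  then have "gauss_dom (pi / 6) (\<lambda>p. f (snd p) * cnj (beta_op (fst p) e (snd p) * gauss (snd p)))" by simp
  from gauss_dom_integral[OF this] show ?thesis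
    by (simp add: fock_inner_gauss mult.assoc)
qed

text \<open>Integrating over z first, by \<open>moyal_kernel\<close>, collapses the superposition of
  shifts to the reproducing kernel and so recovers f up to a constant. Pairing with g then
  finishes.\<close>

lemma moyal:
  assumes f: "exptype f" and g: "exptype g" and e: "exptype e" and e': "exptype e'"
  shows "(\<integral>z. fock_inner f (beta_op z e) * cnj (fock_inner g (beta_op z e')) \<partial>lborel) = fock_inner e' e * fock_inner f g"
proof -
  let ?A = "\<lambda>z. fock_inner f (beta_op z e)"
  \<comment> \<open>The inversion formula: analysing with e and synthesising with e' amounts to
    multiplication by a scalar.\<close>
  have inner: "(\<integral>z. ?A z * beta_op z e' \<zeta> \<partial>lborel) = fock_inner e' e * f \<zeta>" for \<zeta>
  proof -
    have g1: "gauss_dom (0 + (0 + pi / 6)) (\<lambda>p. beta_op (snd p) e' \<zeta> * (f (fst p) * cnj (beta_op (snd p) e (fst p) * gauss (fst p))))"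
      using gauss_dom_swap[OF gauss_dom_beta_pair[OF e]]
      by (intro gauss_dom_mult gauss_dom_snd[OF gauss_dom_beta_snd[OF e']] gauss_dom_fst[OF exptype_gauss_dom[OF f]] gauss_dom_cnj) simp
    have "(\<integral>z. ?A z * beta_op z e' \<zeta> \<partial>lborel) = (\<integral>z. (\<integral>w. beta_op z e' \<zeta> * (f w * cnj (beta_op z e w * gauss w)) \<partial>lborel) \<partial>lborel)"
      unfolding fock_inner_gauss integral_mult_right_zero
      by (simp add: mult.assoc mult.commute[of _ "beta_op _ e' \<zeta>"])
    also have "\<dots> = (\<integral>w. (\<integral>z. beta_op z e' \<zeta> * (f w * cnj (beta_op z e w * gauss w)) \<partial>lborel) \<partial>lborel)"
      using gauss_dom_Fubini[OF g1] pi_gt_zero by simp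
    also have "\<dots> = (\<integral>w. fock_inner e' e * (f w * exp (of_real pi * cdot w \<zeta>) * gauss w) \<partial>lborel)"
    proof (intro Bochner_Integration.integral_cong refl)
      fix w
      have "(\<integral>z. beta_op z e' \<zeta> * (f w * cnj (beta_op z e w * gauss w)) \<partial>lborel) = (\<integral>z. (f w * gauss w) * (cnj (beta_op z e w) * beta_op z e' \<zeta>) \<partial>lborel)"
        by (intro Bochner_Integration.integral_cong refl) (simp add: mult_ac)
      also have "\<dots> = (f w * gauss w) * (exp (of_real pi * cdot w \<zeta>) * fock_inner e' e)"
        by (simp only: integral_mult_right_zero moyal_kernel[OF e' e])
      finally show "(\<integral>z. beta_op z e' \<zeta> * (f w * cnj (beta_op z e w * gauss w)) \<partial>lborel) = fock_inner e' e * (f w * exp (of_real pi * cdot w \<zeta>) * gauss w)"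
        by (simp only: mult_ac)
    qed
    also have "\<dots> = fock_inner e' e * f \<zeta>"
      by (simp only: integral_mult_right_zero reproducing[OF f])
    finally show ?thesis .
  qed
  have gA: "gauss_dom 0 ?A" by (rule gauss_dom_mono[OF gauss_dom_fock_inner_beta[OF f e]]) simp
  have g2: "gauss_dom (0 + (0 + pi / 6)) (\<lambda>p. ?A (fst p) * (cnj (g (snd p)) * (beta_op (fst p) e' (snd p) * gauss (snd p))))"
    by (intro gauss_dom_mult gauss_dom_fst[OF gA] gauss_dom_snd[OF gauss_dom_cnj[OF exptype_gauss_dom[OF g]]] gauss_dom_beta_pair[OF e'])
  have "(\<integral>z. ?A z * cnj (fock_inner g (beta_op z e')) \<partial>lborel) = (\<integral>z. (\<integral>\<zeta>. ?A z * (cnj (g \<zeta>) * (beta_op z e' \<zeta> * gauss \<zeta>)) \<partial>lborel) \<partial>lborel)"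
  proof (intro Bochner_Integration.integral_cong refl)
    fix z
    have "cnj (fock_inner g (beta_op z e')) = (\<integral>\<zeta>. cnj (g \<zeta>) * (beta_op z e' \<zeta> * gauss \<zeta>) \<partial>lborel)"
      unfolding fock_inner_cnj unfolding fock_inner_gauss
      by (intro Bochner_Integration.integral_cong refl) (simp only: mult_ac)
    then show "?A z * cnj (fock_inner g (beta_op z e')) = (\<integral>\<zeta>. ?A z * (cnj (g \<zeta>) * (beta_op z e' \<zeta> * gauss \<zeta>)) \<partial>lborel)"
      by (simp only: integral_mult_right_zero)
  qed
  also have "\<dots> = (\<integral>\<zeta>. (\<integral>z. ?A z * (cnj (g \<zeta>) * (beta_op z e' \<zeta> * gauss \<zeta>)) \<partial>lborel) \<partial>lborel)"
    using gauss_dom_Fubini[OF g2] pi_gt_zero by simp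
  also have "\<dots> = (\<integral>\<zeta>. fock_inner e' e * (f \<zeta> * cnj (g \<zeta>) * gauss \<zeta>) \<partial>lborel)"
  proof (intro Bochner_Integration.integral_cong refl)
    fix \<zeta>
    have "(\<integral>z. ?A z * (cnj (g \<zeta>) * (beta_op z e' \<zeta> * gauss \<zeta>)) \<partial>lborel) = (\<integral>z. (cnj (g \<zeta>) * gauss \<zeta>) * (?A z * beta_op z e' \<zeta>) \<partial>lborel)"
      by (intro Bochner_Integration.integral_cong refl) (simp only: mult_ac)
    also have "\<dots> = (cnj (g \<zeta>) * gauss \<zeta>) * (fock_inner e' e * f \<zeta>)"
      by (simp only: integral_mult_right_zero inner)
    finally show "(\<integral>z. ?A z * (cnj (g \<zeta>) * (beta_op z e' \<zeta> * gauss \<zeta>)) \<partial>lborel) = fock_inner e' e * (f \<zeta> * cnj (g \<zeta>) * gauss \<zeta>)"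
      by (simp only: mult_ac)
  qed
  also have "\<dots> = fock_inner e' e * fock_inner f g"
    by (simp only: integral_mult_right_zero fock_inner_gauss)
  finally show ?thesis .
qed

definition ek_norm2 :: "nat^'d::finite \<Rightarrow> real" where
  "ek_norm2 k = Re (fock_inner (ek k) (ek k))"

lemma ek_inner: "fock_inner (ek k) (ek l) = (if k = l then of_real (ek_norm2 k) else 0)"
proof (cases "k = l")
  case True
  show ?thesis unfolding True ek_norm2_def by (simp only: refl if_True) (rule ek_inner_real)
qed (simp add: ek_orthogonal)

lemma ek_norm2_pos: "ek_norm2 k > 0"
  unfolding ek_norm2_def by (rule ek_norm_pos)

lemma exptype_fock_norm2:
  assumes f: "exptype f"
  shows "fock_norm2 f = ennreal (Re (fock_inner f f))"
proof -
  have eq: "f z * cnj (f z) * gauss z = of_real ((cmod (f z))\<^sup>2 * exp (- pi * (norm z)\<^sup>2))" for z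
    by (simp only: complex_norm_square[symmetric] gauss_def of_real_mult[symmetric])
  have "integrable lborel (\<lambda>z. f z * cnj (f z) * gauss z)"
    by (rule gauss_dom_integrable[OF gauss_dom_inner[OF exptype_gauss_dom[OF f] exptype_gauss_dom[OF f]] pi_gt_zero])
  then have i: "integrable lborel (\<lambda>z. (cmod (f z))\<^sup>2 * exp (- pi * (norm z)\<^sup>2))"
    unfolding eq complex_of_real_integrable_eq .
  have "fock_inner f f = of_real (\<integral>z. (cmod (f z))\<^sup>2 * exp (- pi * (norm z)\<^sup>2) \<partial>lborel)"
    unfolding fock_inner_gauss eq by (rule integral_complex_of_real)
  then have "Re (fock_inner f f) = (\<integral>z. (cmod (f z))\<^sup>2 * exp (- pi * (norm z)\<^sup>2) \<partial>lborel)"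
    by (simp only: Re_complex_of_real)
  then show ?thesis
    unfolding fock_norm2_def by (simp only:) (rule nn_integral_eq_integral[OF i], simp)
qed

lemma exptype_norm_nonneg: "exptype f \<Longrightarrow> Re (fock_inner f f) \<ge> 0"
proof -
  have eq: "f z * cnj (f z) * gauss z = of_real ((cmod (f z))\<^sup>2 * exp (- pi * (norm z)\<^sup>2))" for z
    by (simp only: complex_norm_square[symmetric] gauss_def of_real_mult[symmetric])
  have "fock_inner f f = of_real (\<integral>z. (cmod (f z))\<^sup>2 * exp (- pi * (norm z)\<^sup>2) \<partial>lborel)"
    unfolding fock_inner_gauss eq by (rule integral_complex_of_real)
  then show "Re (fock_inner f f) \<ge> 0" by (simp only: Re_complex_of_real) (simp add: integral_nonneg_AE)
qed

text \<open>By Moyal the contributions of different k are orthogonal because the windows are. The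
  windows enter with their own norms \<open>ek_norm2\<close>, which therefore weight the
  sum.\<close>

lemma polyanalytic_norm:
  assumes f: "\<And>k. exptype (f k)" and K: "finite K"
    and F: "\<And>z. exp (- of_real (pi / 2) * cdot z z) * F z = (\<Sum>k\<in>K. fock_inner (f k) (beta_op z (ek k)))"
  shows "fock_norm2 F = ennreal (\<Sum>k\<in>K. ek_norm2 k * Re (fock_inner (f k) (f k)))"
proof -
  let ?P = "\<lambda>z. \<Sum>k\<in>K. fock_inner (f k) (beta_op z (ek k))"
  have gP: "gauss_dom (pi / 6) ?P" by (intro gauss_dom_sum gauss_dom_fock_inner_beta f exptype_ek)
  have ip: "integrable lborel (\<lambda>z. ?P z * cnj (?P z))"
    by (rule gauss_dom_integrable[OF gauss_dom_mult[OF gP gauss_dom_cnj[OF gP]]]) simp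
  have iq: "integrable lborel (\<lambda>z. fock_inner (f k) (beta_op z (ek k)) * cnj (fock_inner (f l) (beta_op z (ek l))))" for k l
    by (rule gauss_dom_integrable[OF gauss_dom_mult[OF gauss_dom_fock_inner_beta[OF f exptype_ek] gauss_dom_cnj[OF gauss_dom_fock_inner_beta[OF f exptype_ek]]]]) simp
  have sq: "(cmod (F z))\<^sup>2 * exp (- pi * (norm z)\<^sup>2) = (cmod (?P z))\<^sup>2" for z
  proof -
    have "cmod (exp (- of_real (pi / 2) * cdot z z)) = exp (- (pi / 2) * (norm z)\<^sup>2)"
      unfolding cdot_self by simp
    then have "cmod (?P z) = exp (- (pi / 2) * (norm z)\<^sup>2) * cmod (F z)"
      unfolding F[symmetric] norm_mult by simp
    then have "(cmod (?P z))\<^sup>2 = (exp (- (pi / 2) * (norm z)\<^sup>2))\<^sup>2 * (cmod (F z))\<^sup>2"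
      by (simp only: power_mult_distrib)
    also have "(exp (- (pi / 2) * (norm z)\<^sup>2))\<^sup>2 = exp (- pi * (norm z)\<^sup>2)"
      by (simp add: exp_double[symmetric])
    finally show ?thesis by simp
  qed
  have eq: "?P z * cnj (?P z) = of_real ((cmod (?P z))\<^sup>2)" for z
    by (rule complex_norm_square[symmetric])
  have i: "integrable lborel (\<lambda>z. (cmod (?P z))\<^sup>2)"
    using ip unfolding eq complex_of_real_integrable_eq .
  have "complex_of_real (\<integral>z. (cmod (?P z))\<^sup>2 \<partial>lborel) = (\<integral>z. ?P z * cnj (?P z) \<partial>lborel)"
    unfolding eq by (rule integral_complex_of_real[symmetric])
  also have "\<dots> = (\<integral>z. (\<Sum>k\<in>K. \<Sum>l\<in>K. fock_inner (f k) (beta_op z (ek k)) * cnj (fock_inner (f l) (beta_op z (ek l)))) \<partial>lborel)"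
    by (simp only: cnj_sum sum_product)
  also have "\<dots> = (\<Sum>k\<in>K. \<Sum>l\<in>K. fock_inner (ek l) (ek k) * fock_inner (f k) (f l))"
    by (simp add: Bochner_Integration.integral_sum Bochner_Integration.integrable_sum iq moyal[OF f f exptype_ek exptype_ek])
  also have "\<dots> = (\<Sum>k\<in>K. of_real (ek_norm2 k) * fock_inner (f k) (f k))"
  proof (intro sum.cong refl)
    fix k assume k: "k \<in> K"
    have "(\<Sum>l\<in>K. fock_inner (ek l) (ek k) * fock_inner (f k) (f l)) = (\<Sum>l\<in>K. if l = k then of_real (ek_norm2 k) * fock_inner (f k) (f k) else 0)"
      by (intro sum.cong refl) (auto simp: ek_inner)
    then show "(\<Sum>l\<in>K. fock_inner (ek l) (ek k) * fock_inner (f k) (f l)) = of_real (ek_norm2 k) * fock_inner (f k) (f k)"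
      using k K by simp
  qed
  finally have "Re (complex_of_real (\<integral>z. (cmod (?P z))\<^sup>2 \<partial>lborel)) = Re (\<Sum>k\<in>K. of_real (ek_norm2 k) * fock_inner (f k) (f k))"
    by (rule arg_cong)
  then have "(\<integral>z. (cmod (?P z))\<^sup>2 \<partial>lborel) = (\<Sum>k\<in>K. ek_norm2 k * Re (fock_inner (f k) (f k)))"
    by (simp only: Re_complex_of_real Re_sum times_complex.sel Im_complex_of_real mult_zero_left diff_zero)
  then show ?thesis
    unfolding fock_norm2_def sq using nn_integral_eq_integral[OF i] by simp
qed

section \<open>Lattices, characters and Poisson summation\<close>

definition intvec :: "(real^'m) set" where
  "intvec = {k. \<forall>i. k $ i \<in> \<int>}"

lemma countable_intvec: "countable (intvec :: (real^'m::finite) set)"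
proof (rule countable_subset)
  show "(intvec :: (real^'m) set) \<subseteq> vec_lambda ` (PiE UNIV (\<lambda>_. \<int>))"
  proof
    fix k :: "real^'m" assume "k \<in> intvec"
    then have "vec_nth k \<in> PiE UNIV (\<lambda>_. \<int>)" by (auto simp: intvec_def PiE_UNIV_domain)
    then have "vec_lambda (vec_nth k) \<in> vec_lambda ` (PiE UNIV (\<lambda>_. \<int>))" by blast
    then show "k \<in> vec_lambda ` (PiE UNIV (\<lambda>_. \<int>))" by (simp add: vec_nth_inverse)
  qed
  have "countable (\<int> :: real set)" unfolding Ints_def by simp
  then show "countable (vec_lambda ` (PiE (UNIV::'m set) (\<lambda>_. (\<int> :: real set))))"
    by (intro countable_image countable_PiE) auto
qed

lemma infinite_intvec: "infinite (intvec :: (real^'m::finite) set)"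
proof -
  have "inj (\<lambda>n::int. (\<chi> i. of_int n) :: real^'m)"
    by (rule injI) (simp add: vec_eq_iff)
  then have "infinite (range (\<lambda>n::int. (\<chi> i. of_int n) :: real^'m))"
    by (simp add: finite_image_iff infinite_UNIV_char_0)
  moreover have "range (\<lambda>n::int. (\<chi> i. of_int n) :: real^'m) \<subseteq> intvec"
    by (auto simp: intvec_def)
  ultimately show ?thesis using finite_subset by blast
qed

lemma intvec_add: "k \<in> intvec \<Longrightarrow> l \<in> intvec \<Longrightarrow> k + l \<in> intvec"
  and intvec_diff: "k \<in> intvec \<Longrightarrow> l \<in> intvec \<Longrightarrow> k - l \<in> intvec"
  and intvec_minus: "k \<in> intvec \<Longrightarrow> - k \<in> intvec"
  by (simp_all add: intvec_def)

lemma intvec_axis: "axis i 1 \<in> intvec"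
  by (simp add: intvec_def axis_def)

text \<open>A lattice is given by the coordinate map $L$ sending it onto $Z^m$.\<close>

locale lattice_coords =
  fixes L :: "'a::euclidean_space \<Rightarrow> real^'m::finite"
  assumes lin: "linear L" and bij: "bij L"
begin

definition lat :: "'a set" where "lat = {x. L x \<in> intvec}"

text \<open>Half-open so that the translates tile, and centred so that 0 is an interior point: the
  uniqueness argument for Fourier coefficients takes place near 0.\<close>

definition fdom :: "'a set" where "fdom = {x. \<forall>i. - 1/2 \<le> L x $ i \<and> L x $ i < 1/2}"

lemma L_inv: "L (inv L y) = y" "inv L (L x) = x"
  using bij by (simp_all add: bij_is_surj surj_f_inv_f bij_is_inj)

lemma lin_inv: "linear (inv L)"
proof (rule linearI)
  fix x y c
  have "L (inv L x + inv L y) = x + y" by (simp add: linear_add[OF lin] L_inv)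
  then show "inv L (x + y) = inv L x + inv L y" by (metis L_inv(2))
  have "L (c *\<^sub>R inv L x) = c *\<^sub>R x" by (simp add: linear_cmul[OF lin] L_inv)
  then show "inv L (c *\<^sub>R x) = c *\<^sub>R inv L x" by (metis L_inv(2))
qed

lemma L_cont: "continuous_on S L"
  using lin by (simp add: linear_continuous_on linear_conv_bounded_linear)

lemma L_meas [measurable]: "L \<in> borel_measurable borel"
  by (rule borel_measurable_continuous_onI[OF L_cont])

lemma L_add: "L (x + y) = L x + L y" and L_diff: "L (x - y) = L x - L y" and L_minus: "L (- x) = - L x"
  and L_0: "L 0 = 0"
  using lin by (simp_all add: linear_add linear_diff linear_neg linear_0)

lemma lat_eq: "lat = inv L ` intvec"
proof (intro set_eqI iffI)
  fix x assume "x \<in> lat"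
  then have "L x \<in> intvec" by (simp add: lat_def)
  then have "inv L (L x) \<in> inv L ` intvec" by (rule imageI)
  then show "x \<in> inv L ` intvec" by (simp only: L_inv)
qed (auto simp: lat_def L_inv)

lemma countable_lat: "countable lat"
  unfolding lat_eq by (intro countable_image countable_intvec)

lemma infinite_lat: "infinite lat"
proof
  assume "finite lat"
  then have "finite (L ` (inv L ` intvec))" unfolding lat_eq by (rule finite_imageI)
  then show False using infinite_intvec[where 'm='m] by (simp add: image_image L_inv)
qed

lemma lat_minus: "x \<in> lat \<Longrightarrow> - x \<in> lat" and lat_add: "x \<in> lat \<Longrightarrow> y \<in> lat \<Longrightarrow> x + y \<in> lat"
  by (simp_all add: lat_def L_add L_minus intvec_add intvec_minus)

text \<open>Coordinatewise rounding to the nearest integer, with ties rounded upwards to fit the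
  half-open box.\<close>

lemma ex_lat: "\<exists>g. g \<in> lat \<and> x + g \<in> fdom"
proof -
  define g where "g = inv L (\<chi> i. - of_int \<lfloor>L x $ i + 1/2\<rfloor>)"
  have "g \<in> lat" by (simp add: g_def lat_def L_inv intvec_def)
  moreover have "x + g \<in> fdom"
    unfolding fdom_def mem_Collect_eq
  proof
    fix i
    have "L (x + g) $ i = L x $ i - of_int \<lfloor>L x $ i + 1/2\<rfloor>"
      by (simp add: L_add g_def L_inv)
    then show "- 1/2 \<le> L (x + g) $ i \<and> L (x + g) $ i < 1/2" by linarith
  qed
  ultimately show ?thesis by blast
qed

lemma lat_unique:
  assumes g: "g \<in> lat" "x + g \<in> fdom" and h: "h \<in> lat" "x + h \<in> fdom"
  shows "g = h"
proof -
  have "L g $ i = L h $ i" for i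
  proof -
    have "L g $ i - L h $ i \<in> \<int>" using g h by (auto simp: lat_def intvec_def)
    then obtain n where n: "L g $ i - L h $ i = of_int n" by (auto elim: Ints_cases)
    have "- 1/2 \<le> L (x + g) $ i \<and> L (x + g) $ i < 1/2" "- 1/2 \<le> L (x + h) $ i \<and> L (x + h) $ i < 1/2"
      using g h by (auto simp: fdom_def)
    then have "\<bar>real_of_int n\<bar> < 1" unfolding n[symmetric] by (simp add: L_add abs_less_iff)
    then have "n = 0" by linarith
    then show ?thesis using n by simp
  qed
  then have "L g = L h" by (simp add: vec_eq_iff)
  then show "g = h" by (metis L_inv(2))
qed

lemma fdom_sets [measurable]: "fdom \<in> sets borel"
  unfolding fdom_def by measurable

text \<open>Stated for the closed box, which serves both the half-open domain and the compactness
  argument for Fourier coefficients.\<close>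

lemma fdom_bound: "\<exists>R>0. \<forall>x. (\<forall>i. \<bar>L x $ i\<bar> \<le> 1/2) \<longrightarrow> norm x \<le> R"
proof -
  obtain B where B: "B > 0" "\<And>y. norm (inv L y) \<le> B * norm y"
    using linear_bounded_pos[OF lin_inv] by auto
  show ?thesis
  proof (intro exI[of _ "B * (real CARD('m) * (1/2))"] conjI allI impI)
    show "B * (real CARD('m) * (1/2)) > 0" using B(1) by simp
    fix x assume x: "\<forall>i. \<bar>L x $ i\<bar> \<le> 1/2"
    have "norm (L x) \<le> (\<Sum>i\<in>UNIV. \<bar>L x $ i\<bar>)" by (rule norm_le_l1_cart)
    also have "\<dots> \<le> (\<Sum>i\<in>(UNIV::'m set). 1/2)" by (rule sum_mono) (use x in blast)
    finally have "norm (L x) \<le> real CARD('m) * (1/2)" by simp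
    moreover have "norm x \<le> B * norm (L x)" using B(2)[of "L x"] by (simp add: L_inv)
    ultimately show "norm x \<le> B * (real CARD('m) * (1/2))"
      using B(1) by (meson mult_left_mono less_imp_le order_trans)
  qed
qed

lemma fdom_abs:
  assumes "x \<in> fdom"
  shows "\<bar>L x $ i\<bar> \<le> 1/2"
proof -
  have "- 1/2 \<le> L x $ i \<and> L x $ i < 1/2" using assms by (simp add: fdom_def)
  then show ?thesis by linarith
qed

lemma fdom_ball: obtains r where "r > 0" "ball 0 r \<subseteq> fdom"
proof -
  obtain B where B: "B > 0" "\<And>x. norm (L x) \<le> B * norm x"
    using linear_bounded_pos[OF lin] by auto
  show ?thesis
  proof (rule that[of "1 / (4 * B)"])
    show "1 / (4 * B) > 0" using B(1) by simp
    show "ball 0 (1 / (4 * B)) \<subseteq> fdom"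
    proof
      fix x :: 'a assume "x \<in> ball 0 (1 / (4 * B))"
      then have "B * norm x \<le> 1/4" using B(1) by (simp add: field_simps)
      then have "norm (L x) \<le> 1/4" using B(2)[of x] by linarith
      then have "\<bar>L x $ i\<bar> \<le> 1/4" for i using component_le_norm_cart[of "L x" i] by linarith
      note 1 = this
      show "x \<in> fdom" unfolding fdom_def mem_Collect_eq
      proof
        fix i show "- 1/2 \<le> L x $ i \<and> L x $ i < 1/2" using 1[of i] by linarith
      qed
    qed
  qed
qed

lemma emeasure_fdom: "emeasure lborel fdom < \<infinity>" "emeasure lborel fdom \<noteq> 0"
proof -
  obtain R where R: "R > 0" "\<forall>x. (\<forall>i. \<bar>L x $ i\<bar> \<le> 1/2) \<longrightarrow> norm x \<le> R"
    using fdom_bound by blast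
  have "bounded fdom" unfolding bounded_iff using R(2) fdom_abs by blast
  then show 1: "emeasure lborel fdom < \<infinity>" by (rule emeasure_bounded_finite)
  obtain r where r: "r > 0" "ball 0 r \<subseteq> fdom" by (rule fdom_ball)
  have "emeasure lborel (ball (0::'a) r) \<le> emeasure lborel fdom" by (rule emeasure_mono[OF r(2)]) simp
  moreover have "emeasure lborel (ball (0::'a) r) \<noteq> 0"
    using content_ball_pos[OF r(1), of "0::'a"] by (metis measure_eq_emeasure_eq_ennreal less_irrefl ennreal_0 order_refl measure_def enn2real_0)
  ultimately show "emeasure lborel fdom \<noteq> 0" by auto
qed

definition vol :: real where "vol = measure lborel fdom"

lemma vol_pos: "vol > 0" and emeasure_vol: "emeasure lborel fdom = ennreal vol"
proof -
  show 1: "emeasure lborel fdom = ennreal vol"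
    unfolding vol_def using emeasure_fdom(1) by (intro emeasure_eq_ennreal_measure) auto
  show "vol > 0"
    using emeasure_fdom(2) unfolding 1 by (simp add: ennreal_eq_0_iff not_le)
qed

section \<open>Tilings, periodic functions and Gaussian lattice sums\<close>

lemma suminf_unique_indicator:
  assumes "\<exists>!n::nat. P n"
  shows "(\<Sum>n. f n * (if P n then 1 else 0::ennreal)) = f (THE n. P n)"
proof -
  have P: "P n \<longleftrightarrow> n = (THE n. P n)" for n using theI'[OF assms] assms by blast
  have "(\<Sum>n. f n * (if P n then 1 else 0::ennreal)) = (\<Sum>n. if n = (THE n. P n) then f n else 0)"
    by (rule suminf_cong) (subst P, simp)
  also have "\<dots> = (\<Sum>n\<in>{THE n. P n}. if n = (THE n. P n) then f n else 0)"
    by (rule suminf_finite) auto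
  finally show ?thesis by simp
qed

context
  fixes e :: "nat \<Rightarrow> 'a"
  assumes e: "bij_betw e UNIV lat"
begin

lemma e_lat: "e n \<in> lat" using e by (auto simp: bij_betw_def)

lemma ex1_plus: "\<exists>!n. x + e n \<in> fdom"
proof -
  obtain g where g: "g \<in> lat" "x + g \<in> fdom" using ex_lat[of x] by blast
  obtain n where n: "e n = g" using g(1) e by (metis bij_betw_imp_surj_on imageE)
  show ?thesis
  proof (rule ex1I[of _ n])
    show "x + e n \<in> fdom" using g n by simp
    fix m assume "x + e m \<in> fdom"
    then have "e m = e n" using lat_unique[OF e_lat _ g] n by simp
    then show "m = n" using e by (simp add: bij_betw_def inj_eq)
  qed
qed

lemma ex1_minus: "\<exists>!n. x - e n \<in> fdom"
proof -
  obtain g where g: "g \<in> lat" "x + g \<in> fdom" using ex_lat[of x] by blast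
  obtain n where n: "e n = - g" using lat_minus[OF g(1)] e by (metis bij_betw_imp_surj_on imageE)
  show ?thesis
  proof (rule ex1I[of _ n])
    show "x - e n \<in> fdom" using g n by simp
    fix m assume "x - e m \<in> fdom"
    then have "- e m = g" using lat_unique[OF lat_minus[OF e_lat] _ g, of m] by simp
    then have "e m = e n" using n by auto
    then show "m = n" using e by (simp add: bij_betw_def inj_eq)
  qed
qed

text \<open>Exactly one translate of each point lies in the domain. The integral is split
  accordingly and every piece is translated into the domain.\<close>

lemma tiling:
  fixes f :: "'a \<Rightarrow> ennreal"
  assumes [measurable]: "f \<in> borel_measurable borel"
  shows "(\<integral>\<^sup>+x. f x \<partial>lborel) = (\<integral>\<^sup>+x. (\<Sum>n. f (x + e n)) * indicator fdom x \<partial>lborel)"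
proof -
  have "(\<integral>\<^sup>+x. f x \<partial>lborel) = (\<integral>\<^sup>+x. (\<Sum>n. f x * indicator fdom (x - e n)) \<partial>lborel)"
  proof (rule nn_integral_cong)
    fix x
    show "f x = (\<Sum>n. f x * indicator fdom (x - e n))"
      using suminf_unique_indicator[OF ex1_minus, of "\<lambda>_. f x" x] by (simp add: indicator_def of_bool_def)
  qed
  also have "\<dots> = (\<Sum>n. \<integral>\<^sup>+x. f x * indicator fdom (x - e n) \<partial>lborel)"
    by (rule nn_integral_suminf) measurable
  also have "\<dots> = (\<Sum>n. \<integral>\<^sup>+x. f (x + e n) * indicator fdom x \<partial>lborel)"
  proof (rule suminf_cong)
    fix n
    have "(\<integral>\<^sup>+x. f (x + e n) * indicator fdom (x + e n - e n) \<partial>lborel) = (\<integral>\<^sup>+x. f x * indicator fdom (x - e n) \<partial>lborel)"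
      by (rule nn_integral_lborel_translate[where f="\<lambda>x. f x * indicator fdom (x - e n)"]) measurable
    then show "(\<integral>\<^sup>+x. f x * indicator fdom (x - e n) \<partial>lborel) = (\<integral>\<^sup>+x. f (x + e n) * indicator fdom x \<partial>lborel)"
      by simp
  qed
  also have "\<dots> = (\<integral>\<^sup>+x. (\<Sum>n. f (x + e n) * indicator fdom x) \<partial>lborel)"
    by (rule nn_integral_suminf[symmetric]) measurable
  also have "\<dots> = (\<integral>\<^sup>+x. (\<Sum>n. f (x + e n)) * indicator fdom x \<partial>lborel)"
    by (simp add: ennreal_suminf_multc)
  finally show ?thesis .
qed

text \<open>The integral of a periodic function does not depend on the choice of the fundamental
  domain. The shifted domain is cut up along the original one, and each point then contributes a
  single term.\<close>

lemma periodic_shift: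
  fixes Q :: "'a \<Rightarrow> ennreal"
  assumes [measurable]: "Q \<in> borel_measurable borel" and per: "\<And>x g. g \<in> lat \<Longrightarrow> Q (x + g) = Q x"
  shows "(\<integral>\<^sup>+x. Q (x + a) * indicator fdom x \<partial>lborel) = (\<integral>\<^sup>+x. Q x * indicator fdom x \<partial>lborel)"
proof -
  have "(\<integral>\<^sup>+x. Q (x + a) * indicator fdom (x + a - a) \<partial>lborel) = (\<integral>\<^sup>+x. Q x * indicator fdom (x - a) \<partial>lborel)"
    by (rule nn_integral_lborel_translate[where f="\<lambda>x. Q x * indicator fdom (x - a)"]) measurable
  then have "(\<integral>\<^sup>+x. Q (x + a) * indicator fdom x \<partial>lborel) = (\<integral>\<^sup>+x. Q x * indicator fdom (x - a) \<partial>lborel)"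
    by simp
  also have "\<dots> = (\<integral>\<^sup>+x. (\<Sum>n. Q (x + e n) * indicator fdom (x + e n - a)) * indicator fdom x \<partial>lborel)"
    by (rule tiling) measurable
  also have "\<dots> = (\<integral>\<^sup>+x. Q x * indicator fdom x \<partial>lborel)"
  proof (rule nn_integral_cong)
    fix x
    have "(\<Sum>n. Q (x + e n) * indicator fdom (x + e n - a)) = (\<Sum>n. Q x * (if (x - a) + e n \<in> fdom then 1 else 0))"
      by (rule suminf_cong) (simp add: per[OF e_lat] indicator_def algebra_simps)
    also have "\<dots> = Q x" by (rule suminf_unique_indicator[OF ex1_plus])
    finally show "(\<Sum>n. Q (x + e n) * indicator fdom (x + e n - a)) * indicator fdom x = Q x * indicator fdom x" by simp
  qed
  finally show ?thesis .
qed

text \<open>Averaging over the fundamental domain compares the sum with an integral: moving a centre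
  by at most R costs the factor exp(\<epsilon> R^2) and half of the rate, after which tiling yields
  a complete Gaussian integral, independent of w.\<close>

lemma gauss_sum:
  assumes "\<epsilon> > 0"
  obtains C where "C > 0" "\<And>w. summable (\<lambda>n. exp (- \<epsilon> * (norm (w - e n))\<^sup>2))"
    "\<And>w. (\<Sum>n. exp (- \<epsilon> * (norm (w - e n))\<^sup>2)) \<le> C"
proof -
  obtain R where R: "R > 0" "\<forall>x. (\<forall>i. \<bar>L x $ i\<bar> \<le> 1/2) \<longrightarrow> norm x \<le> R"
    using fdom_bound by blast
  define K where "K = exp (\<epsilon> * R\<^sup>2)"
  define G where "G = sqrt (pi / (\<epsilon>/2)) ^ DIM('a)"
  \<comment> \<open>Positivity of the constant is part of the claim, hence the added 1.\<close>
  define C where "C = K * G / vol + 1"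
  have KG: "K > 0" "G \<ge> 0" using assms by (auto simp: K_def G_def)
  have main: "(\<Sum>n. ennreal (exp (- \<epsilon> * (norm (w - e n))\<^sup>2))) \<le> ennreal (K * G / vol)" for w
  proof -
    let ?S = "\<Sum>n. ennreal (exp (- \<epsilon> * (norm (w - e n))\<^sup>2))"
    have "?S * ennreal vol = (\<integral>\<^sup>+x. ?S * indicator fdom x \<partial>lborel)"
      by (simp add: nn_integral_cmult emeasure_vol)
    also have "\<dots> \<le> (\<integral>\<^sup>+x. (\<Sum>n. ennreal (K * exp (- (\<epsilon>/2) * (norm (w - (x + e n)))\<^sup>2))) * indicator fdom x \<partial>lborel)"
    proof (rule nn_integral_mono)
      fix x
      show "?S * indicator fdom x \<le> (\<Sum>n. ennreal (K * exp (- (\<epsilon>/2) * (norm (w - (x + e n)))\<^sup>2))) * indicator fdom x"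
      proof (cases "x \<in> fdom")
        case True
        then have x: "norm x \<le> R" using R(2) fdom_abs by blast
        have "ennreal (exp (- \<epsilon> * (norm (w - e n))\<^sup>2)) \<le> ennreal (K * exp (- (\<epsilon>/2) * (norm (w - (x + e n)))\<^sup>2))" for n
        proof (rule ennreal_leI)
          have "norm (w - (x + e n)) \<le> norm (w - e n) + norm x"
            using norm_triangle_ineq4[of "w - e n" x] by (simp add: algebra_simps)
          then have "(norm (w - (x + e n)))\<^sup>2 \<le> (norm (w - e n) + norm x)\<^sup>2" by (intro power_mono) auto
          also have "\<dots> \<le> 2 * (norm (w - e n))\<^sup>2 + 2 * (norm x)\<^sup>2"
            using sum_squares_bound[of "norm (w - e n)" "norm x"] by (simp add: power2_sum)
          also have "\<dots> \<le> 2 * (norm (w - e n))\<^sup>2 + 2 * R\<^sup>2" using x by (simp add: power_mono)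
          finally have "(\<epsilon>/2) * (norm (w - (x + e n)))\<^sup>2 \<le> (\<epsilon>/2) * (2 * (norm (w - e n))\<^sup>2 + 2 * R\<^sup>2)"
            using assms by (intro mult_left_mono) auto
          then have "- \<epsilon> * (norm (w - e n))\<^sup>2 \<le> \<epsilon> * R\<^sup>2 + - (\<epsilon>/2) * (norm (w - (x + e n)))\<^sup>2"
            by (simp add: algebra_simps)
          then show "exp (- \<epsilon> * (norm (w - e n))\<^sup>2) \<le> K * exp (- (\<epsilon>/2) * (norm (w - (x + e n)))\<^sup>2)"
            unfolding K_def exp_add[symmetric] exp_le_cancel_iff .
        qed
        then show ?thesis by (intro mult_right_mono suminf_le) auto
      qed simp
    qed
    also have "\<dots> = (\<integral>\<^sup>+x. ennreal (K * exp (- (\<epsilon>/2) * (norm (w - x))\<^sup>2)) \<partial>lborel)"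
      by (rule tiling[symmetric]) measurable
    also have "\<dots> = ennreal K * (\<integral>\<^sup>+x. ennreal (exp (- (\<epsilon>/2) * (norm (w - x))\<^sup>2)) \<partial>lborel)"
      using KG by (simp add: ennreal_mult nn_integral_cmult)
    also have "(\<integral>\<^sup>+x. ennreal (exp (- (\<epsilon>/2) * (norm (w - x))\<^sup>2)) \<partial>lborel) = (\<integral>\<^sup>+x. ennreal (exp (- (\<epsilon>/2) * (norm (x::'a))\<^sup>2)) \<partial>lborel)"
      by (rule nn_integral_lborel_reflect[where f="\<lambda>x. ennreal (exp (- (\<epsilon>/2) * (norm x)\<^sup>2))"]) measurable
    also have "\<dots> = ennreal G" unfolding G_def using assms by (intro nn_integral_gauss) simp
    finally have "?S * ennreal vol \<le> ennreal (K * G)" using KG by (simp add: ennreal_mult)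
    then have "?S * ennreal vol * ennreal (1 / vol) \<le> ennreal (K * G) * ennreal (1 / vol)"
      by (rule mult_right_mono) simp
    then show ?thesis
      using vol_pos KG by (simp add: mult.assoc ennreal_mult[symmetric])
  qed
  have sm: "summable (\<lambda>n. exp (- \<epsilon> * (norm (w - e n))\<^sup>2))" for w
    by (rule summable_suminf_not_top) (use main[of w] in \<open>auto simp: top_unique\<close>)
  show ?thesis
  proof (rule that[of C])
    show "C > 0" using KG vol_pos by (simp add: C_def add_nonneg_pos)
    show "summable (\<lambda>n. exp (- \<epsilon> * (norm (w - e n))\<^sup>2))" for w by (rule sm)
    fix w
    have "ennreal (\<Sum>n. exp (- \<epsilon> * (norm (w - e n))\<^sup>2)) \<le> ennreal (K * G / vol)"
      unfolding suminf_ennreal2[OF _ sm[of w], symmetric, OF less_imp_le[OF exp_gt_zero]] by (rule main)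
    then have "(\<Sum>n. exp (- \<epsilon> * (norm (w - e n))\<^sup>2)) \<le> K * G / vol"
      using KG vol_pos by (simp add: ennreal_le_iff)
    then show "(\<Sum>n. exp (- \<epsilon> * (norm (w - e n))\<^sup>2)) \<le> C" by (simp add: C_def)
  qed
qed

end

lemma ex_enum: obtains e where "bij_betw e (UNIV::nat set) lat"
  using bij_betw_from_nat_into[OF countable_lat infinite_lat] by blast

lemma bij_uminus:
  assumes e: "bij_betw e (UNIV::nat set) lat"
  shows "bij_betw (\<lambda>n. - e n) (UNIV::nat set) lat"
proof -
  have "bij_betw uminus lat lat"
    by (rule bij_betw_byWitness[where f'=uminus]) (auto intro: lat_minus)
  from bij_betw_trans[OF e this] show ?thesis by (simp add: o_def)
qed

lemma fdom_integrable:
  fixes h :: "'a \<Rightarrow> complex"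
  assumes "h \<in> borel_measurable borel" "\<And>x. x \<in> fdom \<Longrightarrow> cmod (h x) \<le> B"
  shows "integrable lborel (\<lambda>x. indicator fdom x * h x)"
proof (rule Bochner_Integration.integrable_bound)
  show "integrable lborel (\<lambda>x. indicat_real fdom x * max B 0)"
    using emeasure_fdom(1) by (intro integrable_mult_left) (simp add: integrable_indicator_iff)
  have [measurable]: "h \<in> borel_measurable borel" by (rule assms)
  show "(\<lambda>x. indicator fdom x * h x) \<in> borel_measurable lborel" by measurable
  show "AE x in lborel. norm (indicator fdom x * h x) \<le> norm (indicat_real fdom x * max B 0)"
    using assms(2) by (auto simp: indicator_def norm_mult intro!: AE_I2 order_trans[OF _ max.cobounded1])
qed

section \<open>Characters and their integrals over the fundamental domain\<close>

definition chi :: "real^'m \<Rightarrow> 'a \<Rightarrow> complex" where "chi k x = cis (2 * pi * (k \<bullet> L x))"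

lemma chi_cont: "continuous_on S (chi k)"
  unfolding chi_def[abs_def] by (intro continuous_intros L_cont)

lemma chi_meas [measurable]: "chi k \<in> borel_measurable borel"
  by (rule borel_measurable_continuous_onI[OF chi_cont])

lemma cmod_chi [simp]: "cmod (chi k x) = 1" by (simp add: chi_def)

lemma chi_add: "chi k (x + y) = chi k x * chi k y"
  by (simp add: chi_def cis_mult L_add inner_add_right distrib_left)

lemma chi_add_left: "chi (k + l) x = chi k x * chi l x"
  by (simp add: chi_def cis_mult inner_add_left distrib_left)

lemma chi_lat: "k \<in> intvec \<Longrightarrow> g \<in> lat \<Longrightarrow> chi k g = 1"
proof -
  assume "k \<in> intvec" "g \<in> lat"
  then have "k \<bullet> L g \<in> \<int>" unfolding inner_vec_def by (intro Ints_sum) (auto simp: lat_def intvec_def)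
  then obtain n where "k \<bullet> L g = of_int n" by (auto elim: Ints_cases)
  then have "chi k g = cis (2 * pi * of_int n)" by (simp only: chi_def)
  also have "\<dots> = 1" by (simp add: cis_multiple_2pi)
  finally show "chi k g = 1" .
qed

lemma chi_0 [simp]: "chi 0 x = 1" "chi k 0 = 1" by (simp_all add: chi_def L_0)

lemma chi_minus: "chi (- k) x = cnj (chi k x)" by (simp add: chi_def cis_cnj)

text \<open>Invariance under shifts is available for nonnegative functions. As |h| is at most 1,
  adding 1 makes h nonnegative, and the volume added thereby is the same on both sides.\<close>

lemma integral_fdom_shift:
  fixes h :: "'a \<Rightarrow> real"
  assumes [measurable]: "h \<in> borel_measurable borel" and b: "\<And>x. \<bar>h x\<bar> \<le> 1" and per: "\<And>x g. g \<in> lat \<Longrightarrow> h (x + g) = h x"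
  shows "(\<integral>x. indicator fdom x * h (x + a) \<partial>lborel) = (\<integral>x. indicator fdom x * h x \<partial>lborel)"
proof -
  obtain e where e: "bij_betw e (UNIV::nat set) lat" by (rule ex_enum)
  have ind: "integrable lborel (indicat_real fdom)" using emeasure_fdom(1) by (simp add: integrable_indicator_iff)
  have bb: "\<bar>h x + 1\<bar> \<le> 2" for x using b[of x] by linarith
  have i: "integrable lborel (\<lambda>x. indicator fdom x * (h (x + a) + 1))" for a
    by (rule Bochner_Integration.integrable_bound[OF integrable_mult_right[OF ind, of 2]])
       (measurable, use bb in \<open>auto simp: indicator_def intro!: AE_I2\<close>)
  have i2: "integrable lborel (\<lambda>x. indicator fdom x * h (x + a))" for a
    by (rule Bochner_Integration.integrable_bound[OF ind])
       (use b in \<open>auto simp: indicator_def intro!: AE_I2\<close>)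
  have eq: "(\<integral>x. indicator fdom x * (h (x + a) + 1) \<partial>lborel) = (\<integral>x. indicator fdom x * h (x + a) \<partial>lborel) + (\<integral>x. indicat_real fdom x \<partial>lborel)" for a
    using Bochner_Integration.integral_add[OF i2[of a] ind] by (simp add: distrib_left)
  have nn: "ennreal (\<integral>x. indicator fdom x * (h (x + a) + 1) \<partial>lborel) = (\<integral>\<^sup>+x. ennreal (h (x + a) + 1) * indicator fdom x \<partial>lborel)" for a
  proof -
    have h1: "0 \<le> h (x + a) + 1" for x using b[of "x + a"] by (simp add: abs_le_iff)
    have "(\<integral>\<^sup>+x. ennreal (indicator fdom x * (h (x + a) + 1)) \<partial>lborel) = ennreal (\<integral>x. indicator fdom x * (h (x + a) + 1) \<partial>lborel)"
      by (rule nn_integral_eq_integral[OF i]) (use h1 in \<open>auto intro!: AE_I2\<close>)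
    moreover have "ennreal (indicator fdom x * (h (x + a) + 1)) = ennreal (h (x + a) + 1) * indicator fdom x" for x
      using h1 by (auto simp: indicator_def)
    ultimately show ?thesis by simp
  qed
  have E: "ennreal (\<integral>x. indicator fdom x * (h (x + a) + 1) \<partial>lborel) = ennreal (\<integral>x. indicator fdom x * (h (x + 0) + 1) \<partial>lborel)"
    unfolding nn using periodic_shift[OF e, of "\<lambda>x. ennreal (h x + 1)" a] per by simp
  have N: "0 \<le> (\<integral>x. indicator fdom x * (h (x + a) + 1) \<partial>lborel)" for a
  proof (intro integral_nonneg_AE AE_I2)
    fix x
    have "0 \<le> h (x + a) + 1" using b[of "x + a"] by linarith
    then show "0 \<le> indicator fdom x * (h (x + a) + 1)" by (simp add: indicator_def)
  qed
  have "(\<integral>x. indicator fdom x * (h (x + a) + 1) \<partial>lborel) = (\<integral>x. indicator fdom x * (h (x + 0) + 1) \<partial>lborel)"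
    by (rule ennreal_inj[THEN iffD1, OF N N E])
  then show ?thesis unfolding eq by simp
qed

text \<open>Shifting by half a period in a coordinate where k is nonzero changes the sign of the
  character but not its integral.\<close>

lemma chi_integral:
  assumes k: "k \<in> intvec"
  shows "(\<integral>x. indicator fdom x * chi k x \<partial>lborel) = (if k = 0 then of_real vol else 0)"
proof (cases "k = 0")
  case True
  have "(\<integral>x. complex_of_real (indicat_real fdom x) \<partial>lborel) = of_real vol"
    unfolding integral_complex_of_real vol_def by simp
  then show ?thesis using True by (simp add: of_real_indicator)
next
  case False
  then obtain i where i: "k $ i \<noteq> 0" by (auto simp: vec_eq_iff)
  define a where "a = inv L (axis i (1 / (2 * k $ i)))"
  have "2 * pi * (k \<bullet> L a) = pi" using i by (simp add: a_def L_inv inner_axis)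
  then have "chi k a = cis pi" unfolding chi_def by (rule arg_cong)
  then have ca: "chi k a = -1" by simp
  have int: "integrable lborel (\<lambda>x. indicator fdom x * chi k (x + b))" for b
    by (rule fdom_integrable[where B=1]) auto
  let ?I = "\<lambda>b. \<integral>x. indicator fdom x * chi k (x + b) \<partial>lborel"
  have R: "Re (?I b) = (\<integral>x. indicator fdom x * Re (chi k (x + b)) \<partial>lborel)" for b
    by (subst integral_Re[OF int, symmetric]) (auto intro!: Bochner_Integration.integral_cong simp: indicator_def)
  have I: "Im (?I b) = (\<integral>x. indicator fdom x * Im (chi k (x + b)) \<partial>lborel)" for b
    by (subst integral_Im[OF int, symmetric]) (auto intro!: Bochner_Integration.integral_cong simp: indicator_def)
  have "Re (?I a) = Re (?I 0)"
    unfolding R using integral_fdom_shift[of "\<lambda>x. Re (chi k x)" a] abs_Re_le_cmod[of "chi k x" for x]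
    by (simp add: chi_add chi_lat[OF k])
  moreover have "Im (?I a) = Im (?I 0)"
    unfolding I using integral_fdom_shift[of "\<lambda>x. Im (chi k x)" a] abs_Im_le_cmod[of "chi k x" for x]
    by (simp add: chi_add chi_lat[OF k])
  ultimately have "?I a = ?I 0" by (simp add: complex_eq_iff)
  moreover have "?I a = - ?I 0" by (simp add: chi_add ca)
  ultimately show ?thesis using False by simp
qed

end

context lattice_coords
begin

lemma norm_fdom: "\<exists>R>0. \<forall>x\<in>fdom. norm x \<le> R"
  using fdom_bound fdom_abs by metis

lemma continuous_bounded_fdom:
  fixes h :: "'a \<Rightarrow> complex"
  assumes "continuous_on UNIV h"
  shows "\<exists>B>0. \<forall>x\<in>fdom. cmod (h x) \<le> B"
proof -
  obtain R where R: "R > 0" "\<forall>x\<in>fdom. norm x \<le> R" using norm_fdom by blast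
  have "compact (h ` cball 0 R)"
    by (rule compact_continuous_image[OF continuous_on_subset[OF assms subset_UNIV] compact_cball])
  then have "bounded (h ` cball 0 R)" by (rule compact_imp_bounded)
  then obtain B where B: "B > 0" "\<forall>y\<in>h ` cball 0 R. norm y \<le> B" unfolding bounded_pos by blast
  then show ?thesis using R(2) by (intro exI[of _ B]) auto
qed

lemma continuous_integrable_fdom:
  fixes h :: "'a \<Rightarrow> complex"
  assumes "continuous_on UNIV h"
  shows "integrable lborel (\<lambda>x. indicator fdom x * h x)"
proof -
  obtain B where "\<forall>x\<in>fdom. cmod (h x) \<le> B" using continuous_bounded_fdom[OF assms] by blast
  then show ?thesis using fdom_integrable[OF borel_measurable_continuous_onI[OF assms], of B] by blast
qed

section \<open>Uniqueness of Fourier coefficients\<close>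

definition fejer :: "'a \<Rightarrow> real" where
  "fejer x = (\<Prod>i\<in>UNIV. (1 + cos (2 * pi * L x $ i)) / 2)"

lemma fejer_cont: "continuous_on S fejer"
  unfolding fejer_def[abs_def] by (intro continuous_intros continuous_on_compose2[OF L_cont[of UNIV]]) auto

lemma fejer_factor: "0 \<le> (1 + cos t) / 2" "(1 + cos t) / 2 \<le> (1::real)"
proof -
  have c: "0 \<le> (1 + c) / 2 \<and> (1 + c) / 2 \<le> 1" if "- 1 \<le> c" "c \<le> 1" for c :: real
    using that by auto
  show "0 \<le> (1 + cos t) / 2" "(1 + cos t) / 2 \<le> (1::real)"
    using c[OF cos_ge_minus_one cos_le_one] by blast+
qed

lemma fejer_range: "0 \<le> fejer x" "fejer x \<le> 1"
  unfolding fejer_def by (intro prod_nonneg prod_le_1 conjI fejer_factor)+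

lemma fejer_0: "fejer 0 = 1" by (simp add: fejer_def L_0)

text \<open>A product of factors in [0, 1] is 1 only if each factor is. Every coordinate is then an
  integer of modulus at most 1/2.\<close>

lemma fejer_eq_1:
  assumes "fejer x = 1" "\<And>i. \<bar>L x $ i\<bar> \<le> 1/2"
  shows "x = 0"
proof -
  have "L x $ i = 0" for i
  proof -
    have "fejer x = (1 + cos (2 * pi * L x $ i)) / 2 * (\<Prod>i\<in>UNIV - {i}. (1 + cos (2 * pi * L x $ i)) / 2)"
      unfolding fejer_def by (rule prod.remove) auto
    also have "\<dots> \<le> (1 + cos (2 * pi * L x $ i)) / 2 * 1"
      by (intro mult_left_mono prod_le_1 conjI fejer_factor)
    finally have "cos (2 * pi * L x $ i) = 1" using assms(1) cos_le_one[of "2 * pi * L x $ i"] by simp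
    then obtain n :: int where n: "2 * pi * L x $ i = of_int n * 2 * pi"
      using cos_one_2pi_int by blast
    then have "L x $ i = of_int n" by simp
    then show ?thesis using assms(2)[of i] by simp
  qed
  then have "L x = L 0" by (simp add: vec_eq_iff L_0)
  then show ?thesis by (metis L_inv(2))
qed

lemma fejer_factor_chi: "complex_of_real ((1 + cos (2 * pi * L x $ i)) / 2) = 1/2 + chi (axis i 1) x / 4 + chi (- axis i 1) x / 4"
  by (simp add: chi_def inner_axis' complex_eq_iff)

text \<open>The continuous g for which all coefficients of P g vanish form a set stable under
  multiplication by each cosine factor: such a factor combines three characters and only moves the
  index k.\<close>

lemma fourier_zero_fejer:
  assumes P: "continuous_on UNIV P" and z: "\<And>k. k \<in> intvec \<Longrightarrow> (\<integral>x. indicator fdom x * (P x * chi k x) \<partial>lborel) = 0"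
  shows "(\<integral>x. indicator fdom x * (P x * of_real (fejer x ^ N)) \<partial>lborel) = 0"
proof -
  define V where "V = {g::'a \<Rightarrow> complex. continuous_on UNIV g \<and> (\<forall>k\<in>intvec. (\<integral>x. indicator fdom x * (P x * g x * chi k x) \<partial>lborel) = 0)}"
  have step: "(\<lambda>x. complex_of_real ((1 + cos (2 * pi * L x $ i)) / 2) * g x) \<in> V" if g: "g \<in> V" for g i
  proof -
    have gc: "continuous_on UNIV g" and gz: "\<And>k. k \<in> intvec \<Longrightarrow> (\<integral>x. indicator fdom x * (P x * g x * chi k x) \<partial>lborel) = 0"
      using g by (auto simp: V_def)
    have "(\<integral>x. indicator fdom x * (P x * (complex_of_real ((1 + cos (2 * pi * L x $ i)) / 2) * g x) * chi k x) \<partial>lborel) = 0" if k: "k \<in> intvec" for k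
    proof -
      let ?I = "\<lambda>k x. indicator fdom x * (P x * g x * chi k x)"
      have int: "integrable lborel (?I k)" for k
        by (rule continuous_integrable_fdom) (intro continuous_intros P gc chi_cont)
      have "(\<integral>x. indicator fdom x * (P x * (complex_of_real ((1 + cos (2 * pi * L x $ i)) / 2) * g x) * chi k x) \<partial>lborel)
         = (\<integral>x. (1/2 * ?I k x + 1/4 * ?I (axis i 1 + k) x) + 1/4 * ?I (- axis i 1 + k) x \<partial>lborel)"
        unfolding fejer_factor_chi chi_add_left by (intro Bochner_Integration.integral_cong refl) (simp add: algebra_simps)
      also have "\<dots> = (\<integral>x. 1/2 * ?I k x + 1/4 * ?I (axis i 1 + k) x \<partial>lborel) + (\<integral>x. 1/4 * ?I (- axis i 1 + k) x \<partial>lborel)"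
        by (intro Bochner_Integration.integral_add Bochner_Integration.integrable_add integrable_mult_right int)
      also have "(\<integral>x. 1/2 * ?I k x + 1/4 * ?I (axis i 1 + k) x \<partial>lborel) = (\<integral>x. 1/2 * ?I k x \<partial>lborel) + (\<integral>x. 1/4 * ?I (axis i 1 + k) x \<partial>lborel)"
        by (intro Bochner_Integration.integral_add integrable_mult_right int)
      also have "(\<integral>x. 1/2 * ?I k x \<partial>lborel) + (\<integral>x. 1/4 * ?I (axis i 1 + k) x \<partial>lborel) + (\<integral>x. 1/4 * ?I (- axis i 1 + k) x \<partial>lborel) = 0"
        unfolding integral_mult_right_zero gz[OF k] gz[OF intvec_add[OF intvec_axis k]] gz[OF intvec_add[OF intvec_minus[OF intvec_axis] k]] by simp
      finally show ?thesis .
    qed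
    moreover have "continuous_on UNIV (\<lambda>x. complex_of_real ((1 + cos (2 * pi * L x $ i)) / 2) * g x)"
      by (intro continuous_intros gc continuous_on_compose2[OF L_cont[of UNIV]]) auto
    ultimately show ?thesis by (simp add: V_def)
  qed
  have one: "(\<lambda>x. 1) \<in> V" using z by (simp add: V_def)
  have prodV: "(\<lambda>x. complex_of_real (\<Prod>i\<in>S. (1 + cos (2 * pi * L x $ i)) / 2) * g x) \<in> V" if "finite S" "g \<in> V" for S g
    using that
  proof (induction S)
    case (insert i S)
    have "(\<lambda>x. complex_of_real ((1 + cos (2 * pi * L x $ i)) / 2) * (complex_of_real (\<Prod>i\<in>S. (1 + cos (2 * pi * L x $ i)) / 2) * g x)) \<in> V"
      by (rule step) (use insert in blast)
    then show ?case using insert(1,2) by (simp only: prod.insert of_real_mult mult.assoc not_False_eq_True)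
  qed simp
  have "(\<lambda>x. complex_of_real (fejer x ^ N)) \<in> V"
  proof (induction N)
    case (Suc N)
    then show ?case using prodV[of UNIV "\<lambda>x. complex_of_real (fejer x ^ N)"] by (simp add: fejer_def)
  qed (use one in simp)
  then have "\<forall>k\<in>intvec. (\<integral>x. indicator fdom x * (P x * complex_of_real (fejer x ^ N) * chi k x) \<partial>lborel) = 0"
    unfolding V_def mem_Collect_eq by (rule conjunct2)
  then have "(\<integral>x. indicator fdom x * (P x * complex_of_real (fejer x ^ N) * chi 0 x) \<partial>lborel) = 0"
    by (rule bspec) (simp add: intvec_def)
  then show ?thesis by (simp only: chi_0 mult_1_right)
qed

text \<open>Powers of the product of the $(1 + \cos)/2$ concentrate at the lattice points, and they are
  trigonometric polynomials.\<close>

lemma fourier_unique_0: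
  assumes P: "continuous_on UNIV P" and z: "\<And>k. k \<in> intvec \<Longrightarrow> (\<integral>x. indicator fdom x * (P x * chi k x) \<partial>lborel) = 0"
  shows "P 0 = 0"
proof (rule ccontr)
  assume "P 0 \<noteq> 0"
  \<comment> \<open>Rotated by the conjugate of \<open>P 0\<close>, so that the value at 0 is
    positive; \<eta> is half of that value.\<close>
  define R where "R x = Re (cnj (P 0) * P x)" for x
  define \<eta> where "\<eta> = (cmod (P 0))\<^sup>2 / 2"
  have eta: "\<eta> > 0" using \<open>P 0 \<noteq> 0\<close> by (simp add: \<eta>_def)
  have R0: "R 0 = 2 * \<eta>" unfolding R_def \<eta>_def cmod_power2 by (simp add: power2_eq_square)
  have Rc: "continuous_on UNIV R" unfolding R_def[abs_def] by (intro continuous_intros P)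
  have RI: "(\<integral>x. indicator fdom x * (R x * fejer x ^ N) \<partial>lborel) = 0"
    and Rint: "integrable lborel (\<lambda>x. indicator fdom x * (R x * fejer x ^ N))" for N
  proof -
    have eq: "indicator fdom x * (R x * fejer x ^ N) = Re (cnj (P 0) * (indicator fdom x * (P x * of_real (fejer x ^ N))))" for x
      by (simp add: R_def indicator_def algebra_simps)
    have i: "integrable lborel (\<lambda>x. cnj (P 0) * (indicator fdom x * (P x * of_real (fejer x ^ N))))"
      by (intro integrable_mult_right continuous_integrable_fdom continuous_intros P fejer_cont)
    show "integrable lborel (\<lambda>x. indicator fdom x * (R x * fejer x ^ N))"
      unfolding eq by (rule integrable_Re[OF i])
    show "(\<integral>x. indicator fdom x * (R x * fejer x ^ N) \<partial>lborel) = 0"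
    proof -
      have "(\<integral>x. cnj (P 0) * (indicator fdom x * (P x * of_real (fejer x ^ N))) \<partial>lborel) = cnj (P 0) * 0"
        unfolding integral_mult_right_zero by (rule arg_cong[OF fourier_zero_fejer[OF P z]])
      then have "Re (\<integral>x. cnj (P 0) * (indicator fdom x * (P x * of_real (fejer x ^ N))) \<partial>lborel) = Re (cnj (P 0) * 0)"
        by (rule arg_cong)
      then show ?thesis unfolding eq integral_Re[OF i] by (simp only: mult_zero_right zero_complex.sel)
    qed
  qed
  obtain d1 where d1: "d1 > 0" "\<And>x. norm x < d1 \<Longrightarrow> R x \<ge> \<eta>"
  proof -
    have "isCont R 0" using Rc by (simp add: continuous_on_eq_continuous_at)
    then obtain d where "d > 0" "\<And>x. dist x 0 < d \<Longrightarrow> dist (R x) (R 0) < \<eta>"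
      using eta unfolding continuous_at_eps_delta by blast
    then show thesis using that[of d] R0 by (force simp: dist_real_def abs_less_iff)
  qed
  \<comment> \<open>The closed box minus a ball around 0: compact, and free of the only point of the
    box at which \<open>fejer\<close> equals 1.\<close>
  define S where "S = {x. \<forall>i. \<bar>L x $ i\<bar> \<le> 1/2} \<inter> - ball 0 d1"
  have Sc: "compact S"
  proof -
    have "closed {x. \<bar>L x $ i\<bar> \<le> 1/2}" for i
      by (intro closed_Collect_le continuous_intros continuous_on_compose2[OF L_cont[of UNIV]]) auto
    then have "closed S" unfolding S_def by (intro closed_Int closed_Collect_all) auto
    moreover obtain B where "\<forall>x. (\<forall>i. \<bar>L x $ i\<bar> \<le> 1/2) \<longrightarrow> norm x \<le> B" using fdom_bound by blast
    then have "bounded S" unfolding bounded_iff S_def by blast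
    ultimately show ?thesis by (simp add: compact_eq_bounded_closed)
  qed
  obtain \<rho> where rho: "0 \<le> \<rho>" "\<rho> < 1" "\<And>x. x \<in> S \<Longrightarrow> fejer x \<le> \<rho>"
  proof (cases "S = {}")
    case False
    obtain y where y: "y \<in> S" "\<forall>x\<in>S. fejer x \<le> fejer y"
      using continuous_attains_sup[OF Sc False fejer_cont] by blast
    have "fejer y \<noteq> 1" using fejer_eq_1[of y] y(1) d1(1) by (auto simp: S_def)
    then have "fejer y < 1" using fejer_range(2)[of y] by simp
    then show thesis using that[of "fejer y"] y(2) fejer_range(1) by blast
  qed (use that[of 0] in auto)
  \<comment> \<open>Chosen strictly between \<rho> and 1. Near 0 the N-th power of
    \<open>fejer\<close> stays above the N-th power of \<rho>', on S it stays below that of \<rho>;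
    for large N the positive contribution near 0 outweighs everything else.\<close>
  define \<rho>' where "\<rho>' = (1 + \<rho>) / 2"
  have rho': "0 < \<rho>'" "\<rho> < \<rho>'" "\<rho>' < 1" using rho by (auto simp: \<rho>'_def)
  obtain r where r: "r > 0" "ball 0 r \<subseteq> fdom" by (rule fdom_ball)
  obtain d2 where d2: "d2 > 0" "\<And>x. norm x < d2 \<Longrightarrow> fejer x \<ge> \<rho>'"
  proof -
    have "isCont fejer 0" using fejer_cont[of UNIV] by (simp add: continuous_on_eq_continuous_at)
    moreover have "1 - \<rho>' > 0" using rho' by simp
    ultimately obtain d where "d > 0" "\<And>x. dist x 0 < d \<Longrightarrow> dist (fejer x) (fejer 0) < 1 - \<rho>'"
      unfolding continuous_at_eps_delta by blast
    then show thesis using that[of d] fejer_0 by (force simp: dist_real_def abs_less_iff)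
  qed
  define \<delta> where "\<delta> = min (min d1 d2) r"
  have delta: "\<delta> > 0" using d1(1) d2(1) r(1) by (simp add: \<delta>_def)
  obtain M where M: "M > 0" "\<And>x. x \<in> fdom \<Longrightarrow> \<bar>R x\<bar> \<le> M"
    using continuous_bounded_fdom[of "\<lambda>x. complex_of_real (R x)"] Rc by (auto intro!: continuous_intros)
  have ptw: "\<eta> * \<rho>' ^ N * indicator (ball 0 \<delta>) x - M * \<rho> ^ N * indicator fdom x \<le> indicator fdom x * (R x * fejer x ^ N)" for x N
  proof (cases "x \<in> fdom")
    case False
    then have "x \<notin> ball 0 \<delta>" using r(2) by (auto simp: \<delta>_def)
    then show ?thesis using False by simp
  next
    case True
    show ?thesis
    proof (cases "norm x < d1")
      case n1: True
      have R: "R x \<ge> \<eta>" by (rule d1(2)[OF n1])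
      have "\<eta> * \<rho>' ^ N * indicator (ball 0 \<delta>) x \<le> R x * fejer x ^ N"
      proof (cases "x \<in> ball 0 \<delta>")
        case True
        then have "fejer x \<ge> \<rho>'" using d2(2)[of x] by (simp add: \<delta>_def)
        then have "\<eta> * \<rho>' ^ N \<le> R x * fejer x ^ N"
          using R eta rho' by (intro mult_mono power_mono) auto
        then show ?thesis using True by simp
      qed (use R eta fejer_range(1)[of x] in auto)
      moreover have "0 \<le> M * \<rho> ^ N" using M(1) rho(1) by simp
      ultimately show ?thesis using True by simp
    next
      case False
      then have "x \<in> S" using True fdom_abs by (auto simp: S_def)
      then have "fejer x ^ N \<le> \<rho> ^ N" using rho(3) fejer_range(1) by (intro power_mono) auto
      then have "\<bar>R x\<bar> * fejer x ^ N \<le> M * \<rho> ^ N"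
        using M(2)[OF True] M(1) fejer_range(1)[of x] by (intro mult_mono) auto
      moreover have "- (\<bar>R x\<bar> * fejer x ^ N) \<le> R x * fejer x ^ N"
        using mult_right_mono[of "- \<bar>R x\<bar>" "R x" "fejer x ^ N"] fejer_range(1)[of x] by simp
      moreover have "x \<notin> ball 0 \<delta>" using False by (auto simp: \<delta>_def)
      ultimately show ?thesis using True by simp
    qed
  qed
  have vb: "emeasure lborel (ball (0::'a) \<delta>) < \<infinity>" by (rule emeasure_bounded_finite) simp
  define b where "b = measure lborel (ball (0::'a) \<delta>)"
  have b: "b > 0" unfolding b_def by (rule content_ball_pos[OF delta])
  have main: "\<eta> * \<rho>' ^ N * b \<le> M * \<rho> ^ N * vol" for N
  proof -
    have i1: "integrable lborel (\<lambda>x. \<eta> * \<rho>' ^ N * indicat_real (ball (0::'a) \<delta>) x)"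
      using vb by (intro integrable_mult_right) (simp add: integrable_indicator_iff)
    have i2: "integrable lborel (\<lambda>x. M * \<rho> ^ N * indicat_real fdom x)"
      using emeasure_fdom(1) by (intro integrable_mult_right) (simp add: integrable_indicator_iff)
    have "(\<integral>x. \<eta> * \<rho>' ^ N * indicat_real (ball (0::'a) \<delta>) x - M * \<rho> ^ N * indicat_real fdom x \<partial>lborel) \<le> (\<integral>x. indicator fdom x * (R x * fejer x ^ N) \<partial>lborel)"
      by (intro Bochner_Integration.integral_mono Bochner_Integration.integrable_diff i1 i2 Rint ptw)
    then show ?thesis
      unfolding RI Bochner_Integration.integral_diff[OF i1 i2] by (simp add: b_def vol_def)
  qed
  have "(\<lambda>N. (\<rho> / \<rho>') ^ N * (M * vol)) \<longlonglongrightarrow> 0 * (M * vol)"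
    using rho rho' by (intro tendsto_mult LIMSEQ_realpow_zero tendsto_const) auto
  then have "\<forall>\<^sub>F N in sequentially. (\<rho> / \<rho>') ^ N * (M * vol) < \<eta> * b"
    using eta b by (intro order_tendstoD(2)) auto
  then obtain N where "(\<rho> / \<rho>') ^ N * (M * vol) < \<eta> * b"
    unfolding eventually_sequentially by blast
  then have "\<rho>' ^ N * ((\<rho> / \<rho>') ^ N * (M * vol)) < \<rho>' ^ N * (\<eta> * b)"
    using rho' by (intro mult_strict_left_mono) auto
  moreover have "\<rho>' ^ N * (\<rho> / \<rho>') ^ N = \<rho> ^ N" using rho' by (simp add: power_divide)
  ultimately have "\<rho> ^ N * (M * vol) < \<rho>' ^ N * (\<eta> * b)" by (metis mult.assoc)
  then show False using main[of N] by (simp add: mult_ac)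
qed

section \<open>Termwise integration and Poisson summation\<close>

lemma integral_fdom_suminf:
  fixes f :: "nat \<Rightarrow> 'a \<Rightarrow> complex"
  assumes f: "\<And>n. continuous_on UNIV (f n)" and b: "\<And>n x. x \<in> fdom \<Longrightarrow> cmod (f n x) \<le> b n" and s: "summable b"
  shows "(\<integral>x. indicator fdom x * (\<Sum>n. f n x) \<partial>lborel) = (\<Sum>n. \<integral>x. indicator fdom x * f n x \<partial>lborel)"
    and "summable (\<lambda>n. \<integral>x. indicator fdom x * f n x \<partial>lborel)"
proof -
  have ind: "integrable lborel (indicat_real fdom)" using emeasure_fdom(1) by (simp add: integrable_indicator_iff)
  have b0: "0 \<le> b n" for n
  proof -
    obtain r where "r > 0" "ball 0 r \<subseteq> fdom" by (rule fdom_ball)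
    then have "0 \<in> fdom" by (auto simp: subset_iff)
    then show ?thesis using b[of 0 n] norm_ge_zero order_trans by blast
  qed
  have i: "integrable lborel (\<lambda>x. indicator fdom x * f n x)" for n
    by (rule continuous_integrable_fdom[OF f])
  have le: "cmod (indicator fdom x * f n x) \<le> b n * indicat_real fdom x" for n x
    using b[of x n] by (auto simp: indicator_def)
  have s1: "summable (\<lambda>n. cmod (indicator fdom x * f n x))" for x
  proof (rule summable_comparison_test[OF _ s], intro exI allI impI)
    fix n show "norm (cmod (indicator fdom x * f n x)) \<le> b n"
      using le[of x n] b0[of n] by (auto simp: indicator_def)
  qed
  have s2: "summable (\<lambda>n. \<integral>x. cmod (indicator fdom x * f n x) \<partial>lborel)"
  proof (rule summable_comparison_test[OF _ summable_mult2[OF s, of vol]], intro exI allI impI)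
    fix n
    have "(\<integral>x. cmod (indicator fdom x * f n x) \<partial>lborel) \<le> (\<integral>x. b n * indicat_real fdom x \<partial>lborel)"
      by (intro Bochner_Integration.integral_mono integrable_norm i integrable_mult_right ind le)
    then show "norm (\<integral>x. cmod (indicator fdom x * f n x) \<partial>lborel) \<le> b n * vol"
      by (simp add: vol_def integral_nonneg_AE)
  qed
  have e: "(\<Sum>n. indicator fdom x * f n x) = indicator fdom x * (\<Sum>n. f n x)" for x
    by (simp add: indicator_def)
  show "(\<integral>x. indicator fdom x * (\<Sum>n. f n x) \<partial>lborel) = (\<Sum>n. \<integral>x. indicator fdom x * f n x \<partial>lborel)"
    unfolding e[symmetric] by (rule integral_suminf[OF i AE_I2[OF s1] s2])
  show "summable (\<lambda>n. \<integral>x. indicator fdom x * f n x \<partial>lborel)"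
    by (rule summable_norm_cancel, rule summable_comparison_test[OF _ s2])
       (auto intro!: exI[of _ 0] Bochner_Integration.integral_norm_bound)
qed

text \<open>At every point only one term of the series is nonzero, so the partial sums of the norms
  are bounded by |f|, and this justifies integration term by term.\<close>

lemma tiling_complex:
  fixes f :: "'a \<Rightarrow> complex"
  assumes f: "integrable lborel f" and e: "bij_betw e (UNIV::nat set) lat"
  shows "(\<integral>x. f x \<partial>lborel) = (\<Sum>n. \<integral>x. indicator fdom x * f (x + e n) \<partial>lborel)"
proof -
  note [measurable] = borel_measurable_integrable[OF f]
  let ?g = "\<lambda>n x. indicator fdom (x - e n) * f x"
  have i: "integrable lborel (?g n)" for n
    by (rule Bochner_Integration.integrable_bound[OF f]) (auto simp: indicator_def)
  have fin: "finite {n. x - e n \<in> fdom}" and card: "\<exists>m. {n. x - e n \<in> fdom} = {m}" for x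
  proof -
    show "\<exists>m. {n. x - e n \<in> fdom} = {m}" using ex1_minus[OF e, of x] by blast
    then show "finite {n. x - e n \<in> fdom}" by (metis finite.emptyI finite_insert)
  qed
  have s1: "summable (\<lambda>n. norm (?g n x))" for x
    by (rule summable_finite[OF fin[of x]]) (auto simp: indicator_def)
  have eqf: "(\<Sum>n. ?g n x) = f x" for x
  proof -
    obtain m where m: "{n. x - e n \<in> fdom} = {m}" using card by blast
    have "(\<Sum>n. ?g n x) = (\<Sum>n\<in>{n. x - e n \<in> fdom}. ?g n x)"
      by (rule suminf_finite[OF fin]) (auto simp: indicator_def)
    also have "\<dots> = f x" unfolding m using m by (auto simp: indicator_def)
    finally show ?thesis .
  qed
  have s2: "summable (\<lambda>n. \<integral>x. norm (?g n x) \<partial>lborel)"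
  proof (rule summableI_nonneg_bounded[where x="\<integral>x. cmod (f x) \<partial>lborel"])
    fix N
    have "(\<Sum>n<N. \<integral>x. norm (?g n x) \<partial>lborel) = (\<integral>x. (\<Sum>n<N. norm (?g n x)) \<partial>lborel)"
      by (rule Bochner_Integration.integral_sum[symmetric]) (intro integrable_norm i)
    also have "\<dots> \<le> (\<integral>x. cmod (f x) \<partial>lborel)"
    proof (intro Bochner_Integration.integral_mono Bochner_Integration.integrable_sum integrable_norm i f)
      fix x
      obtain m where m: "{n. x - e n \<in> fdom} = {m}" using card by blast
      have "norm (?g n x) = (if n = m then cmod (f x) else 0)" for n
        using m by (auto simp: indicator_def)
      then show "(\<Sum>n<N. norm (?g n x)) \<le> cmod (f x)" by simp
    qed
    finally show "(\<Sum>n<N. \<integral>x. norm (?g n x) \<partial>lborel) \<le> (\<integral>x. cmod (f x) \<partial>lborel)" .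
  qed (simp add: integral_nonneg_AE)
  have "(\<integral>x. f x \<partial>lborel) = (\<integral>x. (\<Sum>n. ?g n x) \<partial>lborel)" unfolding eqf ..
  also have "\<dots> = (\<Sum>n. \<integral>x. ?g n x \<partial>lborel)"
    by (rule integral_suminf[OF i AE_I2[OF s1] s2])
  also have "\<dots> = (\<Sum>n. \<integral>x. indicator fdom x * f (x + e n) \<partial>lborel)"
  proof (rule suminf_cong)
    fix n
    have "(\<integral>x. indicator fdom (x + e n - e n) * f (x + e n) \<partial>lborel) = (\<integral>x. ?g n x \<partial>lborel)"
      by (rule integral_lborel_translate[where f="?g n"]) measurable
    then show "(\<integral>x. ?g n x \<partial>lborel) = (\<integral>x. indicator fdom x * f (x + e n) \<partial>lborel)" by simp
  qed
  finally show ?thesis .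
qed

text \<open>Compares two continuous functions: the periodisation A of p and the series B formed from
  its Fourier coefficients. Their coefficients agree up to the volume, hence so do their values at
  0. Summability of the coefficients is a hypothesis; in the application it comes from the Gaussian
  decay of shifted kernels.\<close>

theorem poisson:
  fixes p :: "'a \<Rightarrow> complex"
  assumes e: "bij_betw e (UNIV::nat set) lat" and k: "bij_betw k (UNIV::nat set) (intvec :: (real^'m) set)"
    and pc: "continuous_on UNIV p" and eps: "\<epsilon> > 0" and pb: "\<And>x. cmod (p x) \<le> C * exp (- \<epsilon> * (norm x)\<^sup>2)"
    and s: "summable (\<lambda>n. cmod (\<integral>x. p x * chi (- k n) x \<partial>lborel))"
  shows "of_real vol * (\<Sum>n. p (e n)) = (\<Sum>n. \<integral>x. p x * chi (- k n) x \<partial>lborel)"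
proof -
  define a where "a n = (\<integral>x. p x * chi (- k n) x \<partial>lborel)" for n
  have sa: "summable (\<lambda>n. cmod (a n))" using s by (simp add: a_def)
  have kint: "k n \<in> intvec" for n using k by (auto simp: bij_betw_def)
  have kinj: "k n = k m \<longleftrightarrow> n = m" for n m using k by (auto simp: bij_betw_def inj_eq)
  have C0: "C \<ge> 0" using pb[of 0] order_trans[OF norm_ge_zero] by fastforce
  have pint: "integrable lborel (\<lambda>x. p x * chi l x)" for l
  proof -
    have "gauss_dom \<epsilon> p" by (rule gauss_domI[where A=C and B=0]) (use pb borel_measurable_continuous_onI[OF pc] in auto)
    from gauss_dom_integrable[OF this eps] show ?thesis
      by (rule Bochner_Integration.integrable_bound)
         (use borel_measurable_continuous_onI[OF pc] in \<open>auto simp: norm_mult\<close>)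
  qed
  obtain G where G: "G > 0" "\<And>w. summable (\<lambda>n. exp (- (\<epsilon>/2) * (norm (w - e n))\<^sup>2))"
    "\<And>w. (\<Sum>n. exp (- (\<epsilon>/2) * (norm (w - e n))\<^sup>2)) \<le> G"
    using gauss_sum[OF e, of "\<epsilon>/2"] eps by (metis half_gt_zero)
  \<comment> \<open>A majorant uniform on balls, at half of the rate, for the Weierstrass test and
    for termwise integration.\<close>
  have dec: "cmod (p (x + e n)) \<le> C * exp (\<epsilon> * r\<^sup>2) * exp (- (\<epsilon>/2) * (norm (0 - e n))\<^sup>2)" if x: "norm x \<le> r" for x r n
  proof -
    have "norm (e n) \<le> norm (x + e n) + norm x" using norm_triangle_ineq4[of "x + e n" x] by simp
    then have "(norm (e n))\<^sup>2 \<le> (norm (x + e n) + norm x)\<^sup>2" by (intro power_mono) auto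
    also have "\<dots> \<le> 2 * (norm (x + e n))\<^sup>2 + 2 * (norm x)\<^sup>2"
      using sum_squares_bound[of "norm (x + e n)" "norm x"] by (simp add: power2_sum)
    also have "\<dots> \<le> 2 * (norm (x + e n))\<^sup>2 + 2 * r\<^sup>2" using x by (simp add: power_mono)
    finally have "(\<epsilon>/2) * (norm (e n))\<^sup>2 \<le> (\<epsilon>/2) * (2 * (norm (x + e n))\<^sup>2 + 2 * r\<^sup>2)"
      using eps by (intro mult_left_mono) auto
    then have "- \<epsilon> * (norm (x + e n))\<^sup>2 \<le> \<epsilon> * r\<^sup>2 + - (\<epsilon>/2) * (norm (0 - e n))\<^sup>2"
      by (simp add: algebra_simps)
    then have "exp (- \<epsilon> * (norm (x + e n))\<^sup>2) \<le> exp (\<epsilon> * r\<^sup>2) * exp (- (\<epsilon>/2) * (norm (0 - e n))\<^sup>2)"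
      unfolding exp_add[symmetric] exp_le_cancel_iff .
    then have "C * exp (- \<epsilon> * (norm (x + e n))\<^sup>2) \<le> C * (exp (\<epsilon> * r\<^sup>2) * exp (- (\<epsilon>/2) * (norm (0 - e n))\<^sup>2))"
      using C0 by (rule mult_left_mono)
    then show ?thesis using pb[of "x + e n"] by (simp only: mult.assoc)
  qed
  have sdec: "summable (\<lambda>n. C * exp (\<epsilon> * r\<^sup>2) * exp (- (\<epsilon>/2) * (norm (0 - e n))\<^sup>2))" for r
    by (intro summable_mult G)
  have pcn: "continuous_on S (\<lambda>x. p (x + e n))" for n S
    by (rule continuous_on_compose2[OF pc]) (auto intro!: continuous_intros)
  define A where "A x = (\<Sum>n. p (x + e n))" for x
  define B where "B x = (\<Sum>n. a n * chi (k n) x)" for x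
  have Ac: "continuous_on UNIV A"
  proof -
    have "continuous_on (ball 0 r) A" for r
      unfolding A_def
    proof (rule uniform_limit_theorem[OF _ Weierstrass_m_test[OF _ sdec[of r]]])
      show "\<forall>\<^sub>F n in sequentially. continuous_on (ball 0 r) (\<lambda>x. \<Sum>i<n. p (x + e i))"
        by (intro always_eventually allI continuous_on_sum pcn)
      show "norm (p (x + e n)) \<le> C * exp (\<epsilon> * r\<^sup>2) * exp (- (\<epsilon>/2) * (norm (0 - e n))\<^sup>2)" if "x \<in> ball 0 r" for n x
        using dec[of x r n] that by simp
    qed simp
    then have "continuous_on (\<Union>r\<in>UNIV. ball 0 r) A" by (intro continuous_on_open_UN) auto
    moreover have "(\<Union>r\<in>UNIV. ball (0::'a) r) = UNIV"
      using lt_ex gt_ex by (auto simp: )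
    ultimately show ?thesis by simp
  qed
  have Bc: "continuous_on UNIV B"
    unfolding B_def
  proof (rule uniform_limit_theorem[OF _ Weierstrass_m_test[OF _ sa]])
    show "\<forall>\<^sub>F n in sequentially. continuous_on UNIV (\<lambda>x. \<Sum>i<n. a i * chi (k i) x)"
      by (intro always_eventually allI continuous_on_sum continuous_on_mult continuous_on_const chi_cont)
    show "norm (a n * chi (k n) x) \<le> cmod (a n)" for n x by (simp add: norm_mult)
  qed simp
  obtain r where r: "r > 0" "\<forall>x\<in>fdom. norm x \<le> r" using norm_fdom by blast
  have IA: "(\<integral>x. indicator fdom x * (A x * chi (- k m) x) \<partial>lborel) = a m" for m
  proof -
    have sm: "summable (\<lambda>n. p (x + e n))" if "x \<in> fdom" for x
      by (rule summable_norm_cancel, rule summable_comparison_test[OF _ sdec[of r]]) (use dec r that in auto)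
    have "(\<integral>x. indicator fdom x * (A x * chi (- k m) x) \<partial>lborel) = (\<integral>x. indicator fdom x * (\<Sum>n. p (x + e n) * chi (- k m) x) \<partial>lborel)"
      by (intro Bochner_Integration.integral_cong refl) (auto simp: A_def indicator_def suminf_mult2[OF sm])
    also have "\<dots> = (\<Sum>n. \<integral>x. indicator fdom x * (p (x + e n) * chi (- k m) x) \<partial>lborel)"
      by (rule integral_fdom_suminf(1)[OF _ _ sdec[of r]])
         (use dec r in \<open>auto intro!: continuous_on_mult pcn chi_cont simp: norm_mult\<close>)
    also have "\<dots> = (\<Sum>n. \<integral>x. indicator fdom x * (p (x + e n) * chi (- k m) (x + e n)) \<partial>lborel)"
      by (simp add: chi_add chi_lat[OF intvec_minus[OF kint] e_lat[OF e]])
    also have "\<dots> = a m" unfolding a_def by (rule tiling_complex[OF pint e, symmetric])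
    finally show ?thesis .
  qed
  have IB: "(\<integral>x. indicator fdom x * (B x * chi (- k m) x) \<partial>lborel) = of_real vol * a m" for m
  proof -
    have sm: "summable (\<lambda>n. a n * chi (k n) x)" for x
      by (rule summable_norm_cancel) (simp add: norm_mult sa)
    have "(\<integral>x. indicator fdom x * (B x * chi (- k m) x) \<partial>lborel) = (\<integral>x. indicator fdom x * (\<Sum>n. a n * chi (k n) x * chi (- k m) x) \<partial>lborel)"
      by (intro Bochner_Integration.integral_cong refl) (simp add: B_def suminf_mult2[OF sm])
    also have "\<dots> = (\<Sum>n. \<integral>x. indicator fdom x * (a n * chi (k n) x * chi (- k m) x) \<partial>lborel)"
      by (rule integral_fdom_suminf(1)[OF _ _ sa])
         (auto intro!: continuous_on_mult continuous_on_const chi_cont simp: norm_mult)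
    also have "\<dots> = (\<Sum>n. if n = m then of_real vol * a n else 0)"
    proof (rule suminf_cong)
      fix n
      have "(\<integral>x. indicator fdom x * (a n * chi (k n) x * chi (- k m) x) \<partial>lborel) = (\<integral>x. a n * (indicator fdom x * chi (k n - k m) x) \<partial>lborel)"
        by (intro Bochner_Integration.integral_cong refl) (simp add: chi_add_left[symmetric] mult_ac)
      also have "\<dots> = a n * (if k n - k m = 0 then of_real vol else 0)"
        by (simp only: integral_mult_right_zero chi_integral[OF intvec_diff[OF kint kint]])
      finally show "(\<integral>x. indicator fdom x * (a n * chi (k n) x * chi (- k m) x) \<partial>lborel) = (if n = m then of_real vol * a n else 0)"
        by (simp add: kinj)
    qed
    also have "\<dots> = (\<Sum>n\<in>{m}. if n = m then of_real vol * a n else 0)" by (rule suminf_finite) auto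
    finally show ?thesis by simp
  qed
  define P where "P x = of_real vol * A x - B x" for x
  have Pc: "continuous_on UNIV P" unfolding P_def[abs_def] by (intro continuous_intros Ac Bc)
  have "(\<integral>x. indicator fdom x * (P x * chi l x) \<partial>lborel) = 0" if l: "l \<in> intvec" for l
  proof -
    obtain m where m: "k m = - l" using intvec_minus[OF l] k by (metis bij_betw_imp_surj_on imageE)
    then have l': "l = - k m" by simp
    have i: "integrable lborel (\<lambda>x. indicator fdom x * (A x * chi l x))" "integrable lborel (\<lambda>x. indicator fdom x * (B x * chi l x))"
      by (intro continuous_integrable_fdom continuous_on_mult Ac Bc chi_cont)+
    have "(\<integral>x. indicator fdom x * (P x * chi l x) \<partial>lborel) = (\<integral>x. of_real vol * (indicator fdom x * (A x * chi l x)) - indicator fdom x * (B x * chi l x) \<partial>lborel)"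
      by (intro Bochner_Integration.integral_cong refl) (simp add: P_def algebra_simps)
    also have "\<dots> = (\<integral>x. of_real vol * (indicator fdom x * (A x * chi l x)) \<partial>lborel) - (\<integral>x. indicator fdom x * (B x * chi l x) \<partial>lborel)"
      by (rule Bochner_Integration.integral_diff[OF integrable_mult_right[OF i(1)] i(2)])
    also have "\<dots> = 0" unfolding integral_mult_right_zero unfolding l' IA IB by simp
    finally show ?thesis .
  qed
  from fourier_unique_0[OF Pc this] have "P 0 = 0" .
  then show ?thesis by (simp add: P_def A_def B_def a_def)
qed

end

section \<open>Homogeneous components\<close>

text \<open>Cauchy's estimate on the unit disc of the complex line through z in the direction of
  h.\<close>

lemma entire_gradient_bound:
  assumes F: "entire_fun F" and c: "(F has_derivative (\<lambda>h. \<Sum>j\<in>UNIV. c $ j * h $ j)) (at z)"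
    and M: "\<And>w. w \<in> cball z 1 \<Longrightarrow> cmod (F w) \<le> M"
  shows "cmod (\<Sum>j\<in>UNIV. c $ j * h $ j) \<le> M * norm h"
proof (cases "h = 0")
  case False
  define b where "b = complex_of_real (1 / norm h) *s h"
  have nb: "norm b = 1" using False by (simp add: b_def norm_scale norm_divide)
  have c': "(F has_derivative (\<lambda>h. \<Sum>j\<in>UNIV. c $ j * h $ j)) (at (z + 0 *s b))"
    using c by simp
  from has_derivative_compose[OF has_derivative_line c']
  have "((\<lambda>t. F (z + t *s b)) has_derivative (\<lambda>t. (\<Sum>j\<in>UNIV. c $ j * b $ j) * t)) (at 0)"
    by (simp add: sum_distrib_right sum_distrib_left mult_ac)
  then have "((\<lambda>t. F (z + t *s b)) has_field_derivative (\<Sum>j\<in>UNIV. c $ j * b $ j)) (at 0)"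
    unfolding has_field_derivative_def .
  then have d: "deriv (\<lambda>t. F (z + t *s b)) 0 = (\<Sum>j\<in>UNIV. c $ j * b $ j)" by (rule DERIV_imp_deriv)
  have hol: "(\<lambda>t. F (z + t *s b)) holomorphic_on S" for S by (rule entire_on_line[OF F])
  have "cmod ((deriv ^^ 1) (\<lambda>t. F (z + t *s b)) 0) \<le> fact 1 * M / 1 ^ 1"
  proof (rule Cauchy_inequality)
    show "continuous_on (cball 0 1) (\<lambda>t. F (z + t *s b))" by (rule holomorphic_on_imp_continuous_on[OF hol])
    fix x :: complex assume "cmod (0 - x) = 1"
    then show "cmod (F (z + x *s b)) \<le> M" by (intro M) (simp add: dist_norm norm_scale nb)
  qed (use hol in auto)
  then have le: "cmod (\<Sum>j\<in>UNIV. c $ j * b $ j) \<le> M" by (simp add: d)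
  have eq: "(\<Sum>j\<in>UNIV. c $ j * h $ j) = (\<Sum>j\<in>UNIV. c $ j * b $ j) * of_real (norm h)"
    using False by (simp add: b_def sum_distrib_right)
  show ?thesis unfolding eq norm_mult using mult_right_mono[OF le norm_ge_zero[of h]] by simp
qed simp

text \<open>Cauchy estimates make the derivatives uniformly Cauchy near each point. Working with the
  coefficient vectors of the derivatives keeps complex linearity in the limit.\<close>

lemma entire_limit:
  fixes F :: "nat \<Rightarrow> complex^'d::finite \<Rightarrow> complex"
  assumes F: "\<And>n. entire_fun (F n)"
    and lim: "\<And>R e. e > 0 \<Longrightarrow> \<exists>N. \<forall>n\<ge>N. \<forall>z. norm z \<le> R \<longrightarrow> cmod (F n z - f z) \<le> e"
  shows "entire_fun f"
  unfolding entire_fun_def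
proof
  fix z0 :: "complex^'d"
  have "\<forall>n z. \<exists>c. (F n has_derivative (\<lambda>h. \<Sum>j\<in>UNIV. c $ j * h $ j)) (at z)"
    using F by (simp add: entire_fun_def)
  then obtain c where c: "\<And>n z. (F n has_derivative (\<lambda>h. \<Sum>j\<in>UNIV. c n z $ j * h $ j)) (at z)"
    by metis
  define S where "S = ball z0 1"
  \<comment> \<open>Large enough to contain the unit balls around all points of S, on which Cauchy's
    estimate is applied.\<close>
  define R where "R = norm z0 + 2"
  have cb: "norm w \<le> R" if "z \<in> S" "w \<in> cball z 1" for z w
  proof -
    have "norm w \<le> norm z0 + dist z0 z + dist z w"
      using norm_triangle_ineq4[of z "z - w"] norm_triangle_ineq4[of z0 "z0 - z"] by (simp add: dist_norm)
    then show ?thesis using that by (simp add: S_def R_def)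
  qed
  have cau: "\<exists>N. \<forall>n\<ge>N. \<forall>m\<ge>N. \<forall>z\<in>S. \<forall>h. cmod ((\<Sum>j\<in>UNIV. c n z $ j * h $ j) - (\<Sum>j\<in>UNIV. c m z $ j * h $ j)) \<le> e * norm h" if e: "e > 0" for e
  proof -
    obtain N where N: "\<And>n z. n \<ge> N \<Longrightarrow> norm z \<le> R \<Longrightarrow> cmod (F n z - f z) \<le> e / 2"
      using lim[of "e/2" R] e by auto
    show ?thesis
    proof (intro exI[of _ N] allI impI ballI)
      fix n m z h assume n: "n \<ge> N" and m: "m \<ge> N" and z: "z \<in> S"
      have D: "((\<lambda>z. F n z - F m z) has_derivative (\<lambda>h. \<Sum>j\<in>UNIV. (c n z - c m z) $ j * h $ j)) (at z)"
        using has_derivative_diff[OF c[of n z] c[of m z]] by (simp add: left_diff_distrib sum_subtractf)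
      have "cmod (\<Sum>j\<in>UNIV. (c n z - c m z) $ j * h $ j) \<le> e * norm h"
      proof (rule entire_gradient_bound[OF entire_diff[OF F F] D])
        fix w assume "w \<in> cball z 1"
        then have "norm w \<le> R" by (rule cb[OF z])
        then show "cmod (F n w - F m w) \<le> e"
          using N[OF n, of w] N[OF m, of w] norm_triangle_ineq4[of "F n w - f w" "F m w - f w"] by simp
      qed
      then show "cmod ((\<Sum>j\<in>UNIV. c n z $ j * h $ j) - (\<Sum>j\<in>UNIV. c m z $ j * h $ j)) \<le> e * norm h"
        by (simp add: left_diff_distrib sum_subtractf)
    qed
  qed
  have conv: "convergent (\<lambda>n. c n z $ j)" if z: "z \<in> S" for z j
  proof (rule Cauchy_convergent, rule metric_CauchyI)
    fix e :: real assume e: "e > 0"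
    obtain N where N: "\<forall>n\<ge>N. \<forall>m\<ge>N. \<forall>z\<in>S. \<forall>h. cmod ((\<Sum>j\<in>UNIV. c n z $ j * h $ j) - (\<Sum>j\<in>UNIV. c m z $ j * h $ j)) \<le> e / 2 * norm h"
      using cau[OF half_gt_zero[OF e]] by (rule exE)
    have ax: "(\<Sum>i\<in>UNIV. c n z $ i * axis j 1 $ i) = c n z $ j" for n
    proof -
      have "(\<Sum>i\<in>UNIV. c n z $ i * axis j 1 $ i) = (\<Sum>i\<in>UNIV. if i = j then c n z $ i else 0)"
        by (intro sum.cong) (auto simp: axis_def)
      then show ?thesis by simp
    qed
    have "(\<Sum>i\<in>UNIV. (cmod ((axis j 1 :: complex^'d) $ i))\<^sup>2) = (\<Sum>i\<in>UNIV. if i = j then 1 else 0)"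
      by (intro sum.cong) (auto simp: axis_def)
    then have "norm (axis j 1 :: complex^'d) = 1" by (simp add: norm_vec_def L2_set_def)
    note na = this
    have "dist (c n z $ j) (c m z $ j) < e" if "n \<ge> N" "m \<ge> N" for n m
    proof -
      have "cmod ((\<Sum>i\<in>UNIV. c n z $ i * axis j 1 $ i) - (\<Sum>i\<in>UNIV. c m z $ i * axis j 1 $ i)) \<le> e / 2 * norm (axis j 1 :: complex^'d)"
        using N that z by blast
      then show ?thesis using e unfolding ax dist_norm na by simp
    qed
    then show "\<exists>M. \<forall>m\<ge>M. \<forall>n\<ge>M. dist (c m z $ j) (c n z $ j) < e" by blast
  qed
  define c' where "c' z = (\<chi> j. lim (\<lambda>n. c n z $ j))" for z
  have c'lim: "(\<lambda>n. c n z $ j) \<longlonglongrightarrow> c' z $ j" if "z \<in> S" for z j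
    using conv[OF that] by (simp add: c'_def convergent_LIMSEQ_iff)
  have fl: "(\<lambda>n. F n x) \<longlonglongrightarrow> f x" for x
  proof (rule metric_LIMSEQ_I)
    fix e :: real assume e: "e > 0"
    obtain N where N: "\<forall>n\<ge>N. \<forall>z. norm z \<le> norm x \<longrightarrow> cmod (F n z - f z) \<le> e / 2"
      using lim[OF half_gt_zero[OF e], of "norm x"] by (rule exE)
    show "\<exists>N. \<forall>n\<ge>N. dist (F n x) (f x) < e"
    proof (intro exI[of _ N] allI impI)
      fix n assume "n \<ge> N"
      then have "cmod (F n x - f x) \<le> e / 2" using N by blast
      then show "dist (F n x) (f x) < e" using e by (simp add: dist_norm)
    qed
  qed
  have "\<exists>g. \<forall>x\<in>S. (\<lambda>n. F n x) \<longlonglongrightarrow> g x \<and> (g has_derivative (\<lambda>h. \<Sum>j\<in>UNIV. c' x $ j * h $ j)) (at x within S)"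
  proof (rule has_derivative_sequence)
    show "convex S" by (simp add: S_def)
    show "(F n has_derivative (\<lambda>h. \<Sum>j\<in>UNIV. c n x $ j * h $ j)) (at x within S)" for n x
      by (rule has_derivative_at_withinI[OF c])
    show "z0 \<in> S" by (simp add: S_def)
    show "(\<lambda>n. F n z0) \<longlonglongrightarrow> f z0" by (rule fl)
    fix e :: real assume e: "e > 0"
    obtain N where N: "\<forall>n\<ge>N. \<forall>m\<ge>N. \<forall>z\<in>S. \<forall>h. cmod ((\<Sum>j\<in>UNIV. c n z $ j * h $ j) - (\<Sum>j\<in>UNIV. c m z $ j * h $ j)) \<le> e * norm h"
      using cau[OF e] by (rule exE)
    show "\<forall>\<^sub>F n in sequentially. \<forall>x\<in>S. \<forall>h. norm ((\<Sum>j\<in>UNIV. c n x $ j * h $ j) - (\<Sum>j\<in>UNIV. c' x $ j * h $ j)) \<le> e * norm h"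
      unfolding eventually_sequentially
    proof (intro exI[of _ N] allI impI ballI)
      fix n x h assume n: "n \<ge> N" and x: "x \<in> S"
      have "(\<lambda>m. cmod ((\<Sum>j\<in>UNIV. c n x $ j * h $ j) - (\<Sum>j\<in>UNIV. c m x $ j * h $ j))) \<longlonglongrightarrow> cmod ((\<Sum>j\<in>UNIV. c n x $ j * h $ j) - (\<Sum>j\<in>UNIV. c' x $ j * h $ j))"
        by (intro tendsto_norm tendsto_diff tendsto_const tendsto_sum tendsto_mult c'lim x)
      then show "norm ((\<Sum>j\<in>UNIV. c n x $ j * h $ j) - (\<Sum>j\<in>UNIV. c' x $ j * h $ j)) \<le> e * norm h"
        by (rule LIMSEQ_le_const2) (use N n x in blast)
    qed
  qed
  then obtain g where g: "\<And>x. x \<in> S \<Longrightarrow> (\<lambda>n. F n x) \<longlonglongrightarrow> g x"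
    "\<And>x. x \<in> S \<Longrightarrow> (g has_derivative (\<lambda>h. \<Sum>j\<in>UNIV. c' x $ j * h $ j)) (at x within S)" by blast
  have z0: "z0 \<in> S" and oS: "open S" by (simp_all add: S_def)
  have gf: "g x = f x" if "x \<in> S" for x
    using LIMSEQ_unique[OF g(1)[OF that] fl] .
  have "(g has_derivative (\<lambda>h. \<Sum>j\<in>UNIV. c' z0 $ j * h $ j)) (at z0)"
    using g(2)[OF z0] at_within_open[OF z0 oS] by simp
  then have "(f has_derivative (\<lambda>h. \<Sum>j\<in>UNIV. c' z0 $ j * h $ j)) (at z0)"
    by (rule has_derivative_transform_within_open[OF _ oS z0 gf])
  then show "\<exists>c. (f has_derivative (\<lambda>h. \<Sum>j\<in>UNIV. c $ j * h $ j)) (at z0)" by (rule exI)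
qed

text \<open>The term of degree p of the power series at 0, obtained from the Taylor expansion along
  the ray through z in place of a multi-index series. Holomorphy in z is therefore not visible from
  the definition and has to be proved.\<close>

definition homog_part :: "(complex^'d::finite \<Rightarrow> complex) \<Rightarrow> nat \<Rightarrow> complex^'d \<Rightarrow> complex" where
  "homog_part f p z = (deriv ^^ p) (\<lambda>t. f (t *s z)) 0 / fact p"

lemma entire_ray: "entire_fun f \<Longrightarrow> (\<lambda>t. f (t *s z)) holomorphic_on S"
  using entire_on_line[of f 0 z S] by simp

lemma homog_part_sums:
  assumes f: "entire_fun f"
  shows "(\<lambda>p. homog_part f p z * t ^ p) sums f (t *s z)"
proof -
  have "(\<lambda>n. (deriv ^^ n) (\<lambda>t. f (t *s z)) 0 / fact n * (t - 0) ^ n) sums f (t *s z)"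
    by (rule holomorphic_power_series[OF entire_ray[OF f], where r="cmod t + 1"]) simp
  then show ?thesis by (simp add: homog_part_def)
qed

lemma homog_part_bound:
  assumes f: "entire_fun f" and M: "\<And>w. norm w \<le> R \<Longrightarrow> cmod (f w) \<le> M" and r: "r > 0" "r * norm z \<le> R"
  shows "cmod (homog_part f p z) \<le> M / r ^ p"
proof -
  have "cmod ((deriv ^^ p) (\<lambda>t. f (t *s z)) 0) \<le> fact p * M / r ^ p"
  proof (rule Cauchy_inequality[OF entire_ray[OF f] holomorphic_on_imp_continuous_on[OF entire_ray[OF f]] r(1)])
    fix x :: complex assume "cmod (0 - x) = r"
    then show "cmod (f (x *s z)) \<le> M" using r(2) by (intro M) (simp add: norm_scale)
  qed
  then show ?thesis by (simp add: homog_part_def norm_divide field_simps)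
qed

lemma homog_part_scale:
  assumes f: "entire_fun f"
  shows "homog_part f p (a *s z) = a ^ p * homog_part f p z"
proof -
  have "(deriv ^^ p) (\<lambda>w. (\<lambda>t. f (t *s z)) (a * w)) 0 = a ^ p * (deriv ^^ p) (\<lambda>t. f (t *s z)) (a * 0)"
    by (rule higher_deriv_compose_linear[OF entire_ray[OF f, of z UNIV], of UNIV]) auto
  then show ?thesis by (simp add: homog_part_def mult.commute)
qed

lemma entire_bounded_cball:
  assumes f: "entire_fun f"
  shows "\<exists>M>0. \<forall>w. norm w \<le> R \<longrightarrow> cmod (f w) \<le> M"
proof -
  have "compact (f ` cball 0 R)"
    by (rule compact_continuous_image[OF continuous_on_subset[OF entire_continuous[OF f] subset_UNIV] compact_cball])
  then have "bounded (f ` cball 0 R)" by (rule compact_imp_bounded)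
  then obtain B where "B > 0" "\<forall>y\<in>f ` cball 0 R. norm y \<le> B" unfolding bounded_pos by (elim exE conjE)
  then show ?thesis by (intro exI[of _ B]) auto
qed

text \<open>Strong induction: subtract the components of lower degree from f(s z), divide by s^p and
  let s tend to 0. The convergence is locally uniform because the rest of the series, after the
  division, is of order s.\<close>

lemma entire_homog_part:
  fixes f :: "complex^'d::finite \<Rightarrow> complex"
  assumes f: "entire_fun f"
  shows "entire_fun (homog_part f p)"
proof (induction p rule: less_induct)
  case (less p)
  define s where "s n = 1 / complex_of_real (real (Suc n))" for n
  have s0: "s n \<noteq> 0" and sn: "cmod (s n) = 1 / real (Suc n)" for n
    by (simp_all add: s_def norm_divide del: of_nat_Suc)
  have sle: "cmod (s n) \<le> 1" for n unfolding sn by simp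
  define F where "F n z = (1 / s n ^ p) * (f (s n *s z + 0) - (\<Sum>q<p. s n ^ q * homog_part f q z))" for n z
  show ?case
  proof (rule entire_limit[of F])
    show "entire_fun (F n)" for n
      unfolding F_def[abs_def]
      by (intro entire_cmult entire_diff entire_sum entire_affine[OF f]) (use less in auto)
    fix R e :: real assume e: "e > 0"
    define R' where "R' = max R 0"
    obtain M where M: "M > 0" "\<And>w. norm w \<le> 2 * R' \<Longrightarrow> cmod (f w) \<le> M"
      using entire_bounded_cball[OF f, of "2 * R'"] by auto
    have est: "cmod (F n z - homog_part f p z) \<le> 2 * M * cmod (s n)" if z: "norm z \<le> R" for n and z :: "complex^'d"
    proof -
      let ?a = "\<lambda>q. homog_part f q z * s n ^ q"
      \<comment> \<open>The bound M holds on a ball of twice the radius, which gives this geometric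
        decay.\<close>
      have b: "cmod (homog_part f q z) \<le> M / 2 ^ q" for q
        by (rule homog_part_bound[OF f M(2)]) (use z in \<open>auto simp: R'_def\<close>)
      have sm: "(\<lambda>i. ?a (i + Suc p)) sums (f (s n *s z) - (\<Sum>q<Suc p. ?a q))"
        using homog_part_sums[OF f, of z "s n"] by (subst sums_iff_shift) simp
      have b2: "norm (?a (i + Suc p)) \<le> M * cmod (s n) ^ Suc p * (1/2) ^ i" for i
      proof -
        have "norm (?a (i + Suc p)) \<le> M / 2 ^ (i + Suc p) * (cmod (s n) ^ i * cmod (s n) ^ Suc p)"
          unfolding norm_mult norm_power power_add by (intro mult_right_mono order_trans[OF b]) (auto simp: power_add)
        also have "\<dots> \<le> M / 2 ^ i * (1 * cmod (s n) ^ Suc p)"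
          using M(1) by (intro mult_mono frac_le mult_right_mono power_le_one sle power_increasing) auto
        also have "\<dots> = M * cmod (s n) ^ Suc p * (1/2) ^ i" by (simp add: power_divide)
        finally show ?thesis .
      qed
      have "norm (f (s n *s z) - (\<Sum>q<Suc p. ?a q)) \<le> (\<Sum>i. M * cmod (s n) ^ Suc p * (1/2::real) ^ i)"
        unfolding sums_unique[OF sm] using b2 by (intro norm_suminf_le summable_mult summable_geometric) simp_all
      also have "\<dots> = 2 * M * cmod (s n) * cmod (s n) ^ p"
        by (subst suminf_mult) (auto simp: suminf_geometric)
      finally have 1: "norm (f (s n *s z) - (\<Sum>q<Suc p. ?a q)) \<le> 2 * M * cmod (s n) * cmod (s n) ^ p" .
      have "(F n z - homog_part f p z) * s n ^ p = f (s n *s z) - (\<Sum>q<Suc p. ?a q)"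
        using s0[of n] by (simp add: F_def field_simps mult.commute)
      then have "cmod (F n z - homog_part f p z) * cmod (s n) ^ p \<le> 2 * M * cmod (s n) * cmod (s n) ^ p"
        using 1 by (metis norm_mult norm_power)
      then show ?thesis using s0[of n] by simp
    qed
    obtain N where N: "2 * M / e < real N" using reals_Archimedean2 by blast
    show "\<exists>N. \<forall>n\<ge>N. \<forall>z. norm z \<le> R \<longrightarrow> cmod (F n z - homog_part f p z) \<le> e"
    proof (intro exI[of _ N] allI impI)
      fix n and z :: "complex^'d" assume n: "n \<ge> N" and z: "norm z \<le> R"
      have "2 * M < e * real (Suc n)" using N n e by (simp add: field_simps) (smt (verit) mult_left_mono of_nat_mono)
      then have "2 * M * cmod (s n) \<le> e" unfolding sn by (simp add: field_simps)
      then show "cmod (F n z - homog_part f p z) \<le> e" using est[OF z, of n] by linarith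
    qed
  qed
qed

text \<open>Cauchy's estimate with the radius r = exp(-|z|), for which r |z| is at most 1. In effect
  it bounds |z|^p by exp(p |z|).\<close>

lemma exptype_homog_part:
  assumes f: "entire_fun f"
  shows "exptype (homog_part f p)"
  unfolding exptype_def
proof
  show e: "entire_fun (homog_part f p)" by (rule entire_homog_part[OF f])
  obtain M where M: "M > 0" "\<And>w. norm w \<le> 1 \<Longrightarrow> cmod (f w) \<le> M"
    using entire_bounded_cball[OF f, of 1] by auto
  show "gauss_dom 0 (homog_part f p)"
  proof (rule gauss_domI)
    show "homog_part f p \<in> borel_measurable borel" by (rule entire_measurable[OF e])
    fix z :: "complex^'a"
    have n1: "norm z \<le> exp (norm z)" using exp_ge_add_one_self[of "norm z"] by linarith
    have "cmod (homog_part f p z) \<le> M / exp (- norm z) ^ p"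
      by (rule homog_part_bound[OF f M(2)]) (use n1 in \<open>auto simp: exp_minus field_simps\<close>)
    also have "\<dots> = M * exp (real p * norm z - 0 * (norm z)\<^sup>2)"
      by (simp add: exp_minus power_inverse exp_of_nat_mult field_simps)
    finally show "cmod (homog_part f p z) \<le> M * exp (real p * norm z - 0 * (norm z)\<^sup>2)" .
  qed
qed

lemma homog_part_summable:
  assumes f: "entire_fun f"
  shows "summable (\<lambda>p. cmod (homog_part f p z))"
proof -
  obtain M where M: "M > 0" "\<And>w. norm w \<le> 2 * norm z \<Longrightarrow> cmod (f w) \<le> M"
    using entire_bounded_cball[OF f, of "2 * norm z"] by auto
  have b: "cmod (homog_part f p z) \<le> M * (1/2) ^ p" for p
    using homog_part_bound[OF f M(2), where r=2 and z=z and p=p] by (simp add: power_divide)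
  show ?thesis
    by (rule summable_comparison_test[OF _ summable_mult[OF summable_geometric, of "1/2" M]]) (use b in auto)
qed

section \<open>Parseval and orthogonality under rotations\<close>

context lattice_coords
begin

text \<open>Absolute summability makes f continuous and permits integration term by term, first
  against each character and then against f itself.\<close>

lemma parseval:
  fixes x :: "nat \<Rightarrow> complex" and k :: "nat \<Rightarrow> real^'m"
  assumes k: "inj k" "\<And>n. k n \<in> intvec" and s: "summable (\<lambda>n. cmod (x n))"
  shows "(\<integral>\<^sup>+t. ennreal ((cmod (\<Sum>n. x n * chi (k n) t))\<^sup>2) * indicator fdom t \<partial>lborel) = ennreal vol * (\<Sum>n. ennreal ((cmod (x n))\<^sup>2))"
proof -
  define f where "f t = (\<Sum>n. x n * chi (k n) t)" for t
  have sx: "summable (\<lambda>n. x n * chi (k n) t)" for t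
    by (rule summable_norm_cancel) (simp add: norm_mult s)
  have fb: "cmod (f t) \<le> (\<Sum>n. cmod (x n))" for t
    unfolding f_def by (rule norm_suminf_le[OF _ s]) (simp add: norm_mult)
  have fc: "continuous_on UNIV f"
    unfolding f_def
  proof (rule uniform_limit_theorem[OF _ Weierstrass_m_test[OF _ s]])
    show "\<forall>\<^sub>F n in sequentially. continuous_on UNIV (\<lambda>t. \<Sum>i<n. x i * chi (k i) t)"
      by (intro always_eventually allI continuous_on_sum continuous_on_mult continuous_on_const chi_cont)
    show "norm (x n * chi (k n) t) \<le> cmod (x n)" for n t by (simp add: norm_mult)
  qed simp
  define B where "B = (\<Sum>n. cmod (x n))"
  have B: "B \<ge> 0" unfolding B_def by (rule suminf_nonneg[OF s]) simp
  have kd: "k m - k n = 0 \<longleftrightarrow> n = m" for n m using k(1) by (auto simp: inj_eq)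
  have I1: "(\<integral>t. indicator fdom t * (chi (k m) t * cnj (f t)) \<partial>lborel) = of_real vol * cnj (x m)" for m
  proof -
    have "chi (k m) t * cnj (f t) = (\<Sum>n. cnj (x n) * chi (k m - k n) t)" for t
    proof -
      have "(\<lambda>n. cnj (x n * chi (k n) t)) sums cnj (f t)"
        unfolding sums_cnj f_def by (rule summable_sums[OF sx])
      then have S: "(\<lambda>n. chi (k m) t * cnj (x n * chi (k n) t)) sums (chi (k m) t * cnj (f t))"
        by (rule sums_mult)
      have e: "chi (k m) t * cnj (x n * chi (k n) t) = cnj (x n) * chi (k m - k n) t" for n
        using chi_add_left[of "k m" "- k n" t] by (simp add: chi_minus mult_ac)
      show ?thesis unfolding sums_unique[OF S] by (rule suminf_cong) (rule e)
    qed
    then have "(\<integral>t. indicator fdom t * (chi (k m) t * cnj (f t)) \<partial>lborel) = (\<integral>t. indicator fdom t * (\<Sum>n. cnj (x n) * chi (k m - k n) t) \<partial>lborel)"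
      by simp
    also have "\<dots> = (\<Sum>n. \<integral>t. indicator fdom t * (cnj (x n) * chi (k m - k n) t) \<partial>lborel)"
      by (rule integral_fdom_suminf(1)[OF _ _ s])
         (auto intro!: continuous_on_mult continuous_on_const chi_cont simp: norm_mult)
    also have "\<dots> = (\<Sum>n. if n = m then of_real vol * cnj (x n) else 0)"
    proof (rule suminf_cong)
      fix n
      have "(\<integral>t. indicator fdom t * (cnj (x n) * chi (k m - k n) t) \<partial>lborel) = (\<integral>t. cnj (x n) * (indicator fdom t * chi (k m - k n) t) \<partial>lborel)"
        by (intro Bochner_Integration.integral_cong refl) (simp only: mult_ac)
      also have "\<dots> = cnj (x n) * (if k m - k n = 0 then of_real vol else 0)"
        by (simp only: integral_mult_right_zero chi_integral[OF intvec_diff[OF k(2) k(2)]])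
      finally show "(\<integral>t. indicator fdom t * (cnj (x n) * chi (k m - k n) t) \<partial>lborel) = (if n = m then of_real vol * cnj (x n) else 0)"
        unfolding kd by simp
    qed
    also have "\<dots> = (\<Sum>n\<in>{m}. if n = m then of_real vol * cnj (x n) else 0)" by (rule suminf_finite) auto
    finally show ?thesis by simp
  qed
  have sb: "summable (\<lambda>n. cmod (x n) * B)" by (rule summable_mult2[OF s])
  have xB: "cmod (x n) \<le> B" for n
    unfolding B_def using sum_le_suminf[OF s, of "{n}"] by simp
  have s2: "summable (\<lambda>n. (cmod (x n))\<^sup>2)"
    by (rule summable_comparison_test[OF _ sb]) (use xB in \<open>auto simp: power2_eq_square intro!: mult_left_mono\<close>)
  have "(\<integral>t. indicator fdom t * (f t * cnj (f t)) \<partial>lborel) = (\<integral>t. indicator fdom t * (\<Sum>m. x m * (chi (k m) t * cnj (f t))) \<partial>lborel)"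
  proof (intro Bochner_Integration.integral_cong refl)
    fix t
    have "f t * cnj (f t) = (\<Sum>m. x m * (chi (k m) t * cnj (f t)))"
      using suminf_mult2[OF sx[of t], of "cnj (f t)"] by (simp add: f_def mult.assoc)
    then show "indicator fdom t * (f t * cnj (f t)) = indicator fdom t * (\<Sum>m. x m * (chi (k m) t * cnj (f t)))" by simp
  qed
  also have "\<dots> = (\<Sum>m. \<integral>t. indicator fdom t * (x m * (chi (k m) t * cnj (f t))) \<partial>lborel)"
    by (rule integral_fdom_suminf(1)[OF _ _ sb])
       (use fb in \<open>auto intro!: continuous_on_mult continuous_on_const chi_cont continuous_on_cnj fc mult_left_mono simp: norm_mult B_def\<close>)
  also have "\<dots> = (\<Sum>m. of_real (vol * (cmod (x m))\<^sup>2))"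
  proof (rule suminf_cong)
    fix m
    have "(\<integral>t. indicator fdom t * (x m * (chi (k m) t * cnj (f t))) \<partial>lborel) = (\<integral>t. x m * (indicator fdom t * (chi (k m) t * cnj (f t))) \<partial>lborel)"
      by (intro Bochner_Integration.integral_cong refl) (simp only: mult_ac)
    also have "\<dots> = of_real vol * (x m * cnj (x m))"
      unfolding integral_mult_right_zero I1 by (simp only: mult_ac)
    also have "\<dots> = of_real (vol * (cmod (x m))\<^sup>2)"
      by (simp only: complex_norm_square[symmetric] of_real_mult)
    finally show "(\<integral>t. indicator fdom t * (x m * (chi (k m) t * cnj (f t))) \<partial>lborel) = of_real (vol * (cmod (x m))\<^sup>2)" .
  qed
  also have "\<dots> = of_real (\<Sum>m. vol * (cmod (x m))\<^sup>2)"
    by (rule suminf_of_real[OF summable_mult[OF s2], symmetric])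
  also have "(\<Sum>m. vol * (cmod (x m))\<^sup>2) = vol * (\<Sum>m. (cmod (x m))\<^sup>2)" by (rule suminf_mult[OF s2])
  finally have I2: "(\<integral>t. indicator fdom t * (f t * cnj (f t)) \<partial>lborel) = of_real (vol * (\<Sum>m. (cmod (x m))\<^sup>2))" .
  have eq: "indicator fdom t * (f t * cnj (f t)) = of_real (indicat_real fdom t * (cmod (f t))\<^sup>2)" for t
    by (simp add: complex_norm_square[symmetric] indicator_def)
  have "integrable lborel (\<lambda>t. indicator fdom t * (f t * cnj (f t)))"
    by (intro continuous_integrable_fdom continuous_on_mult fc continuous_on_cnj)
  then have i: "integrable lborel (\<lambda>t. indicat_real fdom t * (cmod (f t))\<^sup>2)"
    unfolding eq complex_of_real_integrable_eq .
  have v: "(\<integral>t. indicat_real fdom t * (cmod (f t))\<^sup>2 \<partial>lborel) = vol * (\<Sum>m. (cmod (x m))\<^sup>2)"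
    using I2 unfolding eq integral_complex_of_real of_real_eq_iff .
  have "(\<integral>\<^sup>+t. ennreal ((cmod (f t))\<^sup>2) * indicator fdom t \<partial>lborel) = (\<integral>\<^sup>+t. ennreal (indicat_real fdom t * (cmod (f t))\<^sup>2) \<partial>lborel)"
    by (intro nn_integral_cong) (auto simp: indicator_def)
  also have "\<dots> = ennreal (vol * (\<Sum>m. (cmod (x m))\<^sup>2))"
    unfolding v[symmetric] by (rule nn_integral_eq_integral[OF i]) (simp add: indicator_def)
  also have "\<dots> = ennreal vol * ennreal (\<Sum>m. (cmod (x m))\<^sup>2)"
    using vol_pos by (intro ennreal_mult) (auto intro!: suminf_nonneg s2)
  also have "ennreal (\<Sum>m. (cmod (x m))\<^sup>2) = (\<Sum>m. ennreal ((cmod (x m))\<^sup>2))"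
    by (rule suminf_ennreal2[OF _ s2, symmetric]) simp
  finally show ?thesis unfolding f_def .
qed

end

text \<open>The integers as a lattice in the line: a Fourier series in the rotation angle becomes an
  instance of the general theory.\<close>

interpretation circ: lattice_coords "\<lambda>t::real. (\<chi> i::1. t)"
proof (rule lattice_coords.intro)
  show "linear (\<lambda>t::real. (\<chi> i::1. t))" by (rule linearI) (simp_all add: vec_eq_iff)
  show "bij (\<lambda>t::real. (\<chi> i::1. t))"
  proof (rule bijI)
    show "inj (\<lambda>t::real. (\<chi> i::1. t))" by (rule injI) (simp add: vec_eq_iff)
    show "surj (\<lambda>t::real. (\<chi> i::1. t))"
    proof (rule surjI[where f="\<lambda>x::real^1. x $ (1::1)"])
      show "(\<chi> i::1. x $ (1::1)) = x" for x :: "real^1" by (simp add: vec_eq_iff)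
    qed
  qed
qed

text \<open>For fixed z the function F(u z) is, up to a unimodular factor, a Fourier series in the
  angle of u with coefficients X_j(z), so Parseval applies pointwise. Integrating over z first gives
  the norm of F for every angle, because the weight is radial. The identity lives in
  \<open>ennreal\<close>, so it also transfers finiteness from F to its components.\<close>

lemma fock_norm2_homogeneous_sum:
  fixes X :: "nat \<Rightarrow> complex^'d::finite \<Rightarrow> complex"
  assumes [measurable]: "\<And>j. X j \<in> borel_measurable borel"
    and s: "\<And>z. summable (\<lambda>j. cmod (X j z))"
    and rot: "\<And>u z j. cmod u = 1 \<Longrightarrow> X j (u *s z) * u ^ m = u ^ j * X j z"
  shows "fock_norm2 (\<lambda>z. \<Sum>j. X j z) = (\<Sum>j. fock_norm2 (X j))"
proof -
  define F where "F z = (\<Sum>j. X j z)" for z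
  define k :: "nat \<Rightarrow> real^1" where "k j = (\<chi> i. real j)" for j
  have k: "inj k" "\<And>j. k j \<in> intvec"
    by (auto simp: k_def inj_def vec_eq_iff intvec_def)
  have chi: "circ.chi (k j) t = cis (2 * pi * t) ^ j" for j t
    by (simp add: circ.chi_def k_def inner_vec_def Complex.DeMoivre mult_ac)
  have [measurable]: "F \<in> borel_measurable borel" unfolding F_def by measurable
  have scale: "(\<lambda>p::real \<times> (complex^'d). cis (2 * pi * fst p) *s snd p) \<in> borel_measurable (borel \<Otimes>\<^sub>M borel)"
  proof -
    have "continuous_on UNIV (\<lambda>p::real \<times> (complex^'d). \<chi> j. cis (2 * pi * fst p) * snd p $ j)"
      by (intro continuous_on_vec_lambda continuous_intros)
    then show ?thesis
      unfolding borel_prod by (intro borel_measurable_continuous_onI) (simp add: vector_scalar_mult_def)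
  qed
  have mF: "(\<lambda>p::real \<times> (complex^'d). F (cis (2 * pi * fst p) *s snd p)) \<in> borel_measurable (borel \<Otimes>\<^sub>M borel)"
    by (rule measurable_compose[OF scale]) measurable
  have rotF: "cmod (F (cis (2 * pi * t) *s z)) = cmod (\<Sum>j. X j z * circ.chi (k j) t)" for t z
  proof -
    let ?u = "cis (2 * pi * t)"
    have "F (?u *s z) * ?u ^ m = (\<Sum>j. X j (?u *s z) * ?u ^ m)"
      unfolding F_def by (rule suminf_mult2[OF summable_norm_cancel[OF s]])
    also have "\<dots> = (\<Sum>j. X j z * circ.chi (k j) t)"
      unfolding chi by (rule suminf_cong) (rule trans[OF rot[OF norm_cis] mult.commute])
    finally have "cmod (F (?u *s z) * ?u ^ m) = cmod (\<Sum>j. X j z * circ.chi (k j) t)" by simp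
    then show ?thesis by (simp add: norm_mult norm_power)
  qed
  let ?w = "\<lambda>z::complex^'d. ennreal (exp (- pi * (norm z)\<^sup>2))"
  have fn: "fock_norm2 G = (\<integral>\<^sup>+z. ennreal ((cmod (G z))\<^sup>2) * ?w z \<partial>lborel)" for G :: "complex^'d \<Rightarrow> complex"
    unfolding fock_norm2_def by (simp add: ennreal_mult)
  have inv: "(\<integral>\<^sup>+z. ennreal ((cmod (F (cis (2 * pi * t) *s z)))\<^sup>2) * ?w z \<partial>lborel) = fock_norm2 F" for t
  proof -
    have "(\<integral>\<^sup>+z. ennreal ((cmod (F (cis (2 * pi * t) *s z)))\<^sup>2) * ?w (cis (2 * pi * t) *s z) \<partial>lborel) = (\<integral>\<^sup>+z. ennreal ((cmod (F z))\<^sup>2) * ?w z \<partial>lborel)"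
      by (rule nn_integral_lborel_orthogonal[where f="\<lambda>z. ennreal ((cmod (F z))\<^sup>2) * ?w z"]) (measurable, rule orthogonal_scale, simp)
    then show ?thesis unfolding fn by (simp add: norm_scale)
  qed
  have "fock_norm2 F * ennreal circ.vol = (\<integral>\<^sup>+t. fock_norm2 F * indicator circ.fdom t \<partial>lborel)"
    by (simp add: nn_integral_cmult circ.emeasure_vol)
  also have "\<dots> = (\<integral>\<^sup>+t. (\<integral>\<^sup>+z. ennreal ((cmod (F (cis (2 * pi * t) *s z)))\<^sup>2) * ?w z * indicator circ.fdom t \<partial>lborel) \<partial>lborel)"
  proof (rule nn_integral_cong)
    fix t
    have "(\<integral>\<^sup>+z. ennreal ((cmod (F (cis (2 * pi * t) *s z)))\<^sup>2) * ?w z * indicator circ.fdom t \<partial>lborel) = (\<integral>\<^sup>+z. ennreal ((cmod (F (cis (2 * pi * t) *s z)))\<^sup>2) * ?w z \<partial>lborel) * indicator circ.fdom t"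
    proof (rule nn_integral_multc)
      have "(\<lambda>z. F (cis (2 * pi * t) *s z)) \<in> borel_measurable borel"
        using measurable_compose[OF _ mF, of "\<lambda>z. (t, z)" borel] by simp
      then show "(\<lambda>z. ennreal ((cmod (F (cis (2 * pi * t) *s z)))\<^sup>2) * ?w z) \<in> borel_measurable lborel" by measurable
    qed
    then show "fock_norm2 F * indicator circ.fdom t = (\<integral>\<^sup>+z. ennreal ((cmod (F (cis (2 * pi * t) *s z)))\<^sup>2) * ?w z * indicator circ.fdom t \<partial>lborel)"
      unfolding inv by simp
  qed
  also have "\<dots> = (\<integral>\<^sup>+z. (\<integral>\<^sup>+t. ennreal ((cmod (F (cis (2 * pi * t) *s z)))\<^sup>2) * ?w z * indicator circ.fdom t \<partial>lborel) \<partial>lborel)"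
  proof (rule lborel_pair.Fubini'[symmetric])
    show "(\<lambda>(t, z). ennreal ((cmod (F (cis (2 * pi * t) *s z)))\<^sup>2) * ?w z * indicator circ.fdom t) \<in> borel_measurable (lborel \<Otimes>\<^sub>M lborel)"
    proof -
      have "(\<lambda>p. ennreal ((cmod (F (cis (2 * pi * fst p) *s snd p)))\<^sup>2) * ?w (snd p) * indicator circ.fdom (fst p)) \<in> borel_measurable (borel \<Otimes>\<^sub>M borel)"
        using mF by measurable
      then show ?thesis by (simp add: case_prod_beta' lborel_prod borel_prod)
    qed
  qed
  also have "\<dots> = (\<integral>\<^sup>+z. ennreal circ.vol * (\<Sum>j. ennreal ((cmod (X j z))\<^sup>2) * ?w z) \<partial>lborel)"
  proof (rule nn_integral_cong)
    fix z
    have "(\<integral>\<^sup>+t. ennreal ((cmod (F (cis (2 * pi * t) *s z)))\<^sup>2) * ?w z * indicator circ.fdom t \<partial>lborel)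
        = (\<integral>\<^sup>+t. ?w z * (ennreal ((cmod (\<Sum>j. X j z * circ.chi (k j) t))\<^sup>2) * indicator circ.fdom t) \<partial>lborel)"
      unfolding rotF by (intro nn_integral_cong) (simp only: mult_ac)
    also have "\<dots> = ?w z * (ennreal circ.vol * (\<Sum>j. ennreal ((cmod (X j z))\<^sup>2)))"
    proof (subst nn_integral_cmult)
      show "(\<lambda>t. ennreal ((cmod (\<Sum>j. X j z * circ.chi (k j) t))\<^sup>2) * indicator circ.fdom t) \<in> borel_measurable lborel" by measurable
    qed (simp only: circ.parseval[OF k s])
    also have "\<dots> = ennreal circ.vol * (\<Sum>j. ennreal ((cmod (X j z))\<^sup>2) * ?w z)"
      by (simp add: ennreal_suminf_multc mult_ac)
    finally show "(\<integral>\<^sup>+t. ennreal ((cmod (F (cis (2 * pi * t) *s z)))\<^sup>2) * ?w z * indicator circ.fdom t \<partial>lborel) = ennreal circ.vol * (\<Sum>j. ennreal ((cmod (X j z))\<^sup>2) * ?w z)" .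
  qed
  also have "\<dots> = ennreal circ.vol * (\<Sum>j. fock_norm2 (X j))"
    unfolding fn by (subst nn_integral_cmult, measurable) (subst nn_integral_suminf, measurable)
  finally have "ennreal circ.vol * fock_norm2 F = ennreal circ.vol * (\<Sum>j. fock_norm2 (X j))"
    by (simp only: mult.commute)
  then have "fock_norm2 F = (\<Sum>j. fock_norm2 (X j))"
    using circ.vol_pos by (simp add: ennreal_mult_cancel_left)
  then show ?thesis unfolding F_def .
qed

lemma sums_delayed:
  fixes a :: "nat \<Rightarrow> 'a::real_normed_vector"
  assumes "a sums s"
  shows "(\<lambda>j. if j < d then 0 else a (j - d)) sums s"
  using assms by (subst sums_iff_shift'[of _ d, symmetric]) simp

lemma cmpow_scale: "cmpow (u *s z) k = cnj u ^ mabs k * cmpow z k"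
  by (simp add: cmpow_def mabs_def power_mult_distrib prod.distrib power_sum)

text \<open>A term $\bar z^k$ times a homogeneous polynomial of degree $p$ picks up $u^{p - |k|}$ under rotation;
  the offset $m$ keeps the index $j = p - |k| + m$ natural.\<close>

lemma polyanalytic_homogeneous_decomposition:
  fixes n :: "nat^'d::finite"
  assumes \<phi>: "\<And>k. k \<in> K_set n \<Longrightarrow> entire_fun (\<phi> k)"
  obtains X m where
    "\<And>j. \<exists>\<psi>. (\<forall>k\<in>K_set n. exptype (\<psi> k)) \<and> (\<forall>z. X j z = (\<Sum>k\<in>K_set n. cmpow z k * \<psi> k z))"
    "\<And>z. (\<lambda>j::nat. X j z) sums (\<Sum>k\<in>K_set n. cmpow z k * \<phi> k z)"
    "\<And>z. summable (\<lambda>j. cmod (X j z))"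
    "\<And>u z j. cmod u = 1 \<Longrightarrow> X j (u *s z) * u ^ m = u ^ j * X j z"
proof -
  \<comment> \<open>A convenient common upper bound for the degrees |k| with k in
    \<open>K_set n\<close>.\<close>
  define m where "m = (\<Sum>k\<in>K_set n. mabs k)"
  have km: "mabs k \<le> m" if "k \<in> K_set n" for k
    unfolding m_def using that by (intro member_le_sum) auto
  \<comment> \<open>Delayed by m - |k|, so that the index j collects the terms of rotation weight j
    - m.\<close>
  define \<psi> where "\<psi> j k = (if j < m - mabs k then (\<lambda>z. 0) else homog_part (\<phi> k) (j - (m - mabs k)))" for j k
  define X where "X j z = (\<Sum>k\<in>K_set n. cmpow z k * \<psi> j k z)" for j z
  have \<psi>s: "(\<lambda>j. \<psi> j k z) sums \<phi> k z" if "k \<in> K_set n" for k z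
  proof -
    have "(\<lambda>p. homog_part (\<phi> k) p z) sums \<phi> k z" using homog_part_sums[OF \<phi>[OF that], of z 1] by simp
    from sums_delayed[OF this, of "m - mabs k"] show ?thesis
      by (simp add: \<psi>_def if_distrib[of "\<lambda>f. f z"] cong: if_cong)
  qed
  have \<psi>a: "summable (\<lambda>j. cmod (\<psi> j k z))" if "k \<in> K_set n" for k z
  proof -
    have "(\<lambda>j. if j < m - mabs k then 0 else cmod (homog_part (\<phi> k) (j - (m - mabs k)) z)) sums (\<Sum>p. cmod (homog_part (\<phi> k) p z))"
      by (rule sums_delayed[OF summable_sums[OF homog_part_summable[OF \<phi>[OF that]]]])
    moreover have "(\<lambda>j. if j < m - mabs k then 0 else cmod (homog_part (\<phi> k) (j - (m - mabs k)) z)) = (\<lambda>j. cmod (\<psi> j k z))"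
      by (auto simp: \<psi>_def)
    ultimately show ?thesis by (simp add: sums_iff)
  qed
  show ?thesis
  proof (rule that[of X m])
    fix j
    show "\<exists>\<psi>. (\<forall>k\<in>K_set n. exptype (\<psi> k)) \<and> (\<forall>z. X j z = (\<Sum>k\<in>K_set n. cmpow z k * \<psi> k z))"
      by (intro exI[of _ "\<psi> j"]) (auto simp: X_def \<psi>_def exptype_const exptype_homog_part \<phi>)
  next
    fix z
    show "(\<lambda>j. X j z) sums (\<Sum>k\<in>K_set n. cmpow z k * \<phi> k z)"
      unfolding X_def by (intro sums_sum sums_mult \<psi>s)
    show "summable (\<lambda>j. cmod (X j z))"
    proof (rule summable_comparison_test)
      show "summable (\<lambda>j. \<Sum>k\<in>K_set n. cmod (cmpow z k) * cmod (\<psi> j k z))"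
        by (intro summable_sum summable_mult \<psi>a)
      show "\<exists>N. \<forall>j\<ge>N. norm (cmod (X j z)) \<le> (\<Sum>k\<in>K_set n. cmod (cmpow z k) * cmod (\<psi> j k z))"
        unfolding X_def by (intro exI[of _ 0]) (auto simp: norm_mult[symmetric] intro: norm_sum)
    qed
  next
    fix u :: complex and z j assume u: "cmod u = 1"
    have uc: "cnj u * u = 1" using u complex_norm_square[of u] by (simp add: mult.commute)
    have "cmpow (u *s z) k * \<psi> j k (u *s z) * u ^ m = u ^ j * (cmpow z k * \<psi> j k z)" if k: "k \<in> K_set n" for k
    proof (cases "j < m - mabs k")
      case False
      define q where "q = j - (m - mabs k)"
      have e: "q + m = j + mabs k" using False km[OF k] by (simp add: q_def)
      have "cnj u ^ mabs k * u ^ q * u ^ m = cnj u ^ mabs k * (u ^ j * u ^ mabs k)"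
        unfolding mult.assoc power_add[symmetric] e ..
      also have "\<dots> = u ^ j * (cnj u * u) ^ mabs k" by (simp add: power_mult_distrib mult_ac)
      finally have c: "cnj u ^ mabs k * u ^ q * u ^ m = u ^ j" by (simp add: uc)
      have "cmpow (u *s z) k * \<psi> j k (u *s z) * u ^ m = (cnj u ^ mabs k * u ^ q * u ^ m) * (cmpow z k * \<psi> j k z)"
        using False by (simp add: cmpow_scale \<psi>_def homog_part_scale[OF \<phi>[OF k]] q_def mult_ac)
      then show ?thesis unfolding c .
    qed (simp add: \<psi>_def)
    then show "X j (u *s z) * u ^ m = u ^ j * X j z"
      unfolding X_def sum_distrib_left sum_distrib_right by (intro sum.cong refl) auto
  qed
qed

section \<open>Sampling implies the lower Riesz inequality\<close>

text \<open>Turns the unordered sums of the definitions into series, to which monotone convergence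
  applies.\<close>

lemma infsum_ennreal_enum:
  fixes f :: "'a \<Rightarrow> ennreal"
  assumes e: "bij_betw e (UNIV::nat set) S"
  shows "(\<Sum>\<^sub>\<infinity>z\<in>S. f z) = (\<Sum>n. f (e n))"
proof -
  have "(\<Sum>\<^sub>\<infinity>z\<in>S. f z) = (\<Sum>\<^sub>\<infinity>n\<in>UNIV. f (e n))"
    by (rule infsum_reindex_bij_betw[OF e, symmetric])
  moreover have "(\<lambda>n. f (e n)) summable_on UNIV" by (rule nonneg_summable_on_complete) simp
  then have "((\<lambda>n. f (e n)) has_sum (\<Sum>\<^sub>\<infinity>n\<in>UNIV. f (e n))) UNIV" by (rule has_sum_infsum)
  then have "(\<lambda>n. f (e n)) sums (\<Sum>\<^sub>\<infinity>n\<in>UNIV. f (e n))" by (rule has_sum_imp_sums)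
  ultimately show ?thesis by (simp add: sums_iff)
qed

section \<open>The linear space of polyanalytic functions\<close>

definition polyanalytic_funs :: "nat^'d::finite \<Rightarrow> (complex^'d \<Rightarrow> complex) set" where
  "polyanalytic_funs n = {F. \<exists>\<phi>. (\<forall>k\<in>K_set n. entire_fun (\<phi> k)) \<and> (\<forall>z. F z = (\<Sum>k\<in>K_set n. cmpow z k * \<phi> k z))}"

lemma polyfock_alt: "polyfock_space n = {F \<in> polyanalytic_funs n. fock_norm2 F < \<infinity>}"
  by (auto simp: polyfock_space_def polyanalytic_funs_def)

lemma polyanalytic_funs_add: "F \<in> polyanalytic_funs n \<Longrightarrow> G \<in> polyanalytic_funs n \<Longrightarrow> (\<lambda>z. F z + G z) \<in> polyanalytic_funs n"
proof -
  assume "F \<in> polyanalytic_funs n" "G \<in> polyanalytic_funs n"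
  then obtain \<phi> \<psi> where p: "\<forall>k\<in>K_set n. entire_fun (\<phi> k)" "\<forall>z. F z = (\<Sum>k\<in>K_set n. cmpow z k * \<phi> k z)"
    and q: "\<forall>k\<in>K_set n. entire_fun (\<psi> k)" "\<forall>z. G z = (\<Sum>k\<in>K_set n. cmpow z k * \<psi> k z)"
    unfolding polyanalytic_funs_def mem_Collect_eq by (elim exE conjE)
  have "\<forall>k\<in>K_set n. entire_fun (\<lambda>z. \<phi> k z + \<psi> k z)" using p q by (intro ballI entire_add) blast+
  moreover have "\<forall>z. F z + G z = (\<Sum>k\<in>K_set n. cmpow z k * (\<phi> k z + \<psi> k z))"
    using p(2) q(2) by (simp add: distrib_left sum.distrib)
  ultimately show ?thesis unfolding polyanalytic_funs_def mem_Collect_eq by (intro exI[of _ "\<lambda>k z. \<phi> k z + \<psi> k z"] conjI)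
qed

lemma polyanalytic_funs_cmult: "F \<in> polyanalytic_funs n \<Longrightarrow> (\<lambda>z. c * F z) \<in> polyanalytic_funs n"
proof -
  assume "F \<in> polyanalytic_funs n"
  then obtain \<phi> where p: "\<forall>k\<in>K_set n. entire_fun (\<phi> k)" "\<forall>z. F z = (\<Sum>k\<in>K_set n. cmpow z k * \<phi> k z)"
    unfolding polyanalytic_funs_def mem_Collect_eq by (elim exE conjE)
  have "\<forall>k\<in>K_set n. entire_fun (\<lambda>z. c * \<phi> k z)" using p by (intro ballI entire_cmult) blast
  moreover have "\<forall>z. c * F z = (\<Sum>k\<in>K_set n. cmpow z k * (c * \<phi> k z))"
    using p(2) by (simp add: sum_distrib_left mult_ac)
  ultimately show ?thesis unfolding polyanalytic_funs_def mem_Collect_eq by (intro exI[of _ "\<lambda>k z. c * \<phi> k z"] conjI)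
qed

lemma polyanalytic_funs_zero: "(\<lambda>z. 0) \<in> polyanalytic_funs n"
  unfolding polyanalytic_funs_def mem_Collect_eq by (intro exI[of _ "\<lambda>k z. 0"] conjI ballI entire_const) simp

lemma polyanalytic_funs_sum: "(\<And>i. i \<in> I \<Longrightarrow> F i \<in> polyanalytic_funs n) \<Longrightarrow> (\<lambda>z. \<Sum>i\<in>I. F i z) \<in> polyanalytic_funs n"
proof (induction I rule: infinite_finite_induct)
  case (insert x I)
  then show ?case using polyanalytic_funs_add[of "F x" n "\<lambda>z. \<Sum>i\<in>I. F i z"] by simp
qed (simp_all add: polyanalytic_funs_zero)

lemma polyanalytic_funs_diff: "F \<in> polyanalytic_funs n \<Longrightarrow> G \<in> polyanalytic_funs n \<Longrightarrow> (\<lambda>z. F z - G z) \<in> polyanalytic_funs n"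
  using polyanalytic_funs_add[OF _ polyanalytic_funs_cmult[of G n "-1"], of F] by simp

lemma polyanalytic_funs_measurable: "F \<in> polyanalytic_funs n \<Longrightarrow> F \<in> borel_measurable borel"
proof -
  assume "F \<in> polyanalytic_funs n"
  then obtain \<phi> where p: "\<forall>k\<in>K_set n. entire_fun (\<phi> k)" "\<forall>z. F z = (\<Sum>k\<in>K_set n. cmpow z k * \<phi> k z)"
    unfolding polyanalytic_funs_def mem_Collect_eq by (elim exE conjE)
  have 1: "(\<lambda>z. cmpow z k) \<in> borel_measurable borel" for k
    unfolding cmpow_cnj by (intro borel_measurable_cnj exptype_measurable[OF exptype_mpow])
  have "(\<lambda>z. \<Sum>k\<in>K_set n. cmpow z k * \<phi> k z) \<in> borel_measurable borel"
    by (intro borel_measurable_sum borel_measurable_times 1) (use p(1) entire_measurable in blast)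
  then show ?thesis using p(2) by (subst (asm) measurable_cong) auto
qed

text \<open>Expands the power of conj(\<zeta> - z) one factor at a time; throughout, k + m bounds
  the degree in conj(z).\<close>

lemma polyanalytic_funs_shifted_monomial:
  fixes k m n :: "nat^'d::finite"
  assumes "entire_fun \<phi>" "\<forall>j. k $ j + m $ j < n $ j"
  shows "(\<lambda>z. cmpow z m * cnj (mpow (\<zeta> - z) k) * \<phi> z) \<in> polyanalytic_funs n"
  using assms
proof (induction "mabs k" arbitrary: k m \<phi>)
  case 0
  have k: "k = 0" using 0(1) by (auto simp: mabs_def vec_eq_iff)
  have m: "m \<in> K_set n" using 0(3) by (auto simp: K_set_def k)
  define \<psi> where "\<psi> l = (if l = m then \<phi> else (\<lambda>_. 0))" for l
  have "\<forall>l\<in>K_set n. entire_fun (\<psi> l)" using 0(2) by (simp add: \<psi>_def entire_const)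
  moreover have "cmpow z m * cnj (mpow (\<zeta> - z) k) * \<phi> z = (\<Sum>l\<in>K_set n. cmpow z l * \<psi> l z)" for z
  proof -
    have "(\<Sum>l\<in>K_set n. cmpow z l * \<psi> l z) = (\<Sum>l\<in>K_set n. if l = m then cmpow z m * \<phi> z else 0)"
      by (intro sum.cong) (auto simp: \<psi>_def)
    then show ?thesis using m by (simp add: k mpow_def)
  qed
  ultimately show ?case unfolding polyanalytic_funs_def mem_Collect_eq by (intro exI[of _ \<psi>] conjI) auto
next
  case (Suc N)
  obtain j where j: "k $ j > 0"
    using Suc(2) by (metis mabs_def gr0I sum.neutral nat.distinct(1))
  define k' where "k' = k - axis j 1"
  have k: "k = k' + axis j 1" using j by (auto simp: k'_def vec_eq_iff axis_def)
  have "mabs k = mabs k' + mabs (axis j 1)" by (simp add: k mabs_def sum.distrib)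
  moreover have "mabs (axis j 1) = 1"
  proof -
    have "mabs (axis j 1) = (\<Sum>i\<in>UNIV. if i = j then 1 else 0)"
      unfolding mabs_def by (intro sum.cong) (auto simp: axis_def)
    then show ?thesis by simp
  qed
  ultimately have N: "N = mabs k'" using Suc(2) by simp
  have c1: "\<forall>i. k' $ i + m $ i < n $ i"
    using Suc(4) by (auto simp: k intro: le_less_trans[rotated])
  have c2: "\<forall>i. k' $ i + (m + axis j 1) $ i < n $ i"
    using Suc(4) by (simp add: k add.assoc add.left_commute add.commute)
  have "(\<lambda>z. cnj (\<zeta> $ j) * (cmpow z m * cnj (mpow (\<zeta> - z) k') * \<phi> z) - cmpow z (m + axis j 1) * cnj (mpow (\<zeta> - z) k') * \<phi> z) \<in> polyanalytic_funs n"
    by (intro polyanalytic_funs_diff polyanalytic_funs_cmult Suc(1)[OF N Suc(3) c1] Suc(1)[OF N Suc(3) c2])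
  moreover have "cnj (\<zeta> $ j) * (cmpow z m * cnj (mpow (\<zeta> - z) k') * \<phi> z) - cmpow z (m + axis j 1) * cnj (mpow (\<zeta> - z) k') * \<phi> z
      = cmpow z m * cnj (mpow (\<zeta> - z) k) * \<phi> z" for z
    unfolding k cmpow_cnj mpow_add mpow_axis by (simp add: algebra_simps)
  ultimately show ?case by simp
qed

section \<open>Phases of composed shifts\<close>

lemma cdot_diff_cnj: "cdot z v - cdot v z = \<i> * of_real (2 * Im (cdot z v))"
proof -
  have "cdot z v - cnj (cdot z v) = \<i> * of_real (2 * Im (cdot z v))" by (simp add: complex_eq_iff)
  then show ?thesis by (simp add: cdot_cnj)
qed

lemma beta_beta_cis: "beta_op z (beta_op v f) \<zeta> = cis (pi * Im (cdot z v)) * beta_op (z + v) f \<zeta>"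
proof -
  have "of_real (pi / 2) * (cdot z v - cdot v z) = \<i> * of_real (pi * Im (cdot z v))"
    unfolding cdot_diff_cnj by simp
  then show ?thesis unfolding beta_beta by (simp only: cis_conv_exp)
qed

lemma Im_cdot_swap: "Im (cdot v z) = - Im (cdot z v)"
  using cdot_cnj[of z v] by (metis cnj.sel(2))

text \<open>The phases of the two orders differ by \<open>cis (2 * pi * Im (cdot z v))\<close>,
  which is 1 when the symplectic form is an integer.\<close>

lemma beta_commute:
  assumes "Im (cdot z v) \<in> \<int>"
  shows "beta_op z (beta_op v f) \<zeta> = beta_op v (beta_op z f) \<zeta>"
proof -
  have "cis (pi * Im (cdot z v)) = cis (pi * Im (cdot v z)) * cis (2 * pi * Im (cdot z v))"
    unfolding cis_mult Im_cdot_swap[of v z] by (rule arg_cong[where f=cis]) (simp add: algebra_simps)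
  also have "cis (2 * pi * Im (cdot z v)) = 1" using assms by (rule cis_multiple_2pi)
  finally show ?thesis unfolding beta_beta_cis by (simp add: add.commute)
qed

text \<open>Shifting by w - v and evaluating at w separates the variables: a phase common to all
  \<mu>, a character in w depending on \<mu>, and a function of v alone. The first disappears in the
  modulus, the second produces orthogonality after integration over w.\<close>

lemma beta_beta_diagonal:
  "of_real (exp (- (pi / 2) * (norm w)\<^sup>2)) * beta_op \<mu> (beta_op (w - v) e) w
     = cis (- pi * Im (cdot v w)) * (cis (2 * pi * Im (cdot \<mu> w)) * (cis (- 2 * pi * Im (cdot \<mu> v)) * (of_real (exp (- (pi / 2) * (norm v)\<^sup>2)) * beta_op \<mu> e v)))"
proof -
  have c: "cis (- pi * Im (cdot v w)) = exp (of_real (- pi / 2) * (cdot v w - cdot w v))"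
      "cis (2 * pi * Im (cdot \<mu> w)) = exp (of_real pi * (cdot \<mu> w - cdot w \<mu>))"
      "cis (- 2 * pi * Im (cdot \<mu> v)) = exp (of_real (- pi) * (cdot \<mu> v - cdot v \<mu>))"
    unfolding cis_conv_exp cdot_diff_cnj by (auto intro!: arg_cong[where f=exp] simp: algebra_simps)
  have g: "of_real (exp (- (pi / 2) * (norm x)\<^sup>2)) = exp (of_real (- pi / 2) * cdot x x)" for x
    unfolding cdot_self exp_of_real[symmetric] by (rule arg_cong[where f=exp]) simp
  have arg: "w - \<mu> - (w - v) = v - \<mu>" by simp
  have E: "of_real (- pi / 2) * cdot w w + ((of_real pi * cdot \<mu> w - of_real (pi / 2) * cdot \<mu> \<mu>) + (of_real pi * cdot (w - v) (w - \<mu>) - of_real (pi / 2) * cdot (w - v) (w - v)))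
     = of_real (- pi / 2) * (cdot v w - cdot w v) + (of_real pi * (cdot \<mu> w - cdot w \<mu>) + (of_real (- pi) * (cdot \<mu> v - cdot v \<mu>) + (of_real (- pi / 2) * cdot v v + (of_real pi * cdot \<mu> v - of_real (pi / 2) * cdot \<mu> \<mu>))))"
    by (simp add: cdot_diff_left cdot_diff_right field_simps)
  show ?thesis
    unfolding c g beta_op_cdot arg
    using arg_cong[OF arg_cong[OF E, of exp], of "\<lambda>x. x * e (v - \<mu>)"]
    by (simp only: exp_add mult.assoc)
qed

definition shift_sum :: "((complex^'d) \<times> (nat^'d)) set \<Rightarrow> ((complex^'d) \<times> (nat^'d) \<Rightarrow> complex) \<Rightarrow> complex^'d::finite \<Rightarrow> complex" where
  "shift_sum T a \<zeta> = (\<Sum>i\<in>T. a i * beta_op (fst i) (ek (snd i)) \<zeta>)"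

definition riesz_lower :: "nat^'d::finite \<Rightarrow> (complex^'d) set \<Rightarrow> real \<Rightarrow> bool" where
  "riesz_lower n \<Gamma> c \<longleftrightarrow> (\<forall>T a. finite T \<and> T \<subseteq> \<Gamma> \<times> K_set n \<longrightarrow>
      c * (\<Sum>i\<in>T. (cmod (a i))\<^sup>2) \<le> Re (fock_inner (shift_sum T a) (shift_sum T a)))"

lemma exptype_shift_sum: "exptype (shift_sum T a)"
  unfolding shift_sum_def[abs_def] by (intro exptype_sum exptype_cmult exptype_beta exptype_ek)

text \<open>The pairing makes \<open>G0.lat\<close> the lattice adjoint to \<open>G.lat\<close>.\<close>

locale lattice_pair = G: lattice_coords L + G0: lattice_coords L0
  for L L0 :: "complex^'d::finite \<Rightarrow> real^'m::finite" +
  assumes pairing: "Im (cdot z v) = L z \<bullet> L0 v"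
begin

lemma pairing_int: "z \<in> G.lat \<Longrightarrow> v \<in> G0.lat \<Longrightarrow> Im (cdot z v) \<in> \<int>"
  unfolding pairing inner_vec_def by (intro Ints_sum) (auto simp: G.lat_def G0.lat_def intvec_def)

lemma cis_chi: "cis (2 * pi * Im (cdot \<mu> w)) = G.chi (- L0 \<mu>) w"
proof -
  have "Im (cdot \<mu> w) = - (L w \<bullet> L0 \<mu>)" using Im_cdot_swap[of \<mu> w] pairing[of w \<mu>] by simp
  then show ?thesis by (simp add: G.chi_def inner_commute)
qed

lemma sampling_imp_riesz:
  assumes S: "sampling_seq n G.lat"
  shows "\<exists>c>0. riesz_lower n G0.lat c"
proof -
  obtain A where A: "A > 0" "\<And>F. F \<in> polyfock_space n \<Longrightarrow> ennreal A * fock_norm2 F \<le> (\<Sum>\<^sub>\<infinity>z\<in>G.lat. ennreal ((cmod (F z))\<^sup>2 * exp (- pi * (norm z)\<^sup>2)))"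
    using S unfolding sampling_seq_def by blast
  obtain e where e: "bij_betw e (UNIV::nat set) G.lat" by (rule G.ex_enum)
  \<comment> \<open>The samples will appear as weighted values of h at w - e m, so the tiling runs
    over the negatives.\<close>
  note e' = G.bij_uminus[OF e]
  \<comment> \<open>The smallest squared norm of a window; the default 1 covers an empty
    \<open>K_set n\<close>.\<close>
  obtain c0 where c0: "c0 > 0" "\<And>k. k \<in> K_set n \<Longrightarrow> c0 \<le> ek_norm2 k"
  proof (cases "K_set n = {}")
    case False
    then have "Min (ek_norm2 ` K_set n) \<in> ek_norm2 ` K_set n" by (intro Min_in) auto
    then have "Min (ek_norm2 ` K_set n) > 0" using ek_norm2_pos by auto
    then show thesis using that[of "Min (ek_norm2 ` K_set n)"] by simp
  qed (use that[of 1] in simp)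
  have "riesz_lower n G0.lat (A * G.vol * c0)"
    unfolding riesz_lower_def
  proof (intro allI impI)
    fix T :: "((complex^'d) \<times> (nat^'d)) set" and a
    assume T: "finite T \<and> T \<subseteq> G0.lat \<times> K_set n"
    let ?h = "shift_sum T a"
    define S where "S w z = (\<Sum>i\<in>T. a i * beta_op (fst i) (beta_op z (ek (snd i))) w)" for w z
    \<comment> \<open>As a function of z, the conjugate of \<open>beta_op z (ek k)\<close> at a
      fixed point is a holomorphic exponential times a polynomial in conj(z), apart from exp(-(pi/2)
      |z|^2). The first exponential removes that factor, which makes \<open>F w\<close>
      polyanalytic; the factor in w prepares the weight for the integral over w.\<close>
    define F where "F w z = of_real (exp (pi / 2 * (norm z)\<^sup>2) * exp (- (pi / 2) * (norm w)\<^sup>2)) * cnj (S w z)" for w z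
    define B where "B i v = cis (- 2 * pi * Im (cdot (fst i) v)) * (of_real (exp (- (pi / 2) * (norm v)\<^sup>2)) * beta_op (fst i) (ek (snd i)) v)" for i :: "(complex^'d) \<times> (nat^'d)" and v
    define g where "g i j = (\<integral>v. B i v * cnj (B j v) \<partial>lborel)" for i j
    have gB: "gauss_dom (pi / 2) (B i)" for i
    proof -
      have 1: "gauss_dom 0 (\<lambda>v. cis (- 2 * pi * Im (cdot (fst i) v)))"
      proof (rule gauss_domI[where A=1 and B=0])
        show "(\<lambda>v. cis (- 2 * pi * Im (cdot (fst i) v))) \<in> borel_measurable borel"
          by (intro borel_measurable_continuous_onI continuous_intros)
      qed simp
      have 2: "gauss_dom (pi / 2) (\<lambda>v::complex^'d. complex_of_real (exp (- (pi / 2) * (norm v)\<^sup>2)))"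
        by (rule gauss_domI[where A=1 and B=0]) auto
      show ?thesis
        unfolding B_def[abs_def] using gauss_dom_mult[OF 1 gauss_dom_mult[OF 2 exptype_gauss_dom[OF exptype_beta[OF exptype_ek]]]] by simp
    qed
    have iB: "integrable lborel (\<lambda>v. B i v * cnj (B j v))" for i j
      by (rule gauss_dom_integrable[OF gauss_dom_mult[OF gB gauss_dom_cnj[OF gB]]]) simp
    have Fsq: "(cmod (F w z))\<^sup>2 * exp (- pi * (norm z)\<^sup>2) = (cmod (of_real (exp (- (pi / 2) * (norm w)\<^sup>2)) * S w z))\<^sup>2" for w z
    proof -
      have "(exp (pi / 2 * (norm z)\<^sup>2))\<^sup>2 * exp (- pi * (norm z)\<^sup>2) = 1"
        by (simp add: exp_double[symmetric] exp_add[symmetric])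
      then show ?thesis
        unfolding F_def norm_mult of_real_mult power_mult_distrib complex_mod_cnj norm_of_real abs_exp_cancel
        by (simp add: mult_ac)
    qed
    \<comment> \<open>The substitution z = w - v makes \<open>beta_beta_diagonal\<close> applicable,
      and the phase shared by all terms drops out of the modulus.\<close>
    have Sdiag: "cmod (of_real (exp (- (pi / 2) * (norm w)\<^sup>2)) * S w (w - v)) = cmod (\<Sum>i\<in>T. a i * (G.chi (- L0 (fst i)) w * B i v))" for w v
    proof -
      have "of_real (exp (- (pi / 2) * (norm w)\<^sup>2)) * S w (w - v) = (\<Sum>i\<in>T. a i * (of_real (exp (- (pi / 2) * (norm w)\<^sup>2)) * beta_op (fst i) (beta_op (w - v) (ek (snd i))) w))"
        by (simp add: S_def sum_distrib_left mult_ac)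
      also have "\<dots> = cis (- pi * Im (cdot v w)) * (\<Sum>i\<in>T. a i * (G.chi (- L0 (fst i)) w * B i v))"
        unfolding beta_beta_diagonal cis_chi B_def sum_distrib_left
        by (intro sum.cong refl) (simp only: mult_ac)
      finally show ?thesis by (simp add: norm_mult)
    qed
    \<comment> \<open>This will be the squared norm of \<open>F w\<close>; its dependence on w is
      that of a trigonometric polynomial.\<close>
    define R where "R w = (\<Sum>i\<in>T. \<Sum>j\<in>T. (a i * cnj (a j)) * (G.chi (L0 (fst j) - L0 (fst i)) w * g i j))" for w
    have Fnorm: "fock_norm2 (F w) = ennreal (Re (R w))" and R0: "Re (R w) \<ge> 0" for w
    proof -
      let ?P = "\<lambda>v. \<Sum>i\<in>T. a i * (G.chi (- L0 (fst i)) w * B i v)"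
      have gP: "gauss_dom (pi / 2) ?P" by (intro gauss_dom_sum gauss_dom_cmult gB)
      have Smeas: "(\<lambda>z. S w z) \<in> borel_measurable borel"
      proof -
        have "gauss_dom 0 (\<lambda>z. beta_op \<mu> (beta_op z (ek k)) w)" for \<mu> k
          unfolding beta_op_cdot[of \<mu>] by (intro gauss_dom_cmult gauss_dom_beta_snd exptype_ek)
        then have "gauss_dom 0 (S w)" unfolding S_def[abs_def] by (intro gauss_dom_sum gauss_dom_cmult)
        then show ?thesis by (simp add: gauss_dom_def)
      qed
      have "fock_norm2 (F w) = (\<integral>\<^sup>+z. ennreal ((cmod (of_real (exp (- (pi / 2) * (norm w)\<^sup>2)) * S w z))\<^sup>2) \<partial>lborel)"
        unfolding fock_norm2_def Fsq ..
      also have "\<dots> = (\<integral>\<^sup>+v. ennreal ((cmod (of_real (exp (- (pi / 2) * (norm w)\<^sup>2)) * S w (w - v)))\<^sup>2) \<partial>lborel)"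
        by (rule nn_integral_lborel_reflect[symmetric, where f="\<lambda>z. ennreal ((cmod (of_real (exp (- (pi / 2) * (norm w)\<^sup>2)) * S w z))\<^sup>2)"])
           (use Smeas in measurable)
      also have "\<dots> = (\<integral>\<^sup>+v. ennreal ((cmod (?P v))\<^sup>2) \<partial>lborel)" unfolding Sdiag ..
      finally have 1: "fock_norm2 (F w) = (\<integral>\<^sup>+v. ennreal ((cmod (?P v))\<^sup>2) \<partial>lborel)" .
      have eq: "?P v * cnj (?P v) = of_real ((cmod (?P v))\<^sup>2)" for v by (rule complex_norm_square[symmetric])
      have "integrable lborel (\<lambda>v. ?P v * cnj (?P v))"
        by (rule gauss_dom_integrable[OF gauss_dom_mult[OF gP gauss_dom_cnj[OF gP]]]) simp
      then have i: "integrable lborel (\<lambda>v. (cmod (?P v))\<^sup>2)" unfolding eq complex_of_real_integrable_eq .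
      have "complex_of_real (\<integral>v. (cmod (?P v))\<^sup>2 \<partial>lborel) = (\<integral>v. ?P v * cnj (?P v) \<partial>lborel)"
        unfolding eq by (rule integral_complex_of_real[symmetric])
      also have "\<dots> = (\<integral>v. (\<Sum>i\<in>T. \<Sum>j\<in>T. ((a i * cnj (a j)) * G.chi (L0 (fst j) - L0 (fst i)) w) * (B i v * cnj (B j v))) \<partial>lborel)"
      proof (intro Bochner_Integration.integral_cong refl)
        fix v
        have "G.chi (- L0 (fst i)) w * cnj (G.chi (- L0 (fst j)) w) = G.chi (L0 (fst j) - L0 (fst i)) w" for i j :: "(complex^'d) \<times> (nat^'d)"
          using G.chi_add_left[of "- L0 (fst i)" "L0 (fst j)" w] by (simp add: G.chi_minus)
        then have "(a i * (G.chi (- L0 (fst i)) w * B i v)) * cnj (a j * (G.chi (- L0 (fst j)) w * B j v)) = ((a i * cnj (a j)) * G.chi (L0 (fst j) - L0 (fst i)) w) * (B i v * cnj (B j v))" for i j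
          by (simp add: mult_ac)
        then show "?P v * cnj (?P v) = (\<Sum>i\<in>T. \<Sum>j\<in>T. ((a i * cnj (a j)) * G.chi (L0 (fst j) - L0 (fst i)) w) * (B i v * cnj (B j v)))"
          unfolding cnj_sum sum_product by (intro sum.cong refl)
      qed
      also have "\<dots> = (\<Sum>i\<in>T. \<Sum>j\<in>T. ((a i * cnj (a j)) * G.chi (L0 (fst j) - L0 (fst i)) w) * g i j)"
        unfolding g_def
        by (subst Bochner_Integration.integral_sum, intro Bochner_Integration.integrable_sum integrable_mult_right iB,
            intro sum.cong refl, subst Bochner_Integration.integral_sum, intro integrable_mult_right iB,
            intro sum.cong refl, rule integral_mult_right_zero)
      also have "\<dots> = R w" unfolding R_def by (simp only: mult.assoc)
      finally have 2: "complex_of_real (\<integral>v. (cmod (?P v))\<^sup>2 \<partial>lborel) = R w" .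
      then have 3: "Re (R w) = (\<integral>v. (cmod (?P v))\<^sup>2 \<partial>lborel)" by (rule subst[where P="\<lambda>x. Re x = _"]) (rule Re_complex_of_real)
      show "Re (R w) \<ge> 0" unfolding 3 by simp
      show "fock_norm2 (F w) = ennreal (Re (R w))"
        unfolding 1 3 by (rule nn_integral_eq_integral[OF i]) simp
    qed
    have Fpoly: "F w \<in> polyfock_space n" for w
    proof -
      have "F w \<in> polyanalytic_funs n"
      proof -
        have tm: "(\<lambda>z. of_real (exp (pi / 2 * (norm z)\<^sup>2)) * cnj (beta_op \<mu> (beta_op z (ek k)) w)) \<in> polyanalytic_funs n" if k: "k \<in> K_set n" for \<mu> k
        proof -
          define b where "b = cnj (exp (of_real pi * cdot \<mu> w - of_real (pi / 2) * cdot \<mu> \<mu>)) * of_real (ek_coeff k)"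
          have "(\<lambda>z. b * (cmpow z 0 * cnj (mpow ((w - \<mu>) - z) k) * exp (of_real pi * cdot (w - \<mu>) z))) \<in> polyanalytic_funs n"
            by (intro polyanalytic_funs_cmult polyanalytic_funs_shifted_monomial entire_exp entire_cmult entire_cdot)
               (use k in \<open>auto simp: K_set_def\<close>)
          moreover have "b * (cmpow z 0 * cnj (mpow ((w - \<mu>) - z) k) * exp (of_real pi * cdot (w - \<mu>) z)) = of_real (exp (pi / 2 * (norm z)\<^sup>2)) * cnj (beta_op \<mu> (beta_op z (ek k)) w)" for z
          proof -
            have "of_real (exp (pi / 2 * (norm z)\<^sup>2)) = exp (of_real (pi / 2) * cdot z z)"
              unfolding cdot_self exp_of_real[symmetric] by simp
            moreover have "cnj (exp (of_real pi * cdot z (w - \<mu>) - of_real (pi / 2) * cdot z z)) = exp (of_real pi * cdot (w - \<mu>) z - of_real (pi / 2) * cdot z z)"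
              by (simp add: exp_cnj cdot_cnj)
            moreover have "exp (of_real (pi / 2) * cdot z z) * exp (of_real pi * cdot (w - \<mu>) z - of_real (pi / 2) * cdot z z) = exp (of_real pi * cdot (w - \<mu>) z)"
              by (simp add: mult_exp_exp)
            ultimately show ?thesis
              unfolding beta_op_cdot ek_def b_def ek_coeff_def[symmetric] complex_cnj_mult
              by ((simp add: cmpow_def mult_ac); (metis mult.assoc mult.commute)?)
          qed
          ultimately show ?thesis by simp
        qed
        have "(\<lambda>z. of_real (exp (- (pi / 2) * (norm w)\<^sup>2)) * (\<Sum>i\<in>T. cnj (a i) * (of_real (exp (pi / 2 * (norm z)\<^sup>2)) * cnj (beta_op (fst i) (beta_op z (ek (snd i))) w)))) \<in> polyanalytic_funs n"
          by (intro polyanalytic_funs_cmult polyanalytic_funs_sum tm) (use T in auto)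
        moreover have "of_real (exp (- (pi / 2) * (norm w)\<^sup>2)) * (\<Sum>i\<in>T. cnj (a i) * (of_real (exp (pi / 2 * (norm z)\<^sup>2)) * cnj (beta_op (fst i) (beta_op z (ek (snd i))) w))) = F w z" for z
          unfolding F_def S_def cnj_sum complex_cnj_mult of_real_mult sum_distrib_left
          by (intro sum.cong refl) (simp only: mult_ac)
        ultimately show ?thesis by simp
      qed
      moreover have "fock_norm2 (F w) < \<infinity>" unfolding Fnorm by simp
      ultimately show ?thesis unfolding polyfock_alt by blast
    qed
    \<comment> \<open>At lattice points the two shifts commute, so the samples of \<open>F w\<close>
      become values of shifts of the single function h.\<close>
    have Q: "(\<Sum>\<^sub>\<infinity>z\<in>G.lat. ennreal ((cmod (F w z))\<^sup>2 * exp (- pi * (norm z)\<^sup>2))) = (\<Sum>n. ennreal ((cmod (?h (w + - e n)))\<^sup>2 * exp (- pi * (norm (w + - e n))\<^sup>2)))" for w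
      unfolding infsum_ennreal_enum[OF e]
    proof (rule suminf_cong)
      fix m
      have "S w (e m) = beta_op (e m) ?h w"
      proof -
        have "S w (e m) = (\<Sum>i\<in>T. a i * beta_op (e m) (beta_op (fst i) (ek (snd i))) w)"
          unfolding S_def
        proof (intro sum.cong refl)
          fix i assume "i \<in> T"
          then have "fst i \<in> G0.lat" using T by auto
          then have "Im (cdot (e m) (fst i)) \<in> \<int>" by (rule pairing_int[OF G.e_lat[OF e]])
          from beta_commute[OF this, of "ek (snd i)" w]
          show "a i * beta_op (fst i) (beta_op (e m) (ek (snd i))) w = a i * beta_op (e m) (beta_op (fst i) (ek (snd i))) w" by simp
        qed
        also have "\<dots> = beta_op (e m) ?h w"
          unfolding shift_sum_def[abs_def] beta_sum beta_cmult ..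
        finally show ?thesis .
      qed
      then have "(cmod (F w (e m)))\<^sup>2 * exp (- pi * (norm (e m))\<^sup>2) = (exp (- (pi / 2) * (norm w)\<^sup>2))\<^sup>2 * (cmod (beta_op (e m) ?h w))\<^sup>2"
        unfolding Fsq by (simp add: norm_mult power_mult_distrib)
      also have "(exp (- (pi / 2) * (norm w)\<^sup>2))\<^sup>2 = exp (- pi * (norm w)\<^sup>2)"
        by (simp add: exp_double[symmetric])
      also have "exp (- pi * (norm w)\<^sup>2) * (cmod (beta_op (e m) ?h w))\<^sup>2 = (cmod (?h (w + - e m)))\<^sup>2 * exp (- pi * (norm (w + - e m))\<^sup>2)"
        using cmod_beta[of "e m" ?h w] by (simp add: mult.commute)
      finally show "ennreal ((cmod (F w (e m)))\<^sup>2 * exp (- pi * (norm (e m))\<^sup>2)) = ennreal ((cmod (?h (w + - e m)))\<^sup>2 * exp (- pi * (norm (w + - e m))\<^sup>2))" by simp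
    qed
    \<comment> \<open>For equal \<mu> the phases cancel and the orthogonality of the windows
      remains. These are the pairs that survive the integral over w.\<close>
    have gm: "g i j = (if i = j then of_real (ek_norm2 (snd i)) else 0)" if "fst i = fst j" for i j
    proof -
      have "B i v * cnj (B j v) = beta_op (fst i) (ek (snd i)) v * cnj (beta_op (fst i) (ek (snd j)) v) * gauss v" for v
      proof -
        have "cis (- 2 * pi * Im (cdot (fst i) v)) * cnj (cis (- 2 * pi * Im (cdot (fst i) v))) = 1"
          using complex_norm_square[of "cis (- 2 * pi * Im (cdot (fst i) v))"] by simp
        moreover have "complex_of_real (exp (- (pi / 2) * (norm v)\<^sup>2)) * of_real (exp (- (pi / 2) * (norm v)\<^sup>2)) = gauss v"
          unfolding gauss_def of_real_mult[symmetric] exp_add[symmetric] by (simp add: field_simps)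
        moreover have "B i v * cnj (B j v) = (cis (- 2 * pi * Im (cdot (fst i) v)) * cnj (cis (- 2 * pi * Im (cdot (fst i) v)))) * (beta_op (fst i) (ek (snd i)) v * cnj (beta_op (fst i) (ek (snd j)) v) * (complex_of_real (exp (- (pi / 2) * (norm v)\<^sup>2)) * of_real (exp (- (pi / 2) * (norm v)\<^sup>2))))"
          unfolding B_def that[symmetric] complex_cnj_mult complex_cnj_complex_of_real by (simp only: mult_ac)
        ultimately show ?thesis by simp
      qed
      then have "g i j = fock_inner (beta_op (fst i) (ek (snd i))) (beta_op (fst i) (ek (snd j)))"
        unfolding g_def fock_inner_gauss by simp
      also have "\<dots> = fock_inner (ek (snd i)) (ek (snd j))"
        by (rule fock_inner_beta) (intro exptype_measurable exptype_ek)+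
      finally show ?thesis using that by (auto simp: ek_inner prod_eq_iff)
    qed
    have IR: "(\<integral>w. indicator G.fdom w * R w \<partial>lborel) = of_real (G.vol * (\<Sum>i\<in>T. (cmod (a i))\<^sup>2 * ek_norm2 (snd i)))"
      and iR: "integrable lborel (\<lambda>w. indicator G.fdom w * R w)"
    proof -
      have ch: "L0 (fst j) - L0 (fst i) \<in> intvec" if "i \<in> T" "j \<in> T" for i j
        using T that by (intro intvec_diff) (auto simp: G0.lat_def)
      have ic: "integrable lborel (\<lambda>w. indicator G.fdom w * G.chi k w)" for k
        by (rule G.continuous_integrable_fdom[OF G.chi_cont])
      have eq: "indicator G.fdom w * R w = (\<Sum>i\<in>T. \<Sum>j\<in>T. ((a i * cnj (a j)) * g i j) * (indicator G.fdom w * G.chi (L0 (fst j) - L0 (fst i)) w))" for w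
        unfolding R_def sum_distrib_left by (intro sum.cong refl) (simp only: mult_ac)
      show "integrable lborel (\<lambda>w. indicator G.fdom w * R w)"
        unfolding eq by (intro Bochner_Integration.integrable_sum integrable_mult_right ic)
      have "(\<integral>w. indicator G.fdom w * R w \<partial>lborel) = (\<Sum>i\<in>T. \<Sum>j\<in>T. ((a i * cnj (a j)) * g i j) * (\<integral>w. indicator G.fdom w * G.chi (L0 (fst j) - L0 (fst i)) w \<partial>lborel))"
        unfolding eq
        by (subst Bochner_Integration.integral_sum, intro Bochner_Integration.integrable_sum integrable_mult_right ic,
            intro sum.cong refl, subst Bochner_Integration.integral_sum, intro integrable_mult_right ic,
            intro sum.cong refl, rule integral_mult_right_zero)
      also have "\<dots> = (\<Sum>i\<in>T. \<Sum>j\<in>T. if j = i then of_real (G.vol * ((cmod (a i))\<^sup>2 * ek_norm2 (snd i))) else 0)"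
      proof (intro sum.cong refl)
        fix i j assume ij: "i \<in> T" "j \<in> T"
        have inj: "L0 (fst j) - L0 (fst i) = 0 \<longleftrightarrow> fst i = fst j"
          using G0.L_inv(2) by (metis eq_iff_diff_eq_0)
        show "((a i * cnj (a j)) * g i j) * (\<integral>w. indicator G.fdom w * G.chi (L0 (fst j) - L0 (fst i)) w \<partial>lborel) = (if j = i then of_real (G.vol * ((cmod (a i))\<^sup>2 * ek_norm2 (snd i))) else 0)"
        proof (cases "fst i = fst j")
          case True
          show ?thesis
            unfolding G.chi_integral[OF ch[OF ij]] inj gm[OF True] using True
            by (auto simp: complex_norm_square mult_ac simp del: of_real_power)
        next
          case False
          then show ?thesis unfolding G.chi_integral[OF ch[OF ij]] inj by auto
        qed
      qed
      also have "\<dots> = of_real (G.vol * (\<Sum>i\<in>T. (cmod (a i))\<^sup>2 * ek_norm2 (snd i)))"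
        using T by (simp add: sum_distrib_left)
      finally show "(\<integral>w. indicator G.fdom w * R w \<partial>lborel) = of_real (G.vol * (\<Sum>i\<in>T. (cmod (a i))\<^sup>2 * ek_norm2 (snd i)))" .
    qed
    have nnR: "(\<integral>\<^sup>+w. ennreal (Re (R w)) * indicator G.fdom w \<partial>lborel) = ennreal (G.vol * (\<Sum>i\<in>T. (cmod (a i))\<^sup>2 * ek_norm2 (snd i)))"
    proof -
      have "(\<integral>\<^sup>+w. ennreal (Re (R w)) * indicator G.fdom w \<partial>lborel) = (\<integral>\<^sup>+w. ennreal (Re (indicator G.fdom w * R w)) \<partial>lborel)"
        by (intro nn_integral_cong) (auto simp: indicator_def)
      also have "\<dots> = ennreal (\<integral>w. Re (indicator G.fdom w * R w) \<partial>lborel)"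
        by (rule nn_integral_eq_integral[OF integrable_Re[OF iR]]) (use R0 in \<open>auto simp: indicator_def\<close>)
      also have "(\<integral>w. Re (indicator G.fdom w * R w) \<partial>lborel) = G.vol * (\<Sum>i\<in>T. (cmod (a i))\<^sup>2 * ek_norm2 (snd i))"
        unfolding integral_Re[OF iR] IR by (rule Re_complex_of_real)
      finally show ?thesis .
    qed
    have [measurable]: "?h \<in> borel_measurable borel" by (rule exptype_measurable[OF exptype_shift_sum])
    have Rm [measurable]: "R \<in> borel_measurable borel" unfolding R_def[abs_def] by measurable
    \<comment> \<open>The sampling inequality integrated over w: the left side extracts the constant
      term of R, the right side is tiled into the full norm of h.\<close>
    have "ennreal A * (\<integral>\<^sup>+w. ennreal (Re (R w)) * indicator G.fdom w \<partial>lborel) = (\<integral>\<^sup>+w. ennreal A * ennreal (Re (R w)) * indicator G.fdom w \<partial>lborel)"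
      by (subst nn_integral_cmult[symmetric], measurable) (simp add: mult.assoc)
    also have "\<dots> \<le> (\<integral>\<^sup>+w. (\<Sum>n. ennreal ((cmod (?h (w + - e n)))\<^sup>2 * exp (- pi * (norm (w + - e n))\<^sup>2))) * indicator G.fdom w \<partial>lborel)"
    proof (rule nn_integral_mono, rule mult_right_mono)
      show "ennreal A * ennreal (Re (R w)) \<le> (\<Sum>n. ennreal ((cmod (?h (w + - e n)))\<^sup>2 * exp (- pi * (norm (w + - e n))\<^sup>2)))" for w
        using A(2)[OF Fpoly[of w]] unfolding Fnorm Q .
    qed simp
    also have "\<dots> = fock_norm2 ?h"
      unfolding fock_norm2_def by (rule G.tiling[OF e', symmetric]) measurable
    also have "\<dots> = ennreal (Re (fock_inner ?h ?h))" by (rule exptype_fock_norm2[OF exptype_shift_sum])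
    finally have "ennreal A * ennreal (G.vol * (\<Sum>i\<in>T. (cmod (a i))\<^sup>2 * ek_norm2 (snd i))) \<le> ennreal (Re (fock_inner ?h ?h))"
      unfolding nnR .
    moreover have nn: "0 \<le> G.vol * (\<Sum>i\<in>T. (cmod (a i))\<^sup>2 * ek_norm2 (snd i))"
      using G.vol_pos ek_norm2_pos by (intro mult_nonneg_nonneg sum_nonneg) (auto intro: less_imp_le)
    ultimately have "A * (G.vol * (\<Sum>i\<in>T. (cmod (a i))\<^sup>2 * ek_norm2 (snd i))) \<le> Re (fock_inner ?h ?h)"
      using A(1) exptype_norm_nonneg[OF exptype_shift_sum, of T a] by (simp add: ennreal_mult[symmetric] ennreal_le_iff)
    moreover have "A * G.vol * c0 * (\<Sum>i\<in>T. (cmod (a i))\<^sup>2) \<le> A * (G.vol * (\<Sum>i\<in>T. (cmod (a i))\<^sup>2 * ek_norm2 (snd i)))"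
    proof -
      have "c0 * (\<Sum>i\<in>T. (cmod (a i))\<^sup>2) \<le> (\<Sum>i\<in>T. (cmod (a i))\<^sup>2 * ek_norm2 (snd i))"
        unfolding sum_distrib_left
      proof (rule sum_mono)
        fix i assume "i \<in> T"
        then have "snd i \<in> K_set n" using T by auto
        then show "c0 * (cmod (a i))\<^sup>2 \<le> (cmod (a i))\<^sup>2 * ek_norm2 (snd i)"
          using mult_left_mono[OF c0(2), of "snd i" "(cmod (a i))\<^sup>2"] by (simp add: mult.commute)
      qed
      then have "(A * G.vol) * (c0 * (\<Sum>i\<in>T. (cmod (a i))\<^sup>2)) \<le> (A * G.vol) * (\<Sum>i\<in>T. (cmod (a i))\<^sup>2 * ek_norm2 (snd i))"
        using A(1) G.vol_pos by (intro mult_left_mono) auto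
      then show ?thesis by (simp only: mult.assoc)
    qed
    ultimately show "A * G.vol * c0 * (\<Sum>i\<in>T. (cmod (a i))\<^sup>2) \<le> Re (fock_inner ?h ?h)" by linarith
  qed
  moreover have "A * G.vol * c0 > 0" using A(1) c0(1) G.vol_pos by simp
  ultimately show ?thesis by blast
qed

end

section \<open>Interpolation and the lower Riesz inequality\<close>

text \<open>Exactly what Cauchy-Schwarz asks for, so that it applies alike to functions of
  exponential type and to members of \<open>fock_space\<close>.\<close>

definition fock_L2 :: "(complex^'d::finite \<Rightarrow> complex) \<Rightarrow> bool" where
  "fock_L2 F \<longleftrightarrow> F \<in> borel_measurable borel \<and> fock_norm2 F < \<infinity>"

lemma fock_L2_exptype: "exptype f \<Longrightarrow> fock_L2 f"
  unfolding fock_L2_def using exptype_measurable exptype_fock_norm2 by (metis ennreal_less_top infinity_ennreal_def)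

lemma fock_L2_inner_aux:
  assumes F: "fock_L2 F" and G: "fock_L2 G"
  shows fock_L2_integrable: "integrable lborel (\<lambda>z. F z * cnj (G z) * gauss z)"
    and fock_L2_inner_le: "ennreal ((cmod (fock_inner F G))\<^sup>2) \<le> fock_norm2 F * fock_norm2 G"
proof -
  have [measurable]: "F \<in> borel_measurable borel" "G \<in> borel_measurable borel" using F G by (simp_all add: fock_L2_def)
  \<comment> \<open>Half of the exponent of the weight goes to each factor, so that Cauchy-Schwarz
    can be used for plain Lebesgue measure.\<close>
  define f where "f H z = ennreal (cmod (H z) * exp (- (pi / 2) * (norm z)\<^sup>2))" for H :: "complex^'a \<Rightarrow> complex" and z
  have [measurable]: "f H \<in> borel_measurable borel" if [measurable]: "H \<in> borel_measurable borel" for H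
    unfolding f_def[abs_def] by measurable
  have sq: "fock_norm2 H = (\<integral>\<^sup>+z. (f H z)\<^sup>2 \<partial>lborel)" for H
  proof -
    have "(f H z)\<^sup>2 = ennreal ((cmod (H z))\<^sup>2 * exp (- pi * (norm z)\<^sup>2))" for z
    proof -
      have "(exp (- (pi / 2) * (norm z)\<^sup>2))\<^sup>2 = exp (- pi * (norm z)\<^sup>2)"
        by (simp add: exp_double[symmetric])
      then show ?thesis unfolding f_def by (simp add: ennreal_power power_mult_distrib)
    qed
    then show ?thesis by (simp only: fock_norm2_def)
  qed
  have pr: "ennreal (cmod (F z * cnj (G z) * gauss z)) = f F z * f G z" for z
  proof -
    have "exp (- pi * (norm z)\<^sup>2) = exp (- (pi / 2) * (norm z)\<^sup>2) * exp (- (pi / 2) * (norm z)\<^sup>2)"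
      unfolding exp_add[symmetric] by simp
    then have "cmod (F z * cnj (G z) * gauss z) = (cmod (F z) * exp (- (pi / 2) * (norm z)\<^sup>2)) * (cmod (G z) * exp (- (pi / 2) * (norm z)\<^sup>2))"
      by (simp add: norm_mult cmod_gauss)
    then show ?thesis unfolding f_def by (simp add: ennreal_mult)
  qed
  have cs: "(\<integral>\<^sup>+z. f F z * f G z \<partial>lborel)\<^sup>2 \<le> fock_norm2 F * fock_norm2 G"
    unfolding sq by (rule Cauchy_Schwarz_nn_integral) measurable
  have "fock_norm2 F * fock_norm2 G < \<infinity>" using F G by (simp add: fock_L2_def ennreal_mult_less_top)
  then have "(\<integral>\<^sup>+z. f F z * f G z \<partial>lborel)\<^sup>2 < \<infinity>" using cs by (rule le_less_trans[rotated])
  then have fin: "(\<integral>\<^sup>+z. f F z * f G z \<partial>lborel) < \<infinity>"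
    by (auto simp: power2_eq_square ennreal_mult_less_top less_top top_unique)
  have [measurable]: "gauss \<in> borel_measurable (borel :: (complex^'a) measure)" by (rule gauss_dom_measurable[OF gauss_dom_gauss])
  have m: "(\<lambda>z. F z * cnj (G z) * gauss z) \<in> borel_measurable lborel" by measurable
  show i: "integrable lborel (\<lambda>z. F z * cnj (G z) * gauss z)"
    by (rule integrableI_bounded[OF m]) (unfold pr, rule fin)
  have "ennreal (cmod (fock_inner F G)) \<le> (\<integral>\<^sup>+z. f F z * f G z \<partial>lborel)"
    unfolding fock_inner_gauss pr[symmetric] by (rule integral_norm_bound_ennreal[OF i])
  then have "(ennreal (cmod (fock_inner F G)))\<^sup>2 \<le> (\<integral>\<^sup>+z. f F z * f G z \<partial>lborel)\<^sup>2"
    by (intro power_mono) auto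
  then show "ennreal ((cmod (fock_inner F G))\<^sup>2) \<le> fock_norm2 F * fock_norm2 G"
    using cs by (simp add: ennreal_power)
qed

lemma fock_norm2_cmult:
  assumes [measurable]: "F \<in> borel_measurable borel"
  shows "fock_norm2 (\<lambda>z. c * F z) = ennreal ((cmod c)\<^sup>2) * fock_norm2 F"
proof -
  have m: "(\<lambda>z. ennreal ((cmod (F z))\<^sup>2 * exp (- pi * (norm z)\<^sup>2))) \<in> borel_measurable lborel" by measurable
  have "fock_norm2 (\<lambda>z. c * F z) = (\<integral>\<^sup>+z. ennreal ((cmod c)\<^sup>2) * ennreal ((cmod (F z))\<^sup>2 * exp (- pi * (norm z)\<^sup>2)) \<partial>lborel)"
    unfolding fock_norm2_def by (intro nn_integral_cong) (simp add: norm_mult power_mult_distrib ennreal_mult mult.assoc)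
  also have "\<dots> = ennreal ((cmod c)\<^sup>2) * fock_norm2 F"
    unfolding fock_norm2_def by (rule nn_integral_cmult[OF m])
  finally show ?thesis .
qed

lemma fock_L2_cmult: "fock_L2 F \<Longrightarrow> fock_L2 (\<lambda>z. c * F z)"
  using borel_measurable_times[OF borel_measurable_const, of F borel c]
  by (simp add: fock_L2_def fock_norm2_cmult ennreal_mult_less_top)

lemma fock_norm2_add_le:
  assumes [measurable]: "F \<in> borel_measurable borel" "G \<in> borel_measurable borel"
  shows "fock_norm2 (\<lambda>z. F z + G z) \<le> 2 * fock_norm2 F + 2 * fock_norm2 G"
proof -
  have "fock_norm2 (\<lambda>z. F z + G z) \<le> (\<integral>\<^sup>+z. 2 * ennreal ((cmod (F z))\<^sup>2 * exp (- pi * (norm z)\<^sup>2)) + 2 * ennreal ((cmod (G z))\<^sup>2 * exp (- pi * (norm z)\<^sup>2)) \<partial>lborel)"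
    unfolding fock_norm2_def
  proof (rule nn_integral_mono)
    fix z
    have "(cmod (F z + G z))\<^sup>2 \<le> (cmod (F z) + cmod (G z))\<^sup>2" by (intro power_mono norm_triangle_ineq) simp
    also have "\<dots> \<le> 2 * (cmod (F z))\<^sup>2 + 2 * (cmod (G z))\<^sup>2"
      using sum_squares_bound[of "cmod (F z)" "cmod (G z)"] by (simp add: power2_sum)
    finally have "(cmod (F z + G z))\<^sup>2 * exp (- pi * (norm z)\<^sup>2) \<le> (2 * (cmod (F z))\<^sup>2 + 2 * (cmod (G z))\<^sup>2) * exp (- pi * (norm z)\<^sup>2)"
      by (intro mult_right_mono) auto
    then have "ennreal ((cmod (F z + G z))\<^sup>2 * exp (- pi * (norm z)\<^sup>2)) \<le> ennreal (2 * ((cmod (F z))\<^sup>2 * exp (- pi * (norm z)\<^sup>2)) + 2 * ((cmod (G z))\<^sup>2 * exp (- pi * (norm z)\<^sup>2)))"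
      by (intro ennreal_leI) (simp add: algebra_simps)
    then show "ennreal ((cmod (F z + G z))\<^sup>2 * exp (- pi * (norm z)\<^sup>2)) \<le> 2 * ennreal ((cmod (F z))\<^sup>2 * exp (- pi * (norm z)\<^sup>2)) + 2 * ennreal ((cmod (G z))\<^sup>2 * exp (- pi * (norm z)\<^sup>2))"
      by (simp add: ennreal_mult)
  qed
  also have "\<dots> = 2 * fock_norm2 F + 2 * fock_norm2 G"
    unfolding fock_norm2_def by (subst nn_integral_add, measurable, subst (1 2) nn_integral_cmult, measurable)
  finally show ?thesis .
qed

lemma fock_L2_add: "fock_L2 F \<Longrightarrow> fock_L2 G \<Longrightarrow> fock_L2 (\<lambda>z. F z + G z)"
  unfolding fock_L2_def using fock_norm2_add_le[of F G]
  by (auto simp: ennreal_mult_less_top intro!: le_less_trans[OF fock_norm2_add_le])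

lemma fock_inner_add_cmult:
  assumes "fock_L2 f" "fock_L2 g" "fock_L2 h"
  shows "fock_inner (\<lambda>z. f z + c * g z) h = fock_inner f h + c * fock_inner g h"
proof -
  have "fock_inner (\<lambda>z. f z + c * g z) h = (\<integral>z. f z * cnj (h z) * gauss z + c * (g z * cnj (h z) * gauss z) \<partial>lborel)"
    unfolding fock_inner_gauss by (intro Bochner_Integration.integral_cong refl) (simp add: distrib_right mult.assoc)
  also have "\<dots> = fock_inner f h + c * fock_inner g h"
    unfolding fock_inner_gauss
    by (subst Bochner_Integration.integral_add)
       (intro integrable_mult_right fock_L2_integrable assms, intro integrable_mult_right fock_L2_integrable assms, simp only: integral_mult_right_zero)
  finally show ?thesis .
qed

lemma fock_inner_add_cmult_right:
  assumes "fock_L2 f" "fock_L2 g" "fock_L2 h"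
  shows "fock_inner h (\<lambda>z. f z + c * g z) = fock_inner h f + cnj c * fock_inner h g"
proof -
  have "fock_inner h (\<lambda>z. f z + c * g z) = cnj (fock_inner (\<lambda>z. f z + c * g z) h)" by (rule fock_inner_cnj[symmetric])
  also have "\<dots> = cnj (fock_inner f h) + cnj c * cnj (fock_inner g h)"
    unfolding fock_inner_add_cmult[OF assms] by simp
  finally show ?thesis by (simp only: fock_inner_cnj)
qed

lemma fock_inner_zero: "fock_inner (\<lambda>z. 0) h = 0" "fock_inner h (\<lambda>z. 0) = 0"
  by (simp_all add: fock_inner_def)

lemma fock_L2_sum: "(\<And>i. i \<in> T \<Longrightarrow> fock_L2 (v i)) \<Longrightarrow> fock_L2 (\<lambda>z. \<Sum>i\<in>T. b i * v i z)"
proof (induction T rule: infinite_finite_induct)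
  case (insert x F)
  have "fock_L2 (\<lambda>z. b x * v x z + (\<Sum>i\<in>F. b i * v i z))"
    by (intro fock_L2_add fock_L2_cmult insert(3)) (use insert(4) in auto)
  then show ?case using insert(1,2) by simp
qed (simp_all add: fock_L2_def fock_norm2_def)

lemma fock_inner_sum_right:
  assumes "\<And>i. i \<in> T \<Longrightarrow> fock_L2 (v i)" "fock_L2 h"
  shows "fock_inner h (\<lambda>z. \<Sum>i\<in>T. b i * v i z) = (\<Sum>i\<in>T. cnj (b i) * fock_inner h (v i))"
  using assms
proof (induction T rule: infinite_finite_induct)
  case (insert x F)
  have v: "fock_L2 (v x)" "\<And>i. i \<in> F \<Longrightarrow> fock_L2 (v i)" using insert(4) by auto
  have "fock_inner h (\<lambda>z. (\<Sum>i\<in>F. b i * v i z) + b x * v x z) = fock_inner h (\<lambda>z. \<Sum>i\<in>F. b i * v i z) + cnj (b x) * fock_inner h (v x)"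
    by (rule fock_inner_add_cmult_right[OF fock_L2_sum[OF v(2)] v(1) insert(5)])
  then show ?case using insert(1,2) insert(3)[OF v(2) insert(5)] by (simp add: add.commute)
qed (simp_all add: fock_inner_zero)

text \<open>Evaluation at z is the inner product with the kernel at z, whose squared norm is the
  value of the kernel on the diagonal. It turns norm estimates into locally uniform ones.\<close>

lemma exptype_pointwise:
  assumes f: "exptype f"
  shows "(cmod (f z))\<^sup>2 \<le> exp (pi * (norm z)\<^sup>2) * Re (fock_inner f f)"
proof -
  let ?K = "\<lambda>u. exp (of_real pi * cdot z u)"
  have K: "exptype ?K" by (rule exptype_exp_cdot)
  have K': "fock_inner g ?K = g z" if "exptype g" for g
  proof -
    have "fock_inner g ?K = (\<integral>u. g u * exp (of_real pi * cdot u z) * gauss u \<partial>lborel)"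
      unfolding fock_inner_gauss by (simp add: exp_cnj cdot_cnj)
    then show ?thesis using reproducing[OF that] by simp
  qed
  have "Re (fock_inner ?K ?K) = exp (pi * (norm z)\<^sup>2)"
    unfolding K'[OF K] cdot_self of_real_mult[symmetric] exp_of_real by (rule Re_complex_of_real)
  then have "fock_norm2 ?K = ennreal (exp (pi * (norm z)\<^sup>2))" unfolding exptype_fock_norm2[OF K] by (rule arg_cong)
  then have "ennreal ((cmod (f z))\<^sup>2) \<le> ennreal (Re (fock_inner f f)) * ennreal (exp (pi * (norm z)\<^sup>2))"
    using fock_L2_inner_le[OF fock_L2_exptype[OF f] fock_L2_exptype[OF K]] unfolding K'[OF f] exptype_fock_norm2[OF f] by simp
  then show ?thesis
    using exptype_norm_nonneg[OF f] by (simp add: ennreal_mult[symmetric] ennreal_le_iff mult.commute)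
qed

lemma fock_norm2_fatou:
  assumes F: "\<And>M. F M \<in> borel_measurable borel" and lim: "\<And>z. (\<lambda>M. F M z) \<longlonglongrightarrow> g z"
    and b: "eventually (\<lambda>M. fock_norm2 (F M) \<le> K) sequentially"
  shows "fock_norm2 g \<le> K"
proof -
  note [measurable] = F
  have "fock_norm2 g = (\<integral>\<^sup>+z. liminf (\<lambda>M. ennreal ((cmod (F M z))\<^sup>2 * exp (- pi * (norm z)\<^sup>2))) \<partial>lborel)"
    unfolding fock_norm2_def
  proof (rule nn_integral_cong)
    fix z
    have "(\<lambda>M. ennreal ((cmod (F M z))\<^sup>2 * exp (- pi * (norm z)\<^sup>2))) \<longlonglongrightarrow> ennreal ((cmod (g z))\<^sup>2 * exp (- pi * (norm z)\<^sup>2))"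
      by (intro tendsto_intros lim)
    then show "ennreal ((cmod (g z))\<^sup>2 * exp (- pi * (norm z)\<^sup>2)) = liminf (\<lambda>M. ennreal ((cmod (F M z))\<^sup>2 * exp (- pi * (norm z)\<^sup>2)))"
      by (intro lim_imp_Liminf[symmetric]) simp_all
  qed
  also have "\<dots> \<le> liminf (\<lambda>M. fock_norm2 (F M))"
    unfolding fock_norm2_def by (rule nn_integral_liminf) measurable
  also have "\<dots> \<le> K" 
  proof -
    have "liminf (\<lambda>M. fock_norm2 (F M)) \<le> liminf (\<lambda>M. K)" by (rule Liminf_mono[OF b])
    then show ?thesis by (simp add: Liminf_const)
  qed
  finally show ?thesis .
qed

section \<open>Interpolation by a Riesz system\<close>

definition lincomb :: "(nat \<Rightarrow> 'a \<Rightarrow> complex) \<Rightarrow> (nat \<Rightarrow> complex) \<Rightarrow> nat \<Rightarrow> 'a \<Rightarrow> complex" where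
  "lincomb v b N z = (\<Sum>i<N. b i * v i z)"

locale riesz_system =
  fixes v :: "nat \<Rightarrow> complex^'d::finite \<Rightarrow> complex" and c :: real
  assumes nv: "\<And>i. exptype (v i)" and c: "c > 0"
    and riesz: "\<And>b N. c * (\<Sum>i<N. (cmod (b i))\<^sup>2) \<le> Re (fock_inner (lincomb v b N) (lincomb v b N))"
begin

lemma exptype_lincomb: "exptype (lincomb v b N)"
  unfolding lincomb_def[abs_def] by (intro exptype_sum exptype_cmult nv)

lemma inner_lincomb: "fock_L2 h \<Longrightarrow> fock_inner h (lincomb v b N) = (\<Sum>i<N. cnj (b i) * fock_inner h (v i))"
  unfolding lincomb_def[abs_def] by (rule fock_inner_sum_right[OF fock_L2_exptype[OF nv]])

lemma lincomb_extend: "lincomb v (\<lambda>i. (if i < N then b i else 0) + t * d i) (Suc N) z = lincomb v b N z + t * lincomb v d (Suc N) z"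
  by (simp add: lincomb_def sum.distrib distrib_right sum_distrib_left algebra_simps)

text \<open>The residual of v_N has coefficient 1 at N, so the Riesz inequality keeps its norm away
  from 0. Being orthogonal to the earlier vectors, it has its squared norm as inner product with
  v_N.\<close>

lemma gram_schmidt_step:
  assumes GS: "\<exists>b. \<forall>i<N. fock_inner (\<lambda>z. v N z + (- 1) * lincomb v b N z) (v i) = 0"
  shows "\<exists>d. (\<forall>i<N. fock_inner (lincomb v d (Suc N)) (v i) = 0) \<and> fock_inner (lincomb v d (Suc N)) (v N) \<noteq> 0"
proof -
  obtain b where b: "\<forall>i<N. fock_inner (\<lambda>z. v N z + (- 1) * lincomb v b N z) (v i) = 0" using GS by (rule exE)
  define d where "d i = (if i < N then - b i else 1)" for i
  have "lincomb v d (Suc N) = (\<lambda>z. v N z + (- 1) * lincomb v b N z)"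
    by (rule ext) (simp add: lincomb_def d_def sum_negf)
  then have o: "\<And>i. i < N \<Longrightarrow> fock_inner (lincomb v d (Suc N)) (v i) = 0" using b by simp
  have "fock_inner (lincomb v d (Suc N)) (lincomb v d (Suc N)) = fock_inner (lincomb v d (Suc N)) (v N)"
    unfolding inner_lincomb[OF fock_L2_exptype[OF exptype_lincomb], of _ _ d "Suc N"] using o by (simp add: d_def)
  moreover have "Re (fock_inner (lincomb v d (Suc N)) (lincomb v d (Suc N))) > 0"
  proof -
    have "(\<Sum>i<Suc N. (cmod (d i))\<^sup>2) \<ge> 1" by (simp add: d_def sum_nonneg)
    then have "c * (\<Sum>i<Suc N. (cmod (d i))\<^sup>2) > 0" using c by (intro mult_pos_pos) auto
    then show ?thesis using riesz[of d "Suc N"] by linarith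
  qed
  ultimately have "fock_inner (lincomb v d (Suc N)) (v N) \<noteq> 0" by (metis less_irrefl zero_complex.sel(1))
  then show ?thesis using o by (intro exI[of _ d] conjI allI impI)
qed

text \<open>The induction hypothesis is used twice: for x itself, and for v_N, which yields the
  direction d along which x is corrected.\<close>

lemma gram_schmidt: "exptype x \<Longrightarrow> \<exists>b. \<forall>i<N. fock_inner (\<lambda>z. x z + (- 1) * lincomb v b N z) (v i) = 0"
proof (induction N arbitrary: x)
  case (Suc N)
  from gram_schmidt_step[OF Suc.IH[OF nv[of N]]] obtain d where d: "\<forall>i<N. fock_inner (lincomb v d (Suc N)) (v i) = 0" "fock_inner (lincomb v d (Suc N)) (v N) \<noteq> 0"
    by (elim exE conjE)
  obtain b where b: "\<forall>i<N. fock_inner (\<lambda>z. x z + (- 1) * lincomb v b N z) (v i) = 0" using Suc.IH[OF Suc.prems] by (rule exE)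
  define X where "X = (\<lambda>z. x z + (- 1) * lincomb v b N z)"
  define t where "t = fock_inner X (v N) / fock_inner (lincomb v d (Suc N)) (v N)"
  define b' where "b' i = (if i < N then b i else 0) + t * d i" for i
  have X: "exptype X" unfolding X_def by (intro exptype_add exptype_cmult exptype_lincomb Suc.prems)
  have e: "(\<lambda>z. x z + (- 1) * lincomb v b' (Suc N) z) = (\<lambda>z. X z + (- t) * lincomb v d (Suc N) z)"
    unfolding b'_def lincomb_extend X_def by (simp add: algebra_simps)
  have ip: "fock_inner (\<lambda>z. x z + (- 1) * lincomb v b' (Suc N) z) (v i) = fock_inner X (v i) + (- t) * fock_inner (lincomb v d (Suc N)) (v i)" for i
    unfolding e by (intro fock_inner_add_cmult fock_L2_exptype X exptype_lincomb nv)
  show ?case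
  proof (intro exI[of _ b'] allI impI)
    fix i assume "i < Suc N"
    then show "fock_inner (\<lambda>z. x z + (- 1) * lincomb v b' (Suc N) z) (v i) = 0"
      unfolding ip using b[folded X_def] d by (cases "i = N") (simp_all add: t_def)
  qed
qed simp

text \<open>A multiple of the residual direction d corrects the value at N and leaves the earlier
  values alone, since d is orthogonal to the earlier vectors.\<close>

lemma finite_interpolation: "\<exists>b. \<forall>i<N. fock_inner (lincomb v b N) (v i) = \<alpha> i"
proof (induction N)
  case (Suc N)
  from gram_schmidt_step[OF gram_schmidt[OF nv[of N]]] obtain d where d: "\<forall>i<N. fock_inner (lincomb v d (Suc N)) (v i) = 0" "fock_inner (lincomb v d (Suc N)) (v N) \<noteq> 0"
    by (elim exE conjE)
  obtain b where b: "\<forall>i<N. fock_inner (lincomb v b N) (v i) = \<alpha> i" using Suc by (rule exE)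
  define t where "t = (\<alpha> N - fock_inner (lincomb v b N) (v N)) / fock_inner (lincomb v d (Suc N)) (v N)"
  define b' where "b' i = (if i < N then b i else 0) + t * d i" for i
  have e: "lincomb v b' (Suc N) = (\<lambda>z. lincomb v b N z + t * lincomb v d (Suc N) z)"
    unfolding b'_def by (rule ext) (rule lincomb_extend)
  have ip: "fock_inner (lincomb v b' (Suc N)) (v i) = fock_inner (lincomb v b N) (v i) + t * fock_inner (lincomb v d (Suc N)) (v i)" for i
    unfolding e by (intro fock_inner_add_cmult fock_L2_exptype exptype_lincomb nv)
  show ?case
  proof (intro exI[of _ b'] allI impI)
    fix i assume "i < Suc N"
    then show "fock_inner (lincomb v b' (Suc N)) (v i) = \<alpha> i"
      unfolding ip using b d by (cases "i = N") (simp_all add: t_def)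
  qed
qed simp

text \<open>The solution F_N of the first N conditions is chosen in the span of the first N vectors.
  Hence the data bound its norm, and F_M - F_N is orthogonal to F_N, so the norms increase and the
  sequence is Cauchy. The limit is found locally uniformly and controlled by Fatou, in place of
  completeness.\<close>

lemma interpolation:
  assumes \<alpha>: "\<And>N. (\<Sum>i<N. (cmod (\<alpha> i))\<^sup>2) \<le> A"
  shows "\<exists>F\<in>fock_space. \<forall>i. fock_inner F (v i) = \<alpha> i"
proof -
  have "\<forall>N. \<exists>b. \<forall>i<N. fock_inner (lincomb v b N) (v i) = \<alpha> i" using finite_interpolation by blast
  then obtain b where b: "\<And>N i. i < N \<Longrightarrow> fock_inner (lincomb v (b N) N) (v i) = \<alpha> i" by metis
  define F where "F N = lincomb v (b N) N" for N
  have nF: "exptype (F N)" for N unfolding F_def by (rule exptype_lincomb)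
  define n where "n N = Re (fock_inner (F N) (F N))" for N
  define D where "D M N z = F M z + (- 1) * F N z" for M N z
  have nD: "exptype (D M N)" for M N unfolding D_def[abs_def] by (intro exptype_add exptype_cmult nF)
  have nn: "n N \<le> A / c" for N
  proof -
    have "n N = (\<Sum>i<N. Re (cnj (b N i) * \<alpha> i))"
      unfolding n_def F_def inner_lincomb[OF fock_L2_exptype[OF exptype_lincomb]] by (simp add: b)
    \<comment> \<open>The weights in this inequality are chosen so that the coefficient part is at
      most n_N / 2 by the Riesz inequality and can be absorbed on the left.\<close>
    also have "\<dots> \<le> (\<Sum>i<N. c / 2 * (cmod (b N i))\<^sup>2 + 1 / (2 * c) * (cmod (\<alpha> i))\<^sup>2)"
    proof (rule sum_mono)
      fix i
      let ?x = "cmod (b N i)" and ?y = "cmod (\<alpha> i)"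
      have "Re (cnj (b N i) * \<alpha> i) \<le> ?x * ?y"
        using complex_Re_le_cmod[of "cnj (b N i) * \<alpha> i"] by (simp add: norm_mult)
      moreover have "2 * c * (?x * ?y) \<le> c\<^sup>2 * ?x\<^sup>2 + ?y\<^sup>2"
        using sum_squares_bound[of "c * ?x" ?y] by (simp add: power_mult_distrib mult_ac)
      then have "?x * ?y \<le> (c\<^sup>2 * ?x\<^sup>2 + ?y\<^sup>2) / (2 * c)" using c by (simp add: pos_le_divide_eq mult_ac)
      moreover have "(c\<^sup>2 * ?x\<^sup>2 + ?y\<^sup>2) / (2 * c) = c / 2 * ?x\<^sup>2 + 1 / (2 * c) * ?y\<^sup>2"
        using c by (simp add: field_simps power2_eq_square)
      ultimately show "Re (cnj (b N i) * \<alpha> i) \<le> c / 2 * ?x\<^sup>2 + 1 / (2 * c) * ?y\<^sup>2" by linarith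
    qed
    also have "\<dots> = (c * (\<Sum>i<N. (cmod (b N i))\<^sup>2)) / 2 + (\<Sum>i<N. (cmod (\<alpha> i))\<^sup>2) / (2 * c)"
      by (simp add: sum.distrib sum_distrib_left[symmetric] sum_divide_distrib[symmetric])
    also have "\<dots> \<le> n N / 2 + A / (2 * c)"
      using riesz[of "b N" N] divide_right_mono[OF \<alpha>[of N], of "2 * c"] c unfolding n_def F_def by linarith
    finally show ?thesis by (simp add: field_simps)
  qed
  \<comment> \<open>The difference has product 0 with v_i for i < N, and F_N is a combination of
    these vectors, so Pythagoras applies.\<close>
  have pyth: "Re (fock_inner (D M N) (D M N)) = n M - n N" if "N \<le> M" for M N
  proof -
    have "fock_inner (D M N) (v i) = 0" if "i < N" for i
    proof -
      have "fock_inner (D M N) (v i) = fock_inner (F M) (v i) + (- 1) * fock_inner (F N) (v i)"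
        unfolding D_def[abs_def] by (intro fock_inner_add_cmult fock_L2_exptype nF nv)
      then show ?thesis using b[of i M] b[of i N] that \<open>N \<le> M\<close> by (simp add: F_def)
    qed
    then have DF: "fock_inner (D M N) (F N) = 0"
      unfolding F_def inner_lincomb[OF fock_L2_exptype[OF nD]] by simp
    then have FD: "fock_inner (F N) (D M N) = 0" by (metis fock_inner_cnj complex_cnj_zero)
    have FM: "F M = (\<lambda>z. F N z + 1 * D M N z)" by (rule ext) (simp add: D_def)
    have "fock_inner (F M) (F M) = fock_inner (F N) (F M) + fock_inner (D M N) (F M)"
      using fock_inner_add_cmult[OF fock_L2_exptype[OF nF[of N]] fock_L2_exptype[OF nD[of M N]] fock_L2_exptype[OF nF[of M]], of 1]
      unfolding FM[symmetric] by simp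
    also have "fock_inner (F N) (F M) = fock_inner (F N) (F N)"
      using fock_inner_add_cmult_right[OF fock_L2_exptype[OF nF[of N]] fock_L2_exptype[OF nD[of M N]] fock_L2_exptype[OF nF[of N]], of 1]
      unfolding FM[symmetric] FD by simp
    also have "fock_inner (D M N) (F M) = fock_inner (D M N) (D M N)"
      using fock_inner_add_cmult_right[OF fock_L2_exptype[OF nF[of N]] fock_L2_exptype[OF nD[of M N]] fock_L2_exptype[OF nD[of M N]], of 1]
      unfolding FM[symmetric] DF by simp
    finally show ?thesis unfolding n_def by simp
  qed
  have inc: "n N \<le> n M" if "N \<le> M" for M N using pyth[OF that] exptype_norm_nonneg[OF nD[of M N]] by simp
  have cau: "\<exists>N0. \<forall>N\<ge>N0. \<forall>M\<ge>N. n M - n N \<le> e" if e: "e > 0" for e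
  proof -
    have bdd: "bdd_above (range n)" using nn by (auto intro!: bdd_aboveI)
    obtain N0 where N0: "(SUP N. n N) - e < n N0"
      using less_cSUP_iff[of UNIV n "(SUP N. n N) - e"] bdd e by auto
    show ?thesis
    proof (intro exI[of _ N0] allI impI)
      fix N M assume "N0 \<le> N" "N \<le> M"
      then have "n N0 \<le> n N" "n M \<le> (SUP N. n N)" using inc cSUP_upper[OF _ bdd] by auto
      then show "n M - n N \<le> e" using N0 by linarith
    qed
  qed
  have unif: "\<exists>N0. \<forall>N\<ge>N0. \<forall>M\<ge>N. \<forall>z. norm z \<le> R \<longrightarrow> cmod (F M z - F N z) \<le> e" if e: "e > 0" for e R
  proof -
    have "e\<^sup>2 / exp (pi * R\<^sup>2) > 0" using e by simp
    from cau[OF this] obtain N0 where N0: "\<And>N M. N \<ge> N0 \<Longrightarrow> M \<ge> N \<Longrightarrow> n M - n N \<le> e\<^sup>2 / exp (pi * R\<^sup>2)" by blast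
    show ?thesis
    proof (intro exI[of _ N0] allI impI)
      fix N M and z :: "complex^'d" assume NM: "N0 \<le> N" "N \<le> M" and z: "norm z \<le> R"
      have "(cmod (D M N z))\<^sup>2 \<le> exp (pi * (norm z)\<^sup>2) * (n M - n N)"
        using exptype_pointwise[OF nD[of M N], of z] unfolding pyth[OF NM(2)] .
      also have "\<dots> \<le> exp (pi * R\<^sup>2) * (n M - n N)"
        using z inc[OF NM(2)] by (intro mult_right_mono) (auto intro!: power_mono)
      also have "\<dots> \<le> exp (pi * R\<^sup>2) * (e\<^sup>2 / exp (pi * R\<^sup>2))"
        using N0[OF NM] by (intro mult_left_mono) auto
      also have "\<dots> = e\<^sup>2" by simp
      finally have "cmod (D M N z) \<le> e" using e by (simp add: power2_le_iff_abs_le)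
      then show "cmod (F M z - F N z) \<le> e" by (simp add: D_def)
    qed
  qed
  have "Cauchy (\<lambda>N. F N z)" for z
  proof (rule CauchyI)
    fix e :: real assume e: "e > 0"
    then have "e / 3 > 0" by simp
    from unif[OF this, of "norm z"] obtain N0 where N0: "\<And>N M. N \<ge> N0 \<Longrightarrow> M \<ge> N \<Longrightarrow> cmod (F M z - F N z) \<le> e / 3" by blast
    show "\<exists>M. \<forall>m\<ge>M. \<forall>n\<ge>M. cmod (F m z - F n z) < e"
    proof (intro exI[of _ N0] allI impI)
      fix m n assume mn: "N0 \<le> m" "N0 \<le> n"
      then show "cmod (F m z - F n z) < e"
        using N0[of m n] N0[of n m] e by (cases "m \<le> n") (auto simp: norm_minus_commute)
    qed
  qed
  then have "\<forall>z. \<exists>l. (\<lambda>N. F N z) \<longlonglongrightarrow> l" by (auto simp: Cauchy_convergent_iff convergent_def)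
  then obtain f where f: "\<And>z. (\<lambda>N. F N z) \<longlonglongrightarrow> f z" by metis
  have ent: "entire_fun f"
  proof (rule entire_limit[of F])
    show "entire_fun (F N)" for N by (rule exptype_entire[OF nF])
    fix R e :: real assume e: "e > 0"
    from unif[OF e, of R] obtain N0 where N0: "\<And>N M z. N \<ge> N0 \<Longrightarrow> M \<ge> N \<Longrightarrow> norm z \<le> R \<Longrightarrow> cmod (F M z - F N z) \<le> e" by blast
    show "\<exists>N. \<forall>n\<ge>N. \<forall>z. norm z \<le> R \<longrightarrow> cmod (F n z - f z) \<le> e"
    proof (intro exI[of _ N0] allI impI)
      fix N and z :: "complex^'d" assume N: "N0 \<le> N" and z: "norm z \<le> R"
      have "(\<lambda>M. cmod (F N z - F M z)) \<longlonglongrightarrow> cmod (F N z - f z)" by (intro tendsto_intros f)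
      then show "cmod (F N z - f z) \<le> e"
        by (rule LIMSEQ_le_const2) (use N0[OF N _ z] in \<open>auto simp: norm_minus_commute intro!: exI[of _ N]\<close>)
    qed
  qed
  have fm: "f \<in> borel_measurable borel" by (rule entire_measurable[OF ent])
  define E where "E N z = f z + (- 1) * F N z" for N z
  have Em: "E N \<in> borel_measurable borel" for N
    unfolding E_def[abs_def] using fm exptype_measurable[OF nF[of N]] by measurable
  \<comment> \<open>Fatou transfers the Cauchy estimate to the limit: M tends to infinity while N is
    fixed.\<close>
  have EN: "fock_norm2 (E N) \<le> ennreal e" if N: "\<And>M. M \<ge> N \<Longrightarrow> n M - n N \<le> e" for N e
  proof (rule fock_norm2_fatou[of "\<lambda>M. D M N"])
    show "D M N \<in> borel_measurable borel" for M by (rule exptype_measurable[OF nD])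
    show "(\<lambda>M. D M N z) \<longlonglongrightarrow> E N z" for z unfolding D_def E_def by (intro tendsto_intros f)
    show "eventually (\<lambda>M. fock_norm2 (D M N) \<le> ennreal e) sequentially"
      unfolding eventually_sequentially
      by (intro exI[of _ N] allI impI) (simp add: exptype_fock_norm2[OF nD] pyth N ennreal_leI)
  qed
  have Esq: "fock_L2 (E N)" for N
  proof -
    have "n M - n N \<le> A / c - n N" if "M \<ge> N" for M using nn[of M] by simp
    from EN[OF this] show ?thesis using Em by (simp add: fock_L2_def) (metis ennreal_less_top infinity_ennreal_def le_less_trans)
  qed
  have fE: "f = (\<lambda>z. F N z + 1 * E N z)" for N by (rule ext) (simp add: E_def)
  have fsq: "fock_L2 f" by (subst fE[of 0]) (intro fock_L2_add fock_L2_cmult Esq fock_L2_exptype[OF nF])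
  have "fock_inner f (v i) = \<alpha> i" for i
  proof -
    have "(cmod (fock_inner f (v i) - \<alpha> i))\<^sup>2 \<le> e" if e: "e > 0" for e
    proof -
      define m where "m = Re (fock_inner (v i) (v i)) + 1"
      have m: "m > 0" using exptype_norm_nonneg[OF nv[of i]] by (simp add: m_def)
      have vm: "fock_norm2 (v i) \<le> ennreal m" unfolding exptype_fock_norm2[OF nv] m_def by (rule ennreal_leI) simp
      obtain N0 where N0: "\<And>N M. N \<ge> N0 \<Longrightarrow> M \<ge> N \<Longrightarrow> n M - n N \<le> e / m"
        using cau[of "e / m"] e m by auto
      define N where "N = max N0 (Suc i)"
      have N: "N0 \<le> N" "i < N" by (auto simp: N_def)
      have "fock_inner f (v i) = fock_inner (F N) (v i) + fock_inner (E N) (v i)"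
        using fock_inner_add_cmult[OF fock_L2_exptype[OF nF[of N]] Esq[of N] fock_L2_exptype[OF nv[of i]], of 1]
        unfolding fE[symmetric] by simp
      also have "fock_inner (F N) (v i) = \<alpha> i" unfolding F_def by (rule b[OF N(2)])
      finally have d: "fock_inner f (v i) - \<alpha> i = fock_inner (E N) (v i)" by simp
      have "ennreal ((cmod (fock_inner (E N) (v i)))\<^sup>2) \<le> fock_norm2 (E N) * fock_norm2 (v i)"
        by (rule fock_L2_inner_le[OF Esq fock_L2_exptype[OF nv]])
      also have "\<dots> \<le> ennreal (e / m) * ennreal m"
        by (intro mult_mono EN vm) (use N0[OF N(1)] in auto)
      also have "\<dots> = ennreal e" using e m by (simp add: ennreal_mult[symmetric])
      finally show ?thesis unfolding d using e by (simp add: ennreal_le_iff)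
    qed
    then have "(cmod (fock_inner f (v i) - \<alpha> i))\<^sup>2 \<le> 0" by (rule field_le_epsilon[where y=0, simplified])
    then show ?thesis by simp
  qed
  moreover have "f \<in> fock_space" using ent fsq by (simp add: fock_space_def fock_L2_def)
  ultimately show ?thesis by blast
qed

end

text \<open>Enumerates the pairs of lattice point and index. Initial segments of the enumeration are
  finite index sets, for which the Riesz inequality is given.\<close>

lemma riesz_imp_interp:
  fixes n :: "nat^'d::finite"
  assumes \<Gamma>: "countable \<Gamma>" "infinite \<Gamma>" and K: "K_set n \<noteq> {}" and c: "c > 0" and R: "riesz_lower n \<Gamma> c"
  shows "mult_interp n \<Gamma>"
  unfolding mult_interp_def
proof (intro allI impI)
  fix \<alpha> :: "complex^'d \<Rightarrow> nat^'d \<Rightarrow> complex"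
  assume fin: "(\<Sum>\<^sub>\<infinity>(z,k)\<in>\<Gamma> \<times> K_set n. ennreal ((cmod (\<alpha> z k))\<^sup>2)) < \<infinity>"
  have "countable (\<Gamma> \<times> K_set n)" using \<Gamma>(1) by (intro countable_SIGMA) (auto intro: countable_finite finite_K_set)
  moreover have "infinite (\<Gamma> \<times> K_set n)" using \<Gamma>(2) K finite_cartesian_productD1 by blast
  ultimately obtain e where e: "bij_betw e (UNIV::nat set) (\<Gamma> \<times> K_set n)"
    using bij_betw_from_nat_into by blast
  have inj: "inj e" and ran: "range e = \<Gamma> \<times> K_set n" using e by (auto simp: bij_betw_def)
  define v where "v i = beta_op (fst (e i)) (ek (snd (e i)))" for i
  interpret riesz_system v c
  proof
    show "exptype (v i)" for i unfolding v_def by (intro exptype_beta exptype_ek)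
    show "0 < c" by (rule c)
    fix b :: "nat \<Rightarrow> complex" and N
    have "lincomb v b N = shift_sum (e ` {..<N}) (\<lambda>x. b (inv e x))"
      unfolding lincomb_def[abs_def] shift_sum_def[abs_def]
      by (rule ext) (simp add: sum.reindex inj_on_subset[OF inj] v_def inv_f_f[OF inj])
    moreover have "(\<Sum>i<N. (cmod (b i))\<^sup>2) = (\<Sum>x\<in>e ` {..<N}. (cmod (b (inv e x)))\<^sup>2)"
      by (simp add: sum.reindex inj_on_subset[OF inj] inv_f_f[OF inj])
    moreover have "e ` {..<N} \<subseteq> \<Gamma> \<times> K_set n" using ran by blast
    ultimately show "c * (\<Sum>i<N. (cmod (b i))\<^sup>2) \<le> Re (fock_inner (lincomb v b N) (lincomb v b N))"
      using R unfolding riesz_lower_def by simp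
  qed
  define \<alpha>' where "\<alpha>' i = \<alpha> (fst (e i)) (snd (e i))" for i
  have S: "(\<Sum>i. ennreal ((cmod (\<alpha>' i))\<^sup>2)) < \<infinity>"
    using fin unfolding infsum_ennreal_enum[OF e] by (simp add: \<alpha>'_def case_prod_unfold)
  have "(\<Sum>i<N. (cmod (\<alpha>' i))\<^sup>2) \<le> enn2real (\<Sum>i. ennreal ((cmod (\<alpha>' i))\<^sup>2))" for N
  proof -
    have "ennreal (\<Sum>i<N. (cmod (\<alpha>' i))\<^sup>2) = (\<Sum>i<N. ennreal ((cmod (\<alpha>' i))\<^sup>2))" by simp
    also have "\<dots> \<le> (\<Sum>i. ennreal ((cmod (\<alpha>' i))\<^sup>2))" by (rule sum_le_suminf) auto
    also have "\<dots> = ennreal (enn2real (\<Sum>i. ennreal ((cmod (\<alpha>' i))\<^sup>2)))" using S by simp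
    finally show ?thesis by (simp add: ennreal_le_iff)
  qed
  from interpolation[OF this] obtain F where F: "F \<in> fock_space" "\<forall>i. fock_inner F (v i) = \<alpha>' i" by (rule bexE)
  show "\<exists>F\<in>fock_space. \<forall>z\<in>\<Gamma>. \<forall>k\<in>K_set n. fock_inner F (beta_op z (ek k)) = \<alpha> z k"
  proof (intro bexI[OF _ F(1)] ballI)
    fix z k assume "z \<in> \<Gamma>" "k \<in> K_set n"
    then have "(z, k) \<in> range e" using ran by blast
    then obtain i where "e i = (z, k)" by auto
    then show "fock_inner F (beta_op z (ek k)) = \<alpha> z k" using F(2) by (auto simp: v_def \<alpha>'_def dest: spec[of _ i])
  qed
qed

text \<open>Up to unimodular phases a shift permutes the family, so a finite combination can be
  moved by \<nu> without changing its norm or the moduli of its coefficients.\<close>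

lemma shift_sum_shift:
  assumes "finite T"
  shows "shift_sum ((\<lambda>i. (fst i + \<nu>, snd i)) ` T) (\<lambda>j. a (fst j - \<nu>, snd j) * cis (pi * Im (cdot \<nu> (fst j - \<nu>)))) = beta_op \<nu> (shift_sum T a)"
proof
  fix \<zeta>
  have inj: "inj_on (\<lambda>i. (fst i + \<nu>, snd i)) T" by (auto simp: inj_on_def prod_eq_iff)
  have "beta_op \<nu> (shift_sum T a) \<zeta> = (\<Sum>i\<in>T. a i * beta_op \<nu> (beta_op (fst i) (ek (snd i))) \<zeta>)"
    unfolding shift_sum_def[abs_def] beta_sum beta_cmult ..
  then show "shift_sum ((\<lambda>i. (fst i + \<nu>, snd i)) ` T) (\<lambda>j. a (fst j - \<nu>, snd j) * cis (pi * Im (cdot \<nu> (fst j - \<nu>)))) \<zeta> = beta_op \<nu> (shift_sum T a) \<zeta>"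
    unfolding shift_sum_def sum.reindex[OF inj] by (simp add: beta_beta_cis mult_ac add.commute)
qed

lemma interp_imp_riesz:
  fixes n :: "nat^'d::finite" and \<Gamma> :: "(complex^'d) set"
  assumes \<Gamma>: "infinite \<Gamma>" "\<And>x y. x \<in> \<Gamma> \<Longrightarrow> y \<in> \<Gamma> \<Longrightarrow> x + y \<in> \<Gamma>" and I: "mult_interp n \<Gamma>"
  shows "\<exists>c>0. riesz_lower n \<Gamma> c"
proof (rule ccontr)
  assume neg: "\<not> (\<exists>c>0. riesz_lower n \<Gamma> c)"
  define good where "good \<epsilon> T a \<longleftrightarrow> finite T \<and> T \<subseteq> \<Gamma> \<times> K_set n \<and> (\<Sum>i\<in>T. (cmod (a i))\<^sup>2) = 1 \<and> Re (fock_inner (shift_sum T a) (shift_sum T a)) \<le> \<epsilon>" for \<epsilon> T a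
  have ex1: "\<exists>T a. good \<epsilon> T a" if \<epsilon>: "\<epsilon> > 0" for \<epsilon>
  proof -
    obtain T a where T: "finite T" "T \<subseteq> \<Gamma> \<times> K_set n" and lt: "Re (fock_inner (shift_sum T a) (shift_sum T a)) < \<epsilon> * (\<Sum>i\<in>T. (cmod (a i))\<^sup>2)"
      using neg \<epsilon> unfolding riesz_lower_def by (auto simp: not_le)
    define s where "s = (\<Sum>i\<in>T. (cmod (a i))\<^sup>2)"
    have "\<epsilon> * s > 0" using lt exptype_norm_nonneg[OF exptype_shift_sum, of T a] by (simp add: s_def)
    then have s: "s > 0" using \<epsilon> by (simp add: zero_less_mult_iff)
    define r where "r = 1 / sqrt s"
    have r2: "r * r * s = 1" using s by (simp add: r_def)
    define b where "b i = of_real r * a i" for i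
    have rb: "shift_sum T b = (\<lambda>z. of_real r * shift_sum T a z)"
      by (rule ext) (simp add: shift_sum_def b_def sum_distrib_left mult.assoc)
    have "fock_inner (shift_sum T b) (shift_sum T b) = of_real (r * r) * fock_inner (shift_sum T a) (shift_sum T a)"
      unfolding rb fock_inner_gauss integral_mult_right_zero[symmetric]
      by (intro Bochner_Integration.integral_cong refl) (simp add: mult_ac)
    then have "Re (fock_inner (shift_sum T b) (shift_sum T b)) = r * r * Re (fock_inner (shift_sum T a) (shift_sum T a))" by simp
    also have "\<dots> \<le> r * r * (\<epsilon> * s)" using lt by (intro mult_left_mono) (auto simp: s_def)
    also have "\<dots> = \<epsilon>" using r2 by (simp add: mult_ac)
    finally have 1: "Re (fock_inner (shift_sum T b) (shift_sum T b)) \<le> \<epsilon>" .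
    have "(\<Sum>i\<in>T. (cmod (b i))\<^sup>2) = r * r * s"
      by (simp add: b_def norm_mult power_mult_distrib s_def sum_distrib_left power2_eq_square[of r] power2_eq_square[of "\<bar>r\<bar>"])
    then have "good \<epsilon> T b" using T 1 r2 by (simp add: good_def)
    then show ?thesis by blast
  qed
  have ex2: "\<exists>T a. good \<epsilon> T a \<and> T \<inter> U = {}" if \<epsilon>: "\<epsilon> > 0" and U: "finite U" for \<epsilon> and U :: "((complex^'d) \<times> (nat^'d)) set"
  proof -
    obtain T a where g: "good \<epsilon> T a" using ex1[OF \<epsilon>] by blast
    then have T: "finite T" "T \<subseteq> \<Gamma> \<times> K_set n" by (auto simp: good_def)
    \<comment> \<open>These are the shifts that could make the supports meet. There are finitely
      many of them, while \<Gamma> is infinite.\<close>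
    have "finite ((\<lambda>(u, t). fst u - fst t) ` (U \<times> T))" using U T(1) by simp
    then have "infinite (\<Gamma> - (\<lambda>(u, t). fst u - fst t) ` (U \<times> T))" using \<Gamma>(1) by (rule Diff_infinite_finite)
    then have "\<Gamma> - (\<lambda>(u, t). fst u - fst t) ` (U \<times> T) \<noteq> {}" using finite.emptyI by metis
    then obtain \<nu> where \<nu>: "\<nu> \<in> \<Gamma>" "\<nu> \<notin> (\<lambda>(u, t). fst u - fst t) ` (U \<times> T)" by blast
    define sh where "sh = (\<lambda>i :: (complex^'d) \<times> (nat^'d). (fst i + \<nu>, snd i))"
    define b where "b j = a (fst j - \<nu>, snd j) * cis (pi * Im (cdot \<nu> (fst j - \<nu>)))" for j
    have inj: "inj_on sh T" by (auto simp: inj_on_def prod_eq_iff sh_def)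
    have r: "shift_sum (sh ` T) b = beta_op \<nu> (shift_sum T a)" unfolding sh_def b_def by (rule shift_sum_shift[OF T(1)])
    have "fock_inner (shift_sum (sh ` T) b) (shift_sum (sh ` T) b) = fock_inner (shift_sum T a) (shift_sum T a)"
      unfolding r by (intro fock_inner_beta exptype_measurable exptype_shift_sum)
    moreover have "(\<Sum>i\<in>sh ` T. (cmod (b i))\<^sup>2) = (\<Sum>i\<in>T. (cmod (a i))\<^sup>2)"
      unfolding sum.reindex[OF inj] by (simp add: b_def sh_def norm_mult)
    moreover have "sh ` T \<subseteq> \<Gamma> \<times> K_set n" using T(2) \<Gamma>(2)[OF _ \<nu>(1)] by (auto simp: sh_def)
    ultimately have "good \<epsilon> (sh ` T) b" using g T(1) by (simp add: good_def)
    moreover have "sh ` T \<inter> U = {}"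
    proof (rule ccontr)
      assume "sh ` T \<inter> U \<noteq> {}"
      then obtain t where t: "t \<in> T" "sh t \<in> U" by blast
      have "\<nu> = (\<lambda>(u, t). fst u - fst t) (sh t, t)" by (simp add: sh_def)
      then show False using \<nu>(2) t by blast
    qed
    ultimately show ?thesis by blast
  qed
  \<comment> \<open>The weights below are 2^(-j), so block j of the data has energy 4^(-j) and the
    total is finite. An interpolating F has inner product 2^(-j) with the j-th sum, whose squared
    norm is at most 16^(-j); Cauchy-Schwarz then forces the squared norm of F to be at least
    4^j.\<close>
  have "\<exists>f. \<forall>j. good (1 / 16 ^ j) (fst (f j)) (snd (f j)) \<and> (\<forall>m<j. fst (f j) \<inter> fst (f m) = {})"
  proof (rule dependent_wellorder_choice)
    fix r and f g :: "nat \<Rightarrow> ((complex^'d) \<times> (nat^'d)) set \<times> ((complex^'d) \<times> (nat^'d) \<Rightarrow> complex)" and j :: nat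
    assume "\<And>y. y < j \<Longrightarrow> f y = g y"
    then show "(good (1 / 16 ^ j) (fst r) (snd r) \<and> (\<forall>m<j. fst r \<inter> fst (f m) = {})) = (good (1 / 16 ^ j) (fst r) (snd r) \<and> (\<forall>m<j. fst r \<inter> fst (g m) = {}))"
      by simp
  next
    fix j :: nat and f :: "nat \<Rightarrow> ((complex^'d) \<times> (nat^'d)) set \<times> ((complex^'d) \<times> (nat^'d) \<Rightarrow> complex)"
    assume "\<And>y. y < j \<Longrightarrow> good (1 / 16 ^ y) (fst (f y)) (snd (f y)) \<and> (\<forall>m<y. fst (f y) \<inter> fst (f m) = {})"
    then have "finite (\<Union>m<j. fst (f m))" by (auto simp: good_def)
    from ex2[OF _ this, of "1 / 16 ^ j"] obtain T a where Ta: "good (1 / 16 ^ j) T a" "T \<inter> (\<Union>m<j. fst (f m)) = {}" by auto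
    show "\<exists>r. good (1 / 16 ^ j) (fst r) (snd r) \<and> (\<forall>m<j. fst r \<inter> fst (f m) = {})"
      by (rule exI[of _ "(T, a)"]) (use Ta in auto)
  qed
  then obtain f where f: "\<And>j. good (1 / 16 ^ j) (fst (f j)) (snd (f j))" "\<And>j m. m < j \<Longrightarrow> fst (f j) \<inter> fst (f m) = {}"
    by blast
  define T where "T j = fst (f j)" for j
  define a where "a j = snd (f j)" for j
  have g: "good (1 / 16 ^ j) (T j) (a j)" for j unfolding T_def a_def by (rule f(1))
  have disj: "T j \<inter> T m = {}" if "j \<noteq> m" for j m
    using f(2)[of j m] f(2)[of m j] that unfolding T_def by (cases "j < m") auto
  define ix where "ix i = (THE j. i \<in> T j)" for i
  have ix: "ix i = j" if "i \<in> T j" for i j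
    unfolding ix_def using that disj by (intro the_equality) auto
  \<comment> \<open>Unambiguous because the supports are disjoint; the value is 0 off their
    union.\<close>
  define \<alpha> where "\<alpha> i = (if \<exists>j. i \<in> T j then of_real (1 / 2 ^ ix i) * a (ix i) i else 0)" for i
  have \<alpha>T: "\<alpha> i = of_real (1 / 2 ^ j) * a j i" if "i \<in> T j" for i j
    using that ix[OF that] by (auto simp: \<alpha>_def)
  have sT: "(\<Sum>i\<in>T j. (cmod (\<alpha> i))\<^sup>2) = (1 / 4) ^ j" for j
  proof -
    have "(\<Sum>i\<in>T j. (cmod (\<alpha> i))\<^sup>2) = (\<Sum>i\<in>T j. (1 / 4) ^ j * (cmod (a j i))\<^sup>2)"
    proof (intro sum.cong refl)
      fix i assume "i \<in> T j"
      moreover have "((1::real) / 2 ^ j)\<^sup>2 = (1 / 4) ^ j" by (simp add: power_divide power2_eq_square power_mult_distrib[symmetric])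
      moreover have "cmod (\<alpha> i) = 1 / 2 ^ j * cmod (a j i)"
        unfolding \<alpha>T[OF \<open>i \<in> T j\<close>] by (simp add: norm_mult norm_divide norm_power)
      ultimately show "(cmod (\<alpha> i))\<^sup>2 = (1 / 4) ^ j * (cmod (a j i))\<^sup>2"
        by (simp only: power_mult_distrib)
    qed
    then show ?thesis using g[of j] by (simp add: sum_distrib_left[symmetric] good_def)
  qed
  have fT: "finite (T j)" for j using g by (simp add: good_def)
  have bound: "(\<Sum>i\<in>S. (cmod (\<alpha> i))\<^sup>2) \<le> 2" if S: "finite S" for S
  proof -
    \<comment> \<open>Large enough for every block that S meets; the inserted 0 covers the case of
      an empty S.\<close>
    define J where "J = Suc (Max (insert 0 (ix ` S)))"
    have "(\<Sum>i\<in>S. (cmod (\<alpha> i))\<^sup>2) = (\<Sum>i\<in>S \<inter> (\<Union>j. T j). (cmod (\<alpha> i))\<^sup>2)"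
      by (rule sum.mono_neutral_right[OF S]) (auto simp: \<alpha>_def)
    also have "\<dots> \<le> (\<Sum>i\<in>(\<Union>j<J. T j). (cmod (\<alpha> i))\<^sup>2)"
    proof (rule sum_mono2)
      show "S \<inter> (\<Union>j. T j) \<subseteq> (\<Union>j<J. T j)"
      proof
        fix i assume "i \<in> S \<inter> (\<Union>j. T j)"
        then obtain j where j: "i \<in> T j" "i \<in> S" by blast
        then have "ix i \<le> Max (insert 0 (ix ` S))" using S by (intro Max_ge) auto
        then have "j < J" using ix[OF j(1)] by (simp add: J_def)
        then show "i \<in> (\<Union>j<J. T j)" using j by blast
      qed
    qed (use fT in auto)
    also have "\<dots> = (\<Sum>j<J. \<Sum>i\<in>T j. (cmod (\<alpha> i))\<^sup>2)"
      by (rule sum.UNION_disjoint) (use fT disj in auto)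
    also have "\<dots> = (\<Sum>j<J. (1 / 4) ^ j)" by (simp only: sT)
    also have "\<dots> \<le> (\<Sum>j. (1 / 4) ^ j)" by (rule sum_le_suminf) (auto intro: summable_geometric)
    also have "\<dots> \<le> (2::real)" by (simp add: suminf_geometric)
    finally show ?thesis .
  qed
  have "(\<Sum>\<^sub>\<infinity>(z,k)\<in>\<Gamma> \<times> K_set n. ennreal ((cmod (\<alpha> (z, k)))\<^sup>2)) \<le> ennreal 2"
  proof (rule infsum_le_finite_sums)
    show "(\<lambda>(z, k). ennreal ((cmod (\<alpha> (z, k)))\<^sup>2)) summable_on \<Gamma> \<times> K_set n"
      by (rule nonneg_summable_on_complete) auto
    fix S assume "finite S" "S \<subseteq> \<Gamma> \<times> K_set n"
    have "(\<Sum>(z, k)\<in>S. ennreal ((cmod (\<alpha> (z, k)))\<^sup>2)) = ennreal (\<Sum>i\<in>S. (cmod (\<alpha> i))\<^sup>2)"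
      by (simp add: case_prod_unfold)
    also have "\<dots> \<le> ennreal 2" by (rule ennreal_leI[OF bound[OF \<open>finite S\<close>]])
    finally show "(\<Sum>(z, k)\<in>S. ennreal ((cmod (\<alpha> (z, k)))\<^sup>2)) \<le> ennreal 2" .
  qed
  then have "(\<Sum>\<^sub>\<infinity>(z,k)\<in>\<Gamma> \<times> K_set n. ennreal ((cmod ((\<lambda>z k. \<alpha> (z, k)) z k))\<^sup>2)) < \<infinity>"
    by (simp add: le_less_trans)
  with I obtain F where F: "F \<in> fock_space" and ip: "\<And>z k. z \<in> \<Gamma> \<Longrightarrow> k \<in> K_set n \<Longrightarrow> fock_inner F (beta_op z (ek k)) = \<alpha> (z, k)"
    unfolding mult_interp_def by (elim allE[of _ "\<lambda>z k. \<alpha> (z, k)"]) blast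
  have Fs: "fock_L2 F" using F entire_measurable[of F] by (simp add: fock_space_def fock_L2_def)
  have ineq: "4 ^ j \<le> enn2real (fock_norm2 F)" for j
  proof -
    let ?h = "shift_sum (T j) (a j)"
    have "fock_inner F ?h = (\<Sum>i\<in>T j. cnj (a j i) * fock_inner F (beta_op (fst i) (ek (snd i))))"
      unfolding shift_sum_def[abs_def] by (intro fock_inner_sum_right fock_L2_exptype exptype_beta exptype_ek Fs)
    also have "\<dots> = (\<Sum>i\<in>T j. of_real (1 / 2 ^ j * (cmod (a j i))\<^sup>2))"
    proof (intro sum.cong refl)
      fix i assume i: "i \<in> T j"
      then have "fst i \<in> \<Gamma>" "snd i \<in> K_set n" using g[of j] by (auto simp: good_def)
      then have "fock_inner F (beta_op (fst i) (ek (snd i))) = of_real (1 / 2 ^ j) * a j i"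
        using ip \<alpha>T[OF i] by simp
      then show "cnj (a j i) * fock_inner F (beta_op (fst i) (ek (snd i))) = of_real (1 / 2 ^ j * (cmod (a j i))\<^sup>2)"
        by (simp only: of_real_mult complex_norm_square mult_ac)
    qed
    also have "\<dots> = of_real (1 / 2 ^ j * (\<Sum>i\<in>T j. (cmod (a j i))\<^sup>2))" by (simp only: of_real_sum[symmetric] sum_distrib_left)
    also have "(\<Sum>i\<in>T j. (cmod (a j i))\<^sup>2) = 1" using g[of j] by (simp add: good_def)
    finally have "cmod (fock_inner F ?h) = 1 / 2 ^ j" by (simp add: norm_divide norm_power)
    then have "(cmod (fock_inner F ?h))\<^sup>2 = 1 / 4 ^ j"
      by (simp add: power_divide power2_eq_square power_mult_distrib[symmetric])
    then have "ennreal (1 / 4 ^ j) \<le> fock_norm2 F * fock_norm2 ?h"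
      using fock_L2_inner_le[OF Fs fock_L2_exptype[OF exptype_shift_sum], of "T j" "a j"] by simp
    also have "\<dots> \<le> ennreal (enn2real (fock_norm2 F)) * ennreal (1 / 16 ^ j)"
    proof (rule mult_mono)
      show "fock_norm2 F \<le> ennreal (enn2real (fock_norm2 F))" using Fs by (simp add: fock_L2_def)
      show "fock_norm2 ?h \<le> ennreal (1 / 16 ^ j)"
        unfolding exptype_fock_norm2[OF exptype_shift_sum] using g[of j] by (intro ennreal_leI) (simp add: good_def)
    qed auto
    finally have "1 / 4 ^ j \<le> enn2real (fock_norm2 F) * (1 / 16 ^ j)"
      by (simp add: ennreal_mult[symmetric] ennreal_le_iff)
    then have "16 ^ j * (1 / 4 ^ j) \<le> enn2real (fock_norm2 F)" by (simp add: field_simps)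
    moreover have "(16::real) ^ j * (1 / 4 ^ j) = 4 ^ j"
      by (simp add: power_divide[symmetric])
    ultimately show ?thesis by simp
  qed
  obtain j where "enn2real (fock_norm2 F) < 4 ^ j" using real_arch_pow[of 4] by auto
  with ineq[of j] show False by simp
qed

section \<open>The lower Riesz inequality implies sampling\<close>

lemma suminf_Cauchy_Schwarz:
  fixes f g :: "nat \<Rightarrow> ennreal"
  shows "(\<Sum>n. f n * g n)\<^sup>2 \<le> (\<Sum>n. (f n)\<^sup>2) * (\<Sum>n. (g n)\<^sup>2)"
  unfolding nn_integral_count_space_nat[symmetric] by (rule Cauchy_Schwarz_nn_integral) simp_all

text \<open>Apart from a factor in w, the modulus is f(w - v) damped at rate pi/2. Half of this rate
  absorbs the growth of f by completing the square, which is the origin of the constant exp(C^2 /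
  pi).\<close>

lemma beta_decay:
  assumes f: "exptype f"
  obtains C where "C > 0" "\<And>v w. cmod (beta_op v f w) \<le> C * exp (pi / 2 * (norm w)\<^sup>2) * exp (- (pi / 4) * (norm (w - v))\<^sup>2)"
proof -
  obtain C where C: "C > 0" "\<And>x. cmod (f x) \<le> C * exp (C * norm x - 0 * (norm x)\<^sup>2)"
    using gauss_domE[OF exptype_gauss_dom[OF f]] by metis
  define A where "A = C * exp (C\<^sup>2 / pi)"
  have b: "cmod (f x) * exp (- (pi / 2) * (norm x)\<^sup>2) \<le> A * exp (- (pi / 4) * (norm x)\<^sup>2)" for x
  proof -
    let ?t = "norm x"
    have "0 \<le> (pi / 4) * (?t - 2 * C / pi)\<^sup>2" by simp
    also have "\<dots> = (pi / 4) * ?t\<^sup>2 - C * ?t + C\<^sup>2 / pi"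
      by (simp add: power2_eq_square field_simps)
    finally have le: "C * ?t + - (pi / 2) * ?t\<^sup>2 \<le> C\<^sup>2 / pi + - (pi / 4) * ?t\<^sup>2" by (simp add: field_simps)
    have "cmod (f x) * exp (- (pi / 2) * ?t\<^sup>2) \<le> C * exp (C * ?t) * exp (- (pi / 2) * ?t\<^sup>2)"
      using C(2)[of x] by (intro mult_right_mono) auto
    also have "\<dots> = C * exp (C * ?t + - (pi / 2) * ?t\<^sup>2)" by (simp only: exp_add mult.assoc)
    also have "\<dots> \<le> C * exp (C\<^sup>2 / pi + - (pi / 4) * ?t\<^sup>2)" using le C(1) by (intro mult_left_mono) auto
    also have "\<dots> = A * exp (- (pi / 4) * ?t\<^sup>2)" by (simp only: A_def exp_add mult.assoc)
    finally show ?thesis .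
  qed
  show thesis
  proof (rule that[of A])
    show "A > 0" using C(1) by (simp add: A_def)
    fix v w
    have "cmod (beta_op v f w) = cmod (f (w - v)) * exp (- (pi / 2) * (norm (w - v))\<^sup>2) * exp (pi / 2 * (norm w)\<^sup>2)"
      unfolding cmod_beta_half by (simp add: exp_add[symmetric] mult.assoc)
    also have "\<dots> \<le> A * exp (- (pi / 4) * (norm (w - v))\<^sup>2) * exp (pi / 2 * (norm w)\<^sup>2)"
      using b by (intro mult_right_mono) auto
    finally show "cmod (beta_op v f w) \<le> A * exp (pi / 2 * (norm w)\<^sup>2) * exp (- (pi / 4) * (norm (w - v))\<^sup>2)"
      by (simp only: mult_ac)
  qed
qed

lemma nn_integral_gauss_shift:
  fixes a :: "'a::euclidean_space"
  assumes "e > 0"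
  shows "(\<integral>\<^sup>+x. ennreal (exp (- e * (norm (x - a))\<^sup>2)) \<partial>lborel) = ennreal (sqrt (pi / e) ^ DIM('a))"
  unfolding nn_integral_gauss[OF assms, where 'a='a, symmetric]
  using nn_integral_lborel_translate[of "\<lambda>x. ennreal (exp (- e * (norm (x::'a))\<^sup>2))" "- a"] by simp

section \<open>The upper sampling bound for coefficients of exponential type\<close>

definition exptype_poly :: "nat^'d::finite \<Rightarrow> (complex^'d \<Rightarrow> complex) \<Rightarrow> bool" where
  "exptype_poly n F \<longleftrightarrow> (\<exists>\<phi>. (\<forall>k\<in>K_set n. exptype (\<phi> k)) \<and> (\<forall>z. F z = (\<Sum>k\<in>K_set n. cmpow z k * \<phi> k z)))"

lemma exptype_poly_rep:
  assumes "exptype_poly n F"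
  shows "\<exists>f. (\<forall>k. exptype (f k)) \<and>
    (\<forall>z. (cmod (F z))\<^sup>2 * exp (- pi * (norm z)\<^sup>2) = (cmod (\<Sum>k\<in>K_set n. fock_inner (f k) (beta_op z (ek k))))\<^sup>2) \<and>
    fock_norm2 F = ennreal (\<Sum>k\<in>K_set n. ek_norm2 k * Re (fock_inner (f k) (f k)))"
proof -
  obtain \<phi> where \<phi>: "\<forall>k\<in>K_set n. exptype (\<phi> k)" "\<forall>z. F z = (\<Sum>k\<in>K_set n. cmpow z k * \<phi> k z)"
    using assms unfolding exptype_poly_def by (elim exE conjE)
  have "\<exists>f. (\<forall>k. exptype (f k)) \<and> (\<forall>z. exp (- of_real (pi / 2) * cdot z z) * (\<Sum>k\<in>K_set n. cmpow z k * \<phi> k z) = (\<Sum>k\<in>K_set n. fock_inner (f k) (beta_op z (ek k))))"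
    by (rule exptype_polyanalytic_rep, rule bspec[OF \<phi>(1)])
  then obtain f where f: "\<forall>k. exptype (f k)"
    "\<forall>z. exp (- of_real (pi / 2) * cdot z z) * (\<Sum>k\<in>K_set n. cmpow z k * \<phi> k z) = (\<Sum>k\<in>K_set n. fock_inner (f k) (beta_op z (ek k)))"
    by (elim exE conjE)
  have F: "exp (- of_real (pi / 2) * cdot z z) * F z = (\<Sum>k\<in>K_set n. fock_inner (f k) (beta_op z (ek k)))" for z
    using f(2) \<phi>(2) by simp
  show ?thesis
  proof (intro exI[of _ f] conjI allI)
    show nf: "exptype (f k)" for k using f(1) by (rule spec)
    show "fock_norm2 F = ennreal (\<Sum>k\<in>K_set n. ek_norm2 k * Re (fock_inner (f k) (f k)))"
      by (intro polyanalytic_norm finite_K_set F nf)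
    fix z :: "complex^'a"
    have "cmod (exp (- of_real (pi / 2) * cdot z z)) = exp (- (pi / 2) * (norm z)\<^sup>2)"
      unfolding cdot_self by simp
    then have "(cmod (\<Sum>k\<in>K_set n. fock_inner (f k) (beta_op z (ek k))))\<^sup>2 = (exp (- (pi / 2) * (norm z)\<^sup>2) * cmod (F z))\<^sup>2"
      unfolding F[symmetric] norm_mult by simp
    also have "\<dots> = (exp (- (pi / 2) * (norm z)\<^sup>2))\<^sup>2 * (cmod (F z))\<^sup>2" by (rule power_mult_distrib)
    also have "(exp (- (pi / 2) * (norm z)\<^sup>2))\<^sup>2 = exp (- pi * (norm z)\<^sup>2)"
      by (simp add: exp_double[symmetric])
    finally show "(cmod (F z))\<^sup>2 * exp (- pi * (norm z)\<^sup>2) = (cmod (\<Sum>k\<in>K_set n. fock_inner (f k) (beta_op z (ek k))))\<^sup>2" by simp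
  qed
qed

context lattice_pair
begin

text \<open>A Schur type estimate. The Gaussian that bounds the shifted window is split into two
  equal factors, Cauchy-Schwarz puts one of them next to f, and the lattice sum is then taken under
  the integral, where it is bounded uniformly.\<close>

lemma bessel_single:
  assumes e: "bij_betw e (UNIV::nat set) G.lat" and g: "exptype g"
  shows "\<exists>B>0. \<forall>f. exptype f \<longrightarrow> (\<Sum>n. ennreal ((cmod (fock_inner f (beta_op (e n) g)))\<^sup>2)) \<le> ennreal B * fock_norm2 f"
proof -
  obtain C where C: "C > 0" "\<And>v w. cmod (beta_op v g w) \<le> C * exp (pi / 2 * (norm w)\<^sup>2) * exp (- (pi / 4) * (norm (w - v))\<^sup>2)"
    using beta_decay[OF g] by metis
  obtain C0 where C0: "C0 > 0" "\<And>w. summable (\<lambda>n. exp (- (pi / 4) * (norm (w - e n))\<^sup>2))"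
    "\<And>w. (\<Sum>n. exp (- (pi / 4) * (norm (w - e n))\<^sup>2)) \<le> C0"
    using G.gauss_sum[OF e, of "pi / 4"] by auto
  define M where "M = sqrt (pi / (pi / 4)) ^ DIM(complex^'d)"
  have M: "M > 0" by (simp add: M_def)
  \<comment> \<open>The square root of the Gaussian of rate pi/4 in
    \<open>beta_decay\<close>.\<close>
  define h where "h x = ennreal (exp (- (pi / 8) * (norm (x::complex^'d))\<^sup>2))" for x
  have [measurable]: "h \<in> borel_measurable borel" unfolding h_def[abs_def] by measurable
  have h2: "(h x)\<^sup>2 = ennreal (exp (- (pi / 4) * (norm x)\<^sup>2))" for x
    by (simp add: h_def ennreal_power exp_double[symmetric])
  show ?thesis
  proof (intro exI[of _ "C\<^sup>2 * (M * C0)"] conjI allI impI)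
    show "C\<^sup>2 * (M * C0) > 0" using C(1) M C0(1) by simp
    fix f :: "complex^'d \<Rightarrow> complex" assume f: "exptype f"
    have [measurable]: "f \<in> borel_measurable borel" by (rule exptype_measurable[OF f])
    define F where "F x = ennreal (cmod (f x) * exp (- (pi / 2) * (norm x)\<^sup>2))" for x
    have [measurable]: "F \<in> borel_measurable borel" unfolding F_def[abs_def] by measurable
    have F2: "(F x)\<^sup>2 = ennreal ((cmod (f x))\<^sup>2 * exp (- pi * (norm x)\<^sup>2))" for x
    proof -
      have "(exp (- (pi / 2) * (norm x)\<^sup>2))\<^sup>2 = exp (- pi * (norm x)\<^sup>2)"
        by (simp add: exp_double[symmetric])
      then show ?thesis unfolding F_def by (simp add: ennreal_power power_mult_distrib)
    qed
    have one: "ennreal ((cmod (fock_inner f (beta_op z g)))\<^sup>2) \<le> ennreal (C\<^sup>2 * M) * (\<integral>\<^sup>+x. (F x)\<^sup>2 * (h (x - z))\<^sup>2 \<partial>lborel)" for z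
    proof -
      have i: "integrable lborel (\<lambda>x. f x * cnj (beta_op z g x) * gauss x)"
        by (intro fock_L2_integrable fock_L2_exptype f exptype_beta g)
      have "ennreal (cmod (fock_inner f (beta_op z g))) \<le> (\<integral>\<^sup>+x. ennreal (cmod (f x * cnj (beta_op z g x) * gauss x)) \<partial>lborel)"
        unfolding fock_inner_gauss by (rule integral_norm_bound_ennreal[OF i])
      also have "\<dots> \<le> (\<integral>\<^sup>+x. ennreal C * ((F x * h (x - z)) * h (x - z)) \<partial>lborel)"
      proof (rule nn_integral_mono)
        fix x
        have "cmod (f x * cnj (beta_op z g x) * gauss x) \<le> cmod (f x) * (C * exp (pi / 2 * (norm x)\<^sup>2) * exp (- (pi / 4) * (norm (x - z))\<^sup>2)) * exp (- pi * (norm x)\<^sup>2)"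
          unfolding norm_mult cmod_gauss complex_mod_cnj by (intro mult_right_mono mult_left_mono C(2)) auto
        also have "\<dots> = C * ((cmod (f x) * (exp (pi / 2 * (norm x)\<^sup>2) * exp (- pi * (norm x)\<^sup>2))) * exp (- (pi / 4) * (norm (x - z))\<^sup>2))"
          by (simp only: mult_ac)
        also have "exp (pi / 2 * (norm x)\<^sup>2) * exp (- pi * (norm x)\<^sup>2) = exp (- (pi / 2) * (norm x)\<^sup>2)"
          unfolding exp_add[symmetric] by (simp add: field_simps)
        finally have "ennreal (cmod (f x * cnj (beta_op z g x) * gauss x)) \<le> ennreal (C * ((cmod (f x) * exp (- (pi / 2) * (norm x)\<^sup>2)) * exp (- (pi / 4) * (norm (x - z))\<^sup>2)))"
          by (rule ennreal_leI)
        also have "\<dots> = ennreal C * (F x * (h (x - z))\<^sup>2)"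
          unfolding h2 F_def using C(1) by (simp add: ennreal_mult)
        finally show "ennreal (cmod (f x * cnj (beta_op z g x) * gauss x)) \<le> ennreal C * ((F x * h (x - z)) * h (x - z))"
          by (simp only: power2_eq_square mult.assoc)
      qed
      also have "\<dots> = ennreal C * (\<integral>\<^sup>+x. (F x * h (x - z)) * h (x - z) \<partial>lborel)"
        by (rule nn_integral_cmult) measurable
      finally have "(ennreal (cmod (fock_inner f (beta_op z g))))\<^sup>2 \<le> (ennreal C * (\<integral>\<^sup>+x. (F x * h (x - z)) * h (x - z) \<partial>lborel))\<^sup>2"
        by (intro power_mono) auto
      also have "\<dots> = (ennreal C)\<^sup>2 * (\<integral>\<^sup>+x. (F x * h (x - z)) * h (x - z) \<partial>lborel)\<^sup>2"
        by (rule power_mult_distrib)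
      finally have sq1: "(ennreal (cmod (fock_inner f (beta_op z g))))\<^sup>2 \<le> (ennreal C)\<^sup>2 * (\<integral>\<^sup>+x. (F x * h (x - z)) * h (x - z) \<partial>lborel)\<^sup>2" .
      have m1: "(\<lambda>x. F x * h (x - z)) \<in> borel_measurable lborel" by measurable
      have m2: "(\<lambda>x. h (x - z)) \<in> borel_measurable lborel" by measurable
      note sq1
      also have "(ennreal C)\<^sup>2 * (\<integral>\<^sup>+x. (F x * h (x - z)) * h (x - z) \<partial>lborel)\<^sup>2 \<le> (ennreal C)\<^sup>2 * ((\<integral>\<^sup>+x. (F x * h (x - z))\<^sup>2 \<partial>lborel) * (\<integral>\<^sup>+x. (h (x - z))\<^sup>2 \<partial>lborel))"
        by (intro mult_left_mono Cauchy_Schwarz_nn_integral[OF m1 m2]) simp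
      also have "(\<integral>\<^sup>+x. (h (x - z))\<^sup>2 \<partial>lborel) = ennreal M"
        unfolding h2 M_def by (rule nn_integral_gauss_shift) simp
      also have "(ennreal C)\<^sup>2 * ((\<integral>\<^sup>+x. (F x * h (x - z))\<^sup>2 \<partial>lborel) * ennreal M) = ennreal (C\<^sup>2 * M) * (\<integral>\<^sup>+x. (F x)\<^sup>2 * (h (x - z))\<^sup>2 \<partial>lborel)"
        using C(1) M by (simp add: power_mult_distrib ennreal_mult ennreal_power mult_ac)
      finally show ?thesis by (simp add: ennreal_power)
    qed
    have ms: "(\<lambda>x. (F x)\<^sup>2 * (h (x - e i))\<^sup>2) \<in> borel_measurable lborel" for i by measurable
    have mf: "(\<lambda>x. (F x)\<^sup>2) \<in> borel_measurable lborel" by measurable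
    have "(\<Sum>n. ennreal ((cmod (fock_inner f (beta_op (e n) g)))\<^sup>2)) \<le> (\<Sum>n. ennreal (C\<^sup>2 * M) * (\<integral>\<^sup>+x. (F x)\<^sup>2 * (h (x - e n))\<^sup>2 \<partial>lborel))"
      by (rule suminf_le[OF one]) auto
    also have "\<dots> = ennreal (C\<^sup>2 * M) * (\<integral>\<^sup>+x. (\<Sum>n. (F x)\<^sup>2 * (h (x - e n))\<^sup>2) \<partial>lborel)"
      unfolding nn_integral_suminf[OF ms] by (rule ennreal_suminf_cmult)
    also have "\<dots> \<le> ennreal (C\<^sup>2 * M) * (\<integral>\<^sup>+x. ennreal C0 * (F x)\<^sup>2 \<partial>lborel)"
    proof (intro mult_left_mono nn_integral_mono)
      fix x
      have "(\<Sum>n. (F x)\<^sup>2 * (h (x - e n))\<^sup>2) = (F x)\<^sup>2 * ennreal (\<Sum>n. exp (- (pi / 4) * (norm (x - e n))\<^sup>2))"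
        unfolding h2 by (subst suminf_ennreal2[symmetric, OF _ C0(2)]) simp_all
      also have "\<dots> \<le> (F x)\<^sup>2 * ennreal C0" by (intro mult_left_mono ennreal_leI C0(3)) simp
      finally show "(\<Sum>n. (F x)\<^sup>2 * (h (x - e n))\<^sup>2) \<le> ennreal C0 * (F x)\<^sup>2" by (simp only: mult.commute)
    qed simp
    also have "\<dots> = ennreal (C\<^sup>2 * M) * (ennreal C0 * fock_norm2 f)"
      unfolding fock_norm2_def F2[symmetric] by (simp only: nn_integral_cmult[OF mf])
    also have "\<dots> = ennreal (C\<^sup>2 * (M * C0)) * fock_norm2 f"
      using C(1) M C0(1) by (simp add: ennreal_mult mult.assoc)
    finally show "(\<Sum>n. ennreal ((cmod (fock_inner f (beta_op (e n) g)))\<^sup>2)) \<le> ennreal (C\<^sup>2 * (M * C0)) * fock_norm2 f" .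
  qed
qed

lemma bessel_exptype:
  fixes n :: "nat^'d"
  assumes e: "bij_betw e (UNIV::nat set) G.lat"
  shows "\<exists>B>0. \<forall>F. exptype_poly n F \<longrightarrow> (\<Sum>i. ennreal ((cmod (F (e i)))\<^sup>2 * exp (- pi * (norm (e i))\<^sup>2))) \<le> ennreal B * fock_norm2 F"
proof -
  have "\<forall>k. \<exists>B>0. \<forall>f. exptype f \<longrightarrow> (\<Sum>i. ennreal ((cmod (fock_inner f (beta_op (e i) (ek k))))\<^sup>2)) \<le> ennreal B * fock_norm2 f"
    by (intro allI bessel_single[OF e] exptype_ek)
  then obtain B where B: "\<And>k. B k > 0" "\<And>k f. exptype f \<Longrightarrow> (\<Sum>i. ennreal ((cmod (fock_inner f (beta_op (e i) (ek k))))\<^sup>2)) \<le> ennreal (B k) * fock_norm2 f"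
    by metis
  \<comment> \<open>Passes from the plain norms of the f_k to the weighted sum that equals the norm
    of F.\<close>
  define M where "M = (\<Sum>k\<in>K_set n. B k / ek_norm2 k)"
  have M0: "M \<ge> 0" unfolding M_def using B(1) ek_norm2_pos by (intro sum_nonneg) (auto intro!: less_imp_le divide_pos_pos)
  have BM: "B k \<le> M * ek_norm2 k" if "k \<in> K_set n" for k
  proof -
    have "B k / ek_norm2 k \<le> M"
      unfolding M_def using B(1) ek_norm2_pos
      by (intro member_le_sum that finite_K_set) (auto intro!: less_imp_le divide_pos_pos)
    then show ?thesis using ek_norm2_pos[of k] by (simp add: pos_divide_le_eq)
  qed
  define c where "c = real (card (K_set n))"
  show ?thesis
  \<comment> \<open>The added 1 keeps the bound positive even for an empty index set.\<close>
  proof (intro exI[of _ "c * M + 1"] conjI allI impI)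
    show "c * M + 1 > 0" using M0 by (simp add: c_def add_nonneg_pos)
    fix F assume "exptype_poly n F"
    from exptype_poly_rep[OF this] obtain f where nf: "\<forall>k. exptype (f k)"
      and Ff: "\<forall>z. (cmod (F z))\<^sup>2 * exp (- pi * (norm z)\<^sup>2) = (cmod (\<Sum>k\<in>K_set n. fock_inner (f k) (beta_op z (ek k))))\<^sup>2"
      and FN: "fock_norm2 F = ennreal (\<Sum>k\<in>K_set n. ek_norm2 k * Re (fock_inner (f k) (f k)))"
      by (elim exE conjE)
    note f = spec[OF nf] spec[OF Ff] FN
    let ?A = "\<lambda>k z. fock_inner (f k) (beta_op z (ek k))"
    have sq: "(cmod (\<Sum>k\<in>K_set n. ?A k z))\<^sup>2 \<le> c * (\<Sum>k\<in>K_set n. (cmod (?A k z))\<^sup>2)" for z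
    proof -
      have "(cmod (\<Sum>k\<in>K_set n. ?A k z))\<^sup>2 \<le> (\<Sum>k\<in>K_set n. cmod (?A k z))\<^sup>2"
        by (intro power_mono norm_sum) simp
      also have "\<dots> \<le> (\<Sum>k\<in>K_set n. (cmod (?A k z))\<^sup>2) * c"
        unfolding c_def by (rule sum_squared_le_sum_of_squares)
      finally show ?thesis by (simp only: mult.commute)
    qed
    have "(\<Sum>i. ennreal ((cmod (F (e i)))\<^sup>2 * exp (- pi * (norm (e i))\<^sup>2))) \<le> (\<Sum>i. ennreal c * (\<Sum>k\<in>K_set n. ennreal ((cmod (?A k (e i)))\<^sup>2)))"
    proof (rule suminf_le)
      fix i
      have "ennreal ((cmod (\<Sum>k\<in>K_set n. ?A k (e i)))\<^sup>2) \<le> ennreal (c * (\<Sum>k\<in>K_set n. (cmod (?A k (e i)))\<^sup>2))"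
        by (rule ennreal_leI[OF sq])
      then show "ennreal ((cmod (F (e i)))\<^sup>2 * exp (- pi * (norm (e i))\<^sup>2)) \<le> ennreal c * (\<Sum>k\<in>K_set n. ennreal ((cmod (?A k (e i)))\<^sup>2))"
        unfolding f(2) by (simp add: c_def ennreal_mult sum_nonneg)
    qed auto
    also have "\<dots> = ennreal c * (\<Sum>k\<in>K_set n. (\<Sum>i. ennreal ((cmod (?A k (e i)))\<^sup>2)))"
      by (simp only: ennreal_suminf_cmult suminf_sum[OF summableI])
    also have "\<dots> \<le> ennreal c * (\<Sum>k\<in>K_set n. ennreal (M * (ek_norm2 k * Re (fock_inner (f k) (f k)))))"
    proof (intro mult_left_mono sum_mono)
      fix k assume k: "k \<in> K_set n"
      have "(\<Sum>i. ennreal ((cmod (?A k (e i)))\<^sup>2)) \<le> ennreal (B k) * fock_norm2 (f k)" by (rule B(2)[OF f(1)])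
      also have "\<dots> = ennreal (B k * Re (fock_inner (f k) (f k)))"
        unfolding exptype_fock_norm2[OF f(1)] using B(1) exptype_norm_nonneg[OF f(1)] by (simp add: ennreal_mult less_imp_le)
      also have "\<dots> \<le> ennreal (M * (ek_norm2 k * Re (fock_inner (f k) (f k))))"
        using mult_right_mono[OF BM[OF k] exptype_norm_nonneg[OF f(1)]] by (intro ennreal_leI) (simp add: mult.assoc)
      finally show "(\<Sum>i. ennreal ((cmod (?A k (e i)))\<^sup>2)) \<le> ennreal (M * (ek_norm2 k * Re (fock_inner (f k) (f k))))" .
    qed simp
    also have "\<dots> = ennreal (c * M) * fock_norm2 F"
    proof -
      have nn: "0 \<le> ek_norm2 k * Re (fock_inner (f k) (f k))" for k
        using ek_norm2_pos[of k] exptype_norm_nonneg[OF f(1)] by (simp add: less_imp_le)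
      have "(\<Sum>k\<in>K_set n. ennreal (M * (ek_norm2 k * Re (fock_inner (f k) (f k))))) = ennreal (M * (\<Sum>k\<in>K_set n. ek_norm2 k * Re (fock_inner (f k) (f k))))"
        using M0 nn by (simp add: sum_distrib_left)
      also have "\<dots> = ennreal M * fock_norm2 F" unfolding f(3) using M0 nn by (simp add: ennreal_mult sum_nonneg)
      finally show ?thesis using M0 by (simp add: c_def ennreal_mult mult.assoc)
    qed
    also have "\<dots> \<le> ennreal (c * M + 1) * fock_norm2 F"
      by (intro mult_right_mono ennreal_leI) auto
    finally show "(\<Sum>i. ennreal ((cmod (F (e i)))\<^sup>2 * exp (- pi * (norm (e i))\<^sup>2))) \<le> ennreal (c * M + 1) * fock_norm2 F" .
  qed
qed

end

section \<open>The lower sampling bound through Poisson summation\<close>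

definition repro_ker :: "complex^'d::finite \<Rightarrow> complex^'d \<Rightarrow> complex" where
  "repro_ker w \<xi> = exp (of_real pi * cdot w \<xi>)"

text \<open>Completing the square leaves, apart from one factor in \<zeta> and one in w, a Gaussian
  in w - \<zeta> - z. Superpositions of these functions therefore behave like discrete
  convolutions.\<close>

lemma cmod_beta_repro_ker:
  "cmod (beta_op (- z) (repro_ker w) \<zeta>) = exp (pi / 2 * (norm \<zeta>)\<^sup>2) * exp (pi / 2 * (norm w)\<^sup>2) * exp (- (pi / 2) * (norm ((w - \<zeta>) - z))\<^sup>2)"
proof -
  have "norm ((w - \<zeta>) - z) = norm ((\<zeta> - - z) - w)"
    by (metis diff_diff_eq diff_minus_eq_add minus_diff_eq norm_minus_cancel)
  then have h: "Re (cdot w (\<zeta> - - z)) = ((norm (\<zeta> - - z))\<^sup>2 + (norm w)\<^sup>2 - (norm ((w - \<zeta>) - z))\<^sup>2) / 2"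
    using norm_diff_cdot[of "\<zeta> - - z" w] by simp
  have "pi * Re (cdot w (\<zeta> - - z)) + (pi / 2 * (norm \<zeta>)\<^sup>2 - pi / 2 * (norm (\<zeta> - - z))\<^sup>2) = pi / 2 * (norm \<zeta>)\<^sup>2 + pi / 2 * (norm w)\<^sup>2 + - (pi / 2) * (norm ((w - \<zeta>) - z))\<^sup>2"
    unfolding h by (simp add: field_simps)
  moreover have "cmod (repro_ker w x) = exp (pi * Re (cdot w x))" for x by (simp add: repro_ker_def)
  ultimately show ?thesis unfolding cmod_beta_half by (simp only: exp_add[symmetric])
qed

text \<open>The estimate dual to \<open>bessel_single\<close>: Cauchy-Schwarz in the index with the
  Gaussian split into equal factors, then integration in \<zeta>. The factor exp(pi |w|^2) is the
  squared norm of the kernel at w; the weight in w cancels it later.\<close>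

lemma synthesis_norm:
  fixes e :: "nat \<Rightarrow> complex^'d::finite"
  assumes gs: "\<And>u. summable (\<lambda>n. exp (- (pi / 2) * (norm (u - e n))\<^sup>2))" "\<And>u. (\<Sum>n. exp (- (pi / 2) * (norm (u - e n))\<^sup>2)) \<le> C"
    and x: "\<And>n. cmod (x n) \<le> B"
  shows "summable (\<lambda>n. cmod (x n * beta_op (- e n) (repro_ker w) \<zeta>))"
    and "fock_norm2 (\<lambda>\<zeta>. \<Sum>n. x n * beta_op (- e n) (repro_ker w) \<zeta>) \<le> ennreal (exp (pi * (norm w)\<^sup>2) * C * sqrt (pi / (pi / 2)) ^ DIM(complex^'d)) * (\<Sum>n. ennreal ((cmod (x n))\<^sup>2))"
proof -
  define q where "q n \<zeta> = exp (- (pi / 4) * (norm ((w - \<zeta>) - e n))\<^sup>2)" for n \<zeta>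
  have q2: "exp (- (pi / 2) * (norm ((w - \<zeta>) - e n))\<^sup>2) = q n \<zeta> * q n \<zeta>" for n \<zeta>
    unfolding q_def exp_add[symmetric] by (simp add: field_simps)
  define E where "E \<zeta> = exp (pi / 2 * (norm \<zeta>)\<^sup>2) * exp (pi / 2 * (norm w)\<^sup>2)" for \<zeta> :: "complex^'d"
  define M where "M = sqrt (pi / (pi / 2)) ^ DIM(complex^'d)"
  have sxq: "summable (\<lambda>n. cmod (x n) * (q n \<zeta> * q n \<zeta>))" for \<zeta>
  proof (rule summable_comparison_test'[of "\<lambda>n. B * (q n \<zeta> * q n \<zeta>)" 0])
    show "summable (\<lambda>n. B * (q n \<zeta> * q n \<zeta>))" unfolding q2[symmetric] by (rule summable_mult[OF gs(1)])
    show "norm (cmod (x n) * (q n \<zeta> * q n \<zeta>)) \<le> B * (q n \<zeta> * q n \<zeta>)" for n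
      using x[of n] by (simp add: q_def mult_right_mono)
  qed
  have cm: "cmod (x n * beta_op (- e n) (repro_ker w) \<zeta>) = E \<zeta> * (cmod (x n) * (q n \<zeta> * q n \<zeta>))" for n \<zeta>
    unfolding norm_mult cmod_beta_repro_ker q2 E_def by (simp only: mult_ac)
  show s1: "summable (\<lambda>n. cmod (x n * beta_op (- e n) (repro_ker w) \<zeta>))" for \<zeta>
    unfolding cm by (rule summable_mult[OF sxq])
  have C0: "C \<ge> 0" using gs(2)[of 0] suminf_nonneg[OF gs(1)[of 0]] by (meson exp_ge_zero order_trans)
  define H where "H \<zeta> = (\<Sum>n. x n * beta_op (- e n) (repro_ker w) \<zeta>)" for \<zeta>
  have pt: "ennreal ((cmod (H \<zeta>))\<^sup>2 * exp (- pi * (norm \<zeta>)\<^sup>2)) \<le> ennreal (exp (pi * (norm w)\<^sup>2) * C) * (\<Sum>n. ennreal ((cmod (x n))\<^sup>2) * ennreal (exp (- (pi / 2) * (norm (\<zeta> - (w - e n)))\<^sup>2)))" for \<zeta>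
  proof -
    define s where "s = (\<Sum>n. cmod (x n) * (q n \<zeta> * q n \<zeta>))"
    have "cmod (H \<zeta>) \<le> (\<Sum>n. cmod (x n * beta_op (- e n) (repro_ker w) \<zeta>))"
      unfolding H_def by (rule summable_norm[OF s1])
    also have "\<dots> = E \<zeta> * s" unfolding cm s_def by (rule suminf_mult[OF sxq])
    finally have "(cmod (H \<zeta>))\<^sup>2 \<le> (E \<zeta> * s)\<^sup>2" by (rule power_mono) simp
    then have "(cmod (H \<zeta>))\<^sup>2 * exp (- pi * (norm \<zeta>)\<^sup>2) \<le> (E \<zeta> * s)\<^sup>2 * exp (- pi * (norm \<zeta>)\<^sup>2)"
      by (rule mult_right_mono) simp
    also have "\<dots> = exp (pi * (norm w)\<^sup>2) * s\<^sup>2"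
    proof -
      have "(E \<zeta>)\<^sup>2 * exp (- pi * (norm \<zeta>)\<^sup>2) = exp (pi * (norm w)\<^sup>2)"
        unfolding E_def power2_eq_square exp_add[symmetric] by (simp add: field_simps)
      then show ?thesis by (simp add: power_mult_distrib mult_ac)
    qed
    finally have 1: "ennreal ((cmod (H \<zeta>))\<^sup>2 * exp (- pi * (norm \<zeta>)\<^sup>2)) \<le> ennreal (exp (pi * (norm w)\<^sup>2) * s\<^sup>2)"
      by (rule ennreal_leI)
    have q0: "0 \<le> q n \<zeta>" for n by (simp add: q_def)
    have s0: "0 \<le> s" unfolding s_def using q0 by (intro suminf_nonneg sxq) auto
    have "ennreal s = (\<Sum>n. ennreal (cmod (x n) * q n \<zeta>) * ennreal (q n \<zeta>))"
      unfolding s_def using q0 by (subst suminf_ennreal2[symmetric, OF _ sxq]) (simp_all add: ennreal_mult mult.assoc)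
    then have "ennreal (s\<^sup>2) = (\<Sum>n. ennreal (cmod (x n) * q n \<zeta>) * ennreal (q n \<zeta>))\<^sup>2"
      using s0 by (simp add: ennreal_power[symmetric])
    also have "\<dots> \<le> (\<Sum>n. (ennreal (cmod (x n) * q n \<zeta>))\<^sup>2) * (\<Sum>n. (ennreal (q n \<zeta>))\<^sup>2)"
      by (rule suminf_Cauchy_Schwarz)
    also have "\<dots> \<le> (\<Sum>n. (ennreal (cmod (x n) * q n \<zeta>))\<^sup>2) * ennreal C"
    proof (rule mult_left_mono)
      have "(\<Sum>n. (ennreal (q n \<zeta>))\<^sup>2) = (\<Sum>n. ennreal (exp (- (pi / 2) * (norm ((w - \<zeta>) - e n))\<^sup>2)))"
        unfolding q2 by (simp add: power2_eq_square ennreal_mult q0)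
      also have "\<dots> = ennreal (\<Sum>n. exp (- (pi / 2) * (norm ((w - \<zeta>) - e n))\<^sup>2))"
        by (rule suminf_ennreal2[OF _ gs(1)]) simp
      also have "\<dots> \<le> ennreal C" by (rule ennreal_leI[OF gs(2)])
      finally show "(\<Sum>n. (ennreal (q n \<zeta>))\<^sup>2) \<le> ennreal C" .
    qed simp
    also have "(\<Sum>n. (ennreal (cmod (x n) * q n \<zeta>))\<^sup>2) = (\<Sum>n. ennreal ((cmod (x n))\<^sup>2) * ennreal (exp (- (pi / 2) * (norm (\<zeta> - (w - e n)))\<^sup>2)))"
    proof (rule suminf_cong)
      fix n
      have "norm (\<zeta> - (w - e n)) = norm ((w - \<zeta>) - e n)"
        by (metis add_diff_eq diff_diff_eq norm_minus_commute add.commute diff_diff_eq2)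
      then have "exp (- (pi / 2) * (norm (\<zeta> - (w - e n)))\<^sup>2) = q n \<zeta> * q n \<zeta>" using q2 by simp
      then show "(ennreal (cmod (x n) * q n \<zeta>))\<^sup>2 = ennreal ((cmod (x n))\<^sup>2) * ennreal (exp (- (pi / 2) * (norm (\<zeta> - (w - e n)))\<^sup>2))"
        by (simp add: ennreal_mult power2_eq_square q0 mult_ac)
    qed
    finally have "ennreal (s\<^sup>2) \<le> (\<Sum>n. ennreal ((cmod (x n))\<^sup>2) * ennreal (exp (- (pi / 2) * (norm (\<zeta> - (w - e n)))\<^sup>2))) * ennreal C" .
    then have "ennreal (exp (pi * (norm w)\<^sup>2)) * ennreal (s\<^sup>2) \<le> ennreal (exp (pi * (norm w)\<^sup>2)) * ((\<Sum>n. ennreal ((cmod (x n))\<^sup>2) * ennreal (exp (- (pi / 2) * (norm (\<zeta> - (w - e n)))\<^sup>2))) * ennreal C)"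
      by (rule mult_left_mono) simp
    with 1 show ?thesis using C0 by (simp add: ennreal_mult mult_ac)
  qed
  have "fock_norm2 H \<le> (\<integral>\<^sup>+\<zeta>. ennreal (exp (pi * (norm w)\<^sup>2) * C) * (\<Sum>n. ennreal ((cmod (x n))\<^sup>2) * ennreal (exp (- (pi / 2) * (norm (\<zeta> - (w - e n)))\<^sup>2))) \<partial>lborel)"
    unfolding fock_norm2_def by (rule nn_integral_mono[OF pt])
  also have "\<dots> = ennreal (exp (pi * (norm w)\<^sup>2) * C) * (\<Sum>n. ennreal ((cmod (x n))\<^sup>2) * (\<integral>\<^sup>+\<zeta>. ennreal (exp (- (pi / 2) * (norm (\<zeta> - (w - e n)))\<^sup>2)) \<partial>lborel))"
  proof -
    have m: "(\<lambda>\<zeta>. ennreal (exp (- (pi / 2) * (norm (\<zeta> - (w - e n)))\<^sup>2))) \<in> borel_measurable lborel" for n by measurable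
    have m2: "(\<lambda>\<zeta>. ennreal ((cmod (x n))\<^sup>2) * ennreal (exp (- (pi / 2) * (norm (\<zeta> - (w - e n)))\<^sup>2))) \<in> borel_measurable lborel" for n by measurable
    have m3: "(\<lambda>\<zeta>. \<Sum>n. ennreal ((cmod (x n))\<^sup>2) * ennreal (exp (- (pi / 2) * (norm (\<zeta> - (w - e n)))\<^sup>2))) \<in> borel_measurable lborel" by measurable
    show ?thesis
      unfolding nn_integral_cmult[OF m3] nn_integral_suminf[OF m2] nn_integral_cmult[OF m] ..
  qed
  also have "(\<Sum>n. ennreal ((cmod (x n))\<^sup>2) * (\<integral>\<^sup>+\<zeta>. ennreal (exp (- (pi / 2) * (norm (\<zeta> - (w - e n)))\<^sup>2)) \<partial>lborel)) = ennreal M * (\<Sum>n. ennreal ((cmod (x n))\<^sup>2))"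
    unfolding M_def nn_integral_gauss_shift[OF pi_half_gt_zero] by (subst ennreal_suminf_cmult[symmetric]) (simp add: mult.commute)
  also have "ennreal (exp (pi * (norm w)\<^sup>2) * C) * (ennreal M * (\<Sum>n. ennreal ((cmod (x n))\<^sup>2))) = ennreal (exp (pi * (norm w)\<^sup>2) * C * M) * (\<Sum>n. ennreal ((cmod (x n))\<^sup>2))"
    using C0 by (simp add: ennreal_mult mult.assoc M_def)
  finally show "fock_norm2 (\<lambda>\<zeta>. \<Sum>n. x n * beta_op (- e n) (repro_ker w) \<zeta>) \<le> ennreal (exp (pi * (norm w)\<^sup>2) * C * sqrt (pi / (pi / 2)) ^ DIM(complex^'d)) * (\<Sum>n. ennreal ((cmod (x n))\<^sup>2))"
    unfolding M_def H_def[abs_def] .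
qed

text \<open>\<open>beta_decay\<close> recentred: the Gaussian around w is rewritten as one around 0,
  at the expense of a linear term depending on w.\<close>

lemma gauss_dom_beta_decay:
  assumes f: "exptype f"
  shows "gauss_dom (pi / 4) (\<lambda>v. beta_op v f w)"
proof -
  obtain C where C: "C > 0" "\<And>v w. cmod (beta_op v f w) \<le> C * exp (pi / 2 * (norm w)\<^sup>2) * exp (- (pi / 4) * (norm (w - v))\<^sup>2)"
    using beta_decay[OF f] by metis
  show ?thesis
  proof (rule gauss_domI[where A="C * exp (pi / 2 * (norm w)\<^sup>2)" and B="pi / 2 * norm w"])
    show "(\<lambda>v. beta_op v f w) \<in> borel_measurable borel" by (rule gauss_dom_measurable[OF gauss_dom_beta_snd[OF f]])
    fix v :: "complex^'a"
    have "(norm v)\<^sup>2 - 2 * norm w * norm v \<le> (norm w - norm v)\<^sup>2" by (simp add: power2_diff)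
    also have "\<dots> \<le> (norm (w - v))\<^sup>2"
      using norm_triangle_ineq3[of w v] by (simp add: abs_le_square_iff[symmetric])
    finally have "(pi / 4) * ((norm v)\<^sup>2 - 2 * norm w * norm v) \<le> (pi / 4) * (norm (w - v))\<^sup>2" by (intro mult_left_mono) auto
    then have "- (pi / 4) * (norm (w - v))\<^sup>2 \<le> pi / 2 * norm w * norm v - pi / 4 * (norm v)\<^sup>2" by (simp add: field_simps)
    then have "C * exp (pi / 2 * (norm w)\<^sup>2) * exp (- (pi / 4) * (norm (w - v))\<^sup>2) \<le> C * exp (pi / 2 * (norm w)\<^sup>2) * exp (pi / 2 * norm w * norm v - pi / 4 * (norm v)\<^sup>2)"
      using C(1) by (intro mult_left_mono) auto
    then show "cmod (beta_op v f w) \<le> C * exp (pi / 2 * (norm w)\<^sup>2) * exp (pi / 2 * norm w * norm v - pi / 4 * (norm v)\<^sup>2)"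
      using C(2)[of v w] by linarith
  qed
qed

lemma cmod_inner_beta_le:
  assumes f: "exptype f" and g: "exptype g"
  shows "cmod (fock_inner f (beta_op z g)) \<le> sqrt (Re (fock_inner f f) * Re (fock_inner g g))"
proof -
  have "fock_inner (beta_op z g) (beta_op z g) = fock_inner g g"
    by (rule fock_inner_beta) (rule exptype_measurable[OF g])+
  then have "ennreal ((cmod (fock_inner f (beta_op z g)))\<^sup>2) \<le> ennreal (Re (fock_inner f f)) * ennreal (Re (fock_inner g g))"
    using fock_L2_inner_le[OF fock_L2_exptype[OF f] fock_L2_exptype[OF exptype_beta[OF g]], of z] unfolding exptype_fock_norm2[OF f] exptype_fock_norm2[OF exptype_beta[OF g]] by simp
  then have "(cmod (fock_inner f (beta_op z g)))\<^sup>2 \<le> Re (fock_inner f f) * Re (fock_inner g g)"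
    using exptype_norm_nonneg[OF f] exptype_norm_nonneg[OF g] by (simp add: ennreal_mult[symmetric] ennreal_le_iff)
  then show ?thesis by (rule real_le_rsqrt)
qed

lemma continuous_beta_fst:
  assumes "exptype f"
  shows "continuous_on UNIV (\<lambda>v. beta_op v f w)"
proof -
  have "continuous_on UNIV (\<lambda>v. f (w - v))"
    by (rule continuous_on_compose2[OF entire_continuous[OF exptype_entire[OF assms]]]) (intro continuous_intros, simp)
  then show ?thesis unfolding beta_op_def cdot_def by (intro continuous_intros) 
qed

context lattice_pair
begin

text \<open>The character is the phase that arises on moving \<open>beta_op z\<close> past
  \<open>beta_op v\<close>. Absorbing it replaces the window g by \<open>beta_op z g\<close> and
  adds an outer shift by -z, so every coefficient is again an instance of
  \<open>moyal_kernel\<close>.\<close>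

lemma poisson_coefficient:
  assumes f: "exptype f" and g: "exptype g"
  shows "integrable lborel (\<lambda>v. (cnj (beta_op v f w) * beta_op v g \<zeta>) * G0.chi (- L z) v)"
    and "(\<integral>v. (cnj (beta_op v f w) * beta_op v g \<zeta>) * G0.chi (- L z) v \<partial>lborel) = cnj (fock_inner f (beta_op z g)) * beta_op (- z) (repro_ker w) \<zeta>"
proof -
  have gc: "gauss_dom 0 (G0.chi (- L z))" by (rule gauss_domI[where A=1 and B=0]) auto
  show "integrable lborel (\<lambda>v. (cnj (beta_op v f w) * beta_op v g \<zeta>) * G0.chi (- L z) v)"
    by (rule gauss_dom_integrable[OF gauss_dom_mult[OF gauss_dom_mult[OF gauss_dom_cnj[OF gauss_dom_beta_decay[OF f]] gauss_dom_beta_decay[OF g]] gc]]) simp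
  define b where "b = exp (of_real pi * cdot (- z) \<zeta> - of_real (pi / 2) * cdot (- z) (- z))"
  have bb: "beta_op (- z) F \<zeta> = b * F (\<zeta> - - z)" for F unfolding beta_op_cdot b_def ..
  have comm: "beta_op v g \<zeta> * G0.chi (- L z) v = b * beta_op v (beta_op z g) (\<zeta> - - z)" for v
  proof -
    have "Im (cdot z z) = 0" by (simp add: cdot_self)
    then have im: "Im (cdot (- z) (v + z)) = - Im (cdot z v)" by (simp add: cdot_minus_left cdot_add_right)
    have "beta_op v (beta_op z g) = (\<lambda>\<xi>. cis (pi * Im (cdot v z)) * beta_op (v + z) g \<xi>)"
      by (rule ext) (rule beta_beta_cis)
    then have "b * beta_op v (beta_op z g) (\<zeta> - - z) = cis (pi * Im (cdot v z)) * beta_op (- z) (beta_op (v + z) g) \<zeta>"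
      unfolding bb by simp
    also have "\<dots> = cis (pi * Im (cdot v z)) * (cis (pi * Im (cdot (- z) (v + z))) * beta_op (- z + (v + z)) g \<zeta>)"
      by (simp only: beta_beta_cis)
    also have "- z + (v + z) = v" by simp
    also have "cis (pi * Im (cdot v z)) * (cis (pi * Im (cdot (- z) (v + z))) * beta_op v g \<zeta>) = cis (- 2 * pi * Im (cdot z v)) * beta_op v g \<zeta>"
      unfolding im Im_cdot_swap[of v z] mult.assoc[symmetric] cis_mult by (simp add: mult.assoc)
    also have "cis (- 2 * pi * Im (cdot z v)) = G0.chi (- L z) v"
      unfolding G0.chi_def pairing by simp
    finally show ?thesis by (simp only: mult.commute)
  qed
  have "(\<integral>v. (cnj (beta_op v f w) * beta_op v g \<zeta>) * G0.chi (- L z) v \<partial>lborel) = (\<integral>v. b * (cnj (beta_op v f w) * beta_op v (beta_op z g) (\<zeta> - - z)) \<partial>lborel)"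
  proof (intro Bochner_Integration.integral_cong refl)
    fix v
    show "(cnj (beta_op v f w) * beta_op v g \<zeta>) * G0.chi (- L z) v = b * (cnj (beta_op v f w) * beta_op v (beta_op z g) (\<zeta> - - z))"
      using comm[of v] by (simp only: mult.assoc) (simp only: mult_ac)
  qed
  also have "\<dots> = b * (repro_ker w (\<zeta> - - z) * fock_inner (beta_op z g) f)"
    unfolding integral_mult_right_zero moyal_kernel[OF exptype_beta[OF g] f] repro_ker_def ..
  also have "\<dots> = cnj (fock_inner f (beta_op z g)) * beta_op (- z) (repro_ker w) \<zeta>"
    unfolding bb fock_inner_cnj by (simp only: mult_ac)
  finally show "(\<integral>v. (cnj (beta_op v f w) * beta_op v g \<zeta>) * G0.chi (- L z) v \<partial>lborel) = cnj (fock_inner f (beta_op z g)) * beta_op (- z) (repro_ker w) \<zeta>" .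
qed

end

text \<open>Spending pi/8 of each rate on the triangle inequality buys decay in w - u, and pi/8 of
  the first rate is kept. The two decays serve different purposes: v runs over a lattice, while u is
  a variable of integration.\<close>

lemma gauss_product_bound:
  fixes u v w :: "'a::euclidean_space"
  shows "exp (- (pi / 4) * (norm (w - v))\<^sup>2) * exp (- (pi / 4) * (norm (u - v))\<^sup>2) \<le> exp (- (pi / 16) * (norm (w - u))\<^sup>2) * exp (- (pi / 8) * (norm (w - v))\<^sup>2)"
proof -
  have "norm (w - u) \<le> norm (w - v) + norm (u - v)"
    using norm_triangle_ineq4[of "w - v" "u - v"] by simp
  then have "(norm (w - u))\<^sup>2 \<le> (norm (w - v) + norm (u - v))\<^sup>2" by (rule power_mono) simp
  also have "\<dots> \<le> 2 * (norm (w - v))\<^sup>2 + 2 * (norm (u - v))\<^sup>2"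
    using sum_squares_bound[of "norm (w - v)" "norm (u - v)"] by (simp add: power2_sum)
  finally have h: "(norm (w - u))\<^sup>2 \<le> 2 * (norm (w - v))\<^sup>2 + 2 * (norm (u - v))\<^sup>2" .
  have "- (pi / 4) * a + - (pi / 4) * b \<le> - (pi / 16) * x + - (pi / 8) * a" if "x \<le> 2 * a + 2 * b" "0 \<le> b" for a b x :: real
  proof -
    have "pi * x \<le> pi * (2 * a + 2 * b)" using that(1) by (rule mult_left_mono) simp
    then have "pi * x \<le> 2 * (pi * a) + 2 * (pi * b)" by (simp add: distrib_left)
    moreover have "0 \<le> pi * b" using that(2) by simp
    moreover have "- (pi / 4) * a + - (pi / 4) * b = - (pi * a) / 4 - (pi * b) / 4" "- (pi / 16) * x + - (pi / 8) * a = - (pi * x) / 16 - (pi * a) / 8"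
      by simp_all
    ultimately show ?thesis by linarith
  qed
  from this[OF h] have "- (pi / 4) * (norm (w - v))\<^sup>2 + - (pi / 4) * (norm (u - v))\<^sup>2 \<le> - (pi / 16) * (norm (w - u))\<^sup>2 + - (pi / 8) * (norm (w - v))\<^sup>2" by simp
  then show ?thesis unfolding exp_add[symmetric] by simp
qed

context lattice_pair
begin

text \<open>Two bounds meet in one function. P, the synthesis over the adjoint lattice, is a limit
  of finite sums to which the Riesz inequality applies; after Poisson summation the same function is
  H divided by the volume, for which \<open>synthesis_norm\<close> provides the upper bound.\<close>

lemma riesz_at_point:
  fixes n :: "nat^'d" and f :: "nat^'d \<Rightarrow> complex^'d \<Rightarrow> complex"
  assumes e: "bij_betw e (UNIV::nat set) G.lat" and e0: "bij_betw e0 (UNIV::nat set) G0.lat"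
    and c: "c > 0" and R: "riesz_lower n G0.lat c" and f: "\<And>k. exptype (f k)"
    and gs: "\<And>u. summable (\<lambda>n. exp (- (pi / 2) * (norm (u - e n))\<^sup>2))" "\<And>u. (\<Sum>n. exp (- (pi / 2) * (norm (u - e n))\<^sup>2)) \<le> C"
  shows "ennreal c * (\<Sum>m. \<Sum>k\<in>K_set n. ennreal ((cmod (beta_op (e0 m) (f k) w))\<^sup>2))
     \<le> ennreal (1 / G0.vol\<^sup>2) * (ennreal (exp (pi * (norm w)\<^sup>2) * C * sqrt (pi / (pi / 2)) ^ DIM(complex^'d)) * (\<Sum>i. ennreal ((cmod (\<Sum>k\<in>K_set n. fock_inner (f k) (beta_op (e i) (ek k))))\<^sup>2)))"
proof -
  let ?K = "K_set n"
  define p where "p \<zeta> v = (\<Sum>k\<in>?K. cnj (beta_op v (f k) w) * beta_op v (ek k) \<zeta>)" for \<zeta> v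
  define \<Phi> where "\<Phi> z = (\<Sum>k\<in>?K. fock_inner (f k) (beta_op z (ek k)))" for z
  define H where "H \<zeta> = (\<Sum>i. cnj (\<Phi> (e i)) * beta_op (- e i) (repro_ker w) \<zeta>)" for \<zeta>
  define P where "P \<zeta> = (\<Sum>m. p \<zeta> (e0 m))" for \<zeta>
  have "\<forall>k. \<exists>A>0. \<forall>v u. cmod (beta_op v (f k) u) \<le> A * exp (pi / 2 * (norm u)\<^sup>2) * exp (- (pi / 4) * (norm (u - v))\<^sup>2)"
    using beta_decay[OF f] by metis
  then obtain A where A: "\<And>k. A k > 0" "\<And>k v u. cmod (beta_op v (f k) u) \<le> A k * exp (pi / 2 * (norm u)\<^sup>2) * exp (- (pi / 4) * (norm (u - v))\<^sup>2)"
    by metis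
  have "\<forall>k. \<exists>D>0. \<forall>v u. cmod (beta_op v (ek k) u) \<le> D * exp (pi / 2 * (norm u)\<^sup>2) * exp (- (pi / 4) * (norm (u - v))\<^sup>2)"
    using beta_decay[OF exptype_ek] by metis
  then obtain D where D: "\<And>k. D k > 0" "\<And>(k::nat^'d) v u. cmod (beta_op v (ek k) u) \<le> D k * exp (pi / 2 * (norm u)\<^sup>2) * exp (- (pi / 4) * (norm (u - v))\<^sup>2)"
    by metis
  define M where "M = (\<Sum>k\<in>?K. A k * D k) * exp (pi / 2 * (norm w)\<^sup>2)"
  have M0: "M \<ge> 0" unfolding M_def using A(1) D(1) by (intro mult_nonneg_nonneg sum_nonneg) (auto simp: less_imp_le)
  \<comment> \<open>The decay in v gives summability over the adjoint lattice and the decay required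
    by Poisson summation; the decay in \<zeta> gives an integrable majorant for the partial
    sums.\<close>
  have pb: "cmod (p \<zeta> v) \<le> M * exp (pi / 2 * (norm \<zeta>)\<^sup>2) * exp (- (pi / 16) * (norm (w - \<zeta>))\<^sup>2) * exp (- (pi / 8) * (norm (w - v))\<^sup>2)" for \<zeta> v
  proof -
    have "cmod (p \<zeta> v) \<le> (\<Sum>k\<in>?K. (A k * exp (pi / 2 * (norm w)\<^sup>2) * exp (- (pi / 4) * (norm (w - v))\<^sup>2)) * (D k * exp (pi / 2 * (norm \<zeta>)\<^sup>2) * exp (- (pi / 4) * (norm (\<zeta> - v))\<^sup>2)))"
      unfolding p_def
      by (rule sum_norm_le, unfold norm_mult complex_mod_cnj, rule mult_mono[OF A(2) D(2)])
         (use A(1) in \<open>auto simp: less_imp_le\<close>)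
    also have "\<dots> = M * exp (pi / 2 * (norm \<zeta>)\<^sup>2) * (exp (- (pi / 4) * (norm (w - v))\<^sup>2) * exp (- (pi / 4) * (norm (\<zeta> - v))\<^sup>2))"
      unfolding M_def sum_distrib_right by (intro sum.cong refl) (simp only: mult_ac)
    also have "\<dots> \<le> M * exp (pi / 2 * (norm \<zeta>)\<^sup>2) * (exp (- (pi / 16) * (norm (w - \<zeta>))\<^sup>2) * exp (- (pi / 8) * (norm (w - v))\<^sup>2))"
      using M0 by (intro mult_left_mono gauss_product_bound) auto
    finally show ?thesis by (simp only: mult.assoc)
  qed
  obtain C0 where C0: "C0 > 0" "\<And>u. summable (\<lambda>m. exp (- (pi / 8) * (norm (u - e0 m))\<^sup>2))"
    "\<And>u. (\<Sum>m. exp (- (pi / 8) * (norm (u - e0 m))\<^sup>2)) \<le> C0"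
    using G0.gauss_sum[OF e0, of "pi / 8"] by auto
  define W where "W \<zeta> = M * exp (pi / 2 * (norm \<zeta>)\<^sup>2) * exp (- (pi / 16) * (norm (w - \<zeta>))\<^sup>2)" for \<zeta> :: "complex^'d"
  have W0: "W \<zeta> \<ge> 0" for \<zeta> using M0 by (simp add: W_def)
  have pW: "cmod (p \<zeta> (e0 m)) \<le> W \<zeta> * exp (- (pi / 8) * (norm (w - e0 m))\<^sup>2)" for \<zeta> m
    unfolding W_def by (rule pb)
  have sp: "summable (\<lambda>m. cmod (p \<zeta> (e0 m)))" for \<zeta>
    by (rule summable_comparison_test'[OF summable_mult[OF C0(2), of "W \<zeta>" w], of 0]) (use pW in auto)

  \<comment> \<open>All k produce the same shifted kernel, so their coefficients add up to one
    conjugate sample.\<close>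
  have coef: "(\<integral>v. p \<zeta> v * G0.chi (- L z) v \<partial>lborel) = cnj (\<Phi> z) * beta_op (- z) (repro_ker w) \<zeta>" for \<zeta> z
  proof -
    have "(\<integral>v. p \<zeta> v * G0.chi (- L z) v \<partial>lborel) = (\<integral>v. (\<Sum>k\<in>?K. (cnj (beta_op v (f k) w) * beta_op v (ek k) \<zeta>) * G0.chi (- L z) v) \<partial>lborel)"
      unfolding p_def sum_distrib_right ..
    also have "\<dots> = (\<Sum>k\<in>?K. cnj (fock_inner (f k) (beta_op z (ek k))) * beta_op (- z) (repro_ker w) \<zeta>)"
      by (subst Bochner_Integration.integral_sum, rule poisson_coefficient(1)[OF f exptype_ek],
          intro sum.cong refl, rule poisson_coefficient(2)[OF f exptype_ek])
    also have "\<dots> = cnj (\<Phi> z) * beta_op (- z) (repro_ker w) \<zeta>"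
      unfolding \<Phi>_def cnj_sum sum_distrib_right ..
    finally show ?thesis .
  qed
  define B where "B = (\<Sum>k\<in>?K. sqrt (Re (fock_inner (f k) (f k)) * Re (fock_inner (ek k) (ek k))))"
  have \<Phi>B: "cmod (cnj (\<Phi> z)) \<le> B" for z
    unfolding complex_mod_cnj \<Phi>_def B_def by (rule sum_norm_le) (rule cmod_inner_beta_le[OF f exptype_ek])
  have sH: "summable (\<lambda>i. cmod (cnj (\<Phi> (e i)) * beta_op (- e i) (repro_ker w) \<zeta>))" for \<zeta>
    by (rule synthesis_norm(1)[OF gs \<Phi>B])
  have Hn: "fock_norm2 H \<le> ennreal (exp (pi * (norm w)\<^sup>2) * C * sqrt (pi / (pi / 2)) ^ DIM(complex^'d)) * (\<Sum>i. ennreal ((cmod (\<Phi> (e i)))\<^sup>2))"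
    using synthesis_norm(2)[OF gs, of "\<lambda>i. cnj (\<Phi> (e i))" B w, OF \<Phi>B] unfolding H_def[abs_def] complex_mod_cnj .
  have PH: "of_real G0.vol * P \<zeta> = H \<zeta>" for \<zeta>
  proof -
    \<comment> \<open>The frequencies dual to the adjoint lattice are the L-coordinates of the
      points of the original one.\<close>
    have bL: "bij_betw L G.lat intvec"
      unfolding bij_betw_def
    proof
      show "inj_on L G.lat" using G.bij by (auto simp: bij_def intro: inj_on_subset)
      show "L ` G.lat = intvec"
      proof (intro set_eqI iffI)
        fix k :: "real^'m" assume "k \<in> intvec"
        then have "inv L k \<in> G.lat" "k = L (inv L k)" by (simp_all add: G.lat_def G.L_inv)
        then show "k \<in> L ` G.lat" by blast
      qed (auto simp: G.lat_def)
    qed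
    have bk: "bij_betw (\<lambda>i. L (e i)) (UNIV::nat set) intvec"
      using bij_betw_trans[OF e bL] by (simp add: o_def)
    have pc: "continuous_on UNIV (p \<zeta>)"
      unfolding p_def[abs_def] by (intro continuous_intros continuous_beta_fst f exptype_ek)
    have pb': "cmod (p \<zeta> v) \<le> (W \<zeta> * exp (pi / 8 * (norm w)\<^sup>2)) * exp (- (pi / 16) * (norm v)\<^sup>2)" for v
    proof -
      have "norm v \<le> norm (w - v) + norm w" using norm_triangle_ineq4[of w "w - v"] by simp
      then have "(norm v)\<^sup>2 \<le> (norm (w - v) + norm w)\<^sup>2" by (rule power_mono) simp
      also have "\<dots> \<le> 2 * (norm (w - v))\<^sup>2 + 2 * (norm w)\<^sup>2"
        using sum_squares_bound[of "norm (w - v)" "norm w"] by (simp add: power2_sum)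
      finally have "(pi / 16) * (norm v)\<^sup>2 \<le> (pi / 16) * (2 * (norm (w - v))\<^sup>2 + 2 * (norm w)\<^sup>2)"
        by (rule mult_left_mono) simp
      then have "- (pi / 8) * (norm (w - v))\<^sup>2 \<le> pi / 8 * (norm w)\<^sup>2 + - (pi / 16) * (norm v)\<^sup>2" by (simp add: field_simps)
      then have "exp (- (pi / 8) * (norm (w - v))\<^sup>2) \<le> exp (pi / 8 * (norm w)\<^sup>2) * exp (- (pi / 16) * (norm v)\<^sup>2)"
        unfolding exp_add[symmetric] by simp
      from mult_left_mono[OF this W0[of \<zeta>]] pb[of \<zeta> v] show ?thesis unfolding W_def mult.assoc by linarith
    qed
    have "of_real G0.vol * (\<Sum>m. p \<zeta> (e0 m)) = (\<Sum>i. \<integral>v. p \<zeta> v * G0.chi (- L (e i)) v \<partial>lborel)"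
      by (rule G0.poisson[OF e0 bk pc _ pb']) (use sH in \<open>simp_all add: coef\<close>)
    then show ?thesis unfolding coef P_def H_def .
  qed
  define S where "S N \<zeta> = (\<Sum>m<N. p \<zeta> (e0 m))" for N \<zeta>
  define a where "a i = cnj (beta_op (fst i) (f (snd i)) w)" for i
  have inj0: "inj_on e0 X" for X using e0 by (auto simp: bij_betw_def intro: inj_on_subset)
  have SR: "S N = shift_sum ((e0 ` {..<N}) \<times> ?K) a" for N
  proof (rule ext)
    fix \<zeta>
    have "shift_sum ((e0 ` {..<N}) \<times> ?K) a \<zeta> = (\<Sum>x\<in>e0 ` {..<N}. \<Sum>k\<in>?K. a (x, k) * beta_op x (ek k) \<zeta>)"
      unfolding shift_sum_def sum.cartesian_product by (simp add: case_prod_unfold)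
    then show "S N \<zeta> = shift_sum ((e0 ` {..<N}) \<times> ?K) a \<zeta>"
      unfolding sum.reindex[OF inj0] by (simp add: S_def p_def a_def)
  qed
  have nS: "exptype (S N)" for N unfolding SR by (rule exptype_shift_sum)
  have low: "ennreal c * (\<Sum>m<N. \<Sum>k\<in>?K. ennreal ((cmod (beta_op (e0 m) (f k) w))\<^sup>2)) \<le> fock_norm2 (S N)" for N
  proof -
    have "finite ((e0 ` {..<N}) \<times> ?K)" "(e0 ` {..<N}) \<times> ?K \<subseteq> G0.lat \<times> ?K"
      using G0.e_lat[OF e0] finite_K_set by auto
    then have "c * (\<Sum>i\<in>(e0 ` {..<N}) \<times> ?K. (cmod (a i))\<^sup>2) \<le> Re (fock_inner (S N) (S N))"
      using R unfolding riesz_lower_def SR by blast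
    moreover have "(\<Sum>i\<in>(e0 ` {..<N}) \<times> ?K. (cmod (a i))\<^sup>2) = (\<Sum>m<N. \<Sum>k\<in>?K. (cmod (beta_op (e0 m) (f k) w))\<^sup>2)"
    proof -
      have "(\<Sum>i\<in>(e0 ` {..<N}) \<times> ?K. (cmod (a i))\<^sup>2) = (\<Sum>x\<in>e0 ` {..<N}. \<Sum>k\<in>?K. (cmod (a (x, k)))\<^sup>2)"
        unfolding sum.cartesian_product by (simp add: case_prod_unfold)
      then show ?thesis unfolding sum.reindex[OF inj0] by (simp add: a_def)
    qed
    ultimately have "ennreal (c * (\<Sum>m<N. \<Sum>k\<in>?K. (cmod (beta_op (e0 m) (f k) w))\<^sup>2)) \<le> fock_norm2 (S N)"
      unfolding exptype_fock_norm2[OF nS] by (intro ennreal_leI) simp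
    moreover have "ennreal (c * (\<Sum>m<N. \<Sum>k\<in>?K. (cmod (beta_op (e0 m) (f k) w))\<^sup>2)) = ennreal c * (\<Sum>m<N. \<Sum>k\<in>?K. ennreal ((cmod (beta_op (e0 m) (f k) w))\<^sup>2))"
      using c by (simp add: ennreal_mult sum_nonneg)
    ultimately show ?thesis by simp
  qed
  have Slim: "(\<lambda>N. S N \<zeta>) \<longlonglongrightarrow> P \<zeta>" for \<zeta>
    unfolding S_def P_def by (rule summable_LIMSEQ[OF summable_norm_cancel[OF sp]])
  have Sm [measurable]: "S N \<in> borel_measurable borel" for N by (rule exptype_measurable[OF nS])
  have Pm [measurable]: "P \<in> borel_measurable borel" by (rule borel_measurable_LIMSEQ_metric[OF Sm Slim])
  have SW: "cmod (S N \<zeta>) \<le> W \<zeta> * C0" for N \<zeta>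
  proof -
    have "cmod (S N \<zeta>) \<le> (\<Sum>m<N. W \<zeta> * exp (- (pi / 8) * (norm (w - e0 m))\<^sup>2))"
      unfolding S_def by (rule sum_norm_le) (rule pW)
    also have "\<dots> = W \<zeta> * (\<Sum>m<N. exp (- (pi / 8) * (norm (w - e0 m))\<^sup>2))" by (rule sum_distrib_left[symmetric])
    also have "\<dots> \<le> W \<zeta> * C0"
      by (intro mult_left_mono W0 order_trans[OF sum_le_suminf[OF C0(2)] C0(3)]) auto
    finally show ?thesis .
  qed
  \<comment> \<open>Fatou would bound the norm of P from the wrong side; dominated convergence
    carries the lower bounds of the partial sums over to P.\<close>
  have conv: "(\<lambda>N. fock_norm2 (S N)) \<longlonglongrightarrow> fock_norm2 P"
    unfolding fock_norm2_def
  proof (rule nn_integral_dominated_convergence)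
    let ?w = "\<lambda>\<zeta>. ennreal ((M * C0)\<^sup>2) * ennreal (exp (- (pi / 8) * (norm (\<zeta> - w))\<^sup>2))"
    show "AE \<zeta> in lborel. ennreal ((cmod (S N \<zeta>))\<^sup>2 * exp (- pi * (norm \<zeta>)\<^sup>2)) \<le> ?w \<zeta>" for N
    proof (rule AE_I2)
      fix \<zeta>
      have "(cmod (S N \<zeta>))\<^sup>2 * exp (- pi * (norm \<zeta>)\<^sup>2) \<le> (W \<zeta> * C0)\<^sup>2 * exp (- pi * (norm \<zeta>)\<^sup>2)"
        by (intro mult_right_mono power_mono SW) auto
      also have "\<dots> = (M * C0)\<^sup>2 * (exp (pi / 2 * (norm \<zeta>)\<^sup>2) * exp (pi / 2 * (norm \<zeta>)\<^sup>2) * exp (- (pi / 16) * (norm (\<zeta> - w))\<^sup>2) * exp (- (pi / 16) * (norm (\<zeta> - w))\<^sup>2) * exp (- pi * (norm \<zeta>)\<^sup>2))"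
        unfolding W_def power2_eq_square[of "_ * _"] norm_minus_commute[of w] by (simp only: mult_ac)
      also have "\<dots> = (M * C0)\<^sup>2 * exp (- (pi / 8) * (norm (\<zeta> - w))\<^sup>2)"
        unfolding exp_add[symmetric] by (simp add: field_simps)
      finally show "ennreal ((cmod (S N \<zeta>))\<^sup>2 * exp (- pi * (norm \<zeta>)\<^sup>2)) \<le> ?w \<zeta>"
        by (subst ennreal_mult[symmetric]) (auto intro: ennreal_leI)
    qed
    have m: "(\<lambda>\<zeta>. ennreal (exp (- (pi / 8) * (norm (\<zeta> - w))\<^sup>2))) \<in> borel_measurable lborel" by measurable
    show "(\<integral>\<^sup>+\<zeta>. ?w \<zeta> \<partial>lborel) < \<infinity>"
      unfolding nn_integral_cmult[OF m] by (subst nn_integral_gauss_shift) (simp_all add: ennreal_mult_less_top)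
    show "AE \<zeta> in lborel. (\<lambda>N. ennreal ((cmod (S N \<zeta>))\<^sup>2 * exp (- pi * (norm \<zeta>)\<^sup>2))) \<longlonglongrightarrow> ennreal ((cmod (P \<zeta>))\<^sup>2 * exp (- pi * (norm \<zeta>)\<^sup>2))"
      by (intro AE_I2 tendsto_intros Slim)
  qed measurable
  have "ennreal c * (\<Sum>m<N. \<Sum>k\<in>?K. ennreal ((cmod (beta_op (e0 m) (f k) w))\<^sup>2)) \<le> fock_norm2 P" for N
  proof (rule LIMSEQ_le_const[OF conv], intro exI[of _ N] allI impI)
    fix N' assume "N \<le> N'"
    then have "(\<Sum>m<N. \<Sum>k\<in>?K. ennreal ((cmod (beta_op (e0 m) (f k) w))\<^sup>2)) \<le> (\<Sum>m<N'. \<Sum>k\<in>?K. ennreal ((cmod (beta_op (e0 m) (f k) w))\<^sup>2))"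
      by (intro sum_mono2) auto
    then have "ennreal c * (\<Sum>m<N. \<Sum>k\<in>?K. ennreal ((cmod (beta_op (e0 m) (f k) w))\<^sup>2)) \<le> ennreal c * (\<Sum>m<N'. \<Sum>k\<in>?K. ennreal ((cmod (beta_op (e0 m) (f k) w))\<^sup>2))"
      by (rule mult_left_mono) simp
    then show "ennreal c * (\<Sum>m<N. \<Sum>k\<in>?K. ennreal ((cmod (beta_op (e0 m) (f k) w))\<^sup>2)) \<le> fock_norm2 (S N')"
      using low by (rule order_trans)
  qed
  then have "(\<Sum>m. ennreal c * (\<Sum>k\<in>?K. ennreal ((cmod (beta_op (e0 m) (f k) w))\<^sup>2))) \<le> fock_norm2 P"
    by (intro suminf_le_const summableI) (simp only: sum_distrib_left[symmetric])
  then have 1: "ennreal c * (\<Sum>m. \<Sum>k\<in>?K. ennreal ((cmod (beta_op (e0 m) (f k) w))\<^sup>2)) \<le> fock_norm2 P"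
    by (simp only: ennreal_suminf_cmult)
  have v0: "G0.vol \<noteq> 0" using G0.vol_pos by simp
  have Hm: "H \<in> borel_measurable borel"
  proof -
    have "(\<lambda>\<zeta>. of_real G0.vol * P \<zeta>) \<in> borel_measurable borel" by measurable
    then show ?thesis by (simp only: PH)
  qed
  have "P = (\<lambda>\<zeta>. of_real (1 / G0.vol) * H \<zeta>)"
    by (rule ext) (simp add: PH[symmetric] v0)
  then have "fock_norm2 P = ennreal ((cmod (of_real (1 / G0.vol)))\<^sup>2) * fock_norm2 H"
    by (simp only: fock_norm2_cmult[OF Hm])
  also have "(cmod (of_real (1 / G0.vol)))\<^sup>2 = 1 / G0.vol\<^sup>2"
    unfolding norm_of_real by (simp add: power_divide)
  also have "ennreal (1 / G0.vol\<^sup>2) * fock_norm2 H \<le> ennreal (1 / G0.vol\<^sup>2) * (ennreal (exp (pi * (norm w)\<^sup>2) * C * sqrt (pi / (pi / 2)) ^ DIM(complex^'d)) * (\<Sum>i. ennreal ((cmod (\<Phi> (e i)))\<^sup>2)))"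
    by (rule mult_left_mono[OF Hn]) simp
  finally show ?thesis using 1 unfolding \<Phi>_def by (rule order_trans[rotated])
qed

lemma riesz_imp_lower:
  fixes n :: "nat^'d"
  assumes e: "bij_betw e (UNIV::nat set) G.lat" and c: "c > 0" and R: "riesz_lower n G0.lat c"
  shows "\<exists>A>0. \<forall>F. exptype_poly n F \<longrightarrow> ennreal A * fock_norm2 F \<le> (\<Sum>i. ennreal ((cmod (F (e i)))\<^sup>2 * exp (- pi * (norm (e i))\<^sup>2)))"
proof -
  let ?K = "K_set n"
  obtain e0 where e0: "bij_betw e0 (UNIV::nat set) G0.lat" by (rule G0.ex_enum)
  obtain C where C: "C > 0" "\<And>u. summable (\<lambda>n. exp (- (pi / 2) * (norm (u - e n))\<^sup>2))"
    "\<And>u. (\<Sum>n. exp (- (pi / 2) * (norm (u - e n))\<^sup>2)) \<le> C"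
    using G.gauss_sum[OF e, of "pi / 2"] by auto
  define M where "M = C * sqrt (pi / (pi / 2)) ^ DIM(complex^'d)"
  have M: "M > 0" using C(1) by (simp add: M_def)
  \<comment> \<open>An upper bound for the squared window norms; the added 1 keeps it positive for
    an empty index set.\<close>
  define X where "X = (\<Sum>k\<in>?K. ek_norm2 k) + 1"
  have X: "X > 0" "\<And>k. k \<in> ?K \<Longrightarrow> ek_norm2 k \<le> X"
  proof -
    have e0': "0 \<le> ek_norm2 k" for k :: "nat^'d" using ek_norm2_pos[of k] by simp
    then show "X > 0" unfolding X_def by (intro add_nonneg_pos sum_nonneg) auto
    fix k assume "k \<in> ?K"
    then have "ek_norm2 k \<le> (\<Sum>k\<in>?K. ek_norm2 k)" using e0' by (intro member_le_sum finite_K_set) auto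
    then show "ek_norm2 k \<le> X" by (simp add: X_def)
  qed
  \<comment> \<open>The bound at a single point, M divided by the squared volume, times the volume
    of the domain over which w is integrated.\<close>
  define D where "D = M / G0.vol"
  have D: "D > 0" using M G0.vol_pos by (simp add: D_def)
  show ?thesis
  proof (intro exI[of _ "c / (D * X)"] conjI allI impI)
    show "c / (D * X) > 0" using c D X by simp
    fix F assume "exptype_poly n F"
    from exptype_poly_rep[OF this] obtain f where nf: "\<forall>k. exptype (f k)"
      and Ff: "\<forall>z. (cmod (F z))\<^sup>2 * exp (- pi * (norm z)\<^sup>2) = (cmod (\<Sum>k\<in>K_set n. fock_inner (f k) (beta_op z (ek k))))\<^sup>2"
      and FN: "fock_norm2 F = ennreal (\<Sum>k\<in>K_set n. ek_norm2 k * Re (fock_inner (f k) (f k)))"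
      by (elim exE conjE)
    note f = spec[OF nf] spec[OF Ff] FN
    define Q where "Q = (\<Sum>i. ennreal ((cmod (F (e i)))\<^sup>2 * exp (- pi * (norm (e i))\<^sup>2)))"
    have Q': "Q = (\<Sum>i. ennreal ((cmod (\<Sum>k\<in>?K. fock_inner (f k) (beta_op (e i) (ek k))))\<^sup>2))"
      unfolding Q_def f(2) ..
    define u where "u x = (\<Sum>k\<in>?K. ennreal ((cmod (f k x))\<^sup>2 * exp (- pi * (norm x)\<^sup>2)))" for x
    have fm [measurable]: "f k \<in> borel_measurable borel" for k by (rule exptype_measurable[OF f(1)])
    have um [measurable]: "u \<in> borel_measurable borel" unfolding u_def[abs_def] by measurable
    \<comment> \<open>The weight in w cancels the squared norm of the kernel, which leaves a bound
      independent of w.\<close>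
    have pt: "ennreal c * (\<Sum>m. u (w + - e0 m)) \<le> ennreal (M / G0.vol\<^sup>2) * Q" for w
    proof -
      have "ennreal (exp (- pi * (norm w)\<^sup>2)) * (ennreal c * (\<Sum>m. \<Sum>k\<in>?K. ennreal ((cmod (beta_op (e0 m) (f k) w))\<^sup>2)))
         \<le> ennreal (exp (- pi * (norm w)\<^sup>2)) * (ennreal (1 / G0.vol\<^sup>2) * (ennreal (exp (pi * (norm w)\<^sup>2) * C * sqrt (pi / (pi / 2)) ^ DIM(complex^'d)) * Q))"
        unfolding Q' by (rule mult_left_mono[OF riesz_at_point[OF e e0 c R f(1) C(2,3)]]) simp
      also have "\<dots> = ennreal (exp (- pi * (norm w)\<^sup>2) * (1 / G0.vol\<^sup>2 * (exp (pi * (norm w)\<^sup>2) * M))) * Q"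
      proof -
        have "ennreal x * (ennreal y * (ennreal z * Q)) = ennreal (x * (y * z)) * Q" if "0 \<le> x" "0 \<le> y" "0 \<le> z" for x y z
          using that by (simp add: ennreal_mult mult.assoc)
        from this[of "exp (- pi * (norm w)\<^sup>2)" "1 / G0.vol\<^sup>2" "exp (pi * (norm w)\<^sup>2) * M"] show ?thesis
          using M unfolding M_def mult.assoc by simp
      qed
      also have "exp (- pi * (norm w)\<^sup>2) * (1 / G0.vol\<^sup>2 * (exp (pi * (norm w)\<^sup>2) * M)) = M / G0.vol\<^sup>2"
        by (simp add: exp_minus)
      finally have 1: "ennreal (exp (- pi * (norm w)\<^sup>2)) * (ennreal c * (\<Sum>m. \<Sum>k\<in>?K. ennreal ((cmod (beta_op (e0 m) (f k) w))\<^sup>2))) \<le> ennreal (M / G0.vol\<^sup>2) * Q" .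
      have "ennreal (exp (- pi * (norm w)\<^sup>2)) * (\<Sum>m. \<Sum>k\<in>?K. ennreal ((cmod (beta_op (e0 m) (f k) w))\<^sup>2)) = (\<Sum>m. u (w + - e0 m))"
        unfolding ennreal_suminf_cmult[symmetric]
      proof (rule suminf_cong)
        fix m
        show "ennreal (exp (- pi * (norm w)\<^sup>2)) * (\<Sum>k\<in>?K. ennreal ((cmod (beta_op (e0 m) (f k) w))\<^sup>2)) = u (w + - e0 m)"
          unfolding u_def sum_distrib_left
        proof (intro sum.cong refl)
          fix k
          have "ennreal (exp (- pi * (norm w)\<^sup>2)) * ennreal ((cmod (beta_op (e0 m) (f k) w))\<^sup>2) = ennreal ((cmod (beta_op (e0 m) (f k) w))\<^sup>2 * exp (- pi * (norm w)\<^sup>2))"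
            by (simp add: ennreal_mult mult.commute)
          then show "ennreal (exp (- pi * (norm w)\<^sup>2)) * ennreal ((cmod (beta_op (e0 m) (f k) w))\<^sup>2) = ennreal ((cmod (f k (w + - e0 m)))\<^sup>2 * exp (- pi * (norm (w + - e0 m))\<^sup>2))"
            unfolding cmod_beta by simp
        qed
      qed
      then show ?thesis using 1 by (simp only: mult.left_commute)
    qed
    \<comment> \<open>Tiling over the adjoint lattice reassembles the norms of the f_k from their
      shifted values.\<close>
    have "ennreal c * (\<integral>\<^sup>+x. u x \<partial>lborel) = (\<integral>\<^sup>+x. ennreal c * u x \<partial>lborel)"
      by (rule nn_integral_cmult[symmetric]) measurable
    also have "\<dots> = (\<integral>\<^sup>+w. (\<Sum>m. ennreal c * u (w + - e0 m)) * indicator G0.fdom w \<partial>lborel)"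
      by (rule G0.tiling[OF G0.bij_uminus[OF e0]]) measurable
    also have "\<dots> \<le> (\<integral>\<^sup>+w. (ennreal (M / G0.vol\<^sup>2) * Q) * indicator G0.fdom w \<partial>lborel)"
      by (intro nn_integral_mono mult_right_mono) (simp_all add: pt[unfolded diff_conv_add_uminus[symmetric]])
    also have "\<dots> = (ennreal (M / G0.vol\<^sup>2) * Q) * ennreal G0.vol"
      by (simp add: nn_integral_cmult G0.emeasure_vol)
    also have "\<dots> = ennreal D * Q"
    proof -
      have "ennreal (M / G0.vol\<^sup>2) * ennreal G0.vol = ennreal D"
        unfolding D_def using M G0.vol_pos by (simp add: ennreal_mult[symmetric] power2_eq_square)
      then show ?thesis by (metis mult.assoc mult.commute)
    qed
    also have "(\<integral>\<^sup>+x. u x \<partial>lborel) = (\<Sum>k\<in>?K. fock_norm2 (f k))"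
      unfolding u_def fock_norm2_def by (rule nn_integral_sum) measurable
    also have "(\<Sum>k\<in>?K. fock_norm2 (f k)) = ennreal (\<Sum>k\<in>?K. Re (fock_inner (f k) (f k)))"
      using exptype_norm_nonneg[OF f(1)] by (simp add: exptype_fock_norm2[OF f(1)])
    finally have main: "ennreal c * ennreal (\<Sum>k\<in>?K. Re (fock_inner (f k) (f k))) \<le> ennreal D * Q" .
    define s where "s = (\<Sum>k\<in>?K. Re (fock_inner (f k) (f k)))"
    have s0: "s \<ge> 0" unfolding s_def using exptype_norm_nonneg[OF f(1)] by (rule sum_nonneg)
    have "(\<Sum>k\<in>?K. ek_norm2 k * Re (fock_inner (f k) (f k))) \<le> (\<Sum>k\<in>?K. X * Re (fock_inner (f k) (f k)))"
      using X(2) exptype_norm_nonneg[OF f(1)] by (intro sum_mono mult_right_mono) auto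
    then have "(\<Sum>k\<in>?K. ek_norm2 k * Re (fock_inner (f k) (f k))) \<le> X * s" by (simp add: s_def sum_distrib_left)
    then have "fock_norm2 F \<le> ennreal (X * s)" unfolding f(3) by (rule ennreal_leI)
    then have "ennreal (c / (D * X)) * fock_norm2 F \<le> ennreal (c / (D * X)) * ennreal (X * s)"
      by (rule mult_left_mono) simp
    also have "\<dots> = ennreal (1 / D) * (ennreal c * ennreal s)"
      using c D X(1) s0 by (simp add: ennreal_mult[symmetric])
    also have "\<dots> \<le> ennreal (1 / D) * (ennreal D * Q)"
      using main unfolding s_def by (rule mult_left_mono) simp
    also have "\<dots> = Q" using D by (simp add: mult.assoc[symmetric] ennreal_mult[symmetric])
    finally show "ennreal (c / (D * X)) * fock_norm2 F \<le> (\<Sum>i. ennreal ((cmod (F (e i)))\<^sup>2 * exp (- pi * (norm (e i))\<^sup>2)))"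
      unfolding Q_def .
  qed
qed

end

section \<open>Passage to the full polyanalytic Fock space\<close>

lemma exptype_poly_sum:
  assumes "\<And>j. j \<in> I \<Longrightarrow> exptype_poly n (X j)"
  shows "exptype_poly n (\<lambda>z. \<Sum>j\<in>I. X j z)"
proof -
  have "\<forall>j. \<exists>\<phi>. j \<in> I \<longrightarrow> (\<forall>k\<in>K_set n. exptype (\<phi> k)) \<and> (\<forall>z. X j z = (\<Sum>k\<in>K_set n. cmpow z k * \<phi> k z))"
    using assms unfolding exptype_poly_def by metis
  from choice[OF this] obtain \<phi> where \<phi>: "\<forall>j. j \<in> I \<longrightarrow> (\<forall>k\<in>K_set n. exptype (\<phi> j k)) \<and> (\<forall>z. X j z = (\<Sum>k\<in>K_set n. cmpow z k * \<phi> j k z))"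
    by (rule exE)
  have n: "j \<in> I \<Longrightarrow> k \<in> K_set n \<Longrightarrow> exptype (\<phi> j k)" for j k using \<phi> by simp
  show ?thesis
    unfolding exptype_poly_def
  proof (intro exI[of _ "\<lambda>k z. \<Sum>j\<in>I. \<phi> j k z"] conjI ballI allI)
    show "exptype (\<lambda>z. \<Sum>j\<in>I. \<phi> j k z)" if "k \<in> K_set n" for k by (rule exptype_sum) (rule n[OF _ that])
    fix z
    have "(\<Sum>j\<in>I. X j z) = (\<Sum>j\<in>I. \<Sum>k\<in>K_set n. cmpow z k * \<phi> j k z)" using \<phi> by (intro sum.cong refl) simp
    also have "\<dots> = (\<Sum>k\<in>K_set n. cmpow z k * (\<Sum>j\<in>I. \<phi> j k z))"
      by (subst sum.swap) (simp add: sum_distrib_left)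
    finally show "(\<Sum>j\<in>I. X j z) = (\<Sum>k\<in>K_set n. cmpow z k * (\<Sum>j\<in>I. \<phi> j k z))" .
  qed
qed

lemma exptype_poly_polyanalytic: "exptype_poly n F \<Longrightarrow> F \<in> polyanalytic_funs n"
  unfolding exptype_poly_def polyanalytic_funs_def mem_Collect_eq by (elim exE conjE) (intro exI conjI ballI exptype_entire, erule bspec)

text \<open>Orthogonality under rotations holds for every subfamily of components, obtained by
  setting the others to 0. Initial segments and tails are both subfamilies, so the squared norms of
  the partial sum and of the error add up to that of F.\<close>

lemma polyfock_approx:
  fixes n :: "nat^'d::finite"
  assumes F: "F \<in> polyfock_space n"
  shows "\<exists>G r. (\<forall>N. exptype_poly n (G N)) \<and> (\<forall>z. (\<lambda>N. G N z) \<longlonglongrightarrow> F z) \<and> (\<forall>N. 0 \<le> r N) \<and> r \<longlonglongrightarrow> 0 \<and>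
    (\<forall>N. fock_norm2 (\<lambda>z. F z - G N z) = ennreal (r N)) \<and> (\<forall>N::nat. fock_norm2 F = fock_norm2 (G N) + ennreal (r N))"
proof -
  obtain \<phi> where \<phi>: "\<forall>k\<in>K_set n. entire_fun (\<phi> k)" and Fe: "\<forall>z. F z = (\<Sum>k\<in>K_set n. cmpow z k * \<phi> k z)" and fin: "fock_norm2 F < \<infinity>"
    using F unfolding polyfock_space_def mem_Collect_eq by (elim exE conjE)
  have "\<exists>X m. (\<forall>j. exptype_poly n (X j)) \<and> (\<forall>z. (\<lambda>j::nat. X j z) sums F z) \<and> (\<forall>z. summable (\<lambda>j. cmod (X j z))) \<and>
    (\<forall>u z j. cmod u = 1 \<longrightarrow> X j (u *s z) * u ^ m = u ^ j * X j z)"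
  proof (rule polyanalytic_homogeneous_decomposition[of n \<phi>])
    fix k assume "k \<in> K_set n"
    then show "entire_fun (\<phi> k)" by (rule bspec[OF \<phi>])
  next
    fix X :: "nat \<Rightarrow> complex^'d \<Rightarrow> complex" and m :: nat
    assume a: "\<And>j. \<exists>\<psi>. (\<forall>k\<in>K_set n. exptype (\<psi> k)) \<and> (\<forall>z. X j z = (\<Sum>k\<in>K_set n. cmpow z k * \<psi> k z))"
      "\<And>z. (\<lambda>j. X j z) sums (\<Sum>k\<in>K_set n. cmpow z k * \<phi> k z)"
      "\<And>z. summable (\<lambda>j. cmod (X j z))" "\<And>u z j. cmod u = 1 \<Longrightarrow> X j (u *s z) * u ^ m = u ^ j * X j z"
    have "exptype_poly n (X j)" for j unfolding exptype_poly_def by (rule a(1))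
    moreover have "(\<lambda>j. X j z) sums F z" for z using a(2)[of z] Fe by simp
    ultimately show "\<exists>X m. (\<forall>j. exptype_poly n (X j)) \<and> (\<forall>z. (\<lambda>j::nat. X j z) sums F z) \<and> (\<forall>z. summable (\<lambda>j. cmod (X j z))) \<and>
      (\<forall>u z j. cmod u = 1 \<longrightarrow> X j (u *s z) * u ^ m = u ^ j * X j z)"
      by (intro exI[of _ X] exI[of _ m] conjI allI impI a(3,4))
  qed
  then obtain X m where Xn': "\<forall>j. exptype_poly n (X j)" and Xs': "\<forall>z. (\<lambda>j::nat. X j z) sums F z"
    and X3': "\<forall>z. summable (\<lambda>j. cmod (X j z))" and X4': "\<forall>u z j. cmod u = 1 \<longrightarrow> X j (u *s z) * u ^ m = u ^ j * X j z"
    by (elim exE conjE)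
  note Xn = spec[OF Xn'] and Xs = spec[OF Xs'] and X3 = spec[OF X3']
  have X4: "X j (u *s z) * u ^ m = u ^ j * X j z" if "cmod u = 1" for u z j using X4' that by simp
  have Xm: "X j \<in> borel_measurable borel" for j by (rule polyanalytic_funs_measurable[OF exptype_poly_polyanalytic[OF Xn]])
  have sub: "fock_norm2 (\<lambda>z. \<Sum>j. (if P j then X j z else 0)) = (\<Sum>j. if P j then fock_norm2 (X j) else 0)" for P :: "nat \<Rightarrow> bool"
  proof -
    have "fock_norm2 (\<lambda>z. \<Sum>j. (if P j then X j z else 0)) = (\<Sum>j. fock_norm2 (\<lambda>z. if P j then X j z else 0))"
    proof (rule fock_norm2_homogeneous_sum[where m=m])
      show "(\<lambda>z. if P j then X j z else 0) \<in> borel_measurable borel" for j using Xm by (cases "P j") auto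
      show "summable (\<lambda>j. cmod (if P j then X j z else 0))" for z
        by (rule summable_comparison_test'[OF X3[of z], of 0]) auto
      show "(if P j then X j (u *s z) else 0) * u ^ m = u ^ j * (if P j then X j z else 0)" if "cmod u = 1" for u z j
        using X4[OF that, of j z] by simp
    qed
    also have "\<dots> = (\<Sum>j. if P j then fock_norm2 (X j) else 0)"
      by (intro suminf_cong) (simp add: fock_norm2_def)
    finally show ?thesis .
  qed
  have FX: "fock_norm2 F = (\<Sum>j. fock_norm2 (X j))"
  proof -
    have "F = (\<lambda>z. \<Sum>j. X j z)" by (rule ext) (rule sums_unique[OF Xs])
    then show ?thesis using sub[of "\<lambda>_. True"] by simp
  qed
  define x where "x j = enn2real (fock_norm2 (X j))" for j
  have xf: "fock_norm2 (X j) = ennreal (x j)" for j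
  proof -
    have "fock_norm2 (X j) \<le> fock_norm2 F"
      unfolding FX using sum_le_suminf[OF summableI, of "{j}" "\<lambda>j. fock_norm2 (X j)"] by simp
    then show ?thesis using fin by (simp add: x_def less_top order_le_less_trans)
  qed
  have x0: "0 \<le> x j" for j by (simp add: x_def)
  have xs: "summable x"
    by (rule summable_suminf_not_top[OF x0]) (use fin FX in \<open>simp add: xf\<close>)
  define G where "G N z = (\<Sum>j<N. X j z)" for N z
  define r where "r N = (\<Sum>j. x (j + N))" for N
  have xsN: "summable (\<lambda>j. x (j + N))" for N using xs by (simp add: summable_iff_shift)
  have rr: "r N = suminf x - (\<Sum>j<N. x j)" for N
    unfolding r_def by (rule suminf_minus_initial_segment[OF xs])
  have r0: "0 \<le> r N" for N unfolding r_def by (intro suminf_nonneg xsN x0)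
  have "(\<lambda>N. suminf x - (\<Sum>j<N. x j)) \<longlonglongrightarrow> suminf x - suminf x"
    by (intro tendsto_diff tendsto_const summable_LIMSEQ xs)
  then have rl: "r \<longlonglongrightarrow> 0" by (simp add: rr[abs_def])
  have nG: "fock_norm2 (G N) = ennreal (\<Sum>j<N. x j)" for N
  proof -
    have "G N = (\<lambda>z. \<Sum>j. (if j < N then X j z else 0))"
      unfolding G_def by (rule ext, subst suminf_finite[of "{..<N}"]) auto
    then have "fock_norm2 (G N) = (\<Sum>j. if j < N then fock_norm2 (X j) else 0)" by (simp only: sub)
    also have "\<dots> = (\<Sum>j<N. fock_norm2 (X j))" by (subst suminf_finite[of "{..<N}"]) auto
    finally show ?thesis using x0 by (simp add: xf)
  qed
  have nT: "fock_norm2 (\<lambda>z. F z - G N z) = ennreal (r N)" for N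
  proof -
    have "F z - G N z = (\<Sum>j. (if \<not> j < N then X j z else 0))" for z
    proof -
      have "(\<lambda>j. if j < N then X j z else 0) sums (\<Sum>j<N. X j z)"
        using sums_If_finite_set[of "{..<N}" "\<lambda>j. X j z"] by simp
      from sums_diff[OF Xs[of z] this] have "(\<lambda>j. if \<not> j < N then X j z else 0) sums (F z - G N z)"
        unfolding G_def by (rule sums_cong[THEN iffD1, rotated]) auto
      then show ?thesis by (simp add: sums_iff)
    qed
    then have "fock_norm2 (\<lambda>z. F z - G N z) = (\<Sum>j. if \<not> j < N then fock_norm2 (X j) else 0)" by (simp only: sub)
    also have "\<dots> = (\<Sum>j. ennreal (if \<not> j < N then x j else 0))" by (intro suminf_cong) (simp add: xf)
    also have "\<dots> = ennreal (\<Sum>j. if \<not> j < N then x j else 0)"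
    proof (rule suminf_ennreal2)
      show "summable (\<lambda>j. if \<not> j < N then x j else 0)"
        by (rule summable_comparison_test'[OF xs, of 0]) (use x0 in auto)
    qed (use x0 in auto)
    also have "(\<Sum>j. if \<not> j < N then x j else 0) = r N"
    proof -
      have "(\<lambda>j. if j < N then x j else 0) sums (\<Sum>j<N. x j)"
        using sums_If_finite_set[of "{..<N}" x] by simp
      from sums_diff[OF summable_sums[OF xs] this] have "(\<lambda>j. if \<not> j < N then x j else 0) sums (suminf x - (\<Sum>j<N. x j))"
        by (rule sums_cong[THEN iffD1, rotated]) auto
      then show ?thesis by (simp add: sums_iff rr)
    qed
    finally show ?thesis .
  qed
  have split: "fock_norm2 F = fock_norm2 (G N) + ennreal (r N)" for N
  proof -
    have "fock_norm2 F = ennreal (suminf x)" unfolding FX xf by (rule suminf_ennreal2[OF x0 xs])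
    also have "suminf x = (\<Sum>j<N. x j) + r N" by (simp add: rr)
    also have "ennreal ((\<Sum>j<N. x j) + r N) = fock_norm2 (G N) + ennreal (r N)"
      unfolding nG using x0 r0 by (simp add: sum_nonneg)
    finally show ?thesis .
  qed
  show ?thesis
  proof (intro exI[of _ G] exI[of _ r] conjI allI)
    show "exptype_poly n (G N)" for N unfolding G_def[abs_def] by (intro exptype_poly_sum Xn)
    show "(\<lambda>N. G N z) \<longlonglongrightarrow> F z" for z using Xs[of z] unfolding G_def sums_def .
  qed (fact r0 rl nT split)+
qed

context lattice_pair
begin

text \<open>Pointwise convergence is enough for an upper bound: finite sums of samples pass to the
  limit, and the norms of the approximants do not exceed that of F.\<close>

lemma bessel_polyfock:
  fixes n :: "nat^'d"
  assumes e: "bij_betw e (UNIV::nat set) G.lat"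
    and B: "\<forall>F. exptype_poly n F \<longrightarrow> (\<Sum>i. ennreal ((cmod (F (e i)))\<^sup>2 * exp (- pi * (norm (e i))\<^sup>2))) \<le> ennreal B * fock_norm2 F"
    and F: "F \<in> polyfock_space n"
  shows "(\<Sum>i. ennreal ((cmod (F (e i)))\<^sup>2 * exp (- pi * (norm (e i))\<^sup>2))) \<le> ennreal B * fock_norm2 F"
proof -
  obtain H r where H: "\<forall>N. exptype_poly n (H N)" "\<forall>z. (\<lambda>N. H N z) \<longlonglongrightarrow> F z" "\<forall>N::nat. fock_norm2 F = fock_norm2 (H N) + ennreal (r N)"
    using polyfock_approx[OF F] by (elim exE conjE)
  show ?thesis
  proof (rule suminf_le_const[OF summableI])
    fix M
    show "(\<Sum>i<M. ennreal ((cmod (F (e i)))\<^sup>2 * exp (- pi * (norm (e i))\<^sup>2))) \<le> ennreal B * fock_norm2 F"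
    proof (rule LIMSEQ_le_const2)
      show "(\<lambda>N. \<Sum>i<M. ennreal ((cmod (H N (e i)))\<^sup>2 * exp (- pi * (norm (e i))\<^sup>2))) \<longlonglongrightarrow> (\<Sum>i<M. ennreal ((cmod (F (e i)))\<^sup>2 * exp (- pi * (norm (e i))\<^sup>2)))"
        by (intro tendsto_intros spec[OF H(2)])
      show "\<exists>N0. \<forall>N\<ge>N0. (\<Sum>i<M. ennreal ((cmod (H N (e i)))\<^sup>2 * exp (- pi * (norm (e i))\<^sup>2))) \<le> ennreal B * fock_norm2 F"
      proof (intro exI allI impI)
        fix N
        have "(\<Sum>i<M. ennreal ((cmod (H N (e i)))\<^sup>2 * exp (- pi * (norm (e i))\<^sup>2))) \<le> (\<Sum>i. ennreal ((cmod (H N (e i)))\<^sup>2 * exp (- pi * (norm (e i))\<^sup>2)))"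
          by (rule sum_le_suminf[OF summableI]) auto
        also have "\<dots> \<le> ennreal B * fock_norm2 (H N)" using B H(1) by simp
        also have "\<dots> \<le> ennreal B * fock_norm2 F" by (rule mult_left_mono) (simp_all add: spec[OF H(3), of N])
        finally show "(\<Sum>i<M. ennreal ((cmod (H N (e i)))\<^sup>2 * exp (- pi * (norm (e i))\<^sup>2))) \<le> ennreal B * fock_norm2 F" .
      qed
    qed
  qed
qed

text \<open>A lower bound does not pass to the limit by itself: the samples of an approximant differ
  from those of F by samples of the tail, which the upper bound controls. The factor 2 from squaring
  the triangle inequality turns A into A / 2.\<close>

lemma riesz_imp_sampling:
  fixes n :: "nat^'d"
  assumes c: "c > 0" and R: "riesz_lower n G0.lat c"
  shows "sampling_seq n G.lat"
proof -
  obtain e where e: "bij_betw e (UNIV::nat set) G.lat" by (rule G.ex_enum)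
  define Q where "Q F = (\<Sum>i. ennreal ((cmod (F (e i)))\<^sup>2 * exp (- pi * (norm (e i))\<^sup>2)))" for F :: "complex^'d \<Rightarrow> complex"
  obtain B where B: "B > 0" "\<forall>F. exptype_poly n F \<longrightarrow> Q F \<le> ennreal B * fock_norm2 F"
    using bessel_exptype[OF e, of n] unfolding Q_def by (elim exE conjE)
  obtain A where A: "A > 0" "\<forall>F. exptype_poly n F \<longrightarrow> ennreal A * fock_norm2 F \<le> Q F"
    using riesz_imp_lower[OF e c R] unfolding Q_def by (elim exE conjE)
  have up: "Q F \<le> ennreal B * fock_norm2 F" if "F \<in> polyfock_space n" for F
    unfolding Q_def by (rule bessel_polyfock[OF e B(2)[unfolded Q_def] that])
  have low: "ennreal (A / 2) * fock_norm2 F \<le> Q F" if F: "F \<in> polyfock_space n" for F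
  proof -
    obtain H r where H: "\<forall>N. exptype_poly n (H N)" "\<forall>N. 0 \<le> r N" "r \<longlonglongrightarrow> 0"
      "\<forall>N. fock_norm2 (\<lambda>z. F z - H N z) = ennreal (r N)" "\<forall>N::nat. fock_norm2 F = fock_norm2 (H N) + ennreal (r N)"
      using polyfock_approx[OF F] by (elim exE conjE)
    have Fa: "F \<in> polyanalytic_funs n" using F by (simp add: polyfock_alt)
    have main: "ennreal A * fock_norm2 F \<le> 2 * Q F + ennreal ((2 * B + A) * r N)" for N
    proof -
      let ?T = "\<lambda>z. F z - H N z"
      have T: "?T \<in> polyfock_space n"
        unfolding polyfock_alt mem_Collect_eq
        by (intro conjI polyanalytic_funs_diff Fa exptype_poly_polyanalytic spec[OF H(1)]) (simp add: spec[OF H(4), of N])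
      have "Q (H N) \<le> (\<Sum>i. 2 * ennreal ((cmod (F (e i)))\<^sup>2 * exp (- pi * (norm (e i))\<^sup>2)) + 2 * ennreal ((cmod (?T (e i)))\<^sup>2 * exp (- pi * (norm (e i))\<^sup>2)))"
        unfolding Q_def
      proof (intro suminf_le summableI)
        fix i
        have "(cmod (H N (e i)))\<^sup>2 \<le> (cmod (F (e i)) + cmod (?T (e i)))\<^sup>2"
          using norm_triangle_ineq4[of "F (e i)" "?T (e i)"] by (intro power_mono) simp_all
        also have "\<dots> \<le> 2 * (cmod (F (e i)))\<^sup>2 + 2 * (cmod (?T (e i)))\<^sup>2"
          using sum_squares_bound[of "cmod (F (e i))" "cmod (?T (e i))"] by (simp add: power2_sum)
        finally have "(cmod (H N (e i)))\<^sup>2 * exp (- pi * (norm (e i))\<^sup>2) \<le> (2 * (cmod (F (e i)))\<^sup>2 + 2 * (cmod (?T (e i)))\<^sup>2) * exp (- pi * (norm (e i))\<^sup>2)"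
          by (rule mult_right_mono) simp
        also have "\<dots> = 2 * ((cmod (F (e i)))\<^sup>2 * exp (- pi * (norm (e i))\<^sup>2)) + 2 * ((cmod (?T (e i)))\<^sup>2 * exp (- pi * (norm (e i))\<^sup>2))"
          by (simp only: distrib_right mult.assoc)
        finally have "ennreal ((cmod (H N (e i)))\<^sup>2 * exp (- pi * (norm (e i))\<^sup>2)) \<le> ennreal (2 * ((cmod (F (e i)))\<^sup>2 * exp (- pi * (norm (e i))\<^sup>2)) + 2 * ((cmod (?T (e i)))\<^sup>2 * exp (- pi * (norm (e i))\<^sup>2)))"
          by (rule ennreal_leI)
        then show "ennreal ((cmod (H N (e i)))\<^sup>2 * exp (- pi * (norm (e i))\<^sup>2)) \<le> 2 * ennreal ((cmod (F (e i)))\<^sup>2 * exp (- pi * (norm (e i))\<^sup>2)) + 2 * ennreal ((cmod (?T (e i)))\<^sup>2 * exp (- pi * (norm (e i))\<^sup>2))"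
          by (simp add: ennreal_mult)
      qed
      also have "\<dots> = 2 * Q F + 2 * Q ?T"
        unfolding Q_def by (subst suminf_add[symmetric]) (simp_all add: summableI)
      also have "\<dots> \<le> 2 * Q F + 2 * ennreal (B * r N)"
      proof -
        have "Q ?T \<le> ennreal B * ennreal (r N)" using up[OF T] unfolding spec[OF H(4)] .
        then have "2 * Q ?T \<le> 2 * ennreal (B * r N)" using B(1) H(2) by (intro mult_left_mono) (simp_all add: ennreal_mult)
        then show ?thesis by (rule add_left_mono)
      qed
      finally have 1: "Q (H N) \<le> 2 * Q F + 2 * ennreal (B * r N)" .
      have "ennreal A * fock_norm2 F = ennreal A * fock_norm2 (H N) + ennreal (A * r N)"
        unfolding spec[OF H(5), of N] using A(1) H(2) by (simp add: distrib_left ennreal_mult)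
      also have "\<dots> \<le> (2 * Q F + 2 * ennreal (B * r N)) + ennreal (A * r N)"
        using A(2) H(1) 1 by (intro add_right_mono) (blast intro: order_trans)
      also have "\<dots> = 2 * Q F + ennreal ((2 * B + A) * r N)"
      proof -
        have "2 * ennreal (B * r N) + ennreal (A * r N) = ennreal ((2 * B + A) * r N)"
          using A(1) B(1) spec[OF H(2), of N] by (simp add: distrib_right ennreal_mult mult.assoc)
        then show ?thesis by (simp only: add.assoc)
      qed
      finally show ?thesis .
    qed
    have "(\<lambda>N. 2 * Q F + ennreal ((2 * B + A) * r N)) \<longlonglongrightarrow> 2 * Q F + ennreal ((2 * B + A) * 0)"
      by (intro tendsto_intros H(3))
    then have "ennreal A * fock_norm2 F \<le> 2 * Q F + ennreal ((2 * B + A) * 0)"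
      by (rule LIMSEQ_le_const) (use main in auto)
    then have main': "ennreal A * fock_norm2 F \<le> 2 * Q F" by simp
    obtain h :: real where h: "h \<ge> 0" "h * 2 = 1" "h * A = A / 2" by (rule that[of "1 / 2"]) simp_all
    have "ennreal h * (ennreal A * fock_norm2 F) \<le> ennreal h * (2 * Q F)"
      by (rule mult_left_mono[OF main']) simp
    moreover have "ennreal h * (ennreal A * fock_norm2 F) = ennreal (A / 2) * fock_norm2 F"
      unfolding h(3)[symmetric] using h(1) A(1) by (simp add: ennreal_mult mult.assoc)
    moreover have "ennreal h * 2 = 1" using ennreal_mult[of h 2] h by simp
    then have "ennreal h * (2 * Q F) = Q F" by (simp add: mult.assoc[symmetric])
    ultimately show ?thesis by simp
  qed
  show ?thesis
    unfolding sampling_seq_def infsum_ennreal_enum[OF e] Q_def[symmetric]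
    by (intro exI[of _ "A / 2"] exI[of _ B] conjI ballI low up) (use A(1) B(1) in auto)
qed

theorem sampling_iff_interp:
  fixes n :: "nat^'d"
  assumes n: "\<forall>j. 1 \<le> n $ j"
  shows "sampling_seq n G.lat \<longleftrightarrow> mult_interp n G0.lat"
proof
  \<comment> \<open>Since all n_j are positive, the index set is nonempty and the pairs of lattice
    point and index can be enumerated by the natural numbers.\<close>
  have "0 \<in> K_set n" using n by (simp add: K_set_def) (metis Suc_le_eq One_nat_def)
  then have K: "K_set n \<noteq> {}" by blast
  assume "sampling_seq n G.lat"
  then obtain c where "c > 0" "riesz_lower n G0.lat c" using sampling_imp_riesz by blast
  then show "mult_interp n G0.lat" by (rule riesz_imp_interp[OF G0.countable_lat G0.infinite_lat K])
next
  assume "mult_interp n G0.lat"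
  then obtain c where "c > 0" "riesz_lower n G0.lat c"
    using interp_imp_riesz[OF G0.infinite_lat G0.lat_add] by blast
  then show "sampling_seq n G.lat" by (rule riesz_imp_sampling)
qed

end

section \<open>The lattice and its adjoint in coordinates\<close>

definition to_real :: "complex^'d::finite \<Rightarrow> real^('d + 'd)" where
  "to_real z = (\<chi> i. case i of Inl j \<Rightarrow> Re (z $ j) | Inr j \<Rightarrow> Im (z $ j))"

text \<open>Real coordinates of v transformed by the standard symplectic matrix, so that Im(conj(z)
  . v) becomes a Euclidean inner product.\<close>

definition symp_flip :: "complex^'d::finite \<Rightarrow> real^('d + 'd)" where
  "symp_flip v = (\<chi> i. case i of Inl j \<Rightarrow> Im (v $ j) | Inr j \<Rightarrow> - Re (v $ j))"

lemma linear_to_real: "linear to_real" and linear_symp_flip: "linear symp_flip"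
  by (rule linearI; simp add: to_real_def symp_flip_def vec_eq_iff split: sum.split)+

lemma bij_to_real: "bij (to_real :: complex^'d::finite \<Rightarrow> _)"
proof (rule bijI)
  show "inj (to_real :: complex^'d \<Rightarrow> _)"
    by (rule injI) (auto simp: to_real_def vec_eq_iff complex_eq_iff split: sum.split_asm)
  show "surj (to_real :: complex^'d \<Rightarrow> _)"
  proof (rule surjI)
    fix v :: "real^('d + 'd)"
    show "to_real (\<chi> j. Complex (v $ Inl j) (v $ Inr j)) = v"
      by (simp add: to_real_def vec_eq_iff split: sum.split)
  qed
qed

lemma bij_symp_flip: "bij (symp_flip :: complex^'d::finite \<Rightarrow> _)"
proof (rule bijI)
  show "inj (symp_flip :: complex^'d \<Rightarrow> _)"
    by (rule injI) (auto simp: symp_flip_def vec_eq_iff complex_eq_iff split: sum.split_asm)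
  show "surj (symp_flip :: complex^'d \<Rightarrow> _)"
  proof (rule surjI)
    fix v :: "real^('d + 'd)"
    show "symp_flip (\<chi> j. Complex (- v $ Inr j) (v $ Inl j)) = v"
      by (simp add: symp_flip_def vec_eq_iff split: sum.split)
  qed
qed

lemma sum_UNIV_Plus:
  fixes f :: "'a::finite + 'b::finite \<Rightarrow> 'c::comm_monoid_add"
  shows "(\<Sum>i\<in>UNIV. f i) = (\<Sum>j\<in>UNIV. f (Inl j)) + (\<Sum>j\<in>UNIV. f (Inr j))"
  unfolding UNIV_Plus_UNIV[symmetric] by (subst sum.Plus) simp_all

lemma Im_cdot_symp_flip: "Im (cdot z v) = to_real z \<bullet> symp_flip v"
  by (simp add: cdot_def inner_vec_def sum_UNIV_Plus to_real_def symp_flip_def sum.distrib[symmetric] sum_subtractf[symmetric])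

text \<open>The two orders differ by the constant phase belonging to the symplectic form of the two
  points. For the converse it suffices to compare them on the constant function 1 at t = 0.\<close>

lemma tf_shift_commute_iff:
  fixes l \<mu> :: "(real^'d::finite) \<times> (real^'d)"
  shows "tf_shift l \<circ> tf_shift \<mu> = tf_shift \<mu> \<circ> tf_shift l \<longleftrightarrow> fst l \<bullet> snd \<mu> - snd l \<bullet> fst \<mu> \<in> \<int>"
proof -
  let ?s = "fst l \<bullet> snd \<mu> - snd l \<bullet> fst \<mu>"
  have c: "exp (complex_of_real (2 * pi) * \<i> * complex_of_real x) = cis (2 * pi * x)" for x
    unfolding cis_conv_exp by (simp add: mult_ac)
  have tf: "tf_shift a (tf_shift b f) t = cis (2 * pi * (snd a \<bullet> t)) * cis (2 * pi * (snd b \<bullet> t)) * cis (- (2 * pi * (snd b \<bullet> fst a))) * f (t - (fst a + fst b))"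
    for a b :: "(real^'d) \<times> (real^'d)" and f t
    unfolding tf_shift_def c by (simp add: cis_mult inner_diff_right algebra_simps)
  have eq: "cis (- (2 * pi * (snd l \<bullet> fst \<mu>))) = cis (- (2 * pi * (snd \<mu> \<bullet> fst l))) * cis (2 * pi * ?s)"
    by (simp add: cis_mult inner_commute algebra_simps)
  show ?thesis
  proof
    assume "?s \<in> \<int>"
    then have "cis (2 * pi * ?s) = 1" by (rule cis_multiple_2pi)
    then show "tf_shift l \<circ> tf_shift \<mu> = tf_shift \<mu> \<circ> tf_shift l"
      using eq by (intro ext) (simp add: tf mult.commute add.commute)
  next
    assume "tf_shift l \<circ> tf_shift \<mu> = tf_shift \<mu> \<circ> tf_shift l"
    then have "tf_shift l (tf_shift \<mu> (\<lambda>_. 1)) 0 = tf_shift \<mu> (tf_shift l (\<lambda>_. 1)) 0"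
      by (metis comp_apply)
    then have "cis (- (2 * pi * (snd \<mu> \<bullet> fst l))) = cis (- (2 * pi * (snd l \<bullet> fst \<mu>)))" by (simp add: tf)
    then have "cis (- (2 * pi * (snd \<mu> \<bullet> fst l))) * 1 = cis (- (2 * pi * (snd \<mu> \<bullet> fst l))) * cis (2 * pi * ?s)"
      unfolding eq by simp
    then have "cis (2 * pi * ?s) = 1" by (metis cis_neq_zero mult_cancel_left)
    then have "exp (\<i> * complex_of_real (2 * pi * ?s)) = 1" by (simp only: cis_conv_exp)
    then obtain n :: int where "2 * pi * ?s = of_int (2 * n) * pi" by (auto simp: exp_eq_1)
    then have "?s = of_int n" by simp
    then show "?s \<in> \<int>" by simp
  qed
qed

lemma Gamma_set_alt: "z \<in> Gamma_set \<Lambda> \<longleftrightarrow> ((\<chi> j. Re (z $ j)), (\<chi> j. Im (z $ j))) \<in> \<Lambda>"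
proof
  assume "z \<in> Gamma_set \<Lambda>"
  then obtain x \<omega> where z: "z = (\<chi> j. Complex (x $ j) (\<omega> $ j))" "(x, \<omega>) \<in> \<Lambda>" by (auto simp: Gamma_set_def)
  then show "((\<chi> j. Re (z $ j)), (\<chi> j. Im (z $ j))) \<in> \<Lambda>" by simp
next
  assume "((\<chi> j. Re (z $ j)), (\<chi> j. Im (z $ j))) \<in> \<Lambda>"
  moreover have "z = (\<chi> j. Complex ((\<chi> j. Re (z $ j)) $ j) ((\<chi> j. Im (z $ j)) $ j))" by (simp add: vec_eq_iff)
  ultimately show "z \<in> Gamma_set \<Lambda>" unfolding Gamma_set_def mem_Collect_eq by blast
qed

lemma split_vec_to_real: "split_vec (to_real z) = ((\<chi> j. Re (z $ j)), (\<chi> j. Im (z $ j)))"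
  by (simp add: split_vec_def to_real_def)

lemma inj_split_vec: "split_vec u = split_vec v \<Longrightarrow> u = v"
proof -
  assume "split_vec u = split_vec v"
  then have "u $ Inl j = v $ Inl j" "u $ Inr j = v $ Inr j" for j by (simp_all add: split_vec_def vec_eq_iff)
  then have "u $ i = v $ i" for i by (cases i) auto
  then show "u = v" by (simp add: vec_eq_iff)
qed

theorem theorem3:
  fixes n :: "nat^'d::finite" and \<Lambda> :: "((real^'d) \<times> (real^'d)) set"
  assumes "\<forall>j. 1 \<le> n$j"
    and "is_lattice \<Lambda>"
  shows "sampling_seq n (Gamma_set \<Lambda>) \<longleftrightarrow> mult_interp n (Gamma_set (adjoint_lattice \<Lambda>))"
proof -
  obtain A :: "real^('d+'d)^('d+'d)" where A: "invertible A" and \<Lambda>: "\<Lambda> = {split_vec (A *v k) | k. \<forall>i. k$i \<in> \<int>}"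
    using assms(2) by (auto simp: is_lattice_def)
  obtain A' where A': "A ** A' = mat 1" "A' ** A = mat 1" using A by (auto simp: invertible_def)
  have AA': "A *v (A' *v x) = x" "A' *v (A *v x) = x" for x by (simp_all add: matrix_vector_mul_assoc A')
  have "transpose A ** transpose A' = mat 1" "transpose A' ** transpose A = mat 1"
    by (metis A' matrix_transpose_mul transpose_mat)+
  then have tA: "transpose A *v (transpose A' *v x) = x" "transpose A' *v (transpose A *v x) = x" for x
    by (metis matrix_vector_mul_assoc matrix_vector_mul_lid)+
  have bA': "bij ((*v) A')" by (rule o_bij[of "(*v) A"]) (auto simp: AA')
  have bT: "bij ((*v) (transpose A))" by (rule o_bij[of "(*v) (transpose A')"]; rule ext; unfold comp_apply id_apply; rule tA)
  \<comment> \<open>A' inverts A, so L sends the lattice onto the integer vectors. L0 carries the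
    transpose of A instead, and in the inner product the two matrices cancel: this is the
    pairing.\<close>
  define L where "L z = A' *v to_real z" for z :: "complex^'d"
  define L0 where "L0 v = transpose A *v symp_flip v" for v :: "complex^'d"
  interpret lattice_pair L L0
  proof (intro lattice_pair.intro lattice_coords.intro lattice_pair_axioms.intro)
    show "linear L" unfolding L_def[abs_def] by (rule linear_compose[OF linear_to_real matrix_vector_mul_linear, unfolded o_def])
    show "linear L0" unfolding L0_def[abs_def] by (rule linear_compose[OF linear_symp_flip matrix_vector_mul_linear, unfolded o_def])
    show "bij L" unfolding L_def[abs_def] by (rule bij_comp[OF bij_to_real bA', unfolded o_def])
    show "bij L0" unfolding L0_def[abs_def] by (rule bij_comp[OF bij_symp_flip bT, unfolded o_def])
    fix z v
    have "to_real z \<bullet> symp_flip v = (A *v L z) \<bullet> symp_flip v" by (simp add: L_def AA')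
    also have "\<dots> = L z \<bullet> L0 v" unfolding L0_def by (metis dot_lmul_matrix inner_commute transpose_matrix_vector)
    finally show "Im (cdot z v) = L z \<bullet> L0 v" by (simp only: Im_cdot_symp_flip)
  qed
  have \<Gamma>: "Gamma_set \<Lambda> = G.lat"
  proof (intro set_eqI)
    fix z
    have "z \<in> Gamma_set \<Lambda> \<longleftrightarrow> (\<exists>k. split_vec (to_real z) = split_vec (A *v k) \<and> k \<in> intvec)"
      unfolding Gamma_set_alt split_vec_to_real[symmetric] \<Lambda> intvec_def by blast
    also have "\<dots> \<longleftrightarrow> (\<exists>k. to_real z = A *v k \<and> k \<in> intvec)" using inj_split_vec by metis
    also have "\<dots> \<longleftrightarrow> L z \<in> intvec" unfolding L_def by (metis AA')
    finally show "z \<in> Gamma_set \<Lambda> \<longleftrightarrow> z \<in> G.lat" by (simp add: G.lat_def)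
  qed
  have \<Gamma>0: "Gamma_set (adjoint_lattice \<Lambda>) = G0.lat"
  proof (intro set_eqI)
    fix v
    have pair: "fst l \<bullet> (\<chi> j. Im (v $ j)) - snd l \<bullet> (\<chi> j. Re (v $ j)) = k \<bullet> L0 v" if "l = split_vec (A *v k)" for l k
    proof -
      obtain z where z: "to_real z = A *v k" using bij_to_real by (metis bij_pointE)
      have "fst l \<bullet> (\<chi> j. Im (v $ j)) - snd l \<bullet> (\<chi> j. Re (v $ j)) = to_real z \<bullet> symp_flip v"
        unfolding that z[symmetric] split_vec_to_real
        by (simp add: inner_vec_def sum_UNIV_Plus to_real_def symp_flip_def sum_negf)
      also have "\<dots> = L z \<bullet> L0 v" using pairing[of z v] by (simp only: Im_cdot_symp_flip)
      also have "L z = k" by (simp add: L_def z AA')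
      finally show ?thesis .
    qed
    have "v \<in> Gamma_set (adjoint_lattice \<Lambda>) \<longleftrightarrow> (\<forall>l\<in>\<Lambda>. fst l \<bullet> (\<chi> j. Im (v $ j)) - snd l \<bullet> (\<chi> j. Re (v $ j)) \<in> \<int>)"
      unfolding Gamma_set_alt adjoint_lattice_def mem_Collect_eq tf_shift_commute_iff fst_conv snd_conv ..
    also have "\<dots> \<longleftrightarrow> (\<forall>k\<in>intvec. k \<bullet> L0 v \<in> \<int>)"
    proof -
      have "\<Lambda> = (\<lambda>k. split_vec (A *v k)) ` intvec" unfolding \<Lambda> intvec_def by blast
      then show ?thesis by (simp only: ball_simps pair[OF refl])
    qed
    \<comment> \<open>The integer vectors are self-dual; testing with the unit vectors gives one
      direction.\<close>
    also have "\<dots> \<longleftrightarrow> L0 v \<in> intvec"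
    proof
      assume "\<forall>k\<in>intvec. k \<bullet> L0 v \<in> \<int>"
      then have "axis i 1 \<bullet> L0 v \<in> \<int>" for i using intvec_axis by blast
      then show "L0 v \<in> intvec" by (simp add: intvec_def inner_axis inner_commute)
    next
      assume "L0 v \<in> intvec"
      then show "\<forall>k\<in>intvec. k \<bullet> L0 v \<in> \<int>" unfolding inner_vec_def intvec_def by (auto intro!: Ints_sum)
    qed
    finally show "v \<in> Gamma_set (adjoint_lattice \<Lambda>) \<longleftrightarrow> v \<in> G0.lat" by (simp add: G0.lat_def)
  qed
  show ?thesis unfolding \<Gamma> \<Gamma>0 by (rule sampling_iff_interp[OF assms(1)])
qed

end
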